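(* Let $\Bbbk$ be an arbitrary field, let $X=(x_{i,j})$ be a $k\times\ell$ matrix of distinct indeterminates, let $\Pi$ be the poset of all minors of $X$, and let $$f=f(X)=\prod_{j=0}^{k-2}\left[\det\left(X_{[1,j+1]}^{[1,j+1]}\right)\det\left(X_{[\ell-j,\ell]}^{[k-j,k]}\right)\right]\prod_{j=1}^{\ell-k+1}\det\left(X_{[j,k+j-1]}\right)\in\Bbbk[X].$$ For any generalized ideal $\Omega\subseteq\Pi$, the generalized poset ideal $\Omega\Bbbk[X]$ is in $\mathcal{C}_f$. In particular, $\mathrm{in}_\prec(\Omega\Bbbk[X])$ is a squarefree monomial ideal for any antidiagonal term order $\prec$, and $\Bbbk[X]/\Omega\Bbbk[X]$ is $F$-pure in positive characteristic (i.e. if $\Bbbk$ has positive characteristic).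
   Context: $\Bbbk[X]$ is the polynomial ring over $\Bbbk$ in the entries of $X$. $X_{[a,b]}^{[c,d]}$ is the submatrix of $X$ with column indices $a,\ldots,b$ and row indices $c,\ldots,d$; $X_{[a,b]}=X_{[a,b]}^{[1,k]}$; $X_{r\times s}=X_{[1,s]}^{[1,r]}$. For row indices $i_1<\cdots<i_r$ and column indices $j_1<\cdots<j_r$, $[i_1\cdots i_r|j_1\cdots j_r]$ denotes the corresponding $r$-minor. $\Pi$ is partially ordered by $$[a_1\ldots a_r|b_1\ldots b_r]\le[c_1\ldots c_s|d_1\ldots d_s]\iff r\ge s,\ a_i\le c_i\text{ and }b_i\le d_i\text{ for all }i=1,\ldots,s.$$ For $1\le r\le k$, $1\le s\le\ell$, $\Pi_{r,s}$ is the set of all minors of $X_{r\times s}$. A generalized ideal of $\Pi$ is a subset $\Omega\subseteq\Pi$ such that for all $[i_1\cdots i_r|j_1\cdots j_r]\in\Omega$ and $\pi\in\Pi_{i_r,j_r}$, if $\pi\le[i_1\cdots i_r|j_1\cdots j_r]$ then $\pi\in\Omega$. The generalized poset ideal $\Omega\Bbbk[X]$ is the ideal of $\Bbbk[X]$ generated by $\Omega$. Antidiagonal term order: a term order on $\Bbbk[X]$ such that the initial term of every minor $[i_1\cdots i_r|j_1\cdots j_r]$ is its antidiagonal term $x_{i_1,j_r}x_{i_2,j_{r-1}}\cdots x_{i_r,j_1}$. With respect to an antidiagonal term order, the initial term of $f(X)$ is $\prod_{1\le i\le k,\,1\le j\le\ell}x_{i,j}$. For an ideal $I$, $\mathrm{in}_\prec(I)$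 is its initial ideal with respect to $\prec$. Knutson ideals: for $R$ a polynomial ring over a field and $f\in R$ a homogeneous polynomial whose leading term with respect to some term order is a squarefree monomial, $\mathcal{C}_f$ is the smallest set of ideals of $R$ such that: (i) $(f)\in\mathcal{C}_f$; (ii) if $I\in\mathcal{C}_f$ then $(I:J)\in\mathcal{C}_f$ for every ideal $J\subseteq R$; (iii) if $I,J\in\mathcal{C}_f$ then $I+J\in\mathcal{C}_f$ and $I\cap J\in\mathcal{C}_f$. A ring $S$ of characteristic $p>0$ is $F$-pure if the Frobenius map $S\to F_*S$ is pure, i.e. remains injective after tensoring with any $S$-module.
   Formalization: Membership of the generalized poset ideal in C_f is stated only for nonempty Ω (for empty Ω the ideal is 0, while every ideal in C_f contains f ≠ 0), and k, ℓ ≥ 1 with k ≤ ℓ+1 is assumed, which is where the formula for f makes sense. *)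

theory Defs
  imports
    "HOL-Algebra.Algebra"
    "HOL-Library.Poly_Mapping"
    "HOL-Computational_Algebra.Primes"
    "Jordan_Normal_Form.Determinant"
begin

section \<open>The polynomial ring in the entries of a matrix of indeterminates\<close>

text \<open>
  The indeterminate in row \<open>i\<close> and column \<open>j\<close> is indexed by the pair \<open>(i, j)\<close>; rows and
  columns are numbered from 1.
\<close>

type_synonym monom = "(nat \<times> nat) \<Rightarrow>\<^sub>0 nat"

type_synonym 'a mpoly = "monom \<Rightarrow>\<^sub>0 'a"

definition monoms :: "nat \<Rightarrow> nat \<Rightarrow> monom set" where
  "monoms k l = {m. Poly_Mapping.keys m \<subseteq> {1..k} \<times> {1..l}}"

definition mat_poly_ring :: "nat \<Rightarrow> nat \<Rightarrow> 'a::field mpoly ring" where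
  "mat_poly_ring k l =
     \<lparr>carrier = {p. Poly_Mapping.keys p \<subseteq> monoms k l},
      monoid.mult = (*), one = 1, ring.zero = 0, ring.add = (+)\<rparr>"

definition indet :: "nat \<Rightarrow> nat \<Rightarrow> 'a::field mpoly" where
  "indet i j = Poly_Mapping.single (Poly_Mapping.single (i, j) 1) 1"

section \<open>Minors\<close>

text \<open>The submatrix of the generic matrix on the given lists of row and column indices.\<close>

definition gen_mat :: "nat list \<Rightarrow> nat list \<Rightarrow> 'a::field mpoly mat" where
  "gen_mat is js = mat (length is) (length js) (\<lambda>(p, q). indet (is ! p) (js ! q))"

text \<open>
  \<open>block a b c d\<close> has columns \<open>a, \<dots>, b\<close> (lower indices in the notation of the literature) and
  rows \<open>c, \<dots>, d\<close> (upper indices).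
\<close>

definition block :: "nat \<Rightarrow> nat \<Rightarrow> nat \<Rightarrow> nat \<Rightarrow> 'a::field mpoly mat" where
  "block a b c d = gen_mat [c..<Suc d] [a..<Suc b]"

text \<open>A minor is represented by its row and column indices.\<close>

type_synonym minor = "nat list \<times> nat list"

definition minors :: "nat \<Rightarrow> nat \<Rightarrow> minor set" where
  "minors r s = {(is, js). length is = length js \<and> is \<noteq> [] \<and>
     sorted_wrt (<) is \<and> set is \<subseteq> {1..r} \<and> sorted_wrt (<) js \<and> set js \<subseteq> {1..s}}"

definition minor_poly :: "minor \<Rightarrow> 'a::field mpoly" where
  "minor_poly \<delta> = det (gen_mat (fst \<delta>) (snd \<delta>))"

definition minor_le :: "minor \<Rightarrow> minor \<Rightarrow> bool" where
  "minor_le \<pi> \<delta> \<longleftrightarrow> length (fst \<delta>) \<le> length (fst \<pi>) \<and>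
     (\<forall>i < length (fst \<delta>). fst \<pi> ! i \<le> fst \<delta> ! i \<and> snd \<pi> ! i \<le> snd \<delta> ! i)"

definition generalized_ideal :: "nat \<Rightarrow> nat \<Rightarrow> minor set \<Rightarrow> bool" where
  "generalized_ideal k l \<Omega> \<longleftrightarrow> \<Omega> \<subseteq> minors k l \<and>
     (\<forall>\<delta> \<in> \<Omega>. \<forall>\<pi> \<in> minors (last (fst \<delta>)) (last (snd \<delta>)). minor_le \<pi> \<delta> \<longrightarrow> \<pi> \<in> \<Omega>)"

definition generalized_poset_ideal :: "nat \<Rightarrow> nat \<Rightarrow> minor set \<Rightarrow> 'a::field mpoly set" where
  "generalized_poset_ideal k l \<Omega> = genideal (mat_poly_ring k l) (minor_poly ` \<Omega>)"

text \<open>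
  Meaningful for \<open>1 \<le> k \<le> l + 1\<close>; then every block below is a square submatrix of the
  generic matrix.  For \<open>k = 1\<close> the first product is empty, for \<open>k = l + 1\<close> the second one.
\<close>

definition minors_product :: "nat \<Rightarrow> nat \<Rightarrow> 'a::field mpoly" where
  "minors_product k l =
     (\<Prod>j\<in>{0..<k - 1}. det (block 1 (j + 1) 1 (j + 1)) * det (block (l - j) l (k - j) k)) *
     (\<Prod>j\<in>{1..l + 1 - k}. det (block j (k + j - 1) 1 k))"

section \<open>Knutson ideals\<close>

definition colon_ideal :: "('a, 'b) ring_scheme \<Rightarrow> 'a set \<Rightarrow> 'a set \<Rightarrow> 'a set" where
  "colon_ideal R I J = {r \<in> carrier R. \<forall>j \<in> J. r \<otimes>\<^bsub>R\<^esub> j \<in> I}"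

text \<open>
  Usually considered for a homogeneous \<open>f\<close> with squarefree leading term; the closure conditions
  themselves do not refer to this.  Every ideal in the set contains \<open>f\<close>.
\<close>

inductive_set knutson_ideals :: "('a, 'b) ring_scheme \<Rightarrow> 'a \<Rightarrow> 'a set set"
  for R :: "('a, 'b) ring_scheme" and f :: 'a where
  principal: "PIdl\<^bsub>R\<^esub> f \<in> knutson_ideals R f"
| colon: "I \<in> knutson_ideals R f \<Longrightarrow> ideal J R \<Longrightarrow> colon_ideal R I J \<in> knutson_ideals R f"
| add: "I \<in> knutson_ideals R f \<Longrightarrow> J \<in> knutson_ideals R f \<Longrightarrow> I <+>\<^bsub>R\<^esub> J \<in> knutson_ideals R f"
| inter: "I \<in> knutson_ideals R f \<Longrightarrow> J \<in> knutson_ideals R f \<Longrightarrow> I \<inter> J \<in> knutson_ideals R f"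

section \<open>Term orders and initial ideals\<close>

text \<open>
  Monomials are written additively, so the monomial \<open>1\<close> is \<open>0\<close> here; \<open>prec\<close> is the strict order.
\<close>

definition term_order :: "nat \<Rightarrow> nat \<Rightarrow> (monom \<Rightarrow> monom \<Rightarrow> bool) \<Rightarrow> bool" where
  "term_order k l prec \<longleftrightarrow>
     (\<forall>m \<in> monoms k l. \<not> prec m m) \<and>
     (\<forall>m \<in> monoms k l. \<forall>n \<in> monoms k l. \<forall>u \<in> monoms k l. prec m n \<longrightarrow> prec n u \<longrightarrow> prec m u) \<and>
     (\<forall>m \<in> monoms k l. \<forall>n \<in> monoms k l. m \<noteq> n \<longrightarrow> prec m n \<or> prec n m) \<and>
     (\<forall>m \<in> monoms k l. m \<noteq> 0 \<longrightarrow> prec 0 m) \<and>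
     (\<forall>m \<in> monoms k l. \<forall>n \<in> monoms k l. \<forall>u \<in> monoms k l. prec m n \<longrightarrow> prec (m + u) (n + u))"

text \<open>Initial terms are taken up to their (nonzero) coefficient; only used for \<open>p \<noteq> 0\<close>.\<close>

definition initial_monom :: "(monom \<Rightarrow> monom \<Rightarrow> bool) \<Rightarrow> 'a::field mpoly \<Rightarrow> monom" where
  "initial_monom prec p =
     (THE m. m \<in> Poly_Mapping.keys p \<and> (\<forall>n \<in> Poly_Mapping.keys p. n \<noteq> m \<longrightarrow> prec n m))"

definition initial_ideal ::
  "nat \<Rightarrow> nat \<Rightarrow> (monom \<Rightarrow> monom \<Rightarrow> bool) \<Rightarrow> 'a::field mpoly set \<Rightarrow> 'a mpoly set" where
  "initial_ideal k l prec I =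
     genideal (mat_poly_ring k l)
       ((\<lambda>p. Poly_Mapping.single (initial_monom prec p) 1) ` (I - {0}))"

definition antidiagonal :: "minor \<Rightarrow> monom" where
  "antidiagonal \<delta> = (\<Sum>t < length (fst \<delta>).
     Poly_Mapping.single (fst \<delta> ! t, snd \<delta> ! (length (fst \<delta>) - 1 - t)) 1)"

definition antidiagonal_term_order ::
  "'a::field itself \<Rightarrow> nat \<Rightarrow> nat \<Rightarrow> (monom \<Rightarrow> monom \<Rightarrow> bool) \<Rightarrow> bool" where
  "antidiagonal_term_order _ k l prec \<longleftrightarrow> term_order k l prec \<and>
     (\<forall>\<delta> \<in> minors k l. initial_monom prec (minor_poly \<delta> :: 'a mpoly) = antidiagonal \<delta>)"

definition squarefree_monomial_ideal :: "nat \<Rightarrow> nat \<Rightarrow> 'a::field mpoly set \<Rightarrow> bool" where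
  "squarefree_monomial_ideal k l I \<longleftrightarrow>
     (\<exists>A \<subseteq> monoms k l. (\<forall>m \<in> A. \<forall>v. Poly_Mapping.lookup m v \<le> 1) \<and>
        I = genideal (mat_poly_ring k l) ((\<lambda>m. Poly_Mapping.single m 1) ` A))"

section \<open>Tensor products and F-purity\<close>

text \<open>
  The tensor product over \<open>S\<close>, as an abelian group: the free abelian group on pairs modulo the
  bilinearity relations.
\<close>

definition tensor_rels ::
  "('s, 'x) ring_scheme \<Rightarrow> ('s, 'n) module \<Rightarrow> ('s, 'm) module \<Rightarrow> ('n \<times> 'm \<Rightarrow>\<^sub>0 int) set" where
  "tensor_rels S N M = generate (free_Abelian_group (carrier N \<times> carrier M))
     ({frag_of (x \<oplus>\<^bsub>N\<^esub> x', y) - frag_of (x, y) - frag_of (x', y) | x x' y.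
         x \<in> carrier N \<and> x' \<in> carrier N \<and> y \<in> carrier M} \<union>
      {frag_of (x, y \<oplus>\<^bsub>M\<^esub> y') - frag_of (x, y) - frag_of (x, y') | x y y'.
         x \<in> carrier N \<and> y \<in> carrier M \<and> y' \<in> carrier M} \<union>
      {frag_of (s \<odot>\<^bsub>N\<^esub> x, y) - frag_of (x, s \<odot>\<^bsub>M\<^esub> y) | s x y.
         s \<in> carrier S \<and> x \<in> carrier N \<and> y \<in> carrier M})"

definition tensor ::
  "('s, 'x) ring_scheme \<Rightarrow> ('s, 'n) module \<Rightarrow> ('s, 'm) module \<Rightarrow> ('n \<times> 'm \<Rightarrow>\<^sub>0 int) set monoid" where
  "tensor S N M = free_Abelian_group (carrier N \<times> carrier M) Mod tensor_rels S N M"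

text \<open>
  The map from \<open>N \<otimes> M\<close> to \<open>N' \<otimes> M\<close> induced by an \<open>S\<close>-linear map \<open>\<phi>\<close> from \<open>N\<close> to \<open>N'\<close>: the coset of
  \<open>c\<close> is sent to the coset of the image of \<open>c\<close> (the image of a coset plus the relations is a
  single coset).
\<close>

definition tensor_map ::
  "('s, 'x) ring_scheme \<Rightarrow> ('s, 'n') module \<Rightarrow> ('s, 'm) module \<Rightarrow> ('n \<Rightarrow> 'n') \<Rightarrow>
   ('n \<times> 'm \<Rightarrow>\<^sub>0 int) set \<Rightarrow> ('n' \<times> 'm \<Rightarrow>\<^sub>0 int) set" where
  "tensor_map S N' M \<phi> C =
     tensor_rels S N' M <#>\<^bsub>free_Abelian_group (carrier N' \<times> carrier M)\<^esub>
       (frag_extend (\<lambda>(x, y). frag_of (\<phi> x, y)) ` C)"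

text \<open>Purity is quantified over the \<open>S\<close>-modules whose elements are of type \<open>'m\<close>.\<close>

definition pure_map ::
  "'m itself \<Rightarrow> ('s, 'x) ring_scheme \<Rightarrow> ('s, 'n) module \<Rightarrow> ('s, 'n') module \<Rightarrow> ('n \<Rightarrow> 'n') \<Rightarrow> bool" where
  "pure_map _ S N N' \<phi> \<longleftrightarrow>
     (\<forall>M :: ('s, 'm) module. module S M \<longrightarrow>
        inj_on (tensor_map S N' M \<phi>) (carrier (tensor S N M)))"

definition regular_module :: "('s, 'x) ring_scheme \<Rightarrow> ('s, 's) module" where
  "regular_module S =
     \<lparr>carrier = carrier S, monoid.mult = monoid.mult S, one = one S, ring.zero = ring.zero S, ring.add = ring.add S,
      module.smult = (\<lambda>s x. s \<otimes>\<^bsub>S\<^esub> x)\<rparr>"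

text \<open>\<open>S\<close> as a module over itself by restriction of scalars along the Frobenius map.\<close>

definition frobenius_module :: "nat \<Rightarrow> ('s, 'x) ring_scheme \<Rightarrow> ('s, 's) module" where
  "frobenius_module p S =
     \<lparr>carrier = carrier S, monoid.mult = monoid.mult S, one = one S, ring.zero = ring.zero S, ring.add = ring.add S,
      module.smult = (\<lambda>s x. (s [^]\<^bsub>S\<^esub> p) \<otimes>\<^bsub>S\<^esub> x)\<rparr>"

text \<open>The additive order of \<open>1\<close>; it is \<open>0\<close> if that order is infinite.\<close>

definition ring_char :: "('s, 'x) ring_scheme \<Rightarrow> nat" where
  "ring_char S = group.ord (add_monoid S) \<one>\<^bsub>S\<^esub>"

definition F_pure :: "'m itself \<Rightarrow> ('s, 'x) ring_scheme \<Rightarrow> bool" where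
  "F_pure T S \<longleftrightarrow> cring S \<and> Factorial_Ring.prime (ring_char S) \<and>
     pure_map T S (regular_module S) (frobenius_module (ring_char S) S)
       (\<lambda>x. x [^]\<^bsub>S\<^esub> ring_char S)"

end

theory Submission
  imports
    Defs
    "HOL-Library.Product_Lexorder"
    "Berlekamp_Zassenhaus.Finite_Field"
begin

text \<open>
  The ideals \<open>I\<^sub>t(X\<^sub>r\<^sub>\<times>\<^sub>s)\<close> of minors of upper left submatrices are Knutson ideals by induction over the
  boxes: the sum of the ideals at \<open>(t, r, s)\<close> and \<open>(t + 1, r + 1, s + 1)\<close> is the intersection of those
  at \<open>(t, r, s + 1)\<close> and \<open>(t, r + 1, s)\<close>, and each of the latter is the colon ideal of the
  intersection by the other. Both facts are read off from leading monomials: for an antidiagonal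
  order, a monomial is the leading monomial of an element of \<open>I\<^sub>t\<close> of a box if and only if its
  support contains \<open>t\<close> positions of the box running from north-east to south-west. For the hard
  direction the generic matrix is replaced, inside the box, by a product of two generic matrices;
  every monomial in the image of \<open>I\<^sub>t\<close> then involves an inner index \<open>\<ge> t\<close>.

  The ideal generated by the minors below a minor \<open>\<delta>\<close> is the intersection of the determinantal
  ideals given by the rank conditions of \<open>\<delta>\<close>. Indeed, by straightening, every polynomial is a
  combination of standard products of minors; these have distinct leading monomials under the
  same factorization, which forces the first factor of a product that occurs in an element of the
  intersection to lie below \<open>\<delta>\<close>. Every generalized poset ideal is a sum of such ideals.

  In characteristic \<open>p\<close> the trace of multiplication by \<open>f\<^sup>p\<^sup>-\<^sup>1\<close> splits the Frobenius map and preserves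
  every Knutson ideal. This yields F-purity, and since it divides the exponents of a leading monomial
  that is a \<open>p\<close>-th power by \<open>p\<close>, the leading monomials form a radical monomial ideal. In
  characteristic zero the leading monomials of a given degree are those of an echelon form over
  the integers, which agrees with the one modulo almost every prime.
\<close>

text \<open>The factors of \<open>f\<close> are the blocks whose antidiagonals fill the matrix; they
  are the boxes with \<open>t = r = s\<close>. The recursion for a box calls boxes with larger
  \<open>t\<close> and a longer side, which leave the matrix; hence boxes are continued beyond its
  border. The colon step needs no primality: if the leading monomial of \<open>g\<close> lacks the
  chains of \<open>C\<close>, some minor of \<open>D\<close> has an antidiagonal that adds none, so
  its product with \<open>g\<close> stays outside \<open>C\<close>. In the factorized matrix a
  monomial without a \<open>t\<close>-chain is coloured by the length of the longest chain ending at
  each position. The colour classes then run from north-west to south-east and are the smallest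
  monomials with their row and column degrees, so nothing cancels. In characteristic zero the
  obstacle is that the prime to reduce by depends on the ideal and the order, while a finite field
  is a type; a failing prime is therefore made a constant and turned into a type before the
  contradiction is drawn.\<close>

abbreviation mkeys :: "('m \<Rightarrow>\<^sub>0 'c::zero) \<Rightarrow> 'm set" where "mkeys \<equiv> Poly_Mapping.keys"
abbreviation coef :: "('m \<Rightarrow>\<^sub>0 'c::zero) \<Rightarrow> 'm \<Rightarrow> 'c" where "coef \<equiv> Poly_Mapping.lookup"
abbreviation mono_of :: "'m \<Rightarrow> ('m \<Rightarrow>\<^sub>0 'c::zero_neq_one)" where "mono_of m \<equiv> Poly_Mapping.single m 1"

section \<open>Polynomials\<close>

lemma keys_sum_subset: "mkeys (sum f A) \<subseteq> (\<Union>a\<in>A. mkeys (f a :: 'm \<Rightarrow>\<^sub>0 'c::comm_monoid_add))"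
  by (induction A rule: infinite_finite_induct) (use keys_add in fastforce)+

lemma keys_minus_subset: "mkeys (p - q :: 'm \<Rightarrow>\<^sub>0 'c::ab_group_add) \<subseteq> mkeys p \<union> mkeys q"
  by (auto simp: in_keys_iff lookup_minus)

lemma poly_eq_sum_single:
  fixes p :: "'m \<Rightarrow>\<^sub>0 'c::comm_monoid_add"
  shows "p = (\<Sum>m\<in>mkeys p. Poly_Mapping.single m (coef p m))"
  by (rule poly_mapping_eqI)
     (auto simp: lookup_sum lookup_single when_def in_keys_iff sum.delta)

lemma coef_single_mult:
  fixes p :: "'m::cancel_comm_monoid_add \<Rightarrow>\<^sub>0 'c::comm_semiring_1"
  shows "coef (Poly_Mapping.single m c * p) (m + n) = c * coef p n"
proof -
  have "Poly_Mapping.single m c * p = (\<Sum>a\<in>mkeys p. Poly_Mapping.single (m + a) (c * coef p a))"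
    by (subst (1) poly_eq_sum_single[of p]) (simp add: sum_distrib_left mult_single)
  then show ?thesis
    by (auto simp: lookup_sum lookup_single when_def in_keys_iff sum.delta)
qed

lemma coef_single_mult_0:
  fixes p :: "'m::cancel_comm_monoid_add \<Rightarrow>\<^sub>0 'c::comm_semiring_1"
  assumes "\<And>a. n \<noteq> m + a"
  shows "coef (Poly_Mapping.single m c * p) n = 0"
proof -
  have "Poly_Mapping.single m c * p = (\<Sum>a\<in>mkeys p. Poly_Mapping.single (m + a) (c * coef p a))"
    by (subst (1) poly_eq_sum_single[of p]) (simp add: sum_distrib_left mult_single)
  moreover have "\<forall>a. m + a \<noteq> n" using assms by metis
  ultimately show ?thesis
    by (simp add: lookup_sum lookup_single)
qed

lemma monom_finite_le:
  fixes m :: "'v \<Rightarrow>\<^sub>0 nat"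
  shows "(\<exists>a. m = n + a) \<longleftrightarrow> (\<forall>v. coef n v \<le> coef m v)"
proof
  assume "\<exists>a. m = n + a"
  then show "\<forall>v. coef n v \<le> coef m v" by (auto simp: lookup_add)
next
  assume "\<forall>v. coef n v \<le> coef m v"
  then have "m = n + (m - n)"
    by (intro poly_mapping_eqI) (simp add: lookup_add lookup_minus)
  then show "\<exists>a. m = n + a" ..
qed

subsection \<open>Leading monomials\<close>

text \<open>Totality is left out: the locale also serves for the weights on monomials in
  \<open>uvar\<close>, where distinct monomials may have equal weight. The carrier \<open>M\<close>
  is there because a term order says nothing about monomials outside
  \<open>monoms k l\<close>.\<close>

locale monom_order =
  fixes M :: "'m::cancel_comm_monoid_add set" and prec :: "'m \<Rightarrow> 'm \<Rightarrow> bool"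
  assumes M_zero [simp]: "0 \<in> M"
    and M_add [intro]: "a \<in> M \<Longrightarrow> b \<in> M \<Longrightarrow> a + b \<in> M"
    and irrefl: "a \<in> M \<Longrightarrow> \<not> prec a a"
    and trans: "a \<in> M \<Longrightarrow> b \<in> M \<Longrightarrow> c \<in> M \<Longrightarrow> prec a b \<Longrightarrow> prec b c \<Longrightarrow> prec a c"
    and mono: "a \<in> M \<Longrightarrow> b \<in> M \<Longrightarrow> c \<in> M \<Longrightarrow> prec a b \<Longrightarrow> prec (a + c) (b + c)"
begin

text \<open>A relation instead of a function, since under a partial order a nonzero polynomial may
  have no leading monomial.\<close>

definition lead_at :: "('m \<Rightarrow>\<^sub>0 'c::zero) \<Rightarrow> 'm \<Rightarrow> bool" where
  "lead_at p m \<longleftrightarrow> m \<in> mkeys p \<and> (\<forall>n\<in>mkeys p. n \<noteq> m \<longrightarrow> prec n m)"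

lemma prec_add_right_less:
  assumes "a \<in> M" "b \<in> M" "c \<in> M" "d \<in> M" "prec a b" "c = d \<or> prec c d"
  shows "prec (a + c) (b + d)"
proof (cases "c = d")
  case True
  then show ?thesis using assms mono by blast
next
  case False
  then have "prec (a + c) (b + c)" "prec (c + b) (d + b)"
    using assms by (auto intro: mono)
  then show ?thesis
    using trans[of "a + c" "b + c" "b + d"] assms by (auto simp: add.commute)
qed

text \<open>Every other pair of monomials has a strictly smaller sum, so a single product
  contributes at \<open>m + n\<close> and no cancellation can occur there.\<close>

lemma lead_at_mult:
  fixes p q :: "'m \<Rightarrow>\<^sub>0 'c::{comm_semiring_1, semiring_no_zero_divisors}"
  assumes p: "lead_at p m" "mkeys p \<subseteq> M" and q: "lead_at q n" "mkeys q \<subseteq> M"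
  shows "lead_at (p * q) (m + n)" and "coef (p * q) (m + n) = coef p m * coef q n"
proof -
  have less: "prec (a + b) (m + n)" if "a \<in> mkeys p" "b \<in> mkeys q" "a \<noteq> m \<or> b \<noteq> n" for a b
  proof (cases "a = m")
    case True
    then show ?thesis
      using that assms prec_add_right_less[of b n m m] unfolding lead_at_def
      by (auto simp: add.commute)
  next
    case False
    then show ?thesis
      using that assms prec_add_right_less[of a m b n] unfolding lead_at_def by blast
  qed
  have mnM: "m + n \<in> M"
    using assms unfolding lead_at_def by blast
  have "p * q = (\<Sum>a\<in>mkeys p. \<Sum>b\<in>mkeys q. Poly_Mapping.single (a + b) (coef p a * coef q b))"
    by (subst poly_eq_sum_single[of p], subst poly_eq_sum_single[of q])
       (simp add: sum_product mult_single)
  then have "coef (p * q) (m + n) =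
      (\<Sum>a\<in>mkeys p. \<Sum>b\<in>mkeys q. coef p a * coef q b when a + b = m + n)"
    by (simp add: lookup_sum lookup_single)
  also have "\<dots> = (\<Sum>a\<in>mkeys p. if a = m then \<Sum>b\<in>mkeys q. if b = n then coef p a * coef q b else 0 else 0)"
  proof (intro sum.cong refl)
    fix a assume a: "a \<in> mkeys p"
    have "(coef p a * coef q b when a + b = m + n) = (if a = m \<and> b = n then coef p a * coef q b else 0)"
      if "b \<in> mkeys q" for b
      using less[OF a that] mnM irrefl by (auto simp: when_def)
    then show "(\<Sum>b\<in>mkeys q. coef p a * coef q b when a + b = m + n) =
        (if a = m then \<Sum>b\<in>mkeys q. if b = n then coef p a * coef q b else 0 else 0)"
      by auto
  qed
  also have "\<dots> = coef p m * coef q n"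
    using p q by (simp add: lead_at_def)
  finally show coef: "coef (p * q) (m + n) = coef p m * coef q n" .
  then have "m + n \<in> mkeys (p * q)"
    using p q by (auto simp: lead_at_def in_keys_iff)
  moreover have "prec u (m + n)" if u: "u \<in> mkeys (p * q)" "u \<noteq> m + n" for u
  proof -
    obtain a b where "u = a + b" "a \<in> mkeys p" "b \<in> mkeys q"
      using keys_mult[of p q] u by auto
    then show ?thesis using less u by blast
  qed
  ultimately show "lead_at (p * q) (m + n)"
    by (auto simp: lead_at_def)
qed

lemma lead_at_unique: "lead_at p m \<Longrightarrow> lead_at p n \<Longrightarrow> mkeys p \<subseteq> M \<Longrightarrow> m = n"
  unfolding lead_at_def using irrefl trans by (metis subsetD)

lemma lead_at_single [simp]: "lead_at (Poly_Mapping.single m c) m \<longleftrightarrow> c \<noteq> 0"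
  by (auto simp: lead_at_def)

lemma lead_at_one [simp]: "lead_at (1 :: 'm \<Rightarrow>\<^sub>0 'c::zero_neq_one) 0"
  by (auto simp: lead_at_def)

lemma lead_at_prod:
  fixes f :: "'i \<Rightarrow> ('m \<Rightarrow>\<^sub>0 'c::{comm_semiring_1, semiring_no_zero_divisors})"
  assumes "\<And>i. i \<in> A \<Longrightarrow> lead_at (f i) (g i)" "\<And>i. i \<in> A \<Longrightarrow> mkeys (f i) \<subseteq> M"
  shows "lead_at (prod f A) (sum g A) \<and> mkeys (prod f A) \<subseteq> M"
  using assms
proof (induction A rule: infinite_finite_induct)
  case (insert x A)
  then have 1: "lead_at (prod f A) (sum g A)" "mkeys (prod f A) \<subseteq> M" by auto
  have "mkeys (f x * prod f A) \<subseteq> M"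
    using keys_mult[of "f x" "prod f A"] 1(2) insert.prems(2)[of x] by fastforce
  with 1 insert show ?case by (auto intro: lead_at_mult)
qed (auto simp: keys_one)

lemma lead_at_power:
  fixes p :: "'m \<Rightarrow>\<^sub>0 'c::{comm_semiring_1, semiring_no_zero_divisors}"
  assumes "lead_at p m" "mkeys p \<subseteq> M"
  shows "lead_at (p ^ n) (\<Sum>i<n. m)" "coef (p ^ n) (\<Sum>i<n. m) = coef p m ^ n" "mkeys (p ^ n) \<subseteq> M"
proof -
  have "lead_at (p ^ n) (\<Sum>i<n. m) \<and> coef (p ^ n) (\<Sum>i<n. m) = coef p m ^ n \<and> mkeys (p ^ n) \<subseteq> M"
  proof (induction n)
    case (Suc n)
    have "mkeys (p * p ^ n) \<subseteq> M"
      using keys_mult[of p "p ^ n"] Suc assms(2) by fastforce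
    then show ?case
      using Suc lead_at_mult[OF assms, of "p ^ n" "\<Sum>i<n. m"] by (auto simp: add.commute)
  qed (auto simp: keys_one)
  then show "lead_at (p ^ n) (\<Sum>i<n. m)" "coef (p ^ n) (\<Sum>i<n. m) = coef p m ^ n" "mkeys (p ^ n) \<subseteq> M"
    by auto
qed

end

locale total_monom_order = monom_order M prec
  for M :: "'m::cancel_comm_monoid_add set" and prec +
  assumes total: "a \<in> M \<Longrightarrow> b \<in> M \<Longrightarrow> a \<noteq> b \<Longrightarrow> prec a b \<or> prec b a"
begin

lemma ex_max:
  assumes "finite A" "A \<noteq> {}" "A \<subseteq> M"
  shows "\<exists>m\<in>A. \<forall>n\<in>A. n \<noteq> m \<longrightarrow> prec n m"
  using assms
proof (induction A rule: finite_ne_induct)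
  case (insert x A)
  then obtain m where m: "m \<in> A" "\<forall>n\<in>A. n \<noteq> m \<longrightarrow> prec n m" by auto
  show ?case
  proof (cases "prec m x")
    case True
    then have "\<forall>n\<in>insert x A. n \<noteq> x \<longrightarrow> prec n x"
      using m insert.prems trans by (metis insert_iff subsetD)
    then show ?thesis by blast
  next
    case False
    then have "prec x m"
      using total[of m x] insert m(1) by auto
    then show ?thesis using m by blast
  qed
qed auto

lemma ex_lead:
  assumes "p \<noteq> 0" "mkeys p \<subseteq> M"
  obtains m where "lead_at p m"
  using ex_max[of "mkeys p"] assms that unfolding lead_at_def
  by (metis finite_keys keys_eq_empty)

lemma lead_at_add_less:
  fixes p q :: "'m \<Rightarrow>\<^sub>0 'c::ab_group_add"
  assumes "lead_at p m" "lead_at q m" "coef p m = coef q m" "mkeys p \<subseteq> M" "mkeys q \<subseteq> M"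
    "lead_at (p - q) n"
  shows "prec n m"
proof -
  have "n \<noteq> m" "n \<in> mkeys p \<union> mkeys q"
    using assms keys_minus_subset[of p q] by (auto simp: lead_at_def in_keys_iff lookup_minus)
  then show ?thesis
    using assms(1,2) by (auto simp: lead_at_def)
qed

end

section \<open>Ideals of the polynomial ring\<close>

definition polys :: "nat \<Rightarrow> nat \<Rightarrow> 'a::field mpoly set" where
  "polys k l = {p. mkeys p \<subseteq> monoms k l}"

lemma mat_poly_ring_simps [simp]:
  "carrier (mat_poly_ring k l) = polys k l" "x \<otimes>\<^bsub>mat_poly_ring k l\<^esub> y = x * y"
  "x \<oplus>\<^bsub>mat_poly_ring k l\<^esub> y = x + y" "\<one>\<^bsub>mat_poly_ring k l\<^esub> = 1" "\<zero>\<^bsub>mat_poly_ring k l\<^esub> = 0"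
  by (simp_all add: mat_poly_ring_def polys_def)

lemma monoms_0 [simp]: "0 \<in> monoms k l"
  by (simp add: monoms_def)

lemma keys_monom_add: "mkeys (a + b :: 'v \<Rightarrow>\<^sub>0 nat) = mkeys a \<union> mkeys b"
  by (auto simp: in_keys_iff lookup_add)

lemma monoms_add_iff [simp]: "a + b \<in> monoms k l \<longleftrightarrow> a \<in> monoms k l \<and> b \<in> monoms k l"
  by (auto simp: monoms_def keys_monom_add)

lemma monoms_sum: "(\<And>i. i \<in> A \<Longrightarrow> f i \<in> monoms k l) \<Longrightarrow> sum f A \<in> monoms k l"
  by (induction A rule: infinite_finite_induct) auto

lemma polys_0 [simp, intro]: "0 \<in> polys k l"
  and polys_1 [simp, intro]: "1 \<in> polys k l"
  by (auto simp: polys_def keys_one)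

lemma polys_add [intro]: "p \<in> polys k l \<Longrightarrow> q \<in> polys k l \<Longrightarrow> p + q \<in> polys k l"
  using keys_add[of p q] by (auto simp: polys_def)

lemma polys_uminus [simp]: "- p \<in> polys k l \<longleftrightarrow> p \<in> polys k l"
  by (simp add: polys_def)

lemma polys_mult [intro]: "p \<in> polys k l \<Longrightarrow> q \<in> polys k l \<Longrightarrow> p * q \<in> polys k l"
  using keys_mult[of p q] by (fastforce simp: polys_def)

lemma polys_single [intro]: "m \<in> monoms k l \<Longrightarrow> Poly_Mapping.single m c \<in> polys k l"
  by (auto simp: polys_def)

lemma polys_sum [intro]: "(\<And>i. i \<in> A \<Longrightarrow> f i \<in> polys k l) \<Longrightarrow> sum f A \<in> polys k l"
  by (induction A rule: infinite_finite_induct) auto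

lemma polys_prod [intro]: "(\<And>i. i \<in> A \<Longrightarrow> f i \<in> polys k l) \<Longrightarrow> prod f A \<in> polys k l"
  by (induction A rule: infinite_finite_induct) auto

lemma polys_power [intro]: "p \<in> polys k l \<Longrightarrow> p ^ n \<in> polys k l"
  by (induction n) auto

lemma cring_mat_poly_ring: "cring (mat_poly_ring k l :: 'a::field mpoly ring)"
proof (rule cringI)
  show "abelian_group (mat_poly_ring k l :: 'a mpoly ring)"
  proof (rule abelian_groupI)
    fix x :: "'a mpoly"
    assume "x \<in> carrier (mat_poly_ring k l)"
    then show "\<exists>y\<in>carrier (mat_poly_ring k l). y \<oplus>\<^bsub>mat_poly_ring k l\<^esub> x = \<zero>\<^bsub>mat_poly_ring k l\<^esub>"
      by (intro bexI[of _ "- x"]) simp_all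
  qed (auto simp: algebra_simps)
  show "Group.comm_monoid (mat_poly_ring k l :: 'a mpoly ring)"
    by (rule comm_monoidI) (auto simp: algebra_simps)
qed (auto simp: algebra_simps)

text \<open>Ideals of \<open>mat_poly_ring k l\<close> in terms of the operations of the ambient
  type, without record selectors; \<open>ideal_iff_is_ideal\<close> translates.\<close>

definition is_ideal :: "nat \<Rightarrow> nat \<Rightarrow> 'a::field mpoly set \<Rightarrow> bool" where
  "is_ideal k l I \<longleftrightarrow> I \<subseteq> polys k l \<and> 0 \<in> I \<and> (\<forall>a\<in>I. \<forall>b\<in>I. a + b \<in> I) \<and>
     (\<forall>h\<in>polys k l. \<forall>a\<in>I. h * a \<in> I)"

lemma is_idealD:
  assumes "is_ideal k l I"
  shows "I \<subseteq> polys k l" "0 \<in> I" "a \<in> I \<Longrightarrow> b \<in> I \<Longrightarrow> a + b \<in> I"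
    "h \<in> polys k l \<Longrightarrow> a \<in> I \<Longrightarrow> h * a \<in> I" "a \<in> I \<Longrightarrow> b \<in> I \<Longrightarrow> a - b \<in> I" "a \<in> I \<Longrightarrow> - a \<in> I"
proof -
  show 1: "I \<subseteq> polys k l" "0 \<in> I" "a \<in> I \<Longrightarrow> b \<in> I \<Longrightarrow> a + b \<in> I"
    "h \<in> polys k l \<Longrightarrow> a \<in> I \<Longrightarrow> h * a \<in> I" for a b h
    using assms unfolding is_ideal_def by blast+
  show 2: "a \<in> I \<Longrightarrow> - a \<in> I" for a
    using 1(4)[of "- 1" a] by simp
  show "a \<in> I \<Longrightarrow> b \<in> I \<Longrightarrow> a - b \<in> I"
    using 1(3)[of a "- b"] 2[of b] by simp
qed

lemma is_ideal_sum: "is_ideal k l I \<Longrightarrow> (\<And>i. i \<in> A \<Longrightarrow> f i \<in> I) \<Longrightarrow> sum f A \<in> I"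
  by (induction A rule: infinite_finite_induct) (auto intro: is_idealD)

lemma ideal_iff_is_ideal: "ideal I (mat_poly_ring k l) \<longleftrightarrow> is_ideal k l I"
proof
  assume "ideal I (mat_poly_ring k l)"
  then interpret ideal I "mat_poly_ring k l" .
  show "is_ideal k l I"
    using a_subset additive_subgroup.zero_closed[OF is_additive_subgroup]
      additive_subgroup.a_closed[OF is_additive_subgroup] I_l_closed
    by (auto simp: is_ideal_def)
next
  assume I: "is_ideal k l I"
  show "ideal I (mat_poly_ring k l)"
  proof (rule idealI)
    show "ring (mat_poly_ring k l)"
      using cring_mat_poly_ring by (rule cring.axioms)
    show "subgroup I (add_monoid (mat_poly_ring k l))"
    proof
      fix x assume x: "x \<in> I"
      have "inv\<^bsub>add_monoid (mat_poly_ring k l)\<^esub> x = - x"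
      proof -
        interpret cring "mat_poly_ring k l" by (rule cring_mat_poly_ring)
        have "x \<in> polys k l" "- x \<in> polys k l" using x I is_idealD(1) by auto
        then show ?thesis
          using add.inv_equality[of "- x" x] unfolding a_inv_def[symmetric] by simp
      qed
      then show "inv\<^bsub>add_monoid (mat_poly_ring k l)\<^esub> x \<in> I"
        using is_idealD(6)[OF I x] by simp
    qed (use is_idealD(1-3)[OF I] in auto)
      show "x \<otimes>\<^bsub>mat_poly_ring k l\<^esub> a \<in> I" "a \<otimes>\<^bsub>mat_poly_ring k l\<^esub> x \<in> I"
      if "a \<in> I" "x \<in> carrier (mat_poly_ring k l)" for a x
      using that is_idealD(4)[OF I, of x a] by (simp_all add: mult.commute)
  qed
qed

section \<open>Ideals given by generators\<close>

inductive_set idl :: "nat \<Rightarrow> nat \<Rightarrow> 'a::field mpoly set \<Rightarrow> 'a mpoly set"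
  for k l G where
  zero: "0 \<in> idl k l G"
| step: "g \<in> G \<Longrightarrow> h \<in> polys k l \<Longrightarrow> a \<in> idl k l G \<Longrightarrow> h * g + a \<in> idl k l G"

lemma idl_gen: "g \<in> G \<Longrightarrow> g \<in> idl k l G"
  using idl.step[of g G 1 k l 0] by (simp add: idl.zero)

lemma is_ideal_idl:
  assumes "G \<subseteq> polys k l"
  shows "is_ideal k l (idl k l G)"
  unfolding is_ideal_def
proof (intro conjI ballI)
  show "idl k l G \<subseteq> polys k l"
  proof
    fix x assume "x \<in> idl k l G"
    then show "x \<in> polys k l"
    proof induction
      case (step g h a)
      then show ?case using assms by blast
    qed simp
  qed
  show "a + b \<in> idl k l G" if "a \<in> idl k l G" "b \<in> idl k l G" for a b
    using that by induction (auto simp: add.assoc intro: idl.step)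
  show "h * a \<in> idl k l G" if "h \<in> polys k l" "a \<in> idl k l G" for h a
    using that(2)
  proof induction
    case (step g h' a)
    then show ?case
      using idl.step[of g G "h * h'" k l "h * a"] polys_mult[OF that(1) step.hyps(2)]
      by (simp add: algebra_simps)
  qed (simp add: idl.zero)
qed (rule idl.zero)

lemma idl_least:
  assumes "is_ideal k l I" "G \<subseteq> I"
  shows "idl k l G \<subseteq> I"
proof
  fix x assume "x \<in> idl k l G"
  then show "x \<in> I"
  proof induction
    case zero
    show ?case by (rule is_idealD(2)[OF assms(1)])
  next
    case (step g h a)
    then show ?case using assms is_idealD(3,4)[OF assms(1)] by blast
  qed
qed

lemma genideal_eq_idl:
  assumes "G \<subseteq> polys k l"
  shows "genideal (mat_poly_ring k l) G = idl k l G"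
proof -
  interpret cring "mat_poly_ring k l" by (rule cring_mat_poly_ring)
  have G: "G \<subseteq> carrier (mat_poly_ring k l)" using assms by simp
  show ?thesis
  proof
    show "Idl\<^bsub>mat_poly_ring k l\<^esub> G \<subseteq> idl k l G"
      using is_ideal_idl[OF assms] idl_gen
      by (intro genideal_minimal) (auto simp: ideal_iff_is_ideal)
    show "idl k l G \<subseteq> Idl\<^bsub>mat_poly_ring k l\<^esub> G"
      using genideal_ideal[OF G] genideal_self[OF G]
      by (intro idl_least) (auto simp: ideal_iff_is_ideal)
  qed
qed

lemma cgenideal_eq: "PIdl\<^bsub>mat_poly_ring k l\<^esub> f = {h * f |h. h \<in> polys k l}"
  by (auto simp: cgenideal_def)

lemma set_add_eq: "I <+>\<^bsub>mat_poly_ring k l\<^esub> J = {a + b |a b. a \<in> I \<and> b \<in> J}"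
  by (auto simp: set_add_defs)

lemma idl_Un:
  assumes "G \<subseteq> polys k l" "H \<subseteq> polys k l"
  shows "idl k l (G \<union> H) = {a + b |a b. a \<in> idl k l G \<and> b \<in> idl k l H}"
proof
  have I: "is_ideal k l (idl k l (G \<union> H))" using assms by (intro is_ideal_idl) auto
  show "{a + b |a b. a \<in> idl k l G \<and> b \<in> idl k l H} \<subseteq> idl k l (G \<union> H)"
    using idl_least[OF I, of G] idl_least[OF I, of H] idl_gen[of _ "G \<union> H"] is_idealD(3)[OF I] by blast
  show "idl k l (G \<union> H) \<subseteq> {a + b |a b. a \<in> idl k l G \<and> b \<in> idl k l H}"
  proof
    fix x assume "x \<in> idl k l (G \<union> H)"
    then show "x \<in> {a + b |a b. a \<in> idl k l G \<and> b \<in> idl k l H}"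
    proof induction
      case zero
      show ?case using idl.zero[of k l G] idl.zero[of k l H] by force
    next
      case (step g h a)
      then obtain u v where uv: "a = u + v" "u \<in> idl k l G" "v \<in> idl k l H" by blast
      have "h * g + u \<in> idl k l G \<or> h * g + v \<in> idl k l H"
        using step uv idl.step by blast
      moreover have "h * g + a = (h * g + u) + v" "h * g + a = u + (h * g + v)"
        by (simp_all add: uv algebra_simps)
      ultimately show ?case using uv by blast
    qed
  qed
qed

lemma knutson_is_ideal:
  assumes "I \<in> knutson_ideals (mat_poly_ring k l) f" "f \<in> polys k l"
  shows "is_ideal k l I"
  using assms(1)
proof induction
  case principal
  interpret cring "mat_poly_ring k l" by (rule cring_mat_poly_ring)
  have "f \<in> carrier (mat_poly_ring k l)"
    using assms(2) by simp
  from cgenideal_ideal[OF this] show ?case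
    by (simp only: ideal_iff_is_ideal)
next
  case (colon I J)
  then have I: "is_ideal k l I" and J: "is_ideal k l J" by (auto simp: ideal_iff_is_ideal)
  show ?case
    unfolding is_ideal_def
  proof (intro conjI ballI)
    show "colon_ideal (mat_poly_ring k l) I J \<subseteq> polys k l"
      by (auto simp: colon_ideal_def)
    show "0 \<in> colon_ideal (mat_poly_ring k l) I J"
      using is_idealD(2)[OF I] by (auto simp: colon_ideal_def)
    show "a + b \<in> colon_ideal (mat_poly_ring k l) I J"
      if "a \<in> colon_ideal (mat_poly_ring k l) I J" "b \<in> colon_ideal (mat_poly_ring k l) I J" for a b
      using that is_idealD(3)[OF I]
      by (auto simp: colon_ideal_def distrib_right)
    show "h * a \<in> colon_ideal (mat_poly_ring k l) I J"
      if "h \<in> polys k l" "a \<in> colon_ideal (mat_poly_ring k l) I J" for h a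
      using that is_idealD(4)[OF I]
      by (auto simp: colon_ideal_def mult.assoc)
  qed
next
  case (add I J)
  interpret ring "mat_poly_ring k l" using cring_mat_poly_ring by (rule cring.axioms)
  show ?case
    using add add_ideals[of I J] by (simp add: ideal_iff_is_ideal)
next
  case (inter I J)
  show ?case
    unfolding is_ideal_def
  proof (intro conjI ballI)
    show "I \<inter> J \<subseteq> polys k l" using is_idealD(1)[OF inter.IH(1)] by blast
    show "0 \<in> I \<inter> J" using inter.IH[THEN is_idealD(2)] by blast
    show "a + b \<in> I \<inter> J" if "a \<in> I \<inter> J" "b \<in> I \<inter> J" for a b
      using that inter.IH[THEN is_idealD(3)] by blast
    show "h * a \<in> I \<inter> J" if "h \<in> polys k l" "a \<in> I \<inter> J" for h a
      using that inter.IH[THEN is_idealD(4)] by blast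
  qed
qed

lemma knutson_idl_Un:
  assumes "idl k l G \<in> knutson_ideals (mat_poly_ring k l) f"
    "idl k l H \<in> knutson_ideals (mat_poly_ring k l) f" "G \<subseteq> polys k l" "H \<subseteq> polys k l"
  shows "idl k l (G \<union> H) \<in> knutson_ideals (mat_poly_ring k l) f"
  using knutson_ideals.add[OF assms(1,2)] by (simp add: set_add_eq idl_Un[OF assms(3,4)])

section \<open>Substitution homomorphisms\<close>

definition eval_monom :: "('v \<Rightarrow> 'r) \<Rightarrow> ('v \<Rightarrow>\<^sub>0 nat) \<Rightarrow> 'r::comm_ring_1" where
  "eval_monom \<phi> m = (\<Prod>v\<in>mkeys m. \<phi> v ^ coef m v)"

text \<open>The homomorphism that fixes the coefficients and sends the indeterminate
  \<open>v\<close> to \<open>\<phi> v\<close>; source and target may have variables of different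
  types.\<close>

definition subst :: "('v \<Rightarrow> (('w \<Rightarrow>\<^sub>0 nat) \<Rightarrow>\<^sub>0 'a)) \<Rightarrow> (('v \<Rightarrow>\<^sub>0 nat) \<Rightarrow>\<^sub>0 'a) \<Rightarrow> (('w \<Rightarrow>\<^sub>0 nat) \<Rightarrow>\<^sub>0 'a::comm_ring_1)" where
  "subst \<phi> p = (\<Sum>m\<in>mkeys p. Poly_Mapping.single 0 (coef p m) * eval_monom \<phi> m)"

lemma eval_monom_superset:
  assumes "finite A" "mkeys m \<subseteq> A"
  shows "eval_monom \<phi> m = (\<Prod>v\<in>A. \<phi> v ^ coef m v)"
  unfolding eval_monom_def
  by (rule prod.mono_neutral_left) (use assms in \<open>auto simp: in_keys_iff\<close>)

lemma eval_monom_0 [simp]: "eval_monom \<phi> 0 = 1"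
  by (simp add: eval_monom_def)

lemma eval_monom_add: "eval_monom \<phi> (m + n) = eval_monom \<phi> m * eval_monom \<phi> n"
proof -
  have "eval_monom \<phi> (m + n) = (\<Prod>v\<in>mkeys m \<union> mkeys n. \<phi> v ^ coef (m + n) v)"
    by (rule eval_monom_superset) (auto simp: keys_monom_add)
  also have "\<dots> = (\<Prod>v\<in>mkeys m \<union> mkeys n. \<phi> v ^ coef m v) * (\<Prod>v\<in>mkeys m \<union> mkeys n. \<phi> v ^ coef n v)"
    by (simp add: lookup_add power_add prod.distrib)
  also have "\<dots> = eval_monom \<phi> m * eval_monom \<phi> n"
    by (simp add: eval_monom_superset[of "mkeys m \<union> mkeys n"])
  finally show ?thesis .
qed

lemma eval_monom_single [simp]: "eval_monom \<phi> (Poly_Mapping.single v n) = \<phi> v ^ n"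
  by (simp add: eval_monom_def)

lemma subst_superset:
  assumes "finite A" "mkeys p \<subseteq> A"
  shows "subst \<phi> p = (\<Sum>m\<in>A. Poly_Mapping.single 0 (coef p m) * eval_monom \<phi> m)"
  unfolding subst_def
  by (rule sum.mono_neutral_left) (use assms in \<open>auto simp: in_keys_iff\<close>)

lemma subst_0 [simp]: "subst \<phi> 0 = 0"
  by (simp add: subst_def)

lemma subst_add: "subst \<phi> (p + q) = subst \<phi> p + subst \<phi> q"
proof -
  have "subst \<phi> (p + q) =
      (\<Sum>m\<in>mkeys p \<union> mkeys q. Poly_Mapping.single 0 (coef (p + q) m) * eval_monom \<phi> m)"
    by (rule subst_superset) (use keys_add[of p q] in auto)
  also have "\<dots> = (\<Sum>m\<in>mkeys p \<union> mkeys q. Poly_Mapping.single 0 (coef p m) * eval_monom \<phi> m) +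
      (\<Sum>m\<in>mkeys p \<union> mkeys q. Poly_Mapping.single 0 (coef q m) * eval_monom \<phi> m)"
    by (simp add: lookup_add single_add distrib_right sum.distrib)
  also have "\<dots> = subst \<phi> p + subst \<phi> q"
    by (simp add: subst_superset[of "mkeys p \<union> mkeys q"])
  finally show ?thesis .
qed

lemma subst_sum: "subst \<phi> (sum f A) = (\<Sum>i\<in>A. subst \<phi> (f i))"
  by (induction A rule: infinite_finite_induct) (auto simp: subst_add)

lemma subst_single: "subst \<phi> (Poly_Mapping.single m c) = Poly_Mapping.single 0 c * eval_monom \<phi> m"
  by (cases "c = 0") (auto simp: subst_def)

lemma subst_1 [simp]: "subst \<phi> 1 = 1"
  using subst_single[of \<phi> 0 1] by simp

lemma single_0_mult:
  "Poly_Mapping.single (0::'m::comm_monoid_add) (c * d :: 'c::comm_semiring_1) =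
     Poly_Mapping.single 0 c * Poly_Mapping.single 0 d"
  by (simp add: mult_single)

lemma subst_mult: "subst \<phi> (p * q) = subst \<phi> p * subst \<phi> q"
proof -
  have "p * q = (\<Sum>a\<in>mkeys p. \<Sum>b\<in>mkeys q. Poly_Mapping.single (a + b) (coef p a * coef q b))"
    by (subst poly_eq_sum_single[of p], subst poly_eq_sum_single[of q])
       (simp add: sum_product mult_single)
  then have "subst \<phi> (p * q) = (\<Sum>a\<in>mkeys p. \<Sum>b\<in>mkeys q.
      Poly_Mapping.single 0 (coef p a * coef q b) * eval_monom \<phi> (a + b))"
    by (simp add: subst_sum subst_single)
  also have "\<dots> = (\<Sum>a\<in>mkeys p. \<Sum>b\<in>mkeys q.
      (Poly_Mapping.single 0 (coef p a) * eval_monom \<phi> a) * (Poly_Mapping.single 0 (coef q b) * eval_monom \<phi> b))"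
  proof (intro sum.cong refl)
    fix a b
    show "Poly_Mapping.single 0 (coef p a * coef q b) * eval_monom \<phi> (a + b) =
      (Poly_Mapping.single 0 (coef p a) * eval_monom \<phi> a) * (Poly_Mapping.single 0 (coef q b) * eval_monom \<phi> b)"
      by (simp add: eval_monom_add single_0_mult mult_ac)
  qed
  also have "\<dots> = subst \<phi> p * subst \<phi> q"
    by (simp add: subst_def sum_product)
  finally show ?thesis .
qed

lemma comm_ring_hom_subst: "comm_ring_hom (subst \<phi>)"
  by unfold_locales (auto simp: subst_add subst_mult)

lemma subst_prod: "subst \<phi> (prod f A) = (\<Prod>i\<in>A. subst \<phi> (f i))"
  by (induction A rule: infinite_finite_induct) (auto simp: subst_mult)

lemma subst_det: "subst \<phi> (Determinant.det A) = Determinant.det (map_mat (subst \<phi>) A)"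
  by (rule comm_ring_hom.hom_det[OF comm_ring_hom_subst, symmetric])

section \<open>Chains of positions\<close>

text \<open>The antidiagonals of minors are the chains for \<open>ne_sw\<close>.\<close>

definition ne_sw :: "nat \<times> nat \<Rightarrow> nat \<times> nat \<Rightarrow> bool" where
  "ne_sw p q \<longleftrightarrow> fst p < fst q \<and> snd q < snd p"

definition has_chain :: "(nat \<times> nat) set \<Rightarrow> nat \<Rightarrow> bool" where
  "has_chain F t \<longleftrightarrow> (\<exists>ps. length ps = t \<and> sorted_wrt ne_sw ps \<and> set ps \<subseteq> F)"

lemma has_chainI: "sorted_wrt ne_sw ps \<Longrightarrow> set ps \<subseteq> F \<Longrightarrow> has_chain F (length ps)"
  by (auto simp: has_chain_def)

lemma has_chain_mono: "has_chain F t \<Longrightarrow> F \<subseteq> G \<Longrightarrow> has_chain G t"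
  by (auto simp: has_chain_def)

lemma has_chain_le:
  assumes "has_chain F t" "t' \<le> t"
  shows "has_chain F t'"
proof -
  obtain ps where "length ps = t" "sorted_wrt ne_sw ps" "set ps \<subseteq> F"
    using assms(1) by (auto simp: has_chain_def)
  then show ?thesis
    using assms(2) set_take_subset[of t' ps] unfolding has_chain_def
    by (intro exI[of _ "take t' ps"]) (auto simp: sorted_wrt_take)
qed

lemma has_chain_0 [simp]: "has_chain F 0"
  by (simp add: has_chain_def)

lemma ne_sw_trans: "ne_sw p q \<Longrightarrow> ne_sw q r \<Longrightarrow> ne_sw p r"
  by (auto simp: ne_sw_def)

lemma chain_nth_less: "sorted_wrt ne_sw ps \<Longrightarrow> i < j \<Longrightarrow> j < length ps \<Longrightarrow> ne_sw (ps ! i) (ps ! j)"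
  by (simp add: sorted_wrt_iff_nth_less)

lemma chain_rows:
  assumes "sorted_wrt ne_sw ps" "i \<le> j" "j < length ps"
  shows "fst (ps ! i) + (j - i) \<le> fst (ps ! j)"
proof -
  have "fst (ps ! i) + j \<le> fst (ps ! j) + i"
    using assms(2,3)
  proof (induction j rule: dec_induct)
    case (step n)
    then show ?case
      using chain_nth_less[OF assms(1), of n "Suc n"] by (simp add: ne_sw_def)
  qed simp
  then show ?thesis using assms(2) by simp
qed

lemma chain_cols:
  assumes "sorted_wrt ne_sw ps" "i \<le> j" "j < length ps"
  shows "snd (ps ! j) + (j - i) \<le> snd (ps ! i)"
proof -
  have "snd (ps ! j) + j \<le> snd (ps ! i) + i"
    using assms(2,3)
  proof (induction j rule: dec_induct)
    case (step n)
    then show ?case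
      using chain_nth_less[OF assms(1), of n "Suc n"] by (simp add: ne_sw_def)
  qed simp
  then show ?thesis using assms(2) by simp
qed

lemma chain_append:
  assumes "sorted_wrt ne_sw ps" "sorted_wrt ne_sw qs"
    "ps \<noteq> [] \<Longrightarrow> qs \<noteq> [] \<Longrightarrow> ne_sw (last ps) (hd qs)"
  shows "sorted_wrt ne_sw (ps @ qs)"
proof -
  have "ne_sw p q" if "p \<in> set ps" "q \<in> set qs" for p q
  proof -
    have ne: "ps \<noteq> []" "qs \<noteq> []" using that by auto
    have 1: "p = last ps \<or> ne_sw p (last ps)"
      using that(1) assms(1) ne(1) by (cases ps rule: rev_cases) (auto simp: sorted_wrt_append)
    have 2: "q = hd qs \<or> ne_sw (hd qs) q"
      using that(2) assms(2) ne(2) by (cases qs) auto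
    show ?thesis
      using 1 2 assms(3)[OF ne] ne_sw_trans by blast
  qed
  then show ?thesis
    using assms by (auto simp: sorted_wrt_append)
qed

lemma in_set_takeE:
  assumes "x \<in> set (take n xs)"
  obtains i where "i < n" "i < length xs" "x = xs ! i"
  using assms by (auto simp: in_set_conv_nth)

lemma in_set_dropE:
  assumes "x \<in> set (drop n xs)"
  obtains i where "n \<le> i" "i < length xs" "x = xs ! i"
proof -
  obtain j where "j < length xs - n" "x = drop n xs ! j"
    using assms by (metis in_set_conv_nth length_drop)
  then show ?thesis by (intro that[of "n + j"]) auto
qed

lemma last_take_Suc: "a < length xs \<Longrightarrow> last (take (Suc a) xs) = xs ! a"
  by (simp add: take_Suc_conv_app_nth)

text \<open>Two chains of length \<open>t\<close> are compared index by index. If some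
  \<open>ps ! a\<close> is north-east of \<open>qs ! a\<close>, splicing there gains an element.
  Otherwise, unless one chain already stays in the small box, the two cross, and exchanging tails
  avoids both the new column and the new row. On leading monomials this puts the intersection of two
  determinantal ideals into the sum of two others.\<close>

lemma chain_exchange:
  assumes p: "has_chain (F \<inter> {u..r} \<times> {c..Suc s}) t" and q: "has_chain (F \<inter> {u..Suc r} \<times> {c..s}) t"
  shows "has_chain (F \<inter> {u..r} \<times> {c..s}) t \<or> has_chain (F \<inter> {u..Suc r} \<times> {c..Suc s}) (Suc t)"
proof (cases "t = 0")
  case False
  obtain ps where ps: "length ps = t" "sorted_wrt ne_sw ps" "set ps \<subseteq> F \<inter> {u..r} \<times> {c..Suc s}"
    using p by (auto simp: has_chain_def)
  obtain qs where qs: "length qs = t" "sorted_wrt ne_sw qs" "set qs \<subseteq> F \<inter> {u..Suc r} \<times> {c..s}"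
    using q by (auto simp: has_chain_def)
  have pn: "ps ! i \<in> F" "u \<le> fst (ps ! i)" "fst (ps ! i) \<le> r" "c \<le> snd (ps ! i)" "snd (ps ! i) \<le> Suc s"
    if "i < t" for i
    using subsetD[OF ps(3) nth_mem[of i]] ps(1) that by (auto simp: mem_Times_iff)
  have qn: "qs ! i \<in> F" "u \<le> fst (qs ! i)" "fst (qs ! i) \<le> Suc r" "c \<le> snd (qs ! i)" "snd (qs ! i) \<le> s"
    if "i < t" for i
    using subsetD[OF qs(3) nth_mem[of i]] qs(1) that by (auto simp: mem_Times_iff)
  show ?thesis
  proof (cases "\<exists>a<t. ne_sw (ps ! a) (qs ! a)")
    case True
    then obtain a where a: "a < t" "ne_sw (ps ! a) (qs ! a)" by blast
    \<comment> \<open>Both \<open>ps ! a\<close> and \<open>qs ! a\<close> are kept, which gives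
      length \<open>Suc t\<close>.\<close>
    have "sorted_wrt ne_sw (take (Suc a) ps @ drop a qs)"
      using a ps qs by (intro chain_append) (auto simp: sorted_wrt_take sorted_wrt_drop hd_drop_conv_nth last_take_Suc)
    moreover have "set (take (Suc a) ps @ drop a qs) \<subseteq> F \<inter> {u..Suc r} \<times> {c..Suc s}"
    proof -
      have "{u..r} \<times> {c..Suc s} \<subseteq> {u..Suc r} \<times> {c..Suc s}" "{u..Suc r} \<times> {c..s} \<subseteq> {u..Suc r} \<times> {c..Suc s}"
        by auto
      then have "set ps \<subseteq> F \<inter> {u..Suc r} \<times> {c..Suc s}" "set qs \<subseteq> F \<inter> {u..Suc r} \<times> {c..Suc s}"
        using ps(3) qs(3) by blast+
      then show ?thesis
        using set_take_subset[of "Suc a" ps] set_drop_subset[of a qs] by (simp add: subset_trans)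
    qed
    moreover have "length (take (Suc a) ps @ drop a qs) = Suc t"
      using a(1) ps(1) qs(1) by simp
    ultimately have "has_chain (F \<inter> {u..Suc r} \<times> {c..Suc s}) (Suc t)"
      unfolding has_chain_def by blast
    then show ?thesis ..
  next
    case no: False
    show ?thesis
    proof (cases "snd (ps ! 0) = Suc s \<and> fst (qs ! (t - 1)) = Suc r")
      case False
      have "set ps \<subseteq> F \<inter> {u..r} \<times> {c..s} \<or> set qs \<subseteq> F \<inter> {u..r} \<times> {c..s}"
      proof (cases "snd (ps ! 0) = Suc s")
        case True
        have *: "fst (qs ! i) \<le> r" if "i < t" for i
        proof -
          have "i \<le> t - 1" "t - 1 < length qs" using that qs(1) by auto
          from chain_rows[OF qs(2) this] show ?thesis
            using False True qn(3)[of "t - 1"] that by auto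
        qed
        have "set qs \<subseteq> F \<inter> {u..r} \<times> {c..s}"
        proof
          fix x assume "x \<in> set qs"
          then obtain i where "i < t" "x = qs ! i" using qs(1) by (metis in_set_conv_nth)
          then show "x \<in> F \<inter> {u..r} \<times> {c..s}"
            using qn[of i] * by (simp add: mem_Times_iff)
        qed
        then show ?thesis ..
      next
        case False
        then have *: "snd (ps ! i) \<le> s" if "i < t" for i
          using chain_cols[OF ps(2), of 0 i] pn(5)[of 0] that ps(1) by auto
        have "set ps \<subseteq> F \<inter> {u..r} \<times> {c..s}"
        proof
          fix x assume "x \<in> set ps"
          then obtain i where "i < t" "x = ps ! i" using ps(1) by (metis in_set_conv_nth)
          then show "x \<in> F \<inter> {u..r} \<times> {c..s}"
            using pn[of i] * by (simp add: mem_Times_iff)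
        qed
        then show ?thesis ..
      qed
      then have "has_chain (F \<inter> {u..r} \<times> {c..s}) t"
        using has_chainI[OF ps(2), of "F \<inter> {u..r} \<times> {c..s}"] has_chainI[OF qs(2), of "F \<inter> {u..r} \<times> {c..s}"]
        by (metis ps(1) qs(1))
      then show ?thesis ..
    next
      case True
      \<comment> \<open>\<open>P\<close> holds at \<open>0\<close> because \<open>ps ! 0\<close>
        lies in the new column, and fails at \<open>t - 1\<close> because the last element of
        \<open>qs\<close> lies in the new row. Where it changes, \<open>qs ! a\<close> is north-east
        of \<open>ps ! Suc a\<close>.\<close>
      define P where "P a \<longleftrightarrow> fst (qs ! a) \<le> fst (ps ! a)" for a
      have P0: "P 0"
        using no True qn(5)[of 0] False unfolding P_def ne_sw_def by (auto simp: not_less)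
      have Pt: "\<not> P (t - 1)"
        using True pn(3)[of "t - 1"] False by (auto simp: P_def)
      have "\<exists>a. Suc a < t \<and> P a \<and> \<not> P (Suc a)"
      proof (rule ccontr)
        assume H: "\<nexists>a. Suc a < t \<and> P a \<and> \<not> P (Suc a)"
        have "P a" if "a < t" for a
          using that by (induction a) (use P0 H in auto)
        then show False using Pt False by simp
      qed
      then obtain a where a: "Suc a < t" "P a" "\<not> P (Suc a)" by blast
      have "snd (ps ! Suc a) \<le> snd (qs ! Suc a)"
        using no a unfolding P_def ne_sw_def by (metis not_le)
      then have "ne_sw (qs ! a) (ps ! Suc a)"
        using a chain_nth_less[OF ps(2), of a "Suc a"] chain_nth_less[OF qs(2), of a "Suc a"] ps(1) qs(1)
        unfolding P_def ne_sw_def by auto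
      then have "sorted_wrt ne_sw (take (Suc a) qs @ drop (Suc a) ps)"
        using a ps qs by (intro chain_append) (auto simp: sorted_wrt_take sorted_wrt_drop hd_drop_conv_nth last_take_Suc)
      moreover have "set (take (Suc a) qs @ drop (Suc a) ps) \<subseteq> F \<inter> {u..r} \<times> {c..s}"
      proof -
        have "set (take (Suc a) qs) \<subseteq> F \<inter> {u..r} \<times> {c..s}"
        proof
          fix x assume "x \<in> set (take (Suc a) qs)"
          then obtain i where i: "i < Suc a" "x = qs ! i"
            by (rule in_set_takeE)
          then have "i \<le> t - 1" "t - 1 < length qs" "i < t - 1" using a(1) qs(1) by auto
          from chain_rows[OF qs(2) this(1,2)] this(3) show "x \<in> F \<inter> {u..r} \<times> {c..s}"
            using qn[of i] qn(3)[of "t - 1"] i qs(1) by (simp add: mem_Times_iff)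
        qed
        moreover have "set (drop (Suc a) ps) \<subseteq> F \<inter> {u..r} \<times> {c..s}"
        proof
          fix x assume "x \<in> set (drop (Suc a) ps)"
          then obtain i where i: "Suc a \<le> i" "i < t" "x = ps ! i"
            using ps(1) by (metis in_set_dropE)
          then show "x \<in> F \<inter> {u..r} \<times> {c..s}"
            using chain_cols[OF ps(2), of 0 i] pn[of i] pn(5)[of 0] ps(1)
            by (auto simp: mem_Times_iff)
        qed
        ultimately show ?thesis by simp
      qed
      moreover have "length (take (Suc a) qs @ drop (Suc a) ps) = t"
        using a(1) ps(1) qs(1) by simp
      ultimately have "has_chain (F \<inter> {u..r} \<times> {c..s}) t"
        unfolding has_chain_def by blast
      then show ?thesis ..
    qed
  qed
qed simp

text \<open>A greedy choice: the new positions occupy the columns from \<open>c + t - 1\<close> down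
  to \<open>Suc c\<close>, each as high as possible subject to \<open>ok\<close>. Suppose a
  \<open>t\<close>-chain meets them first in number \<open>a\<close> and last in number
  \<open>b\<close>. Then number \<open>a\<close> has index at most \<open>a\<close> in the chain and
  number \<open>b\<close> has index greater than \<open>b\<close>, but the columns leave room for at
  most \<open>b - a\<close> steps in between.\<close>

lemma chain_extend:
  assumes nc: "\<not> has_chain (F \<inter> {u..r} \<times> {c..Suc s}) t" and cs: "c + t \<le> Suc s" and ur: "u + t \<le> Suc r"
  obtains ps where "Suc (length ps) = t" "sorted_wrt ne_sw ps" "set ps \<subseteq> {u..r} \<times> {Suc c..s}"
    "\<not> has_chain ((F \<union> set ps) \<inter> {u..r} \<times> {c..Suc s}) t"
proof -
  define G where "G = F \<inter> {u..r} \<times> {c..Suc s}"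
  have t0: "0 < t" using nc by (cases t) auto
  \<comment> \<open>New position number \<open>a\<close> is preceded by \<open>a\<close> others, so
    it may stand in row \<open>i\<close> if the old positions strictly south-west of it contain no
    chain of the \<open>t - 1 - a\<close> elements that would complete it to length
    \<open>t\<close>.\<close>
  define ok where "ok a i \<longleftrightarrow> u + a \<le> i \<and>
      \<not> has_chain (G \<inter> {x. i < fst x \<and> snd x + a + 2 \<le> c + t}) (t - 1 - a)" for a i
  define \<rho> where "\<rho> a = (LEAST i. ok a i)" for a
  have okr: "ok a r" if "a + 1 < t" for a
  proof -
    have "G \<inter> {x. r < fst x \<and> snd x + a + 2 \<le> c + t} = {}"
      by (auto simp: G_def)
    then show ?thesis
      using that ur unfolding ok_def has_chain_def by auto
  qed
  have ok\<rho>: "ok a (\<rho> a)" and \<rho>le: "\<And>i. ok a i \<Longrightarrow> \<rho> a \<le> i" and \<rho>r: "\<rho> a \<le> r" if "a + 1 < t" for a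
    using LeastI[of "ok a" r] Least_le[of "ok a"] okr[OF that] unfolding \<rho>_def by auto
  have \<rho>min: "has_chain (G \<inter> {x. \<rho> a \<le> fst x \<and> snd x + a + 2 \<le> c + t}) (t - 1 - a)"
    if "a + 1 < t" "u + a < \<rho> a" for a
  proof -
    have "\<not> ok a (\<rho> a - 1)"
      using \<rho>le[OF that(1), of "\<rho> a - 1"] that(2) by auto
    then have "has_chain (G \<inter> {x. \<rho> a - 1 < fst x \<and> snd x + a + 2 \<le> c + t}) (t - 1 - a)"
      using that(2) unfolding ok_def by auto
    then show ?thesis
      by (rule has_chain_mono) (use that(2) in auto)
  qed
  have \<rho>inc: "\<rho> a < \<rho> (Suc a)" if "Suc a + 1 < t" for a
  proof -
    have u1: "u + Suc a \<le> \<rho> (Suc a)"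
      and no: "\<not> has_chain (G \<inter> {x. \<rho> (Suc a) < fst x \<and> snd x + Suc a + 2 \<le> c + t}) (t - 1 - Suc a)"
      using ok\<rho>[OF that] by (auto simp: ok_def)
    have "\<not> has_chain (G \<inter> {x. \<rho> (Suc a) - 1 < fst x \<and> snd x + a + 2 \<le> c + t}) (t - 1 - a)"
    proof
      assume "has_chain (G \<inter> {x. \<rho> (Suc a) - 1 < fst x \<and> snd x + a + 2 \<le> c + t}) (t - 1 - a)"
      then obtain ps where ps: "length ps = t - 1 - a" "sorted_wrt ne_sw ps"
        "set ps \<subseteq> G \<inter> {x. \<rho> (Suc a) - 1 < fst x \<and> snd x + a + 2 \<le> c + t}"
        by (auto simp: has_chain_def)
      then obtain x xs where xs: "ps = x # xs"
        by (cases ps) (use ps(1) \<open>Suc a + 1 < t\<close> in auto)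
      have "set xs \<subseteq> G \<inter> {x. \<rho> (Suc a) < fst x \<and> snd x + Suc a + 2 \<le> c + t}"
        using ps u1 unfolding xs by (force simp: ne_sw_def)
      then have "has_chain (G \<inter> {x. \<rho> (Suc a) < fst x \<and> snd x + Suc a + 2 \<le> c + t}) (length xs)"
        using ps(2) xs by (intro has_chainI) auto
      moreover have "length xs = t - 1 - Suc a" using ps(1) xs by simp
      ultimately show False using no by metis
    qed
    then have "ok a (\<rho> (Suc a) - 1)"
      using u1 by (auto simp: ok_def)
    then show ?thesis
      using \<rho>le[of a] that u1 by fastforce
  qed
  define pt where "pt a = (\<rho> a, c + t - 1 - a)" for a
  define ps where "ps = map pt [0..<t - 1]"
  have \<rho>less: "\<rho> a < \<rho> b" if "a < b" "b + 1 < t" for a b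
    using that
  proof (induction b)
    case (Suc b)
    then show ?case
      using \<rho>inc[of b] by (cases "a = b") auto
  qed simp
  have len: "Suc (length ps) = t" using t0 by (simp add: ps_def)
  have sorted: "sorted_wrt ne_sw ps"
    using \<rho>less by (auto simp: ps_def sorted_wrt_iff_nth_less ne_sw_def pt_def)
  have sub: "set ps \<subseteq> {u..r} \<times> {Suc c..s}"
  proof
    fix x assume "x \<in> set ps"
    then obtain a where a: "a < t - 1" "x = pt a" by (auto simp: ps_def)
    then have "a + 1 < t" by simp
    with a show "x \<in> {u..r} \<times> {Suc c..s}"
      using ok\<rho>[of a] \<rho>r[of a] cs by (auto simp: ok_def pt_def)
  qed
  have "\<not> has_chain ((F \<union> set ps) \<inter> {u..r} \<times> {c..Suc s}) t"
  proof
    assume "has_chain ((F \<union> set ps) \<inter> {u..r} \<times> {c..Suc s}) t"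
    then obtain xs where xs: "length xs = t" "sorted_wrt ne_sw xs"
      "set xs \<subseteq> (F \<union> set ps) \<inter> {u..r} \<times> {c..Suc s}"
      by (auto simp: has_chain_def)
    have xn: "xs ! i \<in> G \<or> xs ! i \<in> set ps" "u \<le> fst (xs ! i)" if "i < t" for i
      using subsetD[OF xs(3) nth_mem[of i]] xs(1) that by (auto simp: G_def mem_Times_iff)
    define A where "A = {n. n < t \<and> xs ! n \<in> set ps}"
    have "A \<noteq> {}"
    proof
      assume "A = {}"
      then have "xs ! i \<in> G" if "i < t" for i
        using xn(1)[OF that] that by (auto simp: A_def)
      then have "set xs \<subseteq> G"
        using xs(1) by (metis in_set_conv_nth subsetI)
      then show False
        using has_chainI[OF xs(2), of G] nc xs(1) by (auto simp: G_def)
    qed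
    moreover have finA: "finite A" by (simp add: A_def)
    ultimately have "Min A \<in> A" "Max A \<in> A" by simp_all
    define n1 where "n1 = Min A"
    define n2 where "n2 = Max A"
    have n1: "n1 < t" "xs ! n1 \<in> set ps" and n2: "n2 < t" "xs ! n2 \<in> set ps"
      using \<open>Min A \<in> A\<close> \<open>Max A \<in> A\<close> by (auto simp: n1_def n2_def A_def)
    have n12: "n1 \<le> n2" using finA \<open>Max A \<in> A\<close> by (auto simp: n1_def n2_def)
    have before: "xs ! i \<in> G" if "i < n1" for i
    proof -
      have "i \<notin> A" using Min_le[OF finA, of i] that by (auto simp: n1_def)
      then show ?thesis using xn(1)[of i] that n1(1) by (auto simp: A_def)
    qed
    have after: "xs ! i \<in> G" if "n2 < i" "i < t" for i
    proof -
      have "i \<notin> A" using Max_ge[OF finA, of i] that by (auto simp: n2_def)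
      then show ?thesis using xn(1)[of i] that by (auto simp: A_def)
    qed
    obtain a where a: "a < t - 1" "xs ! n1 = pt a" using n1 by (auto simp: ps_def)
    obtain b where b: "b < t - 1" "xs ! n2 = pt b" using n2 by (auto simp: ps_def)
    have a1: "a + 1 < t" and b1: "b + 1 < t" using a(1) b(1) by auto
    have "n2 - n1 + (c + t - 1 - b) \<le> c + t - 1 - a"
      using chain_cols[OF xs(2) n12] n2(1) xs(1) a b by (simp add: pt_def)
    then have ab: "n2 + a \<le> n1 + b"
      using a b n12 by auto
    \<comment> \<open>If the row could not be chosen higher because of a chain of old positions,
      that chain prolongs the part before \<open>n1\<close> and must not reach length
      \<open>t\<close>; if the row is the first one allowed, counting rows suffices.\<close>
    have n1a: "n1 \<le> a"
    proof (cases "\<rho> a = u + a")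
      case True
      then show ?thesis
        using chain_rows[OF xs(2), of 0 n1] n1(1) xs(1) xn(2)[of 0] a by (simp add: pt_def)
    next
      case False
      then have "u + a < \<rho> a" using ok\<rho>[OF a1] by (auto simp: ok_def)
      then obtain ys where ys: "length ys = t - 1 - a" "sorted_wrt ne_sw ys"
        "set ys \<subseteq> G \<inter> {x. \<rho> a \<le> fst x \<and> snd x + a + 2 \<le> c + t}"
        using \<rho>min[OF a1] by (auto simp: has_chain_def)
      have tk: "set (take n1 xs) \<subseteq> G"
      proof
        fix x assume "x \<in> set (take n1 xs)"
        then obtain i where "i < n1" "x = xs ! i" by (rule in_set_takeE)
        then show "x \<in> G" using before by simp
      qed
      have "sorted_wrt ne_sw (take n1 xs @ ys)"
      proof (rule chain_append)
        assume ne: "take n1 xs \<noteq> []" "ys \<noteq> []"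
        then have l: "last (take n1 xs) = xs ! (n1 - 1)" "0 < n1"
          using n1(1) xs(1) by (auto simp: last_conv_nth min_def)
        have "ne_sw (xs ! (n1 - 1)) (xs ! n1)"
          using chain_nth_less[OF xs(2), of "n1 - 1" n1] n1(1) xs(1) l by auto
        moreover have "hd ys \<in> set ys" using ne by simp
        then have "\<rho> a \<le> fst (hd ys)" "snd (hd ys) + a + 2 \<le> c + t" using ys(3) by auto
        ultimately show "ne_sw (last (take n1 xs)) (hd ys)"
          using l a by (auto simp: ne_sw_def pt_def)
      qed (use xs ys in \<open>auto simp: sorted_wrt_take\<close>)
      then have "has_chain G (n1 + (t - 1 - a))"
        using has_chainI[of "take n1 xs @ ys" G] tk ys n1(1) xs(1) by auto
      then show ?thesis
        using has_chain_le[of G "n1 + (t - 1 - a)" t] nc a(1) by (fastforce simp: G_def)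
    qed
    have "b < n2"
    proof (rule ccontr)
      assume "\<not> b < n2"
      have "set (drop (Suc n2) xs) \<subseteq> G \<inter> {x. \<rho> b < fst x \<and> snd x + b + 2 \<le> c + t}"
      proof
        fix x assume "x \<in> set (drop (Suc n2) xs)"
        then obtain i where i: "n2 < i" "i < t" "x = xs ! i"
          using xs(1) by (metis in_set_dropE Suc_le_eq)
        then show "x \<in> G \<inter> {x. \<rho> b < fst x \<and> snd x + b + 2 \<le> c + t}"
          using after[of i] chain_nth_less[OF xs(2), of n2 i] xs(1) b
          by (auto simp: ne_sw_def pt_def)
      qed
      then have "has_chain (G \<inter> {x. \<rho> b < fst x \<and> snd x + b + 2 \<le> c + t}) (t - Suc n2)"
        using has_chainI[of "drop (Suc n2) xs" "G \<inter> {x. \<rho> b < fst x \<and> snd x + b + 2 \<le> c + t}"] xs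
        by (auto simp: sorted_wrt_drop)
      then have "has_chain (G \<inter> {x. \<rho> b < fst x \<and> snd x + b + 2 \<le> c + t}) (t - 1 - b)"
        by (rule has_chain_le) (use \<open>\<not> b < n2\<close> in auto)
      then show False using ok\<rho>[OF b1] by (auto simp: ok_def)
    qed
    with ab n1a show False by simp
  qed
  then show ?thesis using that len sorted sub by blast
qed

subsection \<open>Rank conditions on neighbouring boxes\<close>

text \<open>
  The four regions below are the boxes of the rank conditions (t, r, s), (t, r + 1, s),
  (t, r, s + 1) and (t + 1, r + 1, s + 1) on an upper left submatrix, continued beyond the border
  of the generic matrix: \<open>R\<close> (\<open>S\<close>) says that row \<open>Suc r\<close> (column \<open>Suc s\<close>) belongs to the matrix.
  If it does not, it acts like a row (column) whose only nonzero entry is a 1 in the first column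
  (row) of the box.
\<close>

definition box_right :: "bool \<Rightarrow> nat \<Rightarrow> nat \<Rightarrow> nat \<Rightarrow> nat \<Rightarrow> (nat \<times> nat) set" where
  "box_right S u r c s = (if S then {u..r} \<times> {c..Suc s} else {Suc u..r} \<times> {c..s})"

definition box_down :: "bool \<Rightarrow> nat \<Rightarrow> nat \<Rightarrow> nat \<Rightarrow> nat \<Rightarrow> (nat \<times> nat) set" where
  "box_down R u r c s = (if R then {u..Suc r} \<times> {c..s} else {u..r} \<times> {Suc c..s})"

definition box_diag :: "bool \<Rightarrow> bool \<Rightarrow> nat \<Rightarrow> nat \<Rightarrow> nat \<Rightarrow> nat \<Rightarrow> (nat \<times> nat) set" where
  "box_diag R S u r c s =
     {if S then u else Suc u..if R then Suc r else r} \<times> {if R then c else Suc c..if S then Suc s else s}"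

definition dec_unless :: "bool \<Rightarrow> nat \<Rightarrow> nat" where
  "dec_unless b t = (if b then t else t - 1)"

lemma has_chain_Cons:
  assumes "has_chain F t" "\<And>x. x \<in> F \<Longrightarrow> ne_sw p x"
  shows "has_chain (insert p F) (Suc t)"
proof -
  obtain ps where "length ps = t" "sorted_wrt ne_sw ps" "set ps \<subseteq> F"
    using assms(1) by (auto simp: has_chain_def)
  then show ?thesis
    using assms(2) unfolding has_chain_def by (intro exI[of _ "p # ps"]) auto
qed

lemma has_chain_snoc:
  assumes "has_chain F t" "\<And>x. x \<in> F \<Longrightarrow> ne_sw x p"
  shows "has_chain (insert p F) (Suc t)"
proof -
  obtain ps where "length ps = t" "sorted_wrt ne_sw ps" "set ps \<subseteq> F"
    using assms(1) by (auto simp: has_chain_def)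
  then show ?thesis
    using assms(2) unfolding has_chain_def by (intro exI[of _ "ps @ [p]"]) (auto simp: sorted_wrt_append)
qed

lemma has_chain_tl:
  assumes "has_chain F (Suc t)" "\<And>x y. x \<in> F \<Longrightarrow> y \<in> F \<Longrightarrow> ne_sw x y \<Longrightarrow> y \<in> G"
  shows "has_chain G t"
proof -
  obtain ps where ps: "length ps = Suc t" "sorted_wrt ne_sw ps" "set ps \<subseteq> F"
    using assms(1) by (auto simp: has_chain_def)
  then obtain p qs where "ps = p # qs" by (cases ps) auto
  then have "set qs \<subseteq> G" using ps assms(2)[of p] by auto
  with \<open>ps = p # qs\<close> show ?thesis
    using ps has_chainI[of qs G] by auto
qed

lemma has_chain_butlast:
  assumes "has_chain F (Suc t)" "\<And>x y. x \<in> F \<Longrightarrow> y \<in> F \<Longrightarrow> ne_sw x y \<Longrightarrow> x \<in> G"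
  shows "has_chain G t"
proof -
  obtain ps where ps: "length ps = Suc t" "sorted_wrt ne_sw ps" "set ps \<subseteq> F"
    using assms(1) by (auto simp: has_chain_def)
  then obtain p qs where "ps = qs @ [p]" by (cases ps rule: rev_cases) auto
  then have "set qs \<subseteq> G" using ps assms(2)[of _ p] by (auto simp: sorted_wrt_append)
  with \<open>ps = qs @ [p]\<close> show ?thesis
    using ps has_chainI[of qs G] by (auto simp: sorted_wrt_append)
qed

text \<open>Reduction to \<open>chain_exchange\<close>. A missing column is simulated by the single
  position \<open>(u, Suc s)\<close>, which is north-east of all of \<open>box_right\<close>, and a
  missing row by \<open>(Suc r, c)\<close>, which is south-west of all of \<open>box_down\<close>.
  Afterwards they are stripped off at the price of one chain element each.\<close>

lemma boxes_meet:
  assumes t: "0 < t" and ur: "u \<le> r" and cs: "c \<le> s"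
    and C: "has_chain (F \<inter> box_right S u r c s) (dec_unless S t)"
    and D: "has_chain (F \<inter> box_down R u r c s) (dec_unless R t)"
  shows "has_chain (F \<inter> {u..r} \<times> {c..s}) t \<or>
    has_chain (F \<inter> box_diag R S u r c s) (dec_unless R (dec_unless S (Suc t)))"
proof -
  define F' where "F' = (F \<inter> {u..if R then Suc r else r} \<times> {c..if S then Suc s else s}) \<union>
      (if S then {} else {(u, Suc s)}) \<union> (if R then {} else {(Suc r, c)})"
  have C': "has_chain (F' \<inter> {u..r} \<times> {c..Suc s}) t"
  proof (cases S)
    case True
    then show ?thesis
      using C by (auto simp: box_right_def dec_unless_def F'_def elim!: has_chain_mono)
  next
    case False
    then have "has_chain (insert (u, Suc s) (F \<inter> box_right S u r c s)) (Suc (t - 1))"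
      using C by (intro has_chain_Cons) (auto simp: dec_unless_def box_right_def ne_sw_def)
    then have "has_chain (insert (u, Suc s) (F \<inter> box_right S u r c s)) t"
      using t by simp
    then show ?thesis
      by (rule has_chain_mono) (use ur cs False in \<open>auto simp: box_right_def F'_def\<close>)
  qed
  have D': "has_chain (F' \<inter> {u..Suc r} \<times> {c..s}) t"
  proof (cases R)
    case True
    then show ?thesis
      using D by (auto simp: box_down_def dec_unless_def F'_def elim!: has_chain_mono)
  next
    case False
    then have "has_chain (insert (Suc r, c) (F \<inter> box_down R u r c s)) (Suc (t - 1))"
      using D by (intro has_chain_snoc) (auto simp: dec_unless_def box_down_def ne_sw_def)
    then have "has_chain (insert (Suc r, c) (F \<inter> box_down R u r c s)) t"
      using t by simp
    then show ?thesis
      by (rule has_chain_mono) (use ur cs False in \<open>auto simp: box_down_def F'_def\<close>)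
  qed
  from chain_exchange[OF C' D'] show ?thesis
  proof
    assume "has_chain (F' \<inter> {u..r} \<times> {c..s}) t"
    then have "has_chain (F \<inter> {u..r} \<times> {c..s}) t"
      by (rule has_chain_mono) (auto simp: F'_def split: if_splits)
    then show ?thesis ..
  next
    assume H: "has_chain (F' \<inter> {u..Suc r} \<times> {c..Suc s}) (Suc t)"
    \<comment> \<open>All elements of a chain but the last avoid column \<open>c\<close> and row
      \<open>Suc r\<close>, so for a missing row these positions can be deleted at the cost of one
      element. Row \<open>u\<close> and column \<open>Suc s\<close> are treated in the same way
      below, dropping the first element.\<close>
    define F'' where "F'' = (F' - (if R then {} else {x. snd x = c} \<union> {x. fst x = Suc r})) \<inter> {u..Suc r} \<times> {c..Suc s}"
    have "has_chain F'' (dec_unless R (Suc t))"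
    proof (cases R)
      case True
      then show ?thesis using H by (simp add: dec_unless_def F''_def)
    next
      case False
      from H have "has_chain F'' t"
        by (rule has_chain_butlast) (auto simp: F''_def ne_sw_def)
      then show ?thesis using False by (simp add: dec_unless_def)
    qed
    moreover have "has_chain (F'' - {x. fst x = u} - {x. snd x = Suc s}) (dec_unless R (Suc t) - 1)"
      if "\<not> S"
    proof -
      have "has_chain F'' (Suc (dec_unless R (Suc t) - 1))"
        using calculation t by (simp add: dec_unless_def split: if_splits)
      then show ?thesis
        by (rule has_chain_tl) (auto simp: F''_def ne_sw_def)
    qed
    moreover have "dec_unless R (Suc t) - 1 = dec_unless R (dec_unless False (Suc t))"
      by (simp add: dec_unless_def)
    ultimately have "has_chain (if S then F'' else F'' - {x. fst x = u} - {x. snd x = Suc s})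
        (dec_unless R (dec_unless S (Suc t)))"
      by (auto simp: dec_unless_def)
    then have "has_chain (F \<inter> box_diag R S u r c s) (dec_unless R (dec_unless S (Suc t)))"
      by (rule has_chain_mono) (auto simp: box_diag_def F'_def F''_def split: if_splits)
    then show ?thesis ..
  qed
qed

text \<open>Again \<open>(u, Suc s)\<close> stands in for a missing column. If row
  \<open>Suc r\<close> is present, its position in column \<open>c\<close> completes the chain from
  \<open>chain_extend\<close> to length \<open>t\<close> and does no harm, as it is outside
  \<open>box_right\<close>.\<close>

lemma box_right_extend:
  assumes nC: "\<not> has_chain (F \<inter> box_right S u r c s) (dec_unless S t)"
    and t: "0 < t" and cs: "c + t \<le> Suc s" and ur: "u + t \<le> Suc r"
  obtains ps where "length ps = dec_unless R t" "sorted_wrt ne_sw ps" "set ps \<subseteq> box_down R u r c s"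
    "\<not> has_chain ((F \<union> set ps) \<inter> box_right S u r c s) (dec_unless S t)"
proof -
  define F' where "F' = (if S then F else F \<inter> {u..r} \<times> {c..s} \<union> {(u, Suc s)})"
  have "\<not> has_chain (F' \<inter> {u..r} \<times> {c..Suc s}) t"
  proof (cases S)
    case True
    then show ?thesis using nC by (simp add: box_right_def dec_unless_def F'_def)
  next
    case False
    show ?thesis
    proof
      assume "has_chain (F' \<inter> {u..r} \<times> {c..Suc s}) t"
      then have "has_chain (F' \<inter> {u..r} \<times> {c..Suc s}) (Suc (t - 1))"
        using t by simp
      then have "has_chain (F \<inter> box_right S u r c s) (t - 1)"
        by (rule has_chain_tl) (use False in \<open>auto simp: F'_def box_right_def ne_sw_def\<close>)
      then show False using nC False by (simp add: dec_unless_def)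
    qed
  qed
  then obtain ps where ps: "Suc (length ps) = t" "sorted_wrt ne_sw ps" "set ps \<subseteq> {u..r} \<times> {Suc c..s}"
    "\<not> has_chain ((F' \<union> set ps) \<inter> {u..r} \<times> {c..Suc s}) t"
    using cs ur by (rule chain_extend)
  define qs where "qs = (if R then ps @ [(Suc r, c)] else ps)"
  have "length qs = dec_unless R t"
    using ps(1) by (auto simp: qs_def dec_unless_def)
  moreover have "sorted_wrt ne_sw qs"
    using ps(2,3) by (auto simp: qs_def sorted_wrt_append ne_sw_def)
  moreover have "set qs \<subseteq> box_down R u r c s"
    using ps(3) t cs ur by (force simp: qs_def box_down_def)
  moreover have "\<not> has_chain ((F \<union> set qs) \<inter> box_right S u r c s) (dec_unless S t)"
  proof
    assume H: "has_chain ((F \<union> set qs) \<inter> box_right S u r c s) (dec_unless S t)"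
    have eq: "(F \<union> set qs) \<inter> box_right S u r c s = (F \<union> set ps) \<inter> box_right S u r c s"
      by (auto simp: qs_def box_right_def)
    show False
    proof (cases S)
      case True
      then show False
        using H ps(4) unfolding eq by (simp add: box_right_def F'_def dec_unless_def)
    next
      case False
      have "has_chain (insert (u, Suc s) ((F \<union> set ps) \<inter> box_right S u r c s)) (Suc (t - 1))"
        using H False unfolding eq
        by (intro has_chain_Cons) (auto simp: dec_unless_def box_right_def ne_sw_def)
      then have "has_chain (insert (u, Suc s) ((F \<union> set ps) \<inter> box_right S u r c s)) t"
        using t by simp
      then have "has_chain ((F' \<union> set ps) \<inter> {u..r} \<times> {c..Suc s}) t"
        by (rule has_chain_mono) (use False t cs ur in \<open>auto simp: box_right_def F'_def\<close>)
      then show False using ps(4) by simp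
    qed
  qed
  ultimately show ?thesis by (rule that)
qed

text \<open>Swapping coordinates reverses \<open>ne_sw\<close>, hence the
  \<open>rev\<close>.\<close>

lemma chain_transpose:
  "sorted_wrt ne_sw (rev (map prod.swap ps)) \<longleftrightarrow> sorted_wrt ne_sw ps"
  by (simp add: sorted_wrt_rev sorted_wrt_map ne_sw_def[abs_def] conj_commute)

lemma has_chain_transpose: "has_chain (prod.swap ` F) t \<longleftrightarrow> has_chain F t"
proof -
  have *: "has_chain (prod.swap ` F) t" if F: "has_chain F t" for F
  proof -
    obtain ps where "length ps = t" "sorted_wrt ne_sw ps" "set ps \<subseteq> F"
      using F by (auto simp: has_chain_def)
    then show ?thesis
      unfolding has_chain_def
      by (intro exI[of _ "rev (map prod.swap ps)"]) (auto simp: chain_transpose)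
  qed
  from *[of F] *[of "prod.swap ` F"] show ?thesis
    by (auto simp: image_image)
qed

lemma box_transpose:
  "prod.swap ` (F \<inter> box_right S u r c s) = prod.swap ` F \<inter> box_down S c s u r"
  "prod.swap ` (F \<inter> box_down S u r c s) = prod.swap ` F \<inter> box_right S c s u r"
  by (auto simp: box_right_def box_down_def image_iff)

lemma box_down_extend:
  assumes nC: "\<not> has_chain (F \<inter> box_down R u r c s) (dec_unless R t)"
    and t: "0 < t" and cs: "c + t \<le> Suc s" and ur: "u + t \<le> Suc r"
  obtains ps where "length ps = dec_unless S t" "sorted_wrt ne_sw ps" "set ps \<subseteq> box_right S u r c s"
    "\<not> has_chain ((F \<union> set ps) \<inter> box_down R u r c s) (dec_unless R t)"
proof -
  have "\<not> has_chain (prod.swap ` F \<inter> box_right R c s u r) (dec_unless R t)"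
    using nC by (simp flip: box_transpose add: has_chain_transpose)
  then obtain qs where qs: "length qs = dec_unless S t" "sorted_wrt ne_sw qs" "set qs \<subseteq> box_down S c s u r"
    "\<not> has_chain ((prod.swap ` F \<union> set qs) \<inter> box_right R c s u r) (dec_unless R t)"
    using t ur cs by (rule box_right_extend)
  define ps where "ps = rev (map prod.swap qs)"
  have setps: "set qs = prod.swap ` set ps"
    by (simp add: ps_def image_image)
  have "length ps = dec_unless S t" "sorted_wrt ne_sw ps"
    using qs(1,2) by (auto simp: ps_def chain_transpose)
  moreover have "set ps \<subseteq> box_right S u r c s"
    using qs(3) by (force simp: ps_def box_right_def box_down_def split: if_splits)
  moreover have "\<not> has_chain ((F \<union> set ps) \<inter> box_down R u r c s) (dec_unless R t)"
    using qs(4) unfolding setps image_Un[symmetric] box_transpose[symmetric] has_chain_transpose .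
  ultimately show ?thesis by (rule that)
qed

subsection \<open>Levels\<close>

definition level :: "(nat \<times> nat) set \<Rightarrow> nat \<times> nat \<Rightarrow> nat" where
  "level F x = Max {length ps |ps. sorted_wrt ne_sw ps \<and> set ps \<subseteq> F \<and> ps \<noteq> [] \<and> last ps = x}"

text \<open>Mirsky's argument: a longest chain ending at \<open>x\<close> can be continued by
  \<open>y\<close>. The levels thus colour \<open>F\<close> with \<open>t - 1\<close> colours such
  that no two positions of one colour are related by \<open>ne_sw\<close>.\<close>

lemma level_props:
  assumes nc: "\<not> has_chain F t" and x: "x \<in> F"
  shows "0 < level F x" "level F x < t"
    and "y \<in> F \<Longrightarrow> ne_sw x y \<Longrightarrow> level F x < level F y"
proof -
  define L where "L x = {length ps |ps. sorted_wrt ne_sw ps \<and> set ps \<subseteq> F \<and> ps \<noteq> [] \<and> last ps = x}" for x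
  have Lt: "n < t" if "n \<in> L x" for n x
    using that nc has_chain_le[of F n t] by (force simp: L_def has_chain_def not_less)
  have fin: "finite (L x)" for x
    by (rule finite_subset[of _ "{..<t}"]) (auto dest: Lt)
  have one: "1 \<in> L x" if "x \<in> F" for x
    using that by (auto simp: L_def intro!: exI[of _ "[x]"])
  have lev: "level F x \<in> L x" if "x \<in> F" for x
    using Max_in[OF fin] one[OF that] unfolding level_def L_def[symmetric] by blast
  have ge: "n \<le> level F x" if "n \<in> L x" for n x
    using Max_ge[OF fin that] by (simp add: level_def L_def)
  show "0 < level F x" using ge[OF one[OF x]] by simp
  show "level F x < t" by (rule Lt[OF lev[OF x]])
  show "level F x < level F y" if y: "y \<in> F" "ne_sw x y"
  proof -
    obtain ps where ps: "level F x = length ps" "sorted_wrt ne_sw ps" "set ps \<subseteq> F" "ps \<noteq> []" "last ps = x"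
      using lev[OF x] by (auto simp: L_def)
    then have "sorted_wrt ne_sw (ps @ [y])"
      using y by (intro chain_append) auto
    then have "Suc (length ps) \<in> L y"
      using ps y by (auto simp: L_def intro!: exI[of _ "ps @ [y]"])
    then show ?thesis using ge ps(1) by fastforce
  qed
qed

section \<open>Additive functionals on monomials\<close>

text \<open>Total degrees, row and column degrees, single exponents and weights are all instances of
  this.\<close>

definition lin :: "('v \<Rightarrow> nat) \<Rightarrow> ('v \<Rightarrow>\<^sub>0 nat) \<Rightarrow> nat" where
  "lin f m = (\<Sum>v\<in>mkeys m. f v * coef m v)"

lemma lin_superset: "finite A \<Longrightarrow> mkeys m \<subseteq> A \<Longrightarrow> lin f m = (\<Sum>v\<in>A. f v * coef m v)"
  unfolding lin_def by (rule sum.mono_neutral_left) (auto simp: in_keys_iff)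

lemma lin_0 [simp]: "lin f 0 = 0"
  by (simp add: lin_def)

lemma lin_add [simp]: "lin f (m + n) = lin f m + lin f n"
proof -
  have "lin f (m + n) = (\<Sum>v\<in>mkeys m \<union> mkeys n. f v * coef (m + n) v)"
    by (rule lin_superset) (auto simp: keys_monom_add)
  also have "\<dots> = (\<Sum>v\<in>mkeys m \<union> mkeys n. f v * coef m v) + (\<Sum>v\<in>mkeys m \<union> mkeys n. f v * coef n v)"
    by (simp add: lookup_add distrib_left sum.distrib)
  also have "\<dots> = lin f m + lin f n"
    by (simp add: lin_superset[of "mkeys m \<union> mkeys n"])
  finally show ?thesis .
qed

lemma lin_single [simp]: "lin f (Poly_Mapping.single v c) = f v * c"
  by (simp add: lin_def)

lemma lin_sum: "lin f (sum g A) = (\<Sum>i\<in>A. lin f (g i))"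
  by (induction A rule: infinite_finite_induct) auto

lemma lin_cong: "(\<And>v. v \<in> mkeys m \<Longrightarrow> f v = g v) \<Longrightarrow> lin f m = lin g m"
  by (auto simp: lin_def)

lemma lin_pos: "v \<in> mkeys m \<Longrightarrow> 0 < f v \<Longrightarrow> 0 < lin f m"
  unfolding lin_def by (intro sum_pos2[of _ v]) (auto simp: in_keys_iff)

lemma lin_eq_0: "(\<And>v. v \<in> mkeys m \<Longrightarrow> f v = 0) \<Longrightarrow> lin f m = 0"
  by (simp add: lin_def)

lemma lin_indicator: "lin (\<lambda>w. if w = v then 1 else 0) m = coef m v"
proof -
  have "lin (\<lambda>w. if w = v then 1 else 0) m = (\<Sum>w\<in>mkeys m. if w = v then coef m v else 0)"
    unfolding lin_def by (intro sum.cong) auto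
  then show ?thesis by (simp add: in_keys_iff)
qed

lemma monom_remove:
  assumes "v \<in> mkeys (m :: 'v \<Rightarrow>\<^sub>0 nat)"
  obtains n where "m = n + Poly_Mapping.single v 1"
proof -
  have "m = (m - Poly_Mapping.single v 1) + Poly_Mapping.single v 1"
    using assms by (intro poly_mapping_eqI) (auto simp: lookup_add lookup_minus lookup_single when_def in_keys_iff)
  then show ?thesis using that by blast
qed

lemma monom_induct [case_names zero add]:
  assumes "P 0" "\<And>m v. P m \<Longrightarrow> P (m + Poly_Mapping.single v 1)"
  shows "P (m :: 'v \<Rightarrow>\<^sub>0 nat)"
proof (induction "lin (\<lambda>_. 1) m" arbitrary: m)
  case 0
  then have "mkeys m = {}" using lin_pos[of _ m "\<lambda>_. 1"] by fastforce
  then show ?case using assms(1) by (simp add: keys_eq_empty)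
next
  case (Suc d)
  then have "m \<noteq> 0" by auto
  then obtain v where "v \<in> mkeys m" by (metis keys_eq_empty ex_in_conv)
  then obtain n where n: "m = n + Poly_Mapping.single v 1" by (rule monom_remove)
  then show ?case using Suc assms(2) by simp
qed

section \<open>Term orders selecting antidiagonals\<close>

abbreviation var :: "nat \<Rightarrow> nat \<Rightarrow> monom" where "var i j \<equiv> Poly_Mapping.single (i, j) 1"

lemma var_in_monoms [simp]: "Poly_Mapping.single p (Suc 0) \<in> monoms k l \<longleftrightarrow> p \<in> {1..k} \<times> {1..l}"
  by (simp add: monoms_def)

text \<open>Only 2-minors enter. Exchanging one pair at a time settles the leading monomials of all
  minors (\<open>antidiagonal_max\<close>) and the least monomial with given row and column degrees
  (\<open>nw_se_chain_minimal\<close>).\<close>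

locale adiag_order = total_monom_order "monoms k l" prec for k l :: nat and prec +
  assumes swap: "\<lbrakk>1 \<le> i; i < i'; i' \<le> k; 1 \<le> j; j < j'; j' \<le> l\<rbrakk> \<Longrightarrow>
    prec (var i j + var i' j') (var i j' + var i' j)"

abbreviation row_deg :: "monom \<Rightarrow> nat \<Rightarrow> nat" where
  "row_deg m i \<equiv> lin (\<lambda>p. if fst p = i then 1 else 0) m"
abbreviation col_deg :: "monom \<Rightarrow> nat \<Rightarrow> nat" where
  "col_deg m j \<equiv> lin (\<lambda>p. if snd p = j then 1 else 0) m"

definition nw_se_chain :: "monom \<Rightarrow> bool" where
  "nw_se_chain m \<longleftrightarrow> (\<forall>p\<in>mkeys m. \<forall>q\<in>mkeys m. \<not> ne_sw p q)"

lemma nw_se_chain_min: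
  assumes "nw_se_chain m" "m \<noteq> 0"
  obtains p where "p \<in> mkeys m" "\<And>q. q \<in> mkeys m \<Longrightarrow> fst p \<le> fst q \<and> snd p \<le> snd q"
proof -
  obtain p where p: "p \<in> mkeys m" "\<And>q. q \<in> mkeys m \<Longrightarrow> fst p + snd p \<le> fst q + snd q"
    using ex_min_if_finite[of "(\<lambda>p. fst p + snd p) ` mkeys m"] assms(2)
    by (metis (no_types, lifting) arg_min_if_finite(1) arg_min_least finite_keys keys_eq_empty)
  moreover have "fst p \<le> fst q \<and> snd p \<le> snd q" if q: "q \<in> mkeys m" for q
  proof -
    have "\<not> ne_sw p q" "\<not> ne_sw q p"
      using assms(1) p(1) q by (auto simp: nw_se_chain_def)
    then show ?thesis using p(2)[OF q] by (auto simp: ne_sw_def)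
  qed
  ultimately show ?thesis using that by blast
qed

text \<open>The north-west corner rule: the least position of such a monomial lies in the first row
  and the first column of positive degree. The degrees therefore determine it, and one factor can be
  split off.\<close>

lemma nw_se_chain_unique:
  assumes "nw_se_chain m" "nw_se_chain n" "row_deg m = row_deg n" "col_deg m = col_deg n"
  shows "m = n"
  using assms
proof (induction "lin (\<lambda>_. 1) m" arbitrary: m n rule: less_induct)
  case less
  have zero: "b = 0" if "a = 0" "row_deg a = row_deg b" for a b
  proof (rule ccontr)
    assume "b \<noteq> 0"
    then obtain q where "q \<in> mkeys b" by (metis keys_eq_empty ex_in_conv)
    then have "0 < row_deg b (fst q)" by (intro lin_pos[of q]) auto
    then show False using that fun_cong[OF that(2), of "fst q"] by simp
  qed
  show ?case
  proof (cases "m = 0 \<or> n = 0")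
    case True
    then show ?thesis using zero[of m n] zero[of n m] less.prems by auto
  next
    case False
    obtain p where p: "p \<in> mkeys m" "\<And>q. q \<in> mkeys m \<Longrightarrow> fst p \<le> fst q \<and> snd p \<le> snd q"
      using nw_se_chain_min[of m] False less.prems by blast
    obtain q where q: "q \<in> mkeys n" "\<And>r. r \<in> mkeys n \<Longrightarrow> fst q \<le> fst r \<and> snd q \<le> snd r"
      using nw_se_chain_min[of n] False less.prems by blast
    have ex: "\<exists>r\<in>mkeys a. fst r = i" if "0 < row_deg a i" for a i
      using that lin_eq_0[of a "\<lambda>p. if fst p = i then 1 else 0"] by fastforce
    have ex': "\<exists>r\<in>mkeys a. snd r = i" if "0 < col_deg a i" for a i
      using that lin_eq_0[of a "\<lambda>p. if snd p = i then 1 else 0"] by fastforce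
    have pos: "0 < row_deg m (fst p)" "0 < row_deg n (fst q)" "0 < col_deg m (snd p)" "0 < col_deg n (snd q)"
      using lin_pos[OF p(1), where f = "\<lambda>r. if fst r = fst p then 1 else 0"]
        lin_pos[OF p(1), where f = "\<lambda>r. if snd r = snd p then 1 else 0"]
        lin_pos[OF q(1), where f = "\<lambda>r. if fst r = fst q then 1 else 0"]
        lin_pos[OF q(1), where f = "\<lambda>r. if snd r = snd q then 1 else 0"] by simp_all
    have e: "row_deg m i = row_deg n i" "col_deg m i = col_deg n i" for i
      using fun_cong[OF less.prems(3), of i] fun_cong[OF less.prems(4), of i] by auto
    have "fst p \<le> fst q" using ex[where a = m and i = "fst q"] pos(2) p(2) unfolding e by metis
    moreover have "fst q \<le> fst p" using ex[where a = n and i = "fst p"] pos(1) q(2) unfolding e by metis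
    moreover have "snd p \<le> snd q" using ex'[where a = m and i = "snd q"] pos(4) p(2) unfolding e by metis
    moreover have "snd q \<le> snd p" using ex'[where a = n and i = "snd p"] pos(3) q(2) unfolding e by metis
    ultimately have "p = q" by (simp add: prod_eq_iff)
    then obtain m' n' where mn: "m = m' + Poly_Mapping.single p 1" "n = n' + Poly_Mapping.single p 1"
      using p(1) q(1) monom_remove by metis
    have "m' = n'"
    proof (rule less.hyps)
      show "lin (\<lambda>_. 1) m' < lin (\<lambda>_. 1) m" by (simp add: mn)
      show "nw_se_chain m'" "nw_se_chain n'"
        using less.prems by (auto simp: nw_se_chain_def mn keys_monom_add)
      show "row_deg m' = row_deg n'" "col_deg m' = col_deg n'"
        using less.prems(3,4) by (auto simp: mn fun_eq_iff)
    qed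
    then show ?thesis by (simp add: mn)
  qed
qed

text \<open>Replacing two positions related by \<open>ne_sw\<close> by the other two corners of
  their rectangle keeps all row and column degrees and goes down in the order. The process ends at
  the unique monomial without such a pair.\<close>

lemma (in adiag_order) nw_se_chain_minimal:
  assumes P: "nw_se_chain P" "P \<in> monoms k l" and Q: "Q \<in> monoms k l"
    and "row_deg P = row_deg Q" "col_deg P = col_deg Q"
  shows "P = Q \<or> prec P Q"
  using Q assms(4,5)
proof (induction "lin (\<lambda>p. k * l - fst p * snd p) Q" arbitrary: Q rule: less_induct)
  case less
  show ?case
  proof (cases "nw_se_chain Q")
    case True
    then show ?thesis using nw_se_chain_unique less P by blast
  next
    case False
    then obtain i j i' j' where pq: "(i, j') \<in> mkeys Q" "(i', j) \<in> mkeys Q" "i < i'" "j < j'"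
      by (auto simp: nw_se_chain_def ne_sw_def)
    obtain Q1 where Q1: "Q = Q1 + var i j'" using pq(1) by (rule monom_remove)
    then have "(i', j) \<in> mkeys Q1" using pq by (auto simp: keys_monom_add)
    then obtain Q2 where "Q1 = Q2 + var i' j" by (rule monom_remove)
    then have Q2: "Q = (var i j' + var i' j) + Q2" by (simp add: Q1 algebra_simps)
    define Q' where "Q' = (var i j + var i' j') + Q2"
    have bd: "1 \<le> i" "i' \<le> k" "1 \<le> j" "j' \<le> l" "Q2 \<in> monoms k l" "1 \<le> i'" "1 \<le> j'" "i \<le> k" "j \<le> l"
      using less.prems(1) pq by (auto simp: Q2)
    have Q': "Q' \<in> monoms k l" using bd by (auto simp: Q'_def)
    have "prec Q' Q"
      unfolding Q2 Q'_def using bd pq by (intro mono swap) auto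
    have kl: "i * j \<le> k * l" "i' * j' \<le> k * l" "i * j' \<le> k * l" "i' * j \<le> k * l"
      using bd by (auto intro: mult_le_mono)
    obtain d e where de: "i' = i + d" "j' = j + e" "0 < d" "0 < e"
      using pq(3,4) by (metis less_imp_add_positive)
    \<comment> \<open>Each exchange raises the sum of the products of row and column index, which is
      bounded at fixed degree; this is the termination measure.\<close>
    have "i * j' + i' * j < i * j + i' * j'"
      using de by (simp add: algebra_simps)
    then have "lin (\<lambda>p. k * l - fst p * snd p) Q' < lin (\<lambda>p. k * l - fst p * snd p) Q"
      using kl by (simp add: Q2 Q'_def)
    moreover have "row_deg P = row_deg Q'" "col_deg P = col_deg Q'"
      unfolding less.prems(2,3) by (auto simp: Q2 Q'_def fun_eq_iff)
    ultimately have "P = Q' \<or> prec P Q'" using less.hyps Q' by blast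
    then show ?thesis
      using \<open>prec Q' Q\<close> trans[of P Q' Q] P Q' less.prems(1) by blast
  qed
qed

subsection \<open>Leading monomials of minors\<close>

definition perm_monom :: "nat list \<Rightarrow> nat list \<Rightarrow> (nat \<Rightarrow> nat) \<Rightarrow> monom" where
  "perm_monom is js p = (\<Sum>t<length is. var (is ! t) (js ! p t))"

lemma prod_single: "(\<Prod>i\<in>A. Poly_Mapping.single (f i) (1::'c::comm_semiring_1)) =
    Poly_Mapping.single (\<Sum>i\<in>A. f i :: 'm::comm_monoid_add) 1"
  by (induction A rule: infinite_finite_induct) (auto simp: mult_single)

lemma minor_poly_expand:
  assumes "length is = length js"
  shows "(minor_poly (is, js) :: 'a::field mpoly) =
    (\<Sum>p | p permutes {0..<length is}. Poly_Mapping.single (perm_monom is js p) (signof p))"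
proof -
  have "(minor_poly (is, js) :: 'a mpoly) = (\<Sum>p | p permutes {0..<length is}.
     signof p * (\<Prod>i = 0..<length is. gen_mat is js $$ (i, p i)))"
    unfolding minor_poly_def by (simp add: det_def'[of _ "length is"] gen_mat_def assms)
  also have "\<dots> = (\<Sum>p | p permutes {0..<length is}. Poly_Mapping.single (perm_monom is js p) (signof p))"
  proof (rule sum.cong)
    fix p assume "p \<in> {p. p permutes {0..<length is}}"
    then have "p i < length js" if "i < length is" for i
      using that assms permutes_in_image[of p "{0..<length is}" i] by auto
    then have "(\<Prod>i = 0..<length is. gen_mat is js $$ (i, p i) :: 'a mpoly) =
        (\<Prod>i = 0..<length is. Poly_Mapping.single (var (is ! i) (js ! p i)) 1)"
      by (intro prod.cong) (auto simp: gen_mat_def indet_def)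
    also have "\<dots> = Poly_Mapping.single (perm_monom is js p) 1"
      by (simp add: prod_single perm_monom_def atLeast0LessThan)
    finally show "signof p * (\<Prod>i = 0..<length is. gen_mat is js $$ (i, p i)) =
        (Poly_Mapping.single (perm_monom is js p) (signof p) :: 'a mpoly)"
      by (simp add: sign_def mult_single single_uminus)
  qed simp
  finally show ?thesis .
qed

lemma minorsD:
  assumes "(is, js) \<in> minors k l"
  shows "length is = length js" "is \<noteq> []" "sorted_wrt (<) is" "sorted_wrt (<) js"
    "set is \<subseteq> {1..k}" "set js \<subseteq> {1..l}" "distinct is" "distinct js"
  using assms by (auto simp: minors_def strict_sorted_iff)

lemma minors_nth:
  assumes "(is, js) \<in> minors k l"
  shows "t < length is \<Longrightarrow> 1 \<le> is ! t \<and> is ! t \<le> k" "t < length js \<Longrightarrow> 1 \<le> js ! t \<and> js ! t \<le> l"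
  using subsetD[OF minorsD(5)[OF assms] nth_mem] subsetD[OF minorsD(6)[OF assms] nth_mem] by fastforce+

lemma perm_monom_in_monoms:
  assumes "(is, js) \<in> minors k l" "p permutes {0..<length is}"
  shows "perm_monom is js p \<in> monoms k l"
  unfolding perm_monom_def
proof (rule monoms_sum)
  fix t assume "t \<in> {..<length is}"
  then have "t < length is" "p t < length js"
    using permutes_in_image[OF assms(2), of t] minorsD(1)[OF assms(1)] by auto
  then show "var (is ! t) (js ! p t) \<in> monoms k l"
    using minors_nth[OF assms(1)] by auto
qed

lemma perm_monom_inj:
  assumes "distinct is" "distinct js" "length is = length js"
    "p permutes {0..<length is}" "q permutes {0..<length is}" "perm_monom is js p = perm_monom is js q"
  shows "p = q"
proof
  fix t
  have c: "coef (perm_monom is js r) (is ! t, js ! u) = (if r t = u then 1 else 0)"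
    if "r permutes {0..<length is}" "t < length is" "u < length is" for r t u
  proof -
    have "coef (perm_monom is js r) (is ! t, js ! u) =
        (\<Sum>s<length is. if s = t then if r t = u then 1 else 0 else 0)"
      unfolding perm_monom_def lookup_sum
    proof (rule sum.cong)
      fix s assume s: "s \<in> {..<length is}"
      then have "r s < length is" using permutes_in_image[OF that(1), of s] by auto
      then show "coef (var (is ! s) (js ! r s)) (is ! t, js ! u) = (if s = t then if r t = u then 1 else 0 else 0)"
        using s that assms(1-3) by (auto simp: lookup_single when_def nth_eq_iff_index_eq)
    qed simp
    then show ?thesis using that by simp
  qed
  show "p t = q t"
  proof (cases "t < length is")
    case True
    then have "q t < length is" using permutes_in_image[OF assms(5), of t] by auto
    with c[OF assms(4) True this] c[OF assms(5) True this] show ?thesis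
      unfolding assms(6) by (metis zero_neq_one)
  next
    case False
    then show ?thesis using assms(4,5) by (auto simp: permutes_def)
  qed
qed

definition rev_perm :: "nat \<Rightarrow> nat \<Rightarrow> nat" where
  "rev_perm n t = (if t < n then n - 1 - t else t)"

lemma rev_perm_permutes: "rev_perm n permutes {0..<n}"
proof (rule bij_imp_permutes)
  show "bij_betw (rev_perm n) {0..<n} {0..<n}"
    by (rule bij_betwI[of _ _ _ "rev_perm n"]) (auto simp: rev_perm_def)
qed (auto simp: rev_perm_def)

lemma antidiagonal_eq: "antidiagonal (is, js) = perm_monom is js (rev_perm (length is))"
  by (simp add: antidiagonal_def perm_monom_def rev_perm_def)

lemma decreasing_perm:
  assumes "p permutes {0..<n}" "\<And>s t. s < t \<Longrightarrow> t < n \<Longrightarrow> p t < p s"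
  shows "p = rev_perm n"
proof
  fix t
  show "p t = rev_perm n t"
  proof (cases "t < n")
    case True
    have lt: "p s < n" if "s < n" for s
      using that permutes_in_image[OF assms(1), of s] by auto
    have 1: "p t + t < n"
      using True
    proof (induction t)
      case (Suc t)
      then show ?case using assms(2)[of t "Suc t"] by simp
    qed (use lt in auto)
    have 2: "d \<le> p (n - 1 - d)" if "d < n" for d
      using that
    proof (induction d)
      case (Suc d)
      then have "n - 1 - Suc d < n - 1 - d" "n - 1 - d < n" by auto
      from assms(2)[OF this] Suc show ?case by simp
    qed simp
    show ?thesis using 1 2[of "n - 1 - t"] True by (simp add: rev_perm_def)
  next
    case False
    then show ?thesis using assms(1) by (auto simp: permutes_def rev_perm_def)
  qed
qed

context adiag_order
begin

text \<open>Where a permutation increases, transposing the two images turns a diagonal pair into an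
  antidiagonal one and enlarges the monomial. The largest monomial thus belongs to the decreasing
  permutation.\<close>

lemma antidiagonal_max:
  assumes d: "(is, js) \<in> minors k l" and p: "p permutes {0..<length is}" "p \<noteq> rev_perm (length is)"
  shows "prec (perm_monom is js p) (perm_monom is js (rev_perm (length is)))"
proof -
  let ?n = "length is"
  let ?A = "perm_monom is js ` {p. p permutes {0..<?n}}"
  note D = minorsD[OF d]
  have fin: "finite ?A" by (simp add: finite_permutations)
  have sub: "?A \<subseteq> monoms k l" using perm_monom_in_monoms[OF d] by auto
  obtain \<sigma> where \<sigma>: "\<sigma> permutes {0..<?n}"
    and max: "\<And>\<tau>. \<tau> permutes {0..<?n} \<Longrightarrow> perm_monom is js \<tau> \<noteq> perm_monom is js \<sigma> \<Longrightarrow>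
        prec (perm_monom is js \<tau>) (perm_monom is js \<sigma>)"
    using ex_max[OF fin _ sub] permutes_id by fastforce
  have "\<sigma> = rev_perm ?n"
  proof (rule decreasing_perm[OF \<sigma>], rule ccontr)
    fix s t assume st: "s < t" "t < ?n" "\<not> \<sigma> t < \<sigma> s"
    have inj: "inj \<sigma>" using \<sigma> by (rule permutes_inj)
    then have less: "\<sigma> s < \<sigma> t" using st by (metis inj_eq linorder_cases less_irrefl)
    have lt: "\<sigma> t < ?n" using permutes_in_image[OF \<sigma>, of t] st by auto
    define \<tau> where "\<tau> = \<sigma> \<circ> transpose s t"
    have \<tau>: "\<tau> permutes {0..<?n}"
      unfolding \<tau>_def by (rule permutes_compose[OF _ \<sigma>]) (use st in \<open>auto intro: permutes_swap_id\<close>)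
    define R where "R = (\<Sum>u\<in>{..<?n} - {s, t}. var (is ! u) (js ! \<sigma> u))"
    have split: "perm_monom is js r = var (is ! s) (js ! r s) + var (is ! t) (js ! r t) +
        (\<Sum>u\<in>{..<?n} - {s, t}. var (is ! u) (js ! r u))" for r
    proof -
      have "perm_monom is js r = (\<Sum>u\<in>insert s (insert t ({..<?n} - {s, t})). var (is ! u) (js ! r u))"
        unfolding perm_monom_def using st by (intro sum.cong) auto
      then show ?thesis using st by (simp add: add.assoc)
    qed
    have "(\<Sum>u\<in>{..<?n} - {s, t}. var (is ! u) (js ! \<tau> u)) = R"
      unfolding R_def \<tau>_def by (intro sum.cong) (auto simp: transpose_def)
    then have 1: "perm_monom is js \<tau> = var (is ! s) (js ! \<sigma> t) + var (is ! t) (js ! \<sigma> s) + R"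
      unfolding split[of \<tau>] by (simp add: \<tau>_def)
    have 2: "perm_monom is js \<sigma> = var (is ! s) (js ! \<sigma> s) + var (is ! t) (js ! \<sigma> t) + R"
      unfolding split[of \<sigma>] R_def ..
    have rows: "is ! s < is ! t" "1 \<le> is ! s" "is ! t \<le> k"
      using st sorted_wrt_nth_less[OF D(3)] minors_nth(1)[OF d] by auto
    have cols: "js ! \<sigma> s < js ! \<sigma> t" "1 \<le> js ! \<sigma> s" "js ! \<sigma> t \<le> l"
      using less lt D(1) sorted_wrt_nth_less[OF D(4)] minors_nth(2)[OF d] by auto
    have M: "perm_monom is js \<sigma> \<in> monoms k l" "perm_monom is js \<tau> \<in> monoms k l"
      using perm_monom_in_monoms[OF d] \<sigma> \<tau> by auto
    have "prec (var (is ! s) (js ! \<sigma> s) + var (is ! t) (js ! \<sigma> t))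
        (var (is ! s) (js ! \<sigma> t) + var (is ! t) (js ! \<sigma> s))"
      using rows cols by (intro swap)
    then have "prec (perm_monom is js \<sigma>) (perm_monom is js \<tau>)"
      unfolding 1 2 by (rule mono[rotated 3]) (use M in \<open>auto simp: 1 2\<close>)
    moreover from this have "perm_monom is js \<tau> \<noteq> perm_monom is js \<sigma>"
      using irrefl M by metis
    ultimately show False
      using max[OF \<tau>] trans[OF M(1) M(2) M(1)] irrefl M by blast
  qed
  then show ?thesis
    using max[OF p(1)] perm_monom_inj[OF D(7,8,1) p(1) rev_perm_permutes] p(2) by auto
qed

lemma minor_poly_props:
  assumes d: "\<delta> \<in> minors k l"
  shows "lead_at (minor_poly \<delta> :: 'a::field mpoly) (antidiagonal \<delta>)"
    and "mkeys (minor_poly \<delta> :: 'a::field mpoly) \<subseteq> monoms k l"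
    and "antidiagonal \<delta> \<in> monoms k l"
proof -
  obtain "is" js where \<delta>: "\<delta> = (is, js)" by (cases \<delta>)
  note D = minorsD[OF d[unfolded \<delta>]]
  let ?n = "length is"
  let ?P = "{p. p permutes {0..<?n}}"
  have exp: "(minor_poly \<delta> :: 'a mpoly) = (\<Sum>p\<in>?P. Poly_Mapping.single (perm_monom is js p) (signof p))"
    unfolding \<delta> by (rule minor_poly_expand[OF D(1)])
  have keys: "mkeys (minor_poly \<delta> :: 'a mpoly) \<subseteq> perm_monom is js ` ?P"
    unfolding exp using keys_sum_subset[of "\<lambda>p. Poly_Mapping.single (perm_monom is js p) (signof p :: 'a)" ?P]
    by (auto split: if_splits)
  show "mkeys (minor_poly \<delta> :: 'a mpoly) \<subseteq> monoms k l"
    using keys perm_monom_in_monoms[OF d[unfolded \<delta>]] by auto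
  show "antidiagonal \<delta> \<in> monoms k l"
    using perm_monom_in_monoms[OF d[unfolded \<delta>] rev_perm_permutes] by (simp add: \<delta> antidiagonal_eq)
  have "coef (minor_poly \<delta> :: 'a mpoly) (antidiagonal \<delta>) =
      (\<Sum>p\<in>?P. if p = rev_perm ?n then signof p else 0)"
    unfolding exp lookup_sum
    using perm_monom_inj[OF D(7,8,1) _ rev_perm_permutes]
    by (intro sum.cong) (auto simp: lookup_single when_def \<delta> antidiagonal_eq)
  also have "\<dots> = signof (rev_perm ?n)"
    using rev_perm_permutes[of ?n] by (simp add: finite_permutations)
  finally have "antidiagonal \<delta> \<in> mkeys (minor_poly \<delta> :: 'a mpoly)"
    by (auto simp: in_keys_iff sign_def)
  then show "lead_at (minor_poly \<delta> :: 'a mpoly) (antidiagonal \<delta>)"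
    using keys antidiagonal_max[OF d[unfolded \<delta>]] by (auto simp: lead_at_def \<delta> antidiagonal_eq)
qed

end

lemma minor_poly_in_polys:
  assumes "\<delta> \<in> minors k l"
  shows "minor_poly \<delta> \<in> polys k l"
proof -
  obtain "is" js where \<delta>: "\<delta> = (is, js)" by (cases \<delta>)
  show ?thesis
    unfolding \<delta> minor_poly_expand[OF minorsD(1)[OF assms[unfolded \<delta>]]]
    using perm_monom_in_monoms[OF assms[unfolded \<delta>]] by (intro polys_sum polys_single) auto
qed

section \<open>The generic factorization\<close>

datatype uvar = Orig "nat \<times> nat" | Lft nat nat | Rgt nat nat

type_synonym 'a upoly = "(uvar \<Rightarrow>\<^sub>0 nat) \<Rightarrow>\<^sub>0 'a"

text \<open>Colour \<open>0\<close> marks a position outside the box, whose indeterminate is kept;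
  the colours from \<open>1\<close> to \<open>K\<close> are the inner indices of the matrix
  product.\<close>

definition colors :: "(nat \<times> nat) set \<Rightarrow> nat \<Rightarrow> nat \<times> nat \<Rightarrow> nat set" where
  "colors B K p = (if p \<in> B then {1..K} else {0})"

definition term_monom :: "(nat \<times> nat) set \<Rightarrow> nat \<times> nat \<Rightarrow> nat \<Rightarrow> (uvar \<Rightarrow>\<^sub>0 nat)" where
  "term_monom B p c = (if p \<in> B then Poly_Mapping.single (Lft (fst p) c) 1 + Poly_Mapping.single (Rgt c (snd p)) 1
     else Poly_Mapping.single (Orig p) 1)"

text \<open>On the box \<open>B\<close> the generic matrix becomes a product of two generic matrices with inner dimension \<open>K\<close>.\<close>

definition fac :: "(nat \<times> nat) set \<Rightarrow> nat \<Rightarrow> nat \<times> nat \<Rightarrow> 'a::comm_ring_1 upoly" where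
  "fac B K p = (\<Sum>c\<in>colors B K p. mono_of (term_monom B p c))"

section \<open>Setting variables to zero\<close>

definition kill :: "uvar set \<Rightarrow> uvar \<Rightarrow> 'a::comm_ring_1 upoly" where
  "kill Z v = (if v \<in> Z then 0 else mono_of (Poly_Mapping.single v 1))"

lemma eval_monom_kill:
  "eval_monom (kill Z) m = (if mkeys m \<inter> Z = {} then mono_of m else 0)"
proof (induction m rule: monom_induct)
  case (add m v)
  then show ?case
    by (auto simp: eval_monom_add kill_def keys_monom_add mult_single)
qed simp

lemma coef_subst_kill:
  assumes "mkeys M \<inter> Z = {}"
  shows "coef (subst (kill Z) q) M = coef q M"
proof -
  have "subst (kill Z) q = (\<Sum>m\<in>mkeys q. Poly_Mapping.single m (if mkeys m \<inter> Z = {} then coef q m else 0))"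
    unfolding subst_def by (intro sum.cong) (auto simp: eval_monom_kill mult_single)
  then have "coef (subst (kill Z) q) M = (\<Sum>m\<in>mkeys q. if m = M then coef q M else 0)"
    using assms by (auto simp: lookup_sum lookup_single when_def intro!: sum.cong)
  then show ?thesis by (simp add: in_keys_iff)
qed

lemma subst_power: "subst \<phi> (p ^ n) = subst \<phi> p ^ n"
  by (induction n) (auto simp: subst_mult)

lemma subst_subst: "subst \<phi> (subst \<psi> p) = subst (\<lambda>v. subst \<phi> (\<psi> v)) p"
proof -
  have "subst \<phi> (eval_monom \<psi> m) = eval_monom (\<lambda>v. subst \<phi> (\<psi> v)) m" for m
    by (simp add: eval_monom_def subst_prod subst_power)
  then show ?thesis
    by (simp add: subst_def[of \<psi>] subst_sum subst_mult subst_single)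
       (simp add: subst_def)
qed

lemma subst_vanishes_idl:
  assumes "g \<in> idl k l G" "\<And>q. q \<in> G \<Longrightarrow> subst \<phi> q = 0"
  shows "subst \<phi> g = 0"
  using assms(1) by induction (auto simp: subst_add subst_mult assms(2))

text \<open>The matrix factors through fewer than \<open>n\<close> inner indices; padded to size
  \<open>n\<close>, the left factor has a zero column.\<close>

lemma det_low_rank:
  fixes f :: "nat \<Rightarrow> 'c \<Rightarrow> 'r::comm_ring_1"
  assumes "finite C" "card C < n"
  shows "Determinant.det (mat n n (\<lambda>(p, q). \<Sum>c\<in>C. f p c * g c q)) = 0"
proof -
  obtain h where h: "bij_betw h {0..<card C} C"
    using ex_bij_betw_nat_finite[OF assms(1)] by blast
  define A where "A = mat n n (\<lambda>(p, c). if c < card C then f p (h c) else 0)"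
  define B where "B = mat n n (\<lambda>(c, q). if c < card C then g (h c) q else 0)"
  have "mat n n (\<lambda>(p, q). \<Sum>c\<in>C. f p c * g c q) = A * B"
  proof (rule eq_matI)
    fix p q assume pq: "p < dim_row (A * B)" "q < dim_col (A * B)"
    then have "(A * B) $$ (p, q) = (\<Sum>c\<in>{0..<n}. (if c < card C then f p (h c) else 0) * (if c < card C then g (h c) q else 0))"
      by (simp add: A_def B_def scalar_prod_def)
    also have "\<dots> = (\<Sum>c\<in>{0..<card C}. f p (h c) * g (h c) q)"
      using assms(2) by (intro sum.mono_neutral_cong_right) auto
    also have "\<dots> = (\<Sum>c\<in>C. f p c * g c q)"
      using sum.reindex_bij_betw[OF h, of "\<lambda>c. f p c * g c q"] by simp
    finally show "mat n n (\<lambda>(p, q). \<Sum>c\<in>C. f p c * g c q) $$ (p, q) = (A * B) $$ (p, q)"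
      using pq by (simp add: A_def B_def)
  qed (simp_all add: A_def B_def)
  moreover have "Determinant.det A = 0"
  proof -
    have "A $$ (i, n - 1) = 0" if "i < n" for i
      using that assms(2) by (simp add: A_def)
    moreover have "Determinant.det A = (\<Sum>i<n. A $$ (i, n - 1) * cofactor A i (n - 1))"
      by (rule laplace_expansion_column) (use assms(2) in \<open>simp_all add: A_def\<close>)
    ultimately have "Determinant.det A = (\<Sum>i<n. 0)"
      by simp
    also have "\<dots> = 0" by simp
    finally show ?thesis .
  qed
  moreover have "A \<in> carrier_mat n n" "B \<in> carrier_mat n n"
    by (simp_all add: A_def B_def)
  then have "Determinant.det (A * B) = Determinant.det A * Determinant.det B"
    by (rule det_mult)
  ultimately show ?thesis by simp
qed

lemma subst_indet: "subst \<phi> (indet i j) = \<phi> (i, j)"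
  by (simp add: indet_def subst_single)

lemma subst_minor_poly:
  assumes "length is = length js"
  shows "subst \<phi> (minor_poly (is, js)) =
    Determinant.det (mat (length is) (length is) (\<lambda>(p, q). \<phi> (is ! p, js ! q)))"
  unfolding minor_poly_def subst_det
  by (rule arg_cong[of _ _ Determinant.det]) (auto simp: gen_mat_def assms subst_indet)

lemma subst_kill_fac:
  assumes "p \<in> B"
  shows "subst (kill Z) (fac B K p) =
    (\<Sum>c\<in>{c\<in>{1..K}. Lft (fst p) c \<notin> Z \<and> Rgt c (snd p) \<notin> Z}.
       mono_of (Poly_Mapping.single (Lft (fst p) c) 1) * mono_of (Poly_Mapping.single (Rgt c (snd p)) 1))"
proof -
  have "subst (kill Z) (fac B K p) = (\<Sum>c=1..K. kill Z (Lft (fst p) c) * kill Z (Rgt c (snd p)))"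
    using assms by (simp add: fac_def colors_def term_monom_def subst_sum subst_single eval_monom_add)
  also have "\<dots> = (\<Sum>c\<in>{c\<in>{1..K}. Lft (fst p) c \<notin> Z \<and> Rgt c (snd p) \<notin> Z}.
       mono_of (Poly_Mapping.single (Lft (fst p) c) 1) * mono_of (Poly_Mapping.single (Rgt c (snd p)) 1))"
    by (rule sum.mono_neutral_cong_right) (auto simp: kill_def)
  finally show ?thesis .
qed

text \<open>Once the inner indices from \<open>length is\<close> on are killed, the submatrix is a
  product with inner dimension less than its size. The disjunction in the assumption allows this to
  be done by variables of either factor.\<close>

lemma subst_kill_minor_eq_0:
  assumes d: "length is = length js" "set is \<times> set js \<subseteq> B" "0 < length is"
    and Z: "\<And>x y c. x \<in> set is \<Longrightarrow> y \<in> set js \<Longrightarrow> (Lft x c \<in> Z \<or> Rgt c y \<in> Z) \<longleftrightarrow> length is \<le> c"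
  shows "subst (kill Z) (subst (fac B K) (minor_poly (is, js) :: 'a::field mpoly)) = 0"
proof -
  let ?C = "{c\<in>{1..K}. c < length is}"
  have "subst (kill Z) (subst (fac B K) (minor_poly (is, js) :: 'a mpoly)) =
      Determinant.det (mat (length is) (length is) (\<lambda>(p, q). subst (kill Z) (fac B K (is ! p, js ! q))))"
    unfolding subst_subst by (rule subst_minor_poly[OF d(1)])
  also have "mat (length is) (length is) (\<lambda>(p, q). subst (kill Z) (fac B K (is ! p, js ! q))) =
      mat (length is) (length is) (\<lambda>(p, q). \<Sum>c\<in>?C.
        mono_of (Poly_Mapping.single (Lft (is ! p) c) 1) * (mono_of (Poly_Mapping.single (Rgt c (js ! q)) 1) :: 'a upoly))"
  proof (rule cong_mat)
    fix p q assume pq: "p < length is" "q < length is"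
    then have "is ! p \<in> set is" "js ! q \<in> set js"
      using d(1) by auto
    with d(2) have mem: "is ! p \<in> set is" "js ! q \<in> set js" "(is ! p, js ! q) \<in> B"
      by blast+
    have "{c\<in>{1..K}. Lft (is ! p) c \<notin> Z \<and> Rgt c (js ! q) \<notin> Z} = ?C"
      using Z[OF mem(1,2)] by (metis not_le)
    then show "(case (p, q) of (p, q) \<Rightarrow> subst (kill Z) (fac B K (is ! p, js ! q))) =
        (case (p, q) of (p, q) \<Rightarrow> \<Sum>c\<in>?C. mono_of (Poly_Mapping.single (Lft (is ! p) c) 1) *
          (mono_of (Poly_Mapping.single (Rgt c (js ! q)) 1) :: 'a upoly))"
      by (simp add: subst_kill_fac[OF mem(3)])
  qed simp_all
  also have "Determinant.det \<dots> = 0"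
  proof (rule det_low_rank)
    have "card ?C \<le> card {1..<length is}" by (rule card_mono) auto
    then have "card ?C \<le> length is - 1" by simp
    then show "card ?C < length is" using d(3) by linarith
  qed simp
  finally show ?thesis .
qed

definition det_gens :: "nat \<Rightarrow> nat \<Rightarrow> nat set \<Rightarrow> nat set \<Rightarrow> nat \<Rightarrow> minor set" where
  "det_gens k l R C t = {\<delta> \<in> minors k l. length (fst \<delta>) = t \<and> set (fst \<delta>) \<subseteq> R \<and> set (snd \<delta>) \<subseteq> C}"

definition det_ideal :: "nat \<Rightarrow> nat \<Rightarrow> nat set \<Rightarrow> nat set \<Rightarrow> nat \<Rightarrow> 'a::field mpoly set" where
  "det_ideal k l R C t = idl k l (minor_poly ` det_gens k l R C t)"

text \<open>Setting the variables \<open>Lft x c\<close> with \<open>x\<close> in \<open>R\<close>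
  and \<open>c \<ge> t\<close> to zero annihilates all generators, hence the ideal, but leaves the
  coefficients of monomials free of these variables unchanged.\<close>

lemma fac_keys_rows:
  assumes g: "g \<in> det_ideal k l R C t" and B: "R \<times> C \<subseteq> B" and t: "0 < t"
    and M: "M \<in> mkeys (subst (fac B K) g)"
  shows "\<exists>x\<in>R. \<exists>c\<ge>t. Lft x c \<in> mkeys M"
proof (rule ccontr)
  assume H: "\<not> ?thesis"
  let ?Z = "{Lft x c |x c. x \<in> R \<and> t \<le> c}"
  have "subst (\<lambda>v. subst (kill ?Z) (fac B K v)) g = 0"
    using g unfolding det_ideal_def
  proof (rule subst_vanishes_idl)
    fix q :: "'a mpoly" assume "q \<in> minor_poly ` det_gens k l R C t"
    then obtain "is" js where q: "q = minor_poly (is, js)" "(is, js) \<in> minors k l" "length is = t" "set is \<subseteq> R" "set js \<subseteq> C"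
      by (force simp: det_gens_def)
    have "subst (kill ?Z) (subst (fac B K) q) = 0"
      unfolding q(1) by (rule subst_kill_minor_eq_0) (use q minorsD(1)[OF q(2)] B t in auto)
    then show "subst (\<lambda>v. subst (kill ?Z) (fac B K v)) q = 0" by (simp add: subst_subst)
  qed
  then have "coef (subst (fac B K) g) M = 0"
    using coef_subst_kill[of M ?Z "subst (fac B K) g"] H by (auto simp: subst_subst)
  with M show False by (simp add: in_keys_iff)
qed

lemma fac_keys_cols:
  assumes g: "g \<in> det_ideal k l R C t" and B: "R \<times> C \<subseteq> B" and t: "0 < t"
    and M: "M \<in> mkeys (subst (fac B K) g)"
  shows "\<exists>y\<in>C. \<exists>c\<ge>t. Rgt c y \<in> mkeys M"
proof (rule ccontr)
  assume H: "\<not> ?thesis"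
  let ?Z = "{Rgt c y |y c. y \<in> C \<and> t \<le> c}"
  have "subst (\<lambda>v. subst (kill ?Z) (fac B K v)) g = 0"
    using g unfolding det_ideal_def
  proof (rule subst_vanishes_idl)
    fix q :: "'a mpoly" assume "q \<in> minor_poly ` det_gens k l R C t"
    then obtain "is" js where q: "q = minor_poly (is, js)" "(is, js) \<in> minors k l" "length is = t" "set is \<subseteq> R" "set js \<subseteq> C"
      by (force simp: det_gens_def)
    have "subst (kill ?Z) (subst (fac B K) q) = 0"
      unfolding q(1) by (rule subst_kill_minor_eq_0) (use q minorsD(1)[OF q(2)] B t in auto)
    then show "subst (\<lambda>v. subst (kill ?Z) (fac B K v)) q = 0" by (simp add: subst_subst)
  qed
  then have "coef (subst (fac B K) g) M = 0"
    using coef_subst_kill[of M ?Z "subst (fac B K) g"] H by (auto simp: subst_subst)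
  with M show False by (simp add: in_keys_iff)
qed

subsection \<open>Colourings of monomials\<close>

text \<open>
  \<open>colored B K n N M\<close>: the monomial \<open>M\<close> arises from the monomial \<open>n\<close> under \<open>fac B K\<close> by
  choosing the summand \<open>c\<close> for the factors in \<open>N c\<close>.
\<close>

definition colored :: "(nat \<times> nat) set \<Rightarrow> nat \<Rightarrow> monom \<Rightarrow> (nat \<Rightarrow> monom) \<Rightarrow> (uvar \<Rightarrow>\<^sub>0 nat) \<Rightarrow> bool" where
  "colored B K n N M \<longleftrightarrow> n = (\<Sum>c\<le>K. N c) \<and> (\<forall>c\<le>K. \<forall>p\<in>mkeys (N c). c \<in> colors B K p) \<and>
     (\<forall>v. coef M v = (\<Sum>c\<le>K. lin (\<lambda>p. coef (term_monom B p c) v) (N c)))"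

lemma coloredD: "colored B K n N M \<Longrightarrow> c \<le> K \<Longrightarrow> p \<in> mkeys (N c) \<Longrightarrow> c \<in> colors B K p"
  by (simp add: colored_def)

lemma colored_add:
  assumes "colored B K n N M" "c \<in> colors B K p"
  shows "colored B K (n + Poly_Mapping.single p 1) (N(c := N c + Poly_Mapping.single p 1)) (M + term_monom B p c)"
proof -
  have c: "c \<le> K" using assms(2) by (auto simp: colors_def split: if_splits)
  let ?N = "N(c := N c + Poly_Mapping.single p 1)"
  have upd: "(\<Sum>d\<le>K. F d (?N d)) = (\<Sum>d\<le>K. F d (N d)) + F c (Poly_Mapping.single p 1)"
    if "\<And>d a b. F d (a + b) = F d a + (F d b :: 'z::comm_monoid_add)" for F
  proof -
    have "(\<Sum>d\<le>K. F d (?N d)) = F c (?N c) + (\<Sum>d\<in>{..K} - {c}. F d (?N d))"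
      using c by (simp add: sum.remove)
    also have "(\<Sum>d\<in>{..K} - {c}. F d (?N d)) = (\<Sum>d\<in>{..K} - {c}. F d (N d))"
      by (intro sum.cong) auto
    also have "F c (?N c) + \<dots> = (F c (N c) + (\<Sum>d\<in>{..K} - {c}. F d (N d))) + F c (Poly_Mapping.single p 1)"
      by (simp add: that add_ac)
    also have "F c (N c) + (\<Sum>d\<in>{..K} - {c}. F d (N d)) = (\<Sum>d\<le>K. F d (N d))"
      using c by (simp add: sum.remove)
    finally show ?thesis .
  qed
  show ?thesis
    unfolding colored_def
  proof (intro conjI allI impI ballI)
    show "n + Poly_Mapping.single p 1 = (\<Sum>d\<le>K. ?N d)"
      using upd[of "\<lambda>_ a. a"] assms(1) by (simp add: colored_def)
    show "d \<in> colors B K q" if "d \<le> K" "q \<in> mkeys (?N d)" for d q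
      using that assms by (auto simp: colored_def keys_monom_add split: if_splits)
    show "coef (M + term_monom B p c) v = (\<Sum>d\<le>K. lin (\<lambda>p. coef (term_monom B p d) v) (?N d))" for v
      using upd[of "\<lambda>d a. lin (\<lambda>p. coef (term_monom B p d) v) a"] assms(1)
      by (simp add: colored_def lookup_add)
  qed
qed

lemma keys_fac: "M \<in> mkeys (fac B K p :: 'a::comm_ring_1 upoly) \<Longrightarrow> \<exists>c\<in>colors B K p. M = term_monom B p c"
  unfolding fac_def using keys_sum_subset[of "\<lambda>c. mono_of (term_monom B p c) :: 'a upoly" "colors B K p"] by auto

lemma keys_eval_monom_colored:
  assumes "M \<in> mkeys (eval_monom (fac B K) n :: 'a::comm_ring_1 upoly)"
  shows "\<exists>N. colored B K n N M"
  using assms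
proof (induction n arbitrary: M rule: monom_induct)
  case zero
  then have "M = 0" by (auto simp: keys_one split: if_splits)
  then show ?case by (intro exI[of _ "\<lambda>_. 0"]) (auto simp: colored_def)
next
  case (add n p)
  have "M \<in> mkeys (eval_monom (fac B K) n * fac B K p :: 'a upoly)"
    using add.prems by (simp add: eval_monom_add)
  then obtain a b where ab: "M = a + b" "a \<in> mkeys (eval_monom (fac B K) n :: 'a upoly)" "b \<in> mkeys (fac B K p :: 'a upoly)"
    using keys_mult by blast
  obtain c where c: "c \<in> colors B K p" "b = term_monom B p c"
    using keys_fac[OF ab(3)] by blast
  obtain N where "colored B K n N a" using add.IH[OF ab(2)] by blast
  from colored_add[OF this c(1)] show ?case using ab(1) c(2) by auto
qed

text \<open>The exponent of \<open>Lft i c\<close> counts the factors of colour \<open>c\<close> in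
  row \<open>i\<close>. So \<open>M\<close> fixes the row and column degrees of every colour class,
  though not the class itself.\<close>

lemma colored_margins:
  assumes "colored B K n N M"
  shows "p \<notin> B \<Longrightarrow> coef (N 0) p = coef M (Orig p)"
    and "1 \<le> c \<Longrightarrow> c \<le> K \<Longrightarrow> row_deg (N c) i = coef M (Lft i c)"
    and "1 \<le> c \<Longrightarrow> c \<le> K \<Longrightarrow> col_deg (N c) j = coef M (Rgt c j)"
proof -
  have key: "q \<in> mkeys (N d) \<Longrightarrow> d \<le> K \<Longrightarrow> (q \<in> B \<and> 1 \<le> d) \<or> (q \<notin> B \<and> d = 0)" for q d
    using assms by (auto simp: colored_def colors_def split: if_splits)
  have M: "coef M v = (\<Sum>d\<le>K. lin (\<lambda>p. coef (term_monom B p d) v) (N d))" for v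
    using assms by (simp add: colored_def)
  have pick: "(\<Sum>d\<le>K. lin (f d) (N d)) = lin g (N c)"
    if "c \<le> K" "\<And>d q. d \<le> K \<Longrightarrow> q \<in> mkeys (N d) \<Longrightarrow> f d q = (if d = c then g q else 0)" for f g c
  proof -
    have "(\<Sum>d\<le>K. lin (f d) (N d)) = (\<Sum>d\<le>K. if d = c then lin g (N c) else 0)"
    proof (rule sum.cong)
      fix d assume d: "d \<in> {..K}"
      show "lin (f d) (N d) = (if d = c then lin g (N c) else 0)"
      proof (cases "d = c")
        case True
        then show ?thesis using that(2)[of d] d by (auto intro: lin_cong)
      next
        case False
        then show ?thesis using that(2)[of d] d by (auto intro: lin_eq_0)
      qed
    qed simp
    then show ?thesis using that(1) by simp
  qed
  show "coef (N 0) p = coef M (Orig p)" if "p \<notin> B"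
  proof -
    have "coef M (Orig p) = lin (\<lambda>q. if q = p then 1 else 0) (N 0)"
      unfolding M by (rule pick) (use key that in \<open>auto simp: term_monom_def lookup_add lookup_single when_def\<close>)
    then show ?thesis by (simp only: lin_indicator)
  qed
  show "row_deg (N c) i = coef M (Lft i c)" if "1 \<le> c" "c \<le> K"
    unfolding M by (rule pick[symmetric]) (use key that in \<open>auto simp: term_monom_def lookup_add lookup_single when_def\<close>)
  show "col_deg (N c) j = coef M (Rgt c j)" if "1 \<le> c" "c \<le> K"
    unfolding M by (rule pick[symmetric]) (use key that in \<open>auto simp: term_monom_def lookup_add lookup_single when_def\<close>)
qed

subsection \<open>Leading monomials in determinantal ideals\<close>

definition restr :: "monom \<Rightarrow> (nat \<times> nat) set \<Rightarrow> monom" where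
  "restr m S = (\<Sum>p\<in>mkeys m \<inter> S. Poly_Mapping.single p (coef m p))"

lemma coef_restr: "coef (restr m S) p = (if p \<in> S then coef m p else 0)"
proof -
  have "coef (restr m S) p = (\<Sum>q\<in>mkeys m \<inter> S. if q = p then coef m p else 0)"
    unfolding restr_def lookup_sum by (intro sum.cong) (auto simp: lookup_single when_def)
  then show ?thesis by (simp add: in_keys_iff)
qed

lemma keys_restr: "mkeys (restr m S) = mkeys m \<inter> S"
  by (auto simp: in_keys_iff coef_restr split: if_splits)

text \<open>The colour classes inside the box run weakly from north-west to south-east, so each is
  the least monomial with its row and column degrees.\<close>

definition level_colored :: "(nat \<times> nat) set \<Rightarrow> nat \<Rightarrow> (nat \<times> nat \<Rightarrow> nat) \<Rightarrow> monom \<Rightarrow> bool" where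
  "level_colored B K lev m \<longleftrightarrow> (\<forall>p\<in>mkeys m. lev p \<in> colors B K p) \<and>
     (\<forall>p\<in>mkeys m \<inter> B. \<forall>q\<in>mkeys m \<inter> B. lev p = lev q \<longrightarrow> \<not> ne_sw p q)"

context adiag_order
begin

lemma prec_sum:
  assumes "\<And>i. i \<in> A \<Longrightarrow> a i \<in> monoms k l \<and> b i \<in> monoms k l \<and> (a i = b i \<or> prec (a i) (b i))"
  shows "(\<forall>i\<in>A. a i = b i) \<or> prec (sum a A) (sum b A) \<or> infinite A"
proof (cases "finite A")
  case True
  then show ?thesis using assms
  proof (induction A rule: finite_induct)
    case (insert x A)
    have M: "sum a A \<in> monoms k l" "sum b A \<in> monoms k l"
      using insert.prems by (auto intro!: monoms_sum)
    have x: "a x \<in> monoms k l" "b x \<in> monoms k l" "a x = b x \<or> prec (a x) (b x)"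
      using insert.prems[of x] by auto
    have IH: "(\<forall>i\<in>A. a i = b i) \<or> prec (sum a A) (sum b A)"
      using insert by auto
    show ?case
    proof (cases "prec (a x) (b x)")
      case True
      have "sum a A = sum b A \<or> prec (sum a A) (sum b A)"
        using IH by (auto intro: sum.cong)
      then have "prec (a x + sum a A) (b x + sum b A)"
        using prec_add_right_less[of "a x" "b x" "sum a A" "sum b A"] True M x by blast
      then show ?thesis using insert.hyps by simp
    next
      case False
      then have ax: "a x = b x" using x by blast
      from IH show ?thesis
      proof
        assume "prec (sum a A) (sum b A)"
        then have "prec (a x + sum a A) (b x + sum b A)"
          using mono[of "sum a A" "sum b A" "b x"] M x ax by (simp add: add.commute)
        then show ?thesis using insert.hyps by simp
      qed (use ax in auto)
    qed
  qed simp
qed simp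

text \<open>Since both colourings produce \<open>M\<close>, corresponding colour classes have the
  same row and column degrees. Those of \<open>m\<close> are the least with these degrees, and
  adding up the comparisons puts \<open>m\<close> before \<open>n\<close>.\<close>

lemma colored_compare:
  assumes lc: "level_colored B K lev m" and m: "m \<in> monoms k l" and n: "n \<in> monoms k l"
    and cm: "colored B K m (\<lambda>c. restr m {p. lev p = c}) M" and cn: "colored B K n N M"
  shows "n = m \<or> prec m n" and "n = m \<Longrightarrow> c \<le> K \<Longrightarrow> N c = restr m {p. lev p = c}"
proof -
  let ?P = "\<lambda>c. restr m {p. lev p = c}"
  have mP: "m = (\<Sum>c\<le>K. ?P c)" and nN: "n = (\<Sum>c\<le>K. N c)"
    using cm cn by (auto simp: colored_def)
  have PM: "?P c \<in> monoms k l" and NM: "N c \<in> monoms k l" if "c \<le> K" for c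
  proof -
    show "?P c \<in> monoms k l" using m by (auto simp: monoms_def keys_restr)
    have "N c + (\<Sum>d\<in>{..K} - {c}. N d) = n"
      using that nN by (simp add: sum.remove)
    then show "N c \<in> monoms k l" using n monoms_add_iff by blast
  qed
  have cmp: "?P c = N c \<or> prec (?P c) (N c)" if "c \<le> K" for c
  proof (cases "c = 0")
    case True
    have "coef (?P 0) p = coef (N 0) p" for p
    proof (cases "p \<in> B")
      case False
      then show ?thesis
        using colored_margins(1)[OF cm] colored_margins(1)[OF cn] by simp
    next
      case True
      then have "p \<notin> mkeys (?P 0)" "p \<notin> mkeys (N 0)"
        using coloredD[OF cm, of 0 p] coloredD[OF cn, of 0 p] by (auto simp: colors_def)
      then show ?thesis by (simp add: in_keys_iff)
    qed
    then show ?thesis using True by (simp add: poly_mapping_eqI)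
  next
    case False
    then have c: "1 \<le> c" by simp
    have B: "p \<in> mkeys m \<inter> B \<and> lev p = c" if "p \<in> mkeys (?P c)" for p
      using coloredD[OF cm \<open>c \<le> K\<close> that] c that by (auto simp: colors_def keys_restr split: if_splits)
    have "nw_se_chain (?P c)"
      unfolding nw_se_chain_def
    proof (intro ballI)
      fix p q assume "p \<in> mkeys (?P c)" "q \<in> mkeys (?P c)"
      then show "\<not> ne_sw p q"
        using B[of p] B[of q] lc unfolding level_colored_def by metis
    qed
    moreover have "row_deg (?P c) = row_deg (N c)" "col_deg (?P c) = col_deg (N c)"
      using colored_margins(2,3)[OF cm c that] colored_margins(2,3)[OF cn c that] by auto
    ultimately show ?thesis
      using nw_se_chain_minimal PM[OF that] NM[OF that] by blast
  qed
  have *: "(\<forall>c\<le>K. ?P c = N c) \<or> prec m n"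
    unfolding mP[symmetric] nN[symmetric]
    using prec_sum[of "{..K}" ?P N] cmp PM NM mP nN by auto
  then show "n = m \<or> prec m n"
    using mP nN by (metis (no_types, lifting) atMost_iff sum.cong)
  show "N c = ?P c" if "n = m" "c \<le> K"
    using * that irrefl m by auto
qed

text \<open>By \<open>colored_compare\<close> the colouring by \<open>lev\<close> is the only one of
  \<open>m\<close> that produces this \<open>M\<close>. In the induction only the summand
  \<open>lev p\<close> of the last factor contributes, and the coefficient is 1 over every
  ring.\<close>

lemma coef_eval_monom_level:
  assumes "level_colored B K lev m" "m \<in> monoms k l"
  obtains M where "colored B K m (\<lambda>c. restr m {p. lev p = c}) M"
    "coef (eval_monom (fac B K) m :: 'a::comm_ring_1 upoly) M = 1"
proof -
  have "\<exists>M. colored B K m (\<lambda>c. restr m {p. lev p = c}) M \<and>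
      coef (eval_monom (fac B K) m :: 'a upoly) M = 1"
    using assms
  proof (induction m rule: monom_induct)
    case zero
    show ?case
      by (intro exI[of _ 0]) (auto simp: colored_def restr_def)
  next
    case (add m p)
    have lc: "level_colored B K lev m"
      using add.prems(1) by (auto simp: level_colored_def keys_monom_add)
    then obtain M where M: "colored B K m (\<lambda>c. restr m {p. lev p = c}) M"
      "coef (eval_monom (fac B K) m :: 'a upoly) M = 1"
      using add by auto
    have cp: "lev p \<in> colors B K p"
      using add.prems(1) by (auto simp: level_colored_def keys_monom_add)
    let ?m = "m + Poly_Mapping.single p 1"
    let ?M = "M + term_monom B p (lev p)"
    have fin: "finite (colors B K p)" by (simp add: colors_def)
    have "(\<lambda>c. restr m {p. lev p = c})(lev p := restr m {q. lev q = lev p} + Poly_Mapping.single p 1) =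
        (\<lambda>c. restr ?m {p. lev p = c})"
      by (rule ext, rule poly_mapping_eqI)
         (auto simp: coef_restr lookup_add lookup_single when_def)
    with colored_add[OF M(1) cp] have col: "colored B K ?m (\<lambda>c. restr ?m {p. lev p = c}) ?M"
      by simp
    have "coef (eval_monom (fac B K) ?m :: 'a upoly) ?M =
        (\<Sum>c\<in>colors B K p. coef (mono_of (term_monom B p c) * eval_monom (fac B K) m :: 'a upoly) ?M)"
      by (simp add: eval_monom_add fac_def sum_distrib_left lookup_sum mult.commute)
    also have "\<dots> = (\<Sum>c\<in>colors B K p. if c = lev p then 1 else 0)"
    proof (rule sum.cong)
      fix c assume c: "c \<in> colors B K p"
      show "coef (mono_of (term_monom B p c) * eval_monom (fac B K) m :: 'a upoly) ?M =
          (if c = lev p then 1 else 0)"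
      proof (cases "c = lev p")
        case True
        then show ?thesis
          using coef_single_mult[of "term_monom B p c" 1 "eval_monom (fac B K) m :: 'a upoly" M] M(2)
          by (simp add: add.commute)
      next
        case False
        have "coef (mono_of (term_monom B p c) * eval_monom (fac B K) m :: 'a upoly) ?M = 0"
        proof (rule ccontr)
          assume "coef (mono_of (term_monom B p c) * eval_monom (fac B K) m :: 'a upoly) ?M \<noteq> 0"
          then have "?M \<in> mkeys (mono_of (term_monom B p c) * eval_monom (fac B K) m :: 'a upoly)"
            by (simp add: in_keys_iff)
          then obtain b where b: "?M = term_monom B p c + b" "b \<in> mkeys (eval_monom (fac B K) m :: 'a upoly)"
            using keys_mult[of "mono_of (term_monom B p c)" "eval_monom (fac B K) m :: 'a upoly"]
            by (auto split: if_splits)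
          obtain N where N: "colored B K m N b" using keys_eval_monom_colored[OF b(2)] by blast
          have "colored B K ?m (N(c := N c + Poly_Mapping.single p 1)) ?M"
            using colored_add[OF N c] b(1) by (simp add: add.commute)
          from colored_compare(2)[OF add.prems(1,2,2) col this refl, of c]
          have "N c + Poly_Mapping.single p 1 = restr ?m {p. lev p = c}"
            using c by (auto simp: colors_def split: if_splits)
          then have "p \<in> mkeys (restr ?m {p. lev p = c})"
            by (metis UnI2 keys_monom_add keys_single insertI1 zero_neq_one)
          then show False using False by (simp add: keys_restr)
        qed
        then show ?thesis using False by simp
      qed
    qed simp
    also have "\<dots> = 1" using cp fin by simp
    finally show ?case using col by blast
  qed
  then show ?thesis using that by blast
qed

text \<open>Without the chain, the levels colour \<open>m\<close> with inner indices below
  \<open>t\<close>. The resulting \<open>M\<close> cannot come from another monomial of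
  \<open>g\<close>, which would have to exceed \<open>m\<close>. It therefore survives in the image
  of \<open>g\<close>, where every monomial involves an inner index of at least
  \<open>t\<close>.\<close>

theorem lead_det_ideal:
  fixes g :: "'a::field mpoly"
  assumes g: "g \<in> det_ideal k l R C t" and lead: "lead_at g m" and gp: "mkeys g \<subseteq> monoms k l"
  shows "has_chain (mkeys m \<inter> R \<times> C) t"
proof (rule ccontr)
  assume nc: "\<not> has_chain (mkeys m \<inter> R \<times> C) t"
  then have t: "0 < t" by (cases t) auto
  define B where "B = R \<times> C"
  define F where "F = mkeys m \<inter> B"
  \<comment> \<open>As many inner indices as there are possible levels.\<close>
  define K where "K = t - 1"
  define lev where "lev p = (if p \<in> B then level F p else 0)" for p
  have ncF: "\<not> has_chain F t" using nc by (simp add: F_def B_def)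
  have mM: "m \<in> monoms k l" using lead gp by (auto simp: lead_at_def)
  have lc: "level_colored B K lev m"
    unfolding level_colored_def
  proof (intro conjI ballI impI)
    show "lev p \<in> colors B K p" if "p \<in> mkeys m" for p
      using level_props(1,2)[OF ncF, of p] that t by (auto simp: lev_def colors_def F_def K_def)
    show "\<not> ne_sw p q" if "p \<in> mkeys m \<inter> B" "q \<in> mkeys m \<inter> B" "lev p = lev q" for p q
      using level_props(3)[OF ncF, of p q] that by (auto simp: lev_def F_def)
  qed
  obtain M where M: "colored B K m (\<lambda>c. restr m {p. lev p = c}) M"
    "coef (eval_monom (fac B K) m :: 'a upoly) M = 1"
    using coef_eval_monom_level[OF lc mM] by blast
  have "coef (subst (fac B K) g) M = (\<Sum>n\<in>mkeys g. coef (Poly_Mapping.single 0 (coef g n) * eval_monom (fac B K) n) M)"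
    by (simp add: subst_def lookup_sum)
  also have "\<dots> = (\<Sum>n\<in>mkeys g. if n = m then coef g m else 0)"
  proof (rule sum.cong)
    fix n assume n: "n \<in> mkeys g"
    have eq: "coef (Poly_Mapping.single 0 (coef g n) * eval_monom (fac B K) n) M =
        coef g n * coef (eval_monom (fac B K) n) M"
      using coef_single_mult[of 0 "coef g n" "eval_monom (fac B K) n" M] by simp
    show "coef (Poly_Mapping.single 0 (coef g n) * eval_monom (fac B K) n) M = (if n = m then coef g m else 0)"
    proof (cases "n = m")
      case True
      then show ?thesis unfolding eq using M(2) by simp
    next
      case False
      have "M \<notin> mkeys (eval_monom (fac B K) n :: 'a upoly)"
      proof
        assume "M \<in> mkeys (eval_monom (fac B K) n :: 'a upoly)"
        then obtain N where "colored B K n N M" using keys_eval_monom_colored by blast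
        from colored_compare(1)[OF lc mM _ M(1) this] have "prec m n"
          using False n gp by auto
        moreover have "prec n m" using lead n False by (auto simp: lead_at_def)
        ultimately show False using trans irrefl mM n gp by blast
      qed
      then show ?thesis unfolding eq using False by (simp add: in_keys_iff)
    qed
  qed simp
  also have "\<dots> = coef g m" using lead by (simp add: lead_at_def)
  finally have "M \<in> mkeys (subst (fac B K) g)"
    using lead by (auto simp: lead_at_def in_keys_iff)
  from fac_keys_rows[OF g _ t this] obtain x c where xc: "t \<le> c" "Lft x c \<in> mkeys M"
    by (auto simp: B_def)
  have "coef M (Lft x c) = (\<Sum>d\<le>K. lin (\<lambda>p. coef (term_monom B p d) (Lft x c)) (restr m {p. lev p = d}))"
    using M(1) by (simp add: colored_def)
  also have "\<dots> = 0"
    using xc(1) t by (intro sum.neutral ballI lin_eq_0)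
      (auto simp: term_monom_def K_def lookup_add lookup_single when_def)
  finally show False using xc(2) by (simp add: in_keys_iff)
qed

end

section \<open>Determinantal ideals of upper left submatrices are Knutson ideals\<close>

subsection \<open>Minors and chains\<close>

definition chain_minor :: "(nat \<times> nat) list \<Rightarrow> minor" where
  "chain_minor ps = (map fst ps, rev (map snd ps))"

lemma antidiagonal_chain_minor: "antidiagonal (chain_minor ps) = (\<Sum>t<length ps. Poly_Mapping.single (ps ! t) 1)"
  by (simp add: antidiagonal_def chain_minor_def rev_nth)

lemma chain_minor_in_det_gens:
  assumes "sorted_wrt ne_sw ps" "ps \<noteq> []" "set ps \<subseteq> R \<times> C" "R \<subseteq> {1..k}" "C \<subseteq> {1..l}"
  shows "chain_minor ps \<in> det_gens k l R C (length ps)"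
proof -
  have "sorted_wrt (<) (map fst ps)"
    using assms(1) by (auto simp: sorted_wrt_map ne_sw_def intro: sorted_wrt_mono_rel[rotated])
  moreover have "sorted_wrt (<) (rev (map snd ps))"
    using assms(1) by (auto simp: sorted_wrt_rev sorted_wrt_map ne_sw_def intro: sorted_wrt_mono_rel[rotated])
  moreover have "fst ` set ps \<subseteq> R" "snd ` set ps \<subseteq> C"
    using assms(3) by auto
  ultimately show ?thesis
    using assms by (auto simp: det_gens_def minors_def chain_minor_def)
qed

lemma keys_antidiagonal_chain_minor: "mkeys (antidiagonal (chain_minor ps)) = set ps"
proof -
  have "mkeys (\<Sum>t<n. Poly_Mapping.single (ps ! t) (1::nat)) = (\<lambda>t. ps ! t) ` {..<n}" for n
    by (induction n) (auto simp: keys_monom_add lessThan_Suc)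
  moreover have "(\<lambda>t. ps ! t) ` {..<length ps} = set ps"
    unfolding set_conv_nth by blast
  ultimately show ?thesis
    by (simp add: antidiagonal_chain_minor)
qed

lemma distinct_chain: "sorted_wrt ne_sw ps \<Longrightarrow> distinct ps"
  by (induction ps) (auto simp: ne_sw_def)

lemma antidiagonal_chain_divides:
  assumes "sorted_wrt ne_sw ps" "set ps \<subseteq> mkeys m"
  obtains a where "m = a + antidiagonal (chain_minor ps)"
proof -
  have "coef (antidiagonal (chain_minor ps)) p \<le> coef m p" for p
  proof (cases "p \<in> set ps")
    case True
    then obtain i where i: "i < length ps" "p = ps ! i" by (auto simp: in_set_conv_nth)
    have "coef (antidiagonal (chain_minor ps)) p = (\<Sum>t<length ps. if t = i then 1 else 0)"
      unfolding antidiagonal_chain_minor lookup_sum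
      using distinct_chain[OF assms(1)] i
      by (intro sum.cong) (auto simp: lookup_single when_def nth_eq_iff_index_eq)
    moreover have "coef m p \<noteq> 0" using True assms(2) by (auto simp: in_keys_iff)
    ultimately show ?thesis using i by simp
  next
    case False
    then show ?thesis
      using keys_antidiagonal_chain_minor[of ps] by (metis in_keys_iff le0)
  qed
  then obtain a where "m = antidiagonal (chain_minor ps) + a"
    using monom_finite_le by metis
  then show ?thesis using that by (simp add: add.commute)
qed

lemma det_gens_subset: "minor_poly ` det_gens k l R C t \<subseteq> polys k l"
  using minor_poly_in_polys by (auto simp: det_gens_def)

lemma is_ideal_det_ideal: "is_ideal k l (det_ideal k l R C t)"
  unfolding det_ideal_def by (rule is_ideal_idl[OF det_gens_subset])

text \<open>The easy direction: the minor whose antidiagonal is the chain, times the complementary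
  monomial.\<close>

lemma (in adiag_order) det_ideal_has_lead:
  assumes ch: "has_chain (mkeys m \<inter> R \<times> C) t" and t: "0 < t" and m: "m \<in> monoms k l"
  shows "\<exists>a\<in>det_ideal k l R C t. lead_at (a :: 'a::field mpoly) m"
proof -
  obtain ps where ps: "length ps = t" "sorted_wrt ne_sw ps" "set ps \<subseteq> mkeys m \<inter> R \<times> C"
    using ch by (auto simp: has_chain_def)
  have sub: "set ps \<subseteq> (R \<inter> {1..k}) \<times> (C \<inter> {1..l})"
    using ps(3) m by (auto simp: monoms_def)
  have "chain_minor ps \<in> det_gens k l (R \<inter> {1..k}) (C \<inter> {1..l}) (length ps)"
    using ps t sub by (intro chain_minor_in_det_gens) auto
  then have d: "chain_minor ps \<in> det_gens k l R C t" "chain_minor ps \<in> minors k l"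
    using ps(1) by (auto simp: det_gens_def)
  obtain a where a: "m = a + antidiagonal (chain_minor ps)"
    using antidiagonal_chain_divides[of ps m] ps by auto
  have am: "a \<in> monoms k l" using m a by simp
  let ?g = "mono_of a * (minor_poly (chain_minor ps) :: 'a mpoly)"
  have "lead_at ?g m"
    unfolding a using minor_poly_props[OF d(2)] am by (intro lead_at_mult) auto
  moreover have "?g \<in> det_ideal k l R C t"
    using idl_gen[of "minor_poly (chain_minor ps)" "minor_poly ` det_gens k l R C t"] d(1) am
    by (intro is_idealD(4)[OF is_ideal_det_ideal]) (auto simp: det_ideal_def)
  ultimately show ?thesis by blast
qed

subsection \<open>Ideals with enough leading monomials\<close>

text \<open>Finiteness below every monomial makes the reduction by leading terms terminate.\<close>

locale fin_adiag_order = adiag_order +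
  assumes fin_below: "m \<in> monoms k l \<Longrightarrow> finite {n \<in> monoms k l. prec n m}"
begin

text \<open>Division with remainder zero: cancelling the leading term of \<open>g\<close> against an
  element of \<open>I\<close> leaves an element of \<open>J\<close> with a smaller leading
  monomial.\<close>

lemma ideal_subset_by_leads:
  fixes I J :: "'a::field mpoly set"
  assumes I: "is_ideal k l I" and J: "is_ideal k l J" and IJ: "I \<subseteq> J"
    and leads: "\<And>g m. g \<in> J \<Longrightarrow> lead_at g m \<Longrightarrow> m \<in> monoms k l \<Longrightarrow> \<exists>a\<in>I. lead_at a m"
  shows "J \<subseteq> I"
proof -
  have main: "g \<in> I" if "g \<in> J" "lead_at g m" for g m
    using that
  proof (induction "card {n \<in> monoms k l. prec n m}" arbitrary: g m rule: less_induct)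
    case less
    have gk: "mkeys g \<subseteq> monoms k l" using less.prems(1) is_idealD(1)[OF J] by (auto simp: polys_def)
    have m: "m \<in> monoms k l" using less.prems(2) gk by (auto simp: lead_at_def)
    obtain a where a: "a \<in> I" "lead_at a m" using leads[OF less.prems m] by blast
    have ak: "mkeys a \<subseteq> monoms k l" using a(1) is_idealD(1)[OF I] by (auto simp: polys_def)
    define b where "b = Poly_Mapping.single 0 (coef g m / coef a m) * a"
    have bI: "b \<in> I" unfolding b_def using a(1) by (intro is_idealD(4)[OF I]) auto
    have nz: "coef a m \<noteq> 0" "coef g m \<noteq> 0" using a(2) less.prems(2) by (auto simp: lead_at_def in_keys_iff)
    have lb: "lead_at b m" "coef b m = coef g m"
      using lead_at_mult[of "Poly_Mapping.single 0 (coef g m / coef a m)" 0 a m] a(2) ak nz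
      by (auto simp: b_def)
    have bk: "mkeys b \<subseteq> monoms k l" using bI is_idealD(1)[OF I] by (auto simp: polys_def)
    have "g - b \<in> I"
    proof (cases "g - b = 0")
      case True
      then show ?thesis using is_idealD(2)[OF I] by simp
    next
      case False
      have gbJ: "g - b \<in> J" using less.prems(1) bI IJ is_idealD(5)[OF J] by blast
      then have gbk: "mkeys (g - b) \<subseteq> monoms k l" using is_idealD(1)[OF J] by (auto simp: polys_def)
      obtain n where n: "lead_at (g - b) n" using ex_lead[OF False gbk] .
      have nm: "prec n m" using lead_at_add_less[OF less.prems(2) lb(1) lb(2)[symmetric] gk bk n] .
      have nM: "n \<in> monoms k l" using n gbk by (auto simp: lead_at_def)
      have "u \<in> {u \<in> monoms k l. prec u m}" if "u \<in> {u \<in> monoms k l. prec u n}" for u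
        using that trans[of u n m] nm nM m by blast
      moreover have "n \<in> {u \<in> monoms k l. prec u m}" "n \<notin> {u \<in> monoms k l. prec u n}"
        using nm nM irrefl by auto
      ultimately have "{u \<in> monoms k l. prec u n} \<subset> {u \<in> monoms k l. prec u m}"
        by blast
      then have "card {u \<in> monoms k l. prec u n} < card {u \<in> monoms k l. prec u m}"
        by (rule psubset_card_mono[OF fin_below[OF m]])
      then show ?thesis using less.hyps gbJ n by blast
    qed
    then show ?case using is_idealD(3)[OF I, of "g - b" b] bI by simp
  qed
  show ?thesis
  proof
    fix g assume g: "g \<in> J"
    show "g \<in> I"
    proof (cases "g = 0")
      case True
      then show ?thesis using is_idealD(2)[OF I] by simp
    next
      case False
      moreover have "mkeys g \<subseteq> monoms k l" using g is_idealD(1)[OF J] by (auto simp: polys_def)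
      ultimately obtain m where "lead_at g m" by (rule ex_lead)
      then show ?thesis using main g by blast
    qed
  qed
qed

text \<open>
  If the sum of two determinantal ideals is, on the level of leading monomials, the intersection
  of two others \<open>C\<close> and \<open>D\<close>, then it is this intersection, and \<open>C\<close> is recovered from it as a
  colon ideal by \<open>D\<close>.
\<close>

lemma knutson_step:
  fixes f :: "'a::field mpoly"
  assumes A1: "det_ideal k l R1 C1 t1 \<in> knutson_ideals (mat_poly_ring k l) f"
    and A2: "det_ideal k l R2 C2 t2 \<in> knutson_ideals (mat_poly_ring k l) f"
    and f: "f \<in> polys k l"
    and sub: "det_ideal k l R1 C1 t1 \<subseteq> (det_ideal k l RC CC tC :: 'a mpoly set)"
      "det_ideal k l R2 C2 t2 \<subseteq> (det_ideal k l RC CC tC :: 'a mpoly set)"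
      "det_ideal k l R1 C1 t1 \<subseteq> (det_ideal k l RD CD tD :: 'a mpoly set)"
      "det_ideal k l R2 C2 t2 \<subseteq> (det_ideal k l RD CD tD :: 'a mpoly set)"
    and pos: "0 < t1" "0 < t2" "0 < tC" "0 < tD"
    and grid: "RD \<subseteq> {1..k}" "CD \<subseteq> {1..l}"
    and meet: "\<And>F. has_chain (F \<inter> RC \<times> CC) tC \<Longrightarrow> has_chain (F \<inter> RD \<times> CD) tD \<Longrightarrow>
       has_chain (F \<inter> R1 \<times> C1) t1 \<or> has_chain (F \<inter> R2 \<times> C2) t2"
    and extend: "\<And>F. \<not> has_chain (F \<inter> RC \<times> CC) tC \<Longrightarrow>
       \<exists>ps. length ps = tD \<and> sorted_wrt ne_sw ps \<and> set ps \<subseteq> RD \<times> CD \<and>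
         \<not> has_chain ((F \<union> set ps) \<inter> RC \<times> CC) tC"
  shows "det_ideal k l RC CC tC \<in> knutson_ideals (mat_poly_ring k l) f"
proof -
  let ?C = "det_ideal k l RC CC tC :: 'a mpoly set"
  let ?D = "det_ideal k l RD CD tD :: 'a mpoly set"
  let ?G = "minor_poly ` det_gens k l R1 C1 t1 \<union> minor_poly ` det_gens k l R2 C2 t2 :: 'a mpoly set"
  define A where "A = idl k l ?G"
  have AK: "A \<in> knutson_ideals (mat_poly_ring k l) f"
    unfolding A_def using A1 A2 unfolding det_ideal_def
    by (rule knutson_idl_Un[OF _ _ det_gens_subset det_gens_subset])
  have AI: "is_ideal k l A" using knutson_is_ideal[OF AK f] .
  have CI: "is_ideal k l ?C" and DI: "is_ideal k l ?D" by (rule is_ideal_det_ideal)+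
  have CDI: "is_ideal k l (?C \<inter> ?D)"
    using is_idealD[OF CI] is_idealD[OF DI] unfolding is_ideal_def by (simp add: subset_iff)
  have GA: "?G \<subseteq> A" unfolding A_def by (auto intro: idl_gen)
  then have A12: "det_ideal k l R1 C1 t1 \<subseteq> A" "det_ideal k l R2 C2 t2 \<subseteq> A"
    unfolding det_ideal_def using idl_least[OF AI] by simp_all
  have "?G \<subseteq> ?C \<inter> ?D"
    using sub idl_gen[of _ "minor_poly ` det_gens k l R1 C1 t1" k l]
      idl_gen[of _ "minor_poly ` det_gens k l R2 C2 t2" k l] unfolding det_ideal_def by blast
  then have AC: "A \<subseteq> ?C \<inter> ?D"
    unfolding A_def by (rule idl_least[OF CDI])
  \<comment> \<open>A leading monomial of the intersection has the chains of both ideals;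
    \<open>meet\<close> turns them into a chain for one of the two summands of
    \<open>A\<close>.\<close>
  have "?C \<inter> ?D \<subseteq> A"
  proof (rule ideal_subset_by_leads[OF AI CDI AC])
    fix g m assume g: "g \<in> ?C \<inter> ?D" and lead: "lead_at g m" and m: "m \<in> monoms k l"
    have gk: "mkeys g \<subseteq> monoms k l" using g is_idealD(1)[OF CI] by (auto simp: polys_def)
    have "has_chain (mkeys m \<inter> RC \<times> CC) tC" "has_chain (mkeys m \<inter> RD \<times> CD) tD"
      using lead_det_ideal[OF _ lead gk] g by auto
    from meet[OF this] show "\<exists>a\<in>A. lead_at a m"
      using det_ideal_has_lead[OF _ pos(1) m, of R1 C1, where 'a = 'a]
        det_ideal_has_lead[OF _ pos(2) m, of R2 C2, where 'a = 'a] A12 by blast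
  qed
  with AC have A: "A = ?C \<inter> ?D" by blast
  define J where "J = colon_ideal (mat_poly_ring k l) A ?D"
  have JK: "J \<in> knutson_ideals (mat_poly_ring k l) f"
    unfolding J_def by (rule knutson_ideals.colon[OF AK]) (simp add: ideal_iff_is_ideal DI)
  have JI: "is_ideal k l J" using knutson_is_ideal[OF JK f] .
  have CJ: "?C \<subseteq> J"
  proof
    fix r assume r: "r \<in> ?C"
    have "r * j \<in> A" if j: "j \<in> ?D" for j
    proof -
      have "r \<in> polys k l" "j \<in> polys k l" using r j is_idealD(1)[OF CI] is_idealD(1)[OF DI] by auto
      then show ?thesis
        unfolding A using r j is_idealD(4)[OF CI, of j r] is_idealD(4)[OF DI, of r j] by (simp add: mult.commute)
    qed
    then show "r \<in> J" using r is_idealD(1)[OF CI] by (auto simp: J_def colon_ideal_def)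
  qed
  have "J \<subseteq> ?C"
  proof (rule ideal_subset_by_leads[OF CI JI CJ])
    fix g m assume g: "g \<in> J" and lead: "lead_at g m" and m: "m \<in> monoms k l"
    have gk: "mkeys g \<subseteq> monoms k l" using g is_idealD(1)[OF JI] by (auto simp: polys_def)
    have "has_chain (mkeys m \<inter> RC \<times> CC) tC"
    proof (rule ccontr)
      assume "\<not> has_chain (mkeys m \<inter> RC \<times> CC) tC"
      \<comment> \<open>The minor \<open>?d\<close> is chosen against \<open>m\<close>: the product
        of its antidiagonal with \<open>m\<close> still has no chain for \<open>?C\<close>, although
        \<open>g * ?d\<close> lies in \<open>?C\<close>.\<close>
      from extend[OF this] obtain ps where ps: "length ps = tD" "sorted_wrt ne_sw ps" "set ps \<subseteq> RD \<times> CD"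
        "\<not> has_chain ((mkeys m \<union> set ps) \<inter> RC \<times> CC) tC" by blast
      have d: "chain_minor ps \<in> det_gens k l RD CD tD"
        using chain_minor_in_det_gens[OF ps(2) _ ps(3) grid] ps(1) pos(4) by auto
      then have dm: "chain_minor ps \<in> minors k l" by (simp add: det_gens_def)
      let ?d = "minor_poly (chain_minor ps) :: 'a mpoly"
      have "?d \<in> ?D" using d by (auto simp: det_ideal_def intro: idl_gen)
      then have gd: "g * ?d \<in> ?C" using g A by (auto simp: J_def colon_ideal_def)
      have "lead_at (g * ?d) (m + antidiagonal (chain_minor ps))"
        using lead gk minor_poly_props[OF dm] by (intro lead_at_mult) auto
      moreover have "mkeys (g * ?d) \<subseteq> monoms k l" using gd is_idealD(1)[OF CI] by (auto simp: polys_def)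
      ultimately have "has_chain (mkeys (m + antidiagonal (chain_minor ps)) \<inter> RC \<times> CC) tC"
        by (rule lead_det_ideal[OF gd])
      then show False using ps(4) by (simp add: keys_monom_add keys_antidiagonal_chain_minor)
    qed
    then show "\<exists>a\<in>?C. lead_at a m" by (rule det_ideal_has_lead[OF _ pos(3) m])
  qed
  with CJ have "?C = J" by blast
  then show ?thesis using JK by simp
qed

end

subsection \<open>Laplace expansion\<close>

definition del :: "nat \<Rightarrow> 'b list \<Rightarrow> 'b list" where
  "del i xs = take i xs @ drop (Suc i) xs"

lemma length_del: "i < length xs \<Longrightarrow> length (del i xs) = length xs - 1"
  by (simp add: del_def)

lemma nth_del: "i < length xs \<Longrightarrow> j < length xs - 1 \<Longrightarrow> del i xs ! j = (if j < i then xs ! j else xs ! Suc j)"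
  by (auto simp: del_def nth_append)

lemma set_del_subset: "set (del i xs) \<subseteq> set xs"
  using set_take_subset set_drop_subset by (fastforce simp: del_def)

lemma sorted_del: "sorted_wrt P xs \<Longrightarrow> sorted_wrt P (del i xs)"
proof -
  assume "sorted_wrt P xs"
  then have "sorted_wrt P (take i xs @ drop i xs)" by simp
  then have "sorted_wrt P (take i xs)" "sorted_wrt P (drop i xs)" "\<forall>x\<in>set (take i xs). \<forall>y\<in>set (drop i xs). P x y"
    unfolding sorted_wrt_append by auto
  moreover have "set (drop (Suc i) xs) \<subseteq> set (drop i xs)"
    by (rule set_drop_subset_set_drop) simp
  ultimately show ?thesis
    using \<open>sorted_wrt P xs\<close> by (auto simp: del_def sorted_wrt_append sorted_wrt_drop)
qed

lemma del_minor:
  assumes "(is, js) \<in> minors k l" "length is = Suc t" "0 < t" "i < Suc t" "j < Suc t"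
  shows "(del i is, del j js) \<in> minors k l" "length (del i is) = t"
proof -
  note D = minorsD[OF assms(1)]
  show len: "length (del i is) = t" using assms by (simp add: length_del)
  then have "del i is \<noteq> []" using assms(3) by auto
  then show "(del i is, del j js) \<in> minors k l"
    using D assms len set_del_subset[of i "is"] set_del_subset[of j js]
    by (auto simp: minors_def length_del sorted_del)
qed

lemma mat_delete_gen_mat:
  assumes "length is = Suc t" "length js = Suc t" "i < Suc t" "j < Suc t"
  shows "mat_delete (gen_mat is js) i j = gen_mat (del i is) (del j js)"
  by (rule eq_matI) (use assms in \<open>auto simp: mat_delete_def gen_mat_def length_del nth_del\<close>)

lemma laplace_in_idl:
  assumes d: "(is, js) \<in> minors k l" "length is = Suc t" "0 < t" and I: "is_ideal k l I"
    and mem: "(\<exists>i<Suc t. \<forall>j<Suc t. minor_poly (del i is, del j js) \<in> I) \<or>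
      (\<exists>j<Suc t. \<forall>i<Suc t. minor_poly (del i is, del j js) \<in> I)"
  shows "(minor_poly (is, js) :: 'a::field mpoly) \<in> I"
proof -
  note D = minorsD[OF d(1)]
  let ?A = "gen_mat is js :: 'a mpoly mat"
  have A: "?A \<in> carrier_mat (Suc t) (Suc t)" using d(2) D(1) by (simp add: gen_mat_def)
  have el: "?A $$ (i, j) * cofactor ?A i j \<in> I"
    if "i < Suc t" "j < Suc t" "minor_poly (del i is, del j js) \<in> I" for i j
  proof -
    have "?A $$ (i, j) \<in> polys k l"
      using that d(2) D(1) minors_nth[OF d(1)] by (auto simp: gen_mat_def indet_def intro!: polys_single)
    moreover have "(- 1) ^ (i + j) \<in> polys k l" by (rule polys_power) simp
    ultimately have p: "?A $$ (i, j) * (- 1) ^ (i + j) \<in> polys k l" by blast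
    have "cofactor ?A i j = (- 1) ^ (i + j) * minor_poly (del i is, del j js)"
      using that d(2) D(1) by (simp add: cofactor_def mat_delete_gen_mat[of _ t] minor_poly_def)
    then show ?thesis
      using is_idealD(4)[OF I p that(3)] by (simp add: mult.assoc)
  qed
  from mem show ?thesis
  proof
    assume "\<exists>i<Suc t. \<forall>j<Suc t. minor_poly (del i is, del j js) \<in> I"
    then obtain i where i: "i < Suc t" "\<And>j. j < Suc t \<Longrightarrow> minor_poly (del i is, del j js) \<in> I" by blast
    have "minor_poly (is, js) = (\<Sum>j<Suc t. ?A $$ (i, j) * cofactor ?A i j)"
      unfolding minor_poly_def fst_conv snd_conv by (rule laplace_expansion_row[OF A i(1)])
    also have "\<dots> \<in> I" using i el by (intro is_ideal_sum[OF I]) auto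
    finally show ?thesis .
  next
    assume "\<exists>j<Suc t. \<forall>i<Suc t. minor_poly (del i is, del j js) \<in> I"
    then obtain j where j: "j < Suc t" "\<And>i. i < Suc t \<Longrightarrow> minor_poly (del i is, del j js) \<in> I" by blast
    have "minor_poly (is, js) = (\<Sum>i<Suc t. ?A $$ (i, j) * cofactor ?A i j)"
      unfolding minor_poly_def fst_conv snd_conv by (rule laplace_expansion_column[OF A j(1)])
    also have "\<dots> \<in> I" using j el by (intro is_ideal_sum[OF I]) auto
    finally show ?thesis .
  qed
qed

lemma in_det_ideal:
  assumes "(is, js) \<in> minors k l" "length is = t" "set is \<subseteq> R" "set js \<subseteq> C"
  shows "minor_poly (is, js) \<in> det_ideal k l R C t"
  unfolding det_ideal_def by (rule idl_gen) (use assms in \<open>auto simp: det_gens_def\<close>)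

lemma set_del_distinct: "distinct xs \<Longrightarrow> i < length xs \<Longrightarrow> set (del i xs) = set xs - {xs ! i}"
proof -
  assume a: "distinct xs" "i < length xs"
  then have "xs = take i xs @ xs ! i # drop (Suc i) xs" by (simp add: id_take_nth_drop)
  moreover from this have "distinct (take i xs @ xs ! i # drop (Suc i) xs)" using a(1) by simp
  ultimately show ?thesis
    by (metis (no_types, lifting) Diff_insert_absorb Un_insert_right del_def distinct.simps(2) distinct_append
        insert_iff list.simps(15) not_distinct_conv_prefix set_append disjoint_insert(1) Un_iff)
qed

lemma exists_del:
  assumes "distinct xs" "xs \<noteq> []" "set xs \<subseteq> insert x A"
  shows "\<exists>i<length xs. set (del i xs) \<subseteq> A"
proof (cases "x \<in> set xs")
  case True
  then obtain i where "i < length xs" "xs ! i = x" by (auto simp: in_set_conv_nth)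
  then show ?thesis using set_del_distinct[OF assms(1)] assms(3) by (intro exI[of _ i]) auto
next
  case False
  then show ?thesis using assms set_del_subset[of 0 xs] by (intro exI[of _ 0]) auto
qed

lemma det_ideal_mono:
  assumes "R' \<subseteq> R" "C' \<subseteq> C"
  shows "det_ideal k l R' C' t \<subseteq> det_ideal k l R C t"
  unfolding det_ideal_def[of k l R' C'] 
  by (rule idl_least[OF is_ideal_det_ideal]) (use assms in \<open>auto simp: det_gens_def intro!: in_det_ideal\<close>)

text \<open>Laplace expansion along row \<open>x\<close>, or along any row if \<open>x\<close> does
  not occur, so that the remaining rows lie in \<open>R\<close>.\<close>

lemma det_ideal_subset_row:
  assumes "R' \<subseteq> insert x R" "C' \<subseteq> C" "0 < t"
  shows "det_ideal k l R' C' (Suc t) \<subseteq> det_ideal k l R C t"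
  unfolding det_ideal_def[of k l R' C']
proof (rule idl_least[OF is_ideal_det_ideal], safe)
  fix "is" js assume d: "(is, js) \<in> det_gens k l R' C' (Suc t)"
  then have m: "(is, js) \<in> minors k l" "length is = Suc t" "set is \<subseteq> R'" "set js \<subseteq> C'"
    by (auto simp: det_gens_def)
  obtain i where i: "i < Suc t" "set (del i is) \<subseteq> R"
    using exists_del[of "is" x R, OF minorsD(7,2)[OF m(1)] subset_trans[OF m(3) assms(1)]] m(2) by auto
  have "set (del j js) \<subseteq> C" for j
    using set_del_subset[of j js] m(4) assms(2) by (meson subset_trans)
  with i show "minor_poly (is, js) \<in> det_ideal k l R C t"
    using assms m minorsD(1)[OF m(1)]
    by (intro laplace_in_idl[OF m(1,2) assms(3) is_ideal_det_ideal] disjI1 exI[of _ i] conjI allI impI in_det_ideal)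
       (auto simp: del_minor[OF m(1,2) assms(3)])
qed

lemma det_ideal_subset_col:
  assumes "R' \<subseteq> R" "C' \<subseteq> insert y C" "0 < t"
  shows "det_ideal k l R' C' (Suc t) \<subseteq> det_ideal k l R C t"
  unfolding det_ideal_def[of k l R' C']
proof (rule idl_least[OF is_ideal_det_ideal], safe)
  fix "is" js assume d: "(is, js) \<in> det_gens k l R' C' (Suc t)"
  then have m: "(is, js) \<in> minors k l" "length is = Suc t" "set is \<subseteq> R'" "set js \<subseteq> C'"
    by (auto simp: det_gens_def)
  obtain j where j: "j < Suc t" "set (del j js) \<subseteq> C"
    using exists_del[of js y C, OF minorsD(8)[OF m(1)] _ subset_trans[OF m(4) assms(2)]] minorsD(1,2)[OF m(1)] m(2)
    by (metis length_0_conv)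
  have "set (del i is) \<subseteq> R" for i
    using set_del_subset[of i "is"] m(3) assms(1) by (meson subset_trans)
  with j show "minor_poly (is, js) \<in> det_ideal k l R C t"
    using assms m minorsD(1)[OF m(1)]
    by (intro laplace_in_idl[OF m(1,2) assms(3) is_ideal_det_ideal] disjI2 exI[of _ j] conjI allI impI in_det_ideal)
       (auto simp: del_minor[OF m(1,2) assms(3)])
qed

subsection \<open>The degree lexicographic order\<close>

text \<open>The matrix is read row by row from the top, each row from right to left. Of the four
  corners of a rectangle the north-east one comes first, which makes antidiagonals lead in
  \<open>deglex\<close>.\<close>

definition before :: "nat \<times> nat \<Rightarrow> nat \<times> nat \<Rightarrow> bool" where
  "before p q \<longleftrightarrow> fst p < fst q \<or> (fst p = fst q \<and> snd q < snd p)"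

abbreviation total_deg :: "monom \<Rightarrow> nat" where "total_deg \<equiv> lin (\<lambda>_. 1)"

definition deglex :: "monom \<Rightarrow> monom \<Rightarrow> bool" where
  "deglex m n \<longleftrightarrow> total_deg m < total_deg n \<or> (total_deg m = total_deg n \<and>
     (\<exists>p. coef m p < coef n p \<and> (\<forall>q. before q p \<longrightarrow> coef m q = coef n q)))"

lemma before_trans: "before p q \<Longrightarrow> before q r \<Longrightarrow> before p r"
  and before_total: "p = q \<or> before p q \<or> before q p"
  and before_irrefl: "\<not> before p p"
  by (auto simp: before_def prod_eq_iff)

lemma ex_first:
  assumes "finite A" "A \<noteq> {}"
  shows "\<exists>p\<in>A. \<forall>q. before q p \<longrightarrow> q \<notin> A"
  using assms
proof (induction A rule: finite_ne_induct)
  case (singleton x)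
  then show ?case using before_irrefl by auto
next
  case (insert x A)
  then obtain p where p: "p \<in> A" "\<forall>q. before q p \<longrightarrow> q \<notin> A" by blast
  show ?case
  proof (cases "before x p")
    case True
    then have "\<forall>q. before q x \<longrightarrow> q \<notin> insert x A"
      using p before_trans before_irrefl by blast
    then show ?thesis by blast
  next
    case False
    then show ?thesis using p by blast
  qed
qed

lemma coef_le_total_deg: "coef m p \<le> total_deg m"
proof (cases "p \<in> mkeys m")
  case True
  then have "coef m p \<le> (\<Sum>v\<in>mkeys m. coef m v)" by (intro member_le_sum) auto
  then show ?thesis by (simp add: lin_def)
qed (simp add: in_keys_iff)

lemma finite_monoms_deg: "finite {m \<in> monoms k l. total_deg m \<le> d}"
proof -
  let ?D = "{1..k} \<times> {1..l}"
  have "coef ` {m \<in> monoms k l. total_deg m \<le> d} \<subseteq>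
      {f. \<forall>p. (p \<in> ?D \<longrightarrow> f p \<in> {0..d}) \<and> (p \<notin> ?D \<longrightarrow> f p = 0)}"
  proof
    fix f assume "f \<in> coef ` {m \<in> monoms k l. total_deg m \<le> d}"
    then obtain m where m: "f = coef m" "m \<in> monoms k l" "total_deg m \<le> d" by blast
    have "f p \<le> d" for p using coef_le_total_deg[of m p] m by simp
    moreover have "f p = 0" if "p \<notin> ?D" for p
    proof -
      have "p \<notin> mkeys m" using m(2) that unfolding monoms_def by blast
      then show ?thesis by (simp add: m(1) in_keys_iff)
    qed
    ultimately show "f \<in> {f. \<forall>p. (p \<in> ?D \<longrightarrow> f p \<in> {0..d}) \<and> (p \<notin> ?D \<longrightarrow> f p = 0)}" by simp
  qed
  then have "finite (coef ` {m \<in> monoms k l. total_deg m \<le> d})"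
    by (rule finite_subset) (intro finite_set_of_finite_funs; simp)
  then show ?thesis
    by (rule finite_imageD) (simp add: inj_on_def lookup_inject)
qed

interpretation deglex: fin_adiag_order k l deglex for k l
proof
  show "\<not> deglex a a" for a by (auto simp: deglex_def)
  show "deglex a c" if "deglex a b" "deglex b c" for a b c
  proof (cases "total_deg a = total_deg b \<and> total_deg b = total_deg c")
    case True
    then have "\<exists>p. coef a p < coef b p \<and> (\<forall>r. before r p \<longrightarrow> coef a r = coef b r)"
      "\<exists>q. coef b q < coef c q \<and> (\<forall>r. before r q \<longrightarrow> coef b r = coef c r)"
      using that unfolding deglex_def by simp_all
    then obtain p q where p: "coef a p < coef b p" "\<forall>r. before r p \<longrightarrow> coef a r = coef b r"
      and q: "coef b q < coef c q" "\<forall>r. before r q \<longrightarrow> coef b r = coef c r"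
      by blast
    consider "p = q" | "before p q" | "before q p" using before_total by blast
    then have "\<exists>p. coef a p < coef c p \<and> (\<forall>q. before q p \<longrightarrow> coef a q = coef c q)"
    proof cases
      case 1
      then have "coef a p < coef c p" using p(1) q(1) by simp
      moreover have "\<forall>r. before r p \<longrightarrow> coef a r = coef c r" using 1 p(2) q(2) by simp
      ultimately show ?thesis by blast
    next
      case 2
      then have "coef a p < coef c p" using p(1) q(2) by simp
      moreover have "\<forall>r. before r p \<longrightarrow> coef a r = coef c r" using 2 p(2) q(2) before_trans[of _ p q] by simp
      ultimately show ?thesis by blast
    next
      case 3
      then have "coef a q < coef c q" using q(1) p(2)[rule_format, OF 3] by simp
      moreover have "\<forall>r. before r q \<longrightarrow> coef a r = coef c r" using 3 p(2) q(2) before_trans[of _ q p] by simp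
      ultimately show ?thesis by blast
    qed
    then show ?thesis using True by (simp add: deglex_def)
  next
    case False
    then show ?thesis using that by (auto simp: deglex_def)
  qed
  show "deglex (a + c) (b + c)" if "deglex a b" for a b c
    using that by (auto simp: deglex_def lookup_add)
  show "deglex a b \<or> deglex b a" if "a \<noteq> b" for a b
  proof (cases "total_deg a = total_deg b")
    case True
    let ?A = "{p. coef a p \<noteq> coef b p}"
    have "?A \<subseteq> mkeys a \<union> mkeys b" by (auto simp: in_keys_iff)
    then have "finite ?A" by (rule finite_subset) simp
    moreover have "?A \<noteq> {}"
    proof
      assume "?A = {}"
      then have "coef a p = coef b p" for p by blast
      then show False using that poly_mapping_eqI[of a b] by blast
    qed
    ultimately obtain p where "coef a p \<noteq> coef b p" "\<forall>q. before q p \<longrightarrow> coef a q = coef b q"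
      using ex_first[of ?A] by auto
    then show ?thesis using True unfolding deglex_def by (metis linorder_neqE_nat)
  qed (auto simp: deglex_def)
  show "finite {n \<in> monoms k l. deglex n m}" for k l m
    by (rule finite_subset[OF _ finite_monoms_deg[of k l "total_deg m"]]) (auto simp: deglex_def)
  show "deglex (var i j + var i' j') (var i j' + var i' j)" if "i < i'" "j < j'" for i i' j j'
    unfolding deglex_def
  proof (intro disjI2 conjI exI[of _ "(i, j')"] allI impI)
    show "coef (var i j + var i' j') q = coef (var i j' + var i' j) q" if "before q (i, j')" for q
      using that \<open>i < i'\<close> \<open>j < j'\<close> by (cases q) (auto simp: before_def lookup_add lookup_single when_def)
  qed (use that in \<open>auto simp: lookup_add lookup_single when_def\<close>)
qed auto

subsection \<open>The factors of the product of minors\<close>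

text \<open>The block whose antidiagonal is the whole line \<open>i + j = n + 1\<close> of the
  matrix; truncated subtraction cuts it off at the border. For \<open>n < k\<close>,
  \<open>k \<le> n \<le> l\<close> and \<open>n > l\<close> these are the three kinds of factors of
  \<open>minors_product\<close>.\<close>

definition diag_minor :: "nat \<Rightarrow> nat \<Rightarrow> nat \<Rightarrow> minor" where
  "diag_minor k l n = ([Suc (n - l)..<Suc (min n k)], [Suc (n - k)..<Suc (min n l)])"

lemma diag_minor_in_minors:
  assumes "1 \<le> n" "n < k + l" "1 \<le> k" "1 \<le> l"
  shows "diag_minor k l n \<in> minors k l"
proof -
  have "Suc (min n k) - Suc (n - l) = Suc (min n l) - Suc (n - k)" "Suc (n - l) < Suc (min n k)"
    using assms by auto
  then show ?thesis
    using assms by (auto simp: diag_minor_def minors_def sorted_wrt_upt simp del: upt_Suc)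
qed

lemma minors_product_eq:
  assumes "1 \<le> k" "1 \<le> l" "k \<le> l + 1"
  shows "(minors_product k l :: 'a::field mpoly) = (\<Prod>n\<in>{1..<k + l}. minor_poly (diag_minor k l n))"
proof -
  let ?g = "\<lambda>n. minor_poly (diag_minor k l n) :: 'a mpoly"
  have 1: "Determinant.det (block 1 (j + 1) 1 (j + 1)) = ?g (Suc j)" if "j < k - 1" for j
    using that assms by (simp add: block_def minor_poly_def diag_minor_def min_def)
  have 2: "Determinant.det (block (l - j) l (k - j) k) = ?g (k + l - 1 - j)" if "j < k - 1" for j
  proof -
    have "Suc (k + l - 1 - j - l) = k - j" "min (k + l - 1 - j) k = k"
      "Suc (k + l - 1 - j - k) = l - j" "min (k + l - 1 - j) l = l" using that assms by auto
    then show ?thesis by (simp add: block_def minor_poly_def diag_minor_def)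
  qed
  have 3: "Determinant.det (block j (k + j - 1) 1 k) = ?g (k + j - 1)" if "j \<in> {1..l + 1 - k}" for j
  proof -
    have "Suc (k + j - 1 - l) = 1" "min (k + j - 1) k = k"
      "Suc (k + j - 1 - k) = j" "min (k + j - 1) l = k + j - 1" using that assms by auto
    then show ?thesis by (simp add: block_def minor_poly_def diag_minor_def)
  qed
  have "(minors_product k l :: 'a mpoly) = (\<Prod>j\<in>{0..<k - 1}. ?g (Suc j)) *
      (\<Prod>j\<in>{0..<k - 1}. ?g (k + l - 1 - j)) * (\<Prod>j\<in>{1..l + 1 - k}. ?g (k + j - 1))"
    unfolding minors_product_def prod.distrib using 1 2 3 by (intro arg_cong2[of _ _ _ _ "(*)"] prod.cong) auto
  also have "(\<Prod>j\<in>{0..<k - 1}. ?g (Suc j)) = prod ?g {1..<k}"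
    by (rule prod.reindex_bij_witness[of _ "\<lambda>n. n - 1" Suc]) auto
  also have "(\<Prod>j\<in>{0..<k - 1}. ?g (k + l - 1 - j)) = prod ?g {l + 1..<k + l}"
    using assms by (intro prod.reindex_bij_witness[of _ "\<lambda>n. k + l - 1 - n" "\<lambda>j. k + l - 1 - j"]) auto
  also have "(\<Prod>j\<in>{1..l + 1 - k}. ?g (k + j - 1)) = prod ?g {k..<l + 1}"
    using assms by (intro prod.reindex_bij_witness[of _ "\<lambda>n. n + 1 - k" "\<lambda>j. k + j - 1"]) auto
  also have "prod ?g {1..<k} * prod ?g {l + 1..<k + l} * prod ?g {k..<l + 1} =
      prod ?g {1..<k} * (prod ?g {k..<l + 1} * prod ?g {l + 1..<k + l})"
    by (simp add: ac_simps)
  also have "prod ?g {k..<l + 1} * prod ?g {l + 1..<k + l} = prod ?g {k..<k + l}"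
    using assms by (intro prod.atLeastLessThan_concat) auto
  also have "prod ?g {1..<k} * prod ?g {k..<k + l} = prod ?g {1..<k + l}"
    using assms by (intro prod.atLeastLessThan_concat) auto
  finally show ?thesis .
qed

lemma minors_product_in_polys:
  assumes "1 \<le> k" "1 \<le> l" "k \<le> l + 1"
  shows "minors_product k l \<in> polys k l"
  unfolding minors_product_eq[OF assms]
  by (intro polys_prod minor_poly_in_polys diag_minor_in_minors) (use assms in auto)

lemma antidiagonal_diag_minor:
  assumes "1 \<le> n" "n < k + l" "1 \<le> k" "1 \<le> l"
  shows "antidiagonal (diag_minor k l n) = (\<Sum>p\<in>{p\<in>{1..k} \<times> {1..l}. fst p + snd p = Suc n}. Poly_Mapping.single p 1)"
proof -
  have len: "Suc (min n k) - Suc (n - l) = Suc (min n l) - Suc (n - k)"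
    using assms by auto
  let ?L = "Suc (min n k) - Suc (n - l)"
  have "antidiagonal (diag_minor k l n) =
      (\<Sum>t<?L. Poly_Mapping.single (Suc (n - l) + t, Suc (n - k) + (?L - 1 - t)) 1)"
    unfolding antidiagonal_def diag_minor_def fst_conv snd_conv length_upt
  proof (rule sum.cong)
    fix t assume "t \<in> {..<?L}"
    then have t: "Suc (n - l) + t < Suc (min n k)" "Suc (n - k) + (?L - 1 - t) < Suc (min n l)"
      using len unfolding lessThan_iff by linarith+
    show "var ([Suc (n - l)..<Suc (min n k)] ! t) ([Suc (n - k)..<Suc (min n l)] ! (?L - 1 - t)) =
        var (Suc (n - l) + t) (Suc (n - k) + (?L - 1 - t))"
      by (simp only: nth_upt[OF t(1)] nth_upt[OF t(2)])
  qed simp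
  also have "\<dots> = (\<Sum>p\<in>{p\<in>{1..k} \<times> {1..l}. fst p + snd p = Suc n}. Poly_Mapping.single p 1)"
    using assms
    by (intro sum.reindex_bij_witness[of _ "\<lambda>p. fst p - Suc (n - l)" "\<lambda>t. (Suc (n - l) + t, Suc (n - k) + (?L - 1 - t))"])
       (auto simp: min_def split: if_splits)
  finally show ?thesis .
qed

definition full_monom :: "nat \<Rightarrow> nat \<Rightarrow> monom" where
  "full_monom k l = (\<Sum>p\<in>{1..k} \<times> {1..l}. Poly_Mapping.single p 1)"

text \<open>The lines \<open>fst p + snd p = Suc n\<close> partition the matrix, and each is the
  leading monomial of one factor.\<close>

lemma (in adiag_order) lead_minors_product:
  assumes "1 \<le> k" "1 \<le> l" "k \<le> l + 1"
  shows "lead_at (minors_product k l :: 'a::field mpoly) (full_monom k l)"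
proof -
  have "full_monom k l = (\<Sum>n\<in>{1..<k + l}. \<Sum>p\<in>{p\<in>{1..k} \<times> {1..l}. fst p + snd p - 1 = n}. Poly_Mapping.single p 1)"
    unfolding full_monom_def by (rule sum.group[symmetric]) auto
  also have "\<dots> = (\<Sum>n\<in>{1..<k + l}. antidiagonal (diag_minor k l n))"
  proof (rule sum.cong)
    fix n assume n: "n \<in> {1..<k + l}"
    then have "{p\<in>{1..k} \<times> {1..l}. fst p + snd p - 1 = n} = {p\<in>{1..k} \<times> {1..l}. fst p + snd p = Suc n}"
      by auto
    then show "(\<Sum>p\<in>{p\<in>{1..k} \<times> {1..l}. fst p + snd p - 1 = n}. Poly_Mapping.single p 1) = antidiagonal (diag_minor k l n)"
      using n assms antidiagonal_diag_minor[of n k l] by simp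
  qed simp
  finally have full: "full_monom k l = (\<Sum>n\<in>{1..<k + l}. antidiagonal (diag_minor k l n))" .
  have "diag_minor k l n \<in> minors k l" if "n \<in> {1..<k + l}" for n
    using that assms by (intro diag_minor_in_minors) auto
  then show ?thesis
    unfolding minors_product_eq[OF assms] full
    by (intro lead_at_prod[THEN conjunct1] minor_poly_props(1,2))
qed

lemma mpoly_dvd_cancel:
  fixes a b c :: "'a::field mpoly"
  assumes "a * c = b * c" "c \<noteq> 0"
  shows "a = b"
  using assms by simp

text \<open>With \<open>h\<close> the product of the other factors, the ideal of \<open>f\<close>
  has the wanted principal ideal as its colon by \<open>h\<close>, since \<open>h\<close> can be
  cancelled.\<close>

lemma diag_minor_knutson:
  assumes kl: "1 \<le> k" "1 \<le> l" "k \<le> l + 1" and n: "1 \<le> n" "n < k + l"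
  shows "idl k l {minor_poly (diag_minor k l n) :: 'a::field mpoly}
    \<in> knutson_ideals (mat_poly_ring k l) (minors_product k l)"
proof -
  let ?f = "minors_product k l :: 'a mpoly"
  let ?g = "minor_poly (diag_minor k l n) :: 'a mpoly"
  define h :: "'a mpoly" where "h = (\<Prod>i\<in>{1..<k + l} - {n}. minor_poly (diag_minor k l i))"
  have f: "?f = ?g * h"
    unfolding minors_product_eq[OF kl] h_def using n by (subst prod.remove[of _ n]) auto
  have hp: "h \<in> polys k l"
    unfolding h_def by (intro polys_prod minor_poly_in_polys diag_minor_in_minors) (use kl in auto)
  have gp: "?g \<in> polys k l"
    by (intro minor_poly_in_polys diag_minor_in_minors n kl)
  have "?f \<noteq> 0"
    using deglex.lead_minors_product[OF kl, where 'a = 'a] by (auto simp: deglex.lead_at_def)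
  then have h0: "h \<noteq> 0" using f by auto
  interpret cring "mat_poly_ring k l :: 'a mpoly ring" by (rule cring_mat_poly_ring)
  have "colon_ideal (mat_poly_ring k l) (PIdl\<^bsub>mat_poly_ring k l\<^esub> ?f) (PIdl\<^bsub>mat_poly_ring k l\<^esub> h)
      \<in> knutson_ideals (mat_poly_ring k l) ?f"
    by (intro knutson_ideals.colon knutson_ideals.principal cgenideal_ideal) (simp add: hp)
  also have "colon_ideal (mat_poly_ring k l) (PIdl\<^bsub>mat_poly_ring k l\<^esub> ?f) (PIdl\<^bsub>mat_poly_ring k l\<^esub> h) =
      PIdl\<^bsub>mat_poly_ring k l\<^esub> ?g"
  proof
    show "colon_ideal (mat_poly_ring k l) (PIdl\<^bsub>mat_poly_ring k l\<^esub> ?f) (PIdl\<^bsub>mat_poly_ring k l\<^esub> h) \<subseteq> PIdl\<^bsub>mat_poly_ring k l\<^esub> ?g"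
    proof
      fix r assume r: "r \<in> colon_ideal (mat_poly_ring k l) (PIdl\<^bsub>mat_poly_ring k l\<^esub> ?f) (PIdl\<^bsub>mat_poly_ring k l\<^esub> h)"
      have "h \<in> PIdl\<^bsub>mat_poly_ring k l\<^esub> h" unfolding cgenideal_eq using polys_1 by force
      then obtain q where q: "q \<in> polys k l" "r * h = q * ?f"
        using r by (auto simp: colon_ideal_def cgenideal_eq)
      then have "r * h = (q * ?g) * h" by (simp add: f mult.assoc)
      then have "r = q * ?g" using h0 by (rule mpoly_dvd_cancel)
      then show "r \<in> PIdl\<^bsub>mat_poly_ring k l\<^esub> ?g" using q(1) by (auto simp: cgenideal_eq)
    qed
    show "PIdl\<^bsub>mat_poly_ring k l\<^esub> ?g \<subseteq> colon_ideal (mat_poly_ring k l) (PIdl\<^bsub>mat_poly_ring k l\<^esub> ?f) (PIdl\<^bsub>mat_poly_ring k l\<^esub> h)"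
    proof
      fix r assume "r \<in> PIdl\<^bsub>mat_poly_ring k l\<^esub> ?g"
      then obtain q where q: "q \<in> polys k l" "r = q * ?g" by (auto simp: cgenideal_eq)
      have "\<exists>u\<in>polys k l. r * (v * h) = u * ?f" if "v \<in> polys k l" for v
        using q that by (intro bexI[of _ "q * v"]) (auto simp: f ac_simps)
      then show "r \<in> colon_ideal (mat_poly_ring k l) (PIdl\<^bsub>mat_poly_ring k l\<^esub> ?f) (PIdl\<^bsub>mat_poly_ring k l\<^esub> h)"
        using q gp by (auto simp: colon_ideal_def cgenideal_eq)
    qed
  qed
  also have "PIdl\<^bsub>mat_poly_ring k l\<^esub> ?g = idl k l {?g}"
  proof
    have I: "is_ideal k l (idl k l {?g})" using gp by (intro is_ideal_idl) auto
    show "PIdl\<^bsub>mat_poly_ring k l\<^esub> ?g \<subseteq> idl k l {?g}"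
      using is_idealD(4)[OF I] idl_gen[of ?g "{?g}"] by (auto simp: cgenideal_eq)
    have "is_ideal k l (PIdl\<^bsub>mat_poly_ring k l\<^esub> ?g)"
      using cgenideal_ideal[of ?g] gp by (simp add: ideal_iff_is_ideal)
    moreover have "?g \<in> PIdl\<^bsub>mat_poly_ring k l\<^esub> ?g" unfolding cgenideal_eq using polys_1 by force
    ultimately show "idl k l {?g} \<subseteq> PIdl\<^bsub>mat_poly_ring k l\<^esub> ?g" by (intro idl_least) auto
  qed
  finally show ?thesis .
qed

subsection \<open>Induction over the boxes\<close>

definition rows_at :: "nat \<Rightarrow> nat \<Rightarrow> nat \<Rightarrow> nat \<Rightarrow> nat set" where
  "rows_at k l r s = {Suc (s - l)..min r k}"

definition cols_at :: "nat \<Rightarrow> nat \<Rightarrow> nat \<Rightarrow> nat \<Rightarrow> nat set" where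
  "cols_at k l r s = {Suc (r - k)..min s l}"

text \<open>
  The ideal of \<open>t\<close>-minors of the upper left \<open>r \<times> s\<close> submatrix, continued to \<open>r > k\<close> and \<open>s > l\<close>:
  each missing row (column) cancels one column (row).
\<close>

definition corner_ideal :: "nat \<Rightarrow> nat \<Rightarrow> nat \<Rightarrow> nat \<Rightarrow> nat \<Rightarrow> 'a::field mpoly set" where
  "corner_ideal k l t r s = det_ideal k l (rows_at k l r s) (cols_at k l r s) (t - (r - k) - (s - l))"

lemma strict_sorted_full:
  assumes "sorted_wrt (<) xs" "set xs \<subseteq> {a..<b::nat}" "length xs = b - a"
  shows "xs = [a..<b]"
proof -
  have "card (set xs) = card {a..<b}" using assms by (simp add: distinct_card strict_sorted_iff)
  then have "set xs = {a..<b}" using assms(2) by (intro card_subset_eq) auto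
  then show ?thesis
    using assms(1) by (intro strict_sorted_equal) (auto simp: strict_sorted_iff)
qed

text \<open>At \<open>t = r = s\<close> there are just as many rows and columns as the size of the
  minors, so one minor remains.\<close>

lemma corner_ideal_base:
  assumes "1 \<le> n" "n < k + l" "1 \<le> k" "1 \<le> l"
  shows "corner_ideal k l n n n = idl k l {minor_poly (diag_minor k l n)}"
proof -
  have len: "n - (n - k) - (n - l) = Suc (min n k) - Suc (n - l)"
    "n - (n - k) - (n - l) = Suc (min n l) - Suc (n - k)" using assms by auto
  have "det_gens k l (rows_at k l n n) (cols_at k l n n) (n - (n - k) - (n - l)) = {diag_minor k l n}"
  proof
    show "{diag_minor k l n} \<subseteq> det_gens k l (rows_at k l n n) (cols_at k l n n) (n - (n - k) - (n - l))"
      using diag_minor_in_minors[OF assms] len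
      by (auto simp: det_gens_def diag_minor_def rows_at_def cols_at_def less_Suc_eq_le simp del: upt_Suc)
    show "det_gens k l (rows_at k l n n) (cols_at k l n n) (n - (n - k) - (n - l)) \<subseteq> {diag_minor k l n}"
    proof
      fix \<delta> assume d: "\<delta> \<in> det_gens k l (rows_at k l n n) (cols_at k l n n) (n - (n - k) - (n - l))"
      obtain "is" js where \<delta>: "\<delta> = (is, js)" by (cases \<delta>)
      have m: "(is, js) \<in> minors k l" "length is = n - (n - k) - (n - l)"
        "set is \<subseteq> rows_at k l n n" "set js \<subseteq> cols_at k l n n"
        using d by (auto simp: det_gens_def \<delta>)
      have "is = [Suc (n - l)..<Suc (min n k)]"
      proof (rule strict_sorted_full[OF minorsD(3)[OF m(1)]])
        show "set is \<subseteq> {Suc (n - l)..<Suc (min n k)}"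
          using m(3) unfolding rows_at_def atLeastLessThanSuc_atLeastAtMost .
      qed (use m(2) len(1) in linarith)
      moreover have "js = [Suc (n - k)..<Suc (min n l)]"
      proof (rule strict_sorted_full[OF minorsD(4)[OF m(1)]])
        show "set js \<subseteq> {Suc (n - k)..<Suc (min n l)}"
          using m(4) unfolding cols_at_def atLeastLessThanSuc_atLeastAtMost .
      qed (use m(2) minorsD(1)[OF m(1)] len(2) in linarith)
      ultimately show "\<delta> \<in> {diag_minor k l n}" by (simp add: \<delta> diag_minor_def)
    qed
  qed
  then show ?thesis by (simp add: corner_ideal_def det_ideal_def)
qed

text \<open>For the border case of \<open>corner_step\<close> where the partner ideal would consist
  of 0-minors and no colon can be formed: there the target is a sum of ideals generated by
  indeterminates.\<close>

lemma det_ideal_1_Un: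
  assumes "det_ideal k l R1 C1 1 \<in> knutson_ideals (mat_poly_ring k l) f"
    "det_ideal k l R2 C2 1 \<in> knutson_ideals (mat_poly_ring k l) f"
    "R \<times> C = R1 \<times> C1 \<union> R2 \<times> C2"
  shows "det_ideal k l R C 1 \<in> knutson_ideals (mat_poly_ring k l) f"
proof -
  have mem: "\<delta> \<in> det_gens k l R C 1 \<longleftrightarrow> (\<exists>i j. \<delta> = ([i], [j]) \<and> (i, j) \<in> R \<times> C \<and> \<delta> \<in> minors k l)" for \<delta> R C
  proof
    assume d: "\<delta> \<in> det_gens k l R C 1"
    then have "length (fst \<delta>) = 1" "length (snd \<delta>) = 1" by (auto simp: det_gens_def minors_def)
    then obtain i j where "fst \<delta> = [i]" "snd \<delta> = [j]" by (metis One_nat_def length_0_conv length_Suc_conv)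
    then show "\<exists>i j. \<delta> = ([i], [j]) \<and> (i, j) \<in> R \<times> C \<and> \<delta> \<in> minors k l"
      using d by (cases \<delta>) (auto simp: det_gens_def)
  qed (auto simp: det_gens_def)
  have "det_gens k l R C 1 = det_gens k l R1 C1 1 \<union> det_gens k l R2 C2 1"
    unfolding set_eq_iff Un_iff mem assms(3) by blast
  then show ?thesis
    using knutson_idl_Un[OF assms(1,2)[unfolded det_ideal_def] det_gens_subset det_gens_subset]
    by (simp add: det_ideal_def image_Un)
qed

text \<open>\<open>R\<close> and \<open>S\<close> tell whether row \<open>Suc r\<close> and column
  \<open>Suc s\<close> still belong to the matrix. The arithmetic assumptions keep the effective
  sizes of the minors, after cancelling missing rows and columns, positive.\<close>

lemma corner_step:
  assumes trs: "1 \<le> t" "t \<le> r" "t \<le> s" "Suc (r + s) < k + l + t" "r < k + t" "s < l + t"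
    and A1: "corner_ideal k l t r s \<in> knutson_ideals (mat_poly_ring k l) (f :: 'a::field mpoly)"
    and A2: "corner_ideal k l (Suc t) (Suc r) (Suc s) \<in> knutson_ideals (mat_poly_ring k l) f"
    and f: "f \<in> polys k l"
  shows "Suc s < l + t \<Longrightarrow> corner_ideal k l t r (Suc s) \<in> knutson_ideals (mat_poly_ring k l) f"
    and "Suc r < k + t \<Longrightarrow> corner_ideal k l t (Suc r) s \<in> knutson_ideals (mat_poly_ring k l) f"
proof -
  define R where "R \<longleftrightarrow> r < k"
  define S where "S \<longleftrightarrow> s < l"
  define u where "u = Suc (s - l)"
  define r' where "r' = min r k"
  define c where "c = Suc (r - k)"
  define s' where "s' = min s l"
  define t' where "t' = t - (r - k) - (s - l)"
  define RC where "RC = (if S then {u..r'} else {Suc u..r'})"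
  define CC where "CC = (if S then {c..Suc s'} else {c..s'})"
  define RD where "RD = (if R then {u..Suc r'} else {u..r'})"
  define CD where "CD = (if R then {c..s'} else {Suc c..s'})"
  define R2 where "R2 = {if S then u else Suc u..if R then Suc r' else r'}"
  define C2 where "C2 = {if R then c else Suc c..if S then Suc s' else s'}"
  define tC where "tC = dec_unless S t'"
  define tD where "tD = dec_unless R t'"
  define t2 where "t2 = dec_unless R (dec_unless S (Suc t'))"
  have eC: "corner_ideal k l t r (Suc s) = (det_ideal k l RC CC tC :: 'a mpoly set)"
    by (auto simp: corner_ideal_def rows_at_def cols_at_def RC_def CC_def tC_def dec_unless_def t'_def S_def
        u_def r'_def c_def s'_def min_def Suc_diff_le intro!: arg_cong[of _ _ "det_ideal k l _ _"])
  have eD: "corner_ideal k l t (Suc r) s = (det_ideal k l RD CD tD :: 'a mpoly set)"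
    by (auto simp: corner_ideal_def rows_at_def cols_at_def RD_def CD_def tD_def dec_unless_def t'_def R_def
        u_def r'_def c_def s'_def min_def Suc_diff_le intro!: arg_cong[of _ _ "det_ideal k l _ _"])
  have e1: "corner_ideal k l t r s = (det_ideal k l {u..r'} {c..s'} t' :: 'a mpoly set)"
    by (simp add: corner_ideal_def rows_at_def cols_at_def u_def r'_def c_def s'_def t'_def)
  have e2: "corner_ideal k l (Suc t) (Suc r) (Suc s) = (det_ideal k l R2 C2 t2 :: 'a mpoly set)"
  proof -
    have "Suc t - (Suc r - k) - (Suc s - l) = t2"
      using trs by (auto simp: t2_def dec_unless_def t'_def R_def S_def)
    moreover have "rows_at k l (Suc r) (Suc s) = R2" "cols_at k l (Suc r) (Suc s) = C2"
      by (auto simp: rows_at_def cols_at_def R2_def C2_def R_def S_def u_def r'_def c_def s'_def min_def Suc_diff_le)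
    ultimately show ?thesis by (simp add: corner_ideal_def)
  qed
  have t'2: "0 < t'"
    using trs by (auto simp: t'_def)
  have tCpos: "0 < tC" "0 < t2" if "Suc s < l + t"
    using trs that by (auto simp: tC_def t2_def dec_unless_def t'_def R_def S_def)
  have tDpos: "0 < tD" "0 < t2" if "Suc r < k + t"
    using trs that by (auto simp: tD_def t2_def dec_unless_def t'_def R_def S_def)
  have dims: "c + t' \<le> Suc s'" "u + t' \<le> Suc r'" "u \<le> r'" "c \<le> s'"
    using trs t'2 by (auto simp: c_def t'_def s'_def u_def r'_def min_def)
  have boxes: "RC \<times> CC = box_right S u r' c s'" "RD \<times> CD = box_down R u r' c s'"
    "R2 \<times> C2 = box_diag R S u r' c s'"
    by (auto simp: RC_def CC_def RD_def CD_def R2_def C2_def box_right_def box_down_def box_diag_def)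
  have sub1C: "det_ideal k l {u..r'} {c..s'} t' \<subseteq> (det_ideal k l RC CC tC :: 'a mpoly set)" if "0 < tC"
  proof (cases S)
    case True
    then show ?thesis using det_ideal_mono[of "{u..r'}" RC "{c..s'}" CC k l t']
      by (auto simp: RC_def CC_def tC_def dec_unless_def)
  next
    case False
    then have "t' = Suc tC" using t'2 by (simp add: tC_def dec_unless_def)
    show ?thesis
      unfolding \<open>t' = Suc tC\<close> by (rule det_ideal_subset_row[where x = u]) (use that False in \<open>auto simp: RC_def CC_def\<close>)
  qed
  have sub1D: "det_ideal k l {u..r'} {c..s'} t' \<subseteq> (det_ideal k l RD CD tD :: 'a mpoly set)" if "0 < tD"
  proof (cases R)
    case True
    then show ?thesis using det_ideal_mono[of "{u..r'}" RD "{c..s'}" CD k l t']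
      by (auto simp: RD_def CD_def tD_def dec_unless_def)
  next
    case False
    then have "t' = Suc tD" using t'2 by (simp add: tD_def dec_unless_def)
    show ?thesis
      unfolding \<open>t' = Suc tD\<close> by (rule det_ideal_subset_col[where y = c]) (use that False in \<open>auto simp: RD_def CD_def\<close>)
  qed
  have sub2C: "det_ideal k l R2 C2 t2 \<subseteq> (det_ideal k l RC CC tC :: 'a mpoly set)" if "0 < tC"
  proof (cases R)
    case False
    then have "t2 = tC" using that t'2 by (auto simp: t2_def tC_def dec_unless_def)
    then show ?thesis using False det_ideal_mono[of R2 RC C2 CC k l tC] by (auto simp: R2_def RC_def C2_def CC_def)
  next
    case True
    then have "t2 = Suc tC" using that t'2 by (auto simp: t2_def tC_def dec_unless_def)
    show ?thesis
      unfolding \<open>t2 = Suc tC\<close> by (rule det_ideal_subset_row[where x = "Suc r'"]) (use that True in \<open>auto simp: R2_def RC_def C2_def CC_def\<close>)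
  qed
  have sub2D: "det_ideal k l R2 C2 t2 \<subseteq> (det_ideal k l RD CD tD :: 'a mpoly set)" if "0 < tD"
  proof (cases S)
    case False
    then have "t2 = tD" using that t'2 by (auto simp: t2_def tD_def dec_unless_def)
    then show ?thesis using False det_ideal_mono[of R2 RD C2 CD k l tD] by (auto simp: R2_def RD_def C2_def CD_def)
  next
    case True
    then have "t2 = Suc tD" using that t'2 by (auto simp: t2_def tD_def dec_unless_def)
    show ?thesis
      unfolding \<open>t2 = Suc tD\<close> by (rule det_ideal_subset_col[where y = "Suc s'"]) (use that True in \<open>auto simp: R2_def RD_def C2_def CD_def\<close>)
  qed
  have meet: "has_chain (F \<inter> {u..r'} \<times> {c..s'}) t' \<or> has_chain (F \<inter> R2 \<times> C2) t2"
    if "has_chain (F \<inter> RC \<times> CC) tC" "has_chain (F \<inter> RD \<times> CD) tD" for F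
    using boxes_meet[OF t'2 dims(3,4)] that unfolding boxes tC_def tD_def t2_def by blast
  have extC: "\<exists>ps. length ps = tD \<and> sorted_wrt ne_sw ps \<and> set ps \<subseteq> RD \<times> CD \<and>
         \<not> has_chain ((F \<union> set ps) \<inter> RC \<times> CC) tC"
    if "\<not> has_chain (F \<inter> RC \<times> CC) tC" for F
    using box_right_extend[OF _ t'2 dims(1,2), of F S R] that unfolding boxes tC_def tD_def by metis
  have extD: "\<exists>ps. length ps = tC \<and> sorted_wrt ne_sw ps \<and> set ps \<subseteq> RC \<times> CC \<and>
         \<not> has_chain ((F \<union> set ps) \<inter> RD \<times> CD) tD"
    if "\<not> has_chain (F \<inter> RD \<times> CD) tD" for F
    using box_down_extend[OF _ t'2 dims(1,2), of F R S] that unfolding boxes tC_def tD_def by metis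
  have gridC: "RC \<subseteq> {1..k}" "CC \<subseteq> {1..l}"
    by (auto simp: RC_def CC_def S_def u_def c_def r'_def s'_def)
  have gridD: "RD \<subseteq> {1..k}" "CD \<subseteq> {1..l}"
    by (auto simp: RD_def CD_def R_def u_def c_def r'_def s'_def)
  note A = A1[unfolded e1] A2[unfolded e2]
  show "corner_ideal k l t r (Suc s) \<in> knutson_ideals (mat_poly_ring k l) f" if s: "Suc s < l + t"
  proof (cases "tD = 0")
    case False
    then have D: "0 < tD" by simp
    note C = tCpos[OF s]
    show ?thesis
      unfolding eC
      by (rule deglex.knutson_step[OF A f sub1C sub2C sub1D sub2D t'2 C(2,1) D gridD meet extC]) (use C D in auto)
  next
    \<comment> \<open>A partner of size \<open>0\<close> would be the unit ideal. This forces
      \<open>t' = 1\<close>, and the positions of the target are the union of those of the two given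
      ideals.\<close>
    case True
    then have "\<not> R" "t' = 1" using t'2 by (auto simp: tD_def dec_unless_def split: if_splits)
    moreover from this have "S" "tC = 1" "t2 = 1"
      using tCpos[OF s] by (auto simp: tC_def t2_def dec_unless_def split: if_splits)
    moreover have "{c..Suc s'} = {c..s'} \<union> {Suc c..Suc s'}" using dims by auto
    ultimately show ?thesis
      using det_ideal_1_Un[OF A[unfolded \<open>t' = 1\<close> \<open>t2 = 1\<close>], of RC CC] unfolding eC
      by (auto simp: RC_def CC_def R2_def C2_def)
  qed
  show "corner_ideal k l t (Suc r) s \<in> knutson_ideals (mat_poly_ring k l) f" if r: "Suc r < k + t"
  proof (cases "tC = 0")
    case False
    then have C: "0 < tC" by simp
    note D = tDpos[OF r]
    show ?thesis
      unfolding eD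
      by (rule deglex.knutson_step[OF A f sub1D sub2D sub1C sub2C t'2 D(2,1) C gridC meet extD]) (use C D in auto)
  next
    case True
    then have "\<not> S" "t' = 1" using t'2 by (auto simp: tC_def dec_unless_def split: if_splits)
    moreover from this have "R" "tD = 1" "t2 = 1"
      using tDpos[OF r] by (auto simp: tD_def t2_def dec_unless_def split: if_splits)
    moreover have "{u..Suc r'} = {u..r'} \<union> {Suc u..Suc r'}" using dims by auto
    ultimately show ?thesis
      using det_ideal_1_Un[OF A[unfolded \<open>t' = 1\<close> \<open>t2 = 1\<close>], of RD CD] unfolding eD
      by (auto simp: RD_def CD_def R2_def C2_def)
  qed
qed

text \<open>Both boxes used in a step have a smaller \<open>(r - t) + (s - t)\<close>: one has a
  shorter side, the other enlarges \<open>t\<close> together with the other side and so may reach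
  beyond the matrix. The induction ends at \<open>t = r = s\<close>, a single factor of
  \<open>minors_product k l\<close>.\<close>

lemma corner_ideal_knutson:
  assumes kl: "1 \<le> k" "1 \<le> l" "k \<le> l + 1" and "1 \<le> t" "t \<le> r" "t \<le> s" "r + s < k + l + t" "r < k + t" "s < l + t"
  shows "corner_ideal k l t r s \<in> knutson_ideals (mat_poly_ring k l) (minors_product k l :: 'a::field mpoly)"
  using assms(4-)
proof (induction "(r - t) + (s - t)" arbitrary: t r s rule: less_induct)
  case less
  note f = minors_product_in_polys[OF kl, where 'a = 'a]
  show ?case
  proof (cases "s = t")
    case False
    then obtain s' where s: "s = Suc s'" using less.prems by (cases s) auto
    show ?thesis
      unfolding s
    proof (rule corner_step(1)[OF _ _ _ _ _ _ _ _ f])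
      show "corner_ideal k l t r s' \<in> knutson_ideals (mat_poly_ring k l) (minors_product k l :: 'a mpoly)"
        using less.prems False s by (intro less.hyps) auto
      show "corner_ideal k l (Suc t) (Suc r) (Suc s') \<in> knutson_ideals (mat_poly_ring k l) (minors_product k l :: 'a mpoly)"
        using less.prems False s by (intro less.hyps) auto
    qed (use less.prems False s in auto)
  next
    case st: True
    show ?thesis
    proof (cases "r = t")
      case False
      then obtain r' where r: "r = Suc r'" using less.prems by (cases r) auto
      show ?thesis
        unfolding r
      proof (rule corner_step(2)[OF _ _ _ _ _ _ _ _ f])
        show "corner_ideal k l t r' s \<in> knutson_ideals (mat_poly_ring k l) (minors_product k l :: 'a mpoly)"
          using less.prems False r by (intro less.hyps) auto
        show "corner_ideal k l (Suc t) (Suc r') (Suc s) \<in> knutson_ideals (mat_poly_ring k l) (minors_product k l :: 'a mpoly)"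
          using less.prems False r by (intro less.hyps) auto
      qed (use less.prems False r in auto)
    next
      case True
      then show ?thesis
        using st less.prems diag_minor_knutson[OF kl, of t, where 'a = 'a] by (simp add: corner_ideal_base kl)
    qed
  qed
qed

theorem det_ideal_knutson:
  assumes "1 \<le> k" "1 \<le> l" "k \<le> l + 1" "1 \<le> t" "t \<le> r" "t \<le> s" "r \<le> k" "s \<le> l"
  shows "det_ideal k l {1..r} {1..s} t \<in> knutson_ideals (mat_poly_ring k l) (minors_product k l :: 'a::field mpoly)"
  using corner_ideal_knutson[of k l t r s, where 'a = 'a] assms
  by (simp add: corner_ideal_def rows_at_def cols_at_def)

section \<open>Straightening products of maximal minors\<close>

definition maxdet :: "nat \<Rightarrow> (nat \<Rightarrow> nat \<Rightarrow> 'r) \<Rightarrow> (nat \<Rightarrow> nat) \<Rightarrow> 'r::idom" where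
  "maxdet n z g = Determinant.det (mat n n (\<lambda>(r, c). z c (g r)))"

text \<open>The Pluecker coordinate of \<open>C\<close>; sorting the set fixes its sign.\<close>

definition setdet :: "nat \<Rightarrow> (nat \<Rightarrow> nat \<Rightarrow> 'r) \<Rightarrow> nat set \<Rightarrow> 'r::idom" where
  "setdet n z C = maxdet n z (\<lambda>r. sorted_list_of_set C ! r)"

text \<open>No permutation sends \<open>R\<close> into the smaller set \<open>C\<close>, so every
  term of the expansion contains a zero entry.\<close>

lemma det_row_support:
  fixes A :: "'r::comm_ring_1 mat"
  assumes A: "A \<in> carrier_mat m m" and R: "R \<subseteq> {0..<m}" and C: "finite C" "card C < card R"
    and zero: "\<And>r c. r \<in> R \<Longrightarrow> c < m \<Longrightarrow> c \<notin> C \<Longrightarrow> A $$ (r, c) = 0"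
  shows "Determinant.det A = 0"
  unfolding det_def'[OF A]
proof (rule sum.neutral, safe)
  fix p assume p: "p permutes {0..<m}"
  have "\<not> p ` R \<subseteq> C"
  proof
    assume "p ` R \<subseteq> C"
    then have "card (p ` R) \<le> card C" using C by (intro card_mono)
    moreover have "card (p ` R) = card R" using permutes_inj[OF p] by (intro card_image) (auto intro: inj_on_subset)
    ultimately show False using C by simp
  qed
  then obtain r where r: "r \<in> R" "p r \<notin> C" by auto
  have "r \<in> {0..<m}" using r R by auto
  moreover from this have "p r < m" using permutes_in_image[OF p, of r] by auto
  ultimately have "(\<Prod>i = 0..<m. A $$ (i, p i)) = 0"
    using zero[OF r(1) _ r(2)] by (intro prod_zero) auto
  then show "signof p * (\<Prod>i = 0..<m. A $$ (i, p i)) = 0" by simp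
qed

lemma det_rows_add:
  fixes x y :: "nat \<Rightarrow> nat \<Rightarrow> 'r::comm_ring_1"
  shows "Determinant.det (mat m m (\<lambda>(r, c). x r c + y r c)) =
    (\<Sum>T\<in>Pow {0..<m}. Determinant.det (mat m m (\<lambda>(r, c). if r \<in> T then x r c else y r c)))"
proof -
  have c: "mat m m f \<in> carrier_mat m m" for f :: "nat \<times> nat \<Rightarrow> 'r" by simp
  have "Determinant.det (mat m m (\<lambda>(r, c). x r c + y r c)) =
      (\<Sum>p | p permutes {0..<m}. signof p * (\<Prod>i = 0..<m. x i (p i) + y i (p i)))"
    unfolding det_def'[OF c]
    by (intro sum.cong arg_cong2[of _ _ _ _ "(*)"] prod.cong refl) (auto dest: permutes_in_image)
  also have "\<dots> = (\<Sum>p | p permutes {0..<m}. \<Sum>T\<in>Pow {0..<m}.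
      signof p * (\<Prod>i = 0..<m. if i \<in> T then x i (p i) else y i (p i)))"
  proof (intro sum.cong refl)
    fix p
    have "(\<Prod>i = 0..<m. x i (p i) + y i (p i)) =
        (\<Sum>T\<in>Pow {0..<m}. (\<Prod>i\<in>T. x i (p i)) * (\<Prod>i\<in>{0..<m} - T. y i (p i)))"
      by (rule prod_add) simp
    also have "\<dots> = (\<Sum>T\<in>Pow {0..<m}. \<Prod>i = 0..<m. if i \<in> T then x i (p i) else y i (p i))"
    proof (intro sum.cong refl)
      fix T assume "T \<in> Pow {0..<m}"
      then have "{0..<m} \<inter> T = T" "{0..<m} \<inter> - T = {0..<m} - T" by auto
      then show "(\<Prod>i\<in>T. x i (p i)) * (\<Prod>i\<in>{0..<m} - T. y i (p i)) = (\<Prod>i = 0..<m. if i \<in> T then x i (p i) else y i (p i))"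
        by (simp add: prod.If_cases)
    qed
    finally show "signof p * (\<Prod>i = 0..<m. x i (p i) + y i (p i)) =
        (\<Sum>T\<in>Pow {0..<m}. signof p * (\<Prod>i = 0..<m. if i \<in> T then x i (p i) else y i (p i)))"
      by (simp add: sum_distrib_left)
  qed
  also have "\<dots> = (\<Sum>T\<in>Pow {0..<m}. \<Sum>p | p permutes {0..<m}.
      signof p * (\<Prod>i = 0..<m. if i \<in> T then x i (p i) else y i (p i)))"
    by (rule sum.swap)
  also have "\<dots> = (\<Sum>T\<in>Pow {0..<m}. Determinant.det (mat m m (\<lambda>(r, c). if r \<in> T then x r c else y r c)))"
    unfolding det_def'[OF c]
    by (intro sum.cong arg_cong2[of _ _ _ _ "(*)"] prod.cong refl) (auto dest: permutes_in_image)
  finally show ?thesis .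
qed

lemma maxdet_cong: "(\<And>r. r < n \<Longrightarrow> g r = h r) \<Longrightarrow> maxdet n z g = maxdet n z h"
  unfolding maxdet_def by (intro arg_cong[of _ _ Determinant.det] cong_mat) auto

lemma sign_cases: "signof p = (1::'r::ring_1) \<or> signof p = (-1::'r)"
  by (simp add: sign_def)

lemma signof_mult_eqD:
  fixes x y :: "'r::ring_1"
  assumes "signof p * x = y"
  shows "x = signof p * y"
  unfolding assms[symmetric] by (simp add: sign_def)

lemma maxdet_permute:
  assumes "p permutes {0..<n}"
  shows "maxdet n z (\<lambda>r. g (p r)) = signof p * maxdet n z g"
proof -
  let ?A = "mat n n (\<lambda>(r, c). z c (g r))"
  have "mat n n (\<lambda>(i, j). ?A $$ (p i, j)) = mat n n (\<lambda>(r, c). z c (g (p r)))"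
    using permutes_in_image[OF assms] by (intro cong_mat) auto
  then show ?thesis
    using det_permute_rows[of ?A n p, OF _ assms] by (simp add: maxdet_def)
qed

lemma maxdet_not_inj:
  assumes "\<not> inj_on g {0..<n}"
  shows "maxdet n z g = 0"
proof -
  obtain i j where ij: "i < n" "j < n" "i \<noteq> j" "g i = g j"
    using assms by (auto simp: inj_on_def)
  show ?thesis
    unfolding maxdet_def
    by (rule det_identical_rows[of _ n i j]) (use ij in \<open>auto intro!: eq_vecI\<close>)
qed

lemma nth_sorted_list_bij:
  assumes "finite C" "card C = n"
  shows "bij_betw (\<lambda>r. sorted_list_of_set C ! r) {0..<n} C"
  by (rule bij_betw_nth) (use assms in \<open>auto simp: atLeast0LessThan\<close>)

lemma maxdet_image:
  assumes "inj_on g {0..<n}"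
  shows "maxdet n z g = setdet n z (g ` {0..<n}) \<or> maxdet n z g = - setdet n z (g ` {0..<n})"
proof -
  let ?C = "g ` {0..<n}"
  let ?s = "\<lambda>r. sorted_list_of_set ?C ! r"
  have cardC: "card ?C = n" using card_image[OF assms] by simp
  have s: "bij_betw ?s {0..<n} ?C"
    using cardC by (intro nth_sorted_list_bij) simp_all
  define q where "q r = (if r < n then inv_into {0..<n} ?s (g r) else r)" for r
  have "bij_betw (inv_into {0..<n} ?s \<circ> g) {0..<n} {0..<n}"
    using assms s by (intro bij_betw_trans[OF _ bij_betw_inv_into[OF s]]) (simp add: bij_betw_def)
  then have "bij_betw q {0..<n} {0..<n}"
    by (rule bij_betw_cong[THEN iffD1, rotated]) (simp add: q_def)
  then have q: "q permutes {0..<n}"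
    by (rule bij_imp_permutes) (simp add: q_def)
  have "maxdet n z g = maxdet n z (\<lambda>r. ?s (q r))"
    using bij_betw_inv_into_right[OF s] by (intro maxdet_cong) (simp add: q_def)
  also have "\<dots> = signof q * setdet n z ?C"
    by (simp add: maxdet_permute[OF q] setdet_def)
  finally show ?thesis using sign_cases[of q, where 'r = 'a] by auto
qed

text \<open>
  The expansion of a singular \<open>2n \<times> 2n\<close> determinant: with \<open>z\<^sub>r\<close> the vector at \<open>L r\<close>, its rows are
  \<open>(z\<^sub>r, 0)\<close> for \<open>r < i\<close>, \<open>(z\<^sub>r, z\<^sub>r)\<close> for \<open>i \<le> r \<le> n + i\<close> and \<open>(0, z\<^sub>r)\<close> for \<open>r > n + i\<close>.
\<close>

lemma shuffle_relation:
  fixes z :: "nat \<Rightarrow> nat \<Rightarrow> 'r::idom"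
  assumes i: "i < n"
    and \<T>_def: "\<T> = {T \<in> Pow {0..<2 * n}. card T = n \<and> {0..<i} \<subseteq> T \<and> T \<subseteq> {0..n + i}}"
  obtains \<epsilon> h h' where "\<And>T. T \<in> \<T> \<Longrightarrow> \<epsilon> T = 1 \<or> \<epsilon> T = (-1::'r)"
    "\<And>T. T \<in> \<T> \<Longrightarrow> bij_betw (h T) {0..<n} T"
    "\<And>T. T \<in> \<T> \<Longrightarrow> bij_betw (h' T) {0..<n} ({0..<2 * n} - T)"
    "(\<Sum>T\<in>\<T>. \<epsilon> T * (maxdet n z (\<lambda>r. L (h T r)) * maxdet n z (\<lambda>r. L (h' T r)))) = 0"
proof -
  let ?m = "2 * n"
  define x where "x r c = (if c < n \<and> r \<le> n + i then z c (L r) else 0)" for r c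
  define y where "y r c = (if n \<le> c \<and> i \<le> r then z (c - n) (L r) else 0)" for r c
  define M where "M = mat ?m ?m (\<lambda>(r, c). x r c + y r c)"
  \<comment> \<open>Multiplication by \<open>N\<close> subtracts the left half of the columns from
    the right half; then the \<open>n + 1\<close> rows from \<open>i\<close> to \<open>n + i\<close>
    are supported in the first \<open>n\<close> columns.\<close>
  define N where "N = mat ?m ?m (\<lambda>(a, c). if a = c then 1 else if c = a + n then - 1 else (0::'r))"
  have Mc: "M \<in> carrier_mat ?m ?m" and Nc: "N \<in> carrier_mat ?m ?m" by (simp_all add: M_def N_def)
  have detN: "Determinant.det N = 1"
  proof -
    have "upper_triangular N" by (auto simp: upper_triangular_def N_def)
    then have "Determinant.det N = prod_list (diag_mat N)" using Nc by (rule det_upper_triangular)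
    also have "\<dots> = (\<Prod>j\<in>{0..<?m}. N $$ (j, j))" using prod_list_diag_prod[of N] by (simp add: N_def)
    also have "\<dots> = 1" by (intro prod.neutral) (simp add: N_def)
    finally show ?thesis .
  qed
  have "Determinant.det (M * N) = 0"
  proof (rule det_row_support)
    show "M * N \<in> carrier_mat ?m ?m" using Mc Nc by simp
    show "{i..n + i} \<subseteq> {0..<?m}" using i by auto
    show "card {0..<n} < card {i..n + i}" by simp
    fix r c assume r: "r \<in> {i..n + i}" and c: "c < ?m" "c \<notin> {0..<n}"
    have rm: "r < ?m" using r i by auto
    have "(M * N) $$ (r, c) = (\<Sum>a = 0..<?m. M $$ (r, a) * N $$ (a, c))"
      using rm c(1) by (simp add: scalar_prod_def M_def N_def)
    also have "\<dots> = (\<Sum>a\<in>{c, c - n}. M $$ (r, a) * N $$ (a, c))"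
      using c by (intro sum.mono_neutral_right) (auto simp: N_def)
    also have "\<dots> = M $$ (r, c) - M $$ (r, c - n)"
    proof -
      have "c \<noteq> c - n" using c i by auto
      then show ?thesis using c by (simp add: N_def)
    qed
    also have "\<dots> = 0"
      using r rm c by (auto simp: M_def x_def y_def)
    finally show "(M * N) $$ (r, c) = 0" .
  qed simp
  then have detM: "Determinant.det M = 0"
    using det_mult[OF Mc Nc] detN by simp
  define MT where "MT T = mat ?m ?m (\<lambda>(r, c). if r \<in> T then x r c else y r c)" for T
  have MTc: "MT T \<in> carrier_mat ?m ?m" for T by (simp add: MT_def)
  \<comment> \<open>\<open>T\<close> is the set of rows that keep only their left half. The
    determinant vanishes if \<open>T\<close> has the wrong size, contains a row whose left half is
    zero, or omits one whose right half is zero.\<close>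
  have MT0: "Determinant.det (MT T) = 0" if TP: "T \<in> Pow {0..<?m}" "T \<notin> \<T>" for T
  proof -
    have finT: "finite T" and Tm: "T \<subseteq> {0..<?m}" using TP(1) finite_subset by auto
    consider "n < card T" | "card T < n" | r where "r \<in> T" "n + i < r" | r where "r < i" "r \<notin> T"
    proof -
      have "n < card T \<or> card T < n \<or> (\<exists>r\<in>T. n + i < r) \<or> (\<exists>r<i. r \<notin> T)"
        using TP unfolding \<T>_def by (cases "card T = n") (auto simp: subset_iff not_le)
      then show ?thesis using that by blast
    qed
    then show ?thesis
    proof cases
      case 1
      have "MT T $$ (r, c) = 0" if "r \<in> T" "c < ?m" "c \<notin> {0..<n}" for r c
        using that subsetD[OF Tm that(1)] by (simp add: MT_def x_def)
      then show ?thesis using 1 by (intro det_row_support[OF MTc Tm, of "{0..<n}"]) simp_all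
    next
      case 2
      have "card ({0..<?m} - T) = ?m - card T" using Tm finT by (simp add: card_Diff_subset)
      moreover have "MT T $$ (r, c) = 0" if "r \<in> {0..<?m} - T" "c < ?m" "c \<notin> {n..<?m}" for r c
        using that by (simp add: MT_def y_def)
      ultimately show ?thesis using 2
        by (intro det_row_support[OF MTc, of "{0..<?m} - T" "{n..<?m}"]) auto
    next
      case (3 r)
      then have "MT T $$ (r, c) = 0" if "c < ?m" for c
        using that subsetD[OF Tm 3(1)] by (simp add: MT_def x_def)
      then show ?thesis using subsetD[OF Tm 3(1)]
        by (intro det_row_support[OF MTc, of "{r}" "{}"]) auto
    next
      case (4 r)
      then have "MT T $$ (r, c) = 0" if "c < ?m" for c
        using that i by (simp add: MT_def y_def)
      then show ?thesis using 4 i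
        by (intro det_row_support[OF MTc, of "{r}" "{}"]) auto
    qed
  qed
  have ex: "\<exists>e h h'. (e = 1 \<or> e = (-1::'r)) \<and> bij_betw h {0..<n} T \<and> bij_betw h' {0..<n} ({0..<?m} - T) \<and>
      Determinant.det (MT T) = e * (maxdet n z (\<lambda>r. L (h r)) * maxdet n z (\<lambda>r. L (h' r)))"
    if T: "T \<in> \<T>" for T
  proof -
    have Tm: "T \<subseteq> {0..<?m}" "card T = n" "{0..<i} \<subseteq> T" "T \<subseteq> {0..n + i}" using T by (auto simp: \<T>_def)
    have finT: "finite T" using Tm(1) finite_subset[of T "{0..<?m}"] by simp
    have card': "card ({0..<?m} - T) = n" using Tm finT by (simp add: card_Diff_subset)
    obtain h where h: "bij_betw h {0..<n} T"
      using ex_bij_betw_nat_finite[OF finT] Tm(2) by auto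
    obtain h' where h': "bij_betw h' {0..<n} ({0..<?m} - T)"
      using ex_bij_betw_nat_finite[of "{0..<?m} - T"] card' by auto
    \<comment> \<open>Moving the rows of \<open>T\<close> to the top makes the matrix block
      diagonal.\<close>
    define p where "p r = (if r < n then h r else if r < ?m then h' (r - n) else r)" for r
    have shift: "bij_betw (\<lambda>r. r - n) {n..<?m} {0..<n}"
      by (rule bij_betwI[of _ _ _ "\<lambda>r. r + n"]) auto
    have "bij_betw p ({0..<n} \<union> {n..<?m}) (T \<union> ({0..<?m} - T))"
    proof (rule bij_betw_combine)
      show "bij_betw p {0..<n} T"
        using h by (rule bij_betw_cong[THEN iffD1, rotated]) (simp add: p_def)
      show "bij_betw p {n..<?m} ({0..<?m} - T)"
        using bij_betw_trans[OF shift h'] by (rule bij_betw_cong[THEN iffD1, rotated]) (auto simp: p_def)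
    qed auto
    moreover have "{0..<n} \<union> {n..<?m} = {0..<?m}" "T \<union> ({0..<?m} - T) = {0..<?m}" using Tm(1) by auto
    ultimately have "bij_betw p {0..<?m} {0..<?m}" by simp
    then have p: "p permutes {0..<?m}" by (rule bij_imp_permutes) (simp add: p_def)
    let ?A = "mat n n (\<lambda>(r, c). z c (L (h r)))"
    let ?D = "mat n n (\<lambda>(r, c). z c (L (h' r)))"
    have hT: "h r \<in> T" if "r < n" for r using h that by (auto simp: bij_betw_def)
    have hT': "h' r \<in> {0..<?m} - T" if "r < n" for r using h' that by (auto simp: bij_betw_def)
    have "mat ?m ?m (\<lambda>(r, c). MT T $$ (p r, c)) = four_block_mat ?A (0\<^sub>m n n) (0\<^sub>m n n) ?D"
    proof (rule eq_matI)
      fix r c assume rc: "r < dim_row (four_block_mat ?A (0\<^sub>m n n) (0\<^sub>m n n) ?D)"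
        "c < dim_col (four_block_mat ?A (0\<^sub>m n n) (0\<^sub>m n n) ?D)"
      then have rc': "r < ?m" "c < ?m" by auto
      have pr: "p r < ?m" using permutes_in_image[OF p, of r] rc' by auto
      show "mat ?m ?m (\<lambda>(r, c). MT T $$ (p r, c)) $$ (r, c) = four_block_mat ?A (0\<^sub>m n n) (0\<^sub>m n n) ?D $$ (r, c)"
      proof (cases "r < n")
        case True
        then have "p r \<in> T" "p r = h r" using hT by (auto simp: p_def)
        moreover from this have "h r \<le> n + i" using Tm(4) by auto
        ultimately show ?thesis using True rc' pr by (auto simp: MT_def x_def)
      next
        case False
        then have "p r \<notin> T" "p r = h' (r - n)" using hT'[of "r - n"] rc' by (auto simp: p_def)
        moreover from this have "i \<le> h' (r - n)" using Tm(3) by (metis atLeastLessThan_iff le0 not_le subsetD)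
        ultimately show ?thesis using False rc' pr by (auto simp: MT_def y_def)
      qed
    qed auto
    then have "signof p * Determinant.det (MT T) = Determinant.det (four_block_mat ?A (0\<^sub>m n n) (0\<^sub>m n n) ?D)"
      using det_permute_rows[OF MTc[of T] p] by (simp only:)
    also have "\<dots> = Determinant.det ?A * Determinant.det ?D"
      by (rule det_four_block_mat_upper_right_zero) auto
    finally have "signof p * Determinant.det (MT T) = Determinant.det ?A * Determinant.det ?D" .
    then have "Determinant.det (MT T) = signof p * (maxdet n z (\<lambda>r. L (h r)) * maxdet n z (\<lambda>r. L (h' r)))"
      unfolding maxdet_def by (rule signof_mult_eqD)
    with h h' sign_cases[of p, where 'r = 'r] show ?thesis
      by (intro exI[of _ "signof p"] exI[of _ h] exI[of _ h'] conjI)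
  qed
  have "\<forall>T. \<exists>e h h'. T \<in> \<T> \<longrightarrow> ((e = 1 \<or> e = (-1::'r)) \<and> bij_betw h {0..<n} T \<and> bij_betw h' {0..<n} ({0..<?m} - T) \<and>
      Determinant.det (MT T) = e * (maxdet n z (\<lambda>r. L (h r)) * maxdet n z (\<lambda>r. L (h' r))))"
    by (intro allI, subst ex_simps, subst ex_simps, subst ex_simps) (use ex in blast)
  then obtain \<epsilon> h h' where eh: "\<And>T. T \<in> \<T> \<Longrightarrow> (\<epsilon> T = 1 \<or> \<epsilon> T = (-1::'r)) \<and> bij_betw (h T) {0..<n} T \<and>
      bij_betw (h' T) {0..<n} ({0..<?m} - T) \<and>
      Determinant.det (MT T) = \<epsilon> T * (maxdet n z (\<lambda>r. L (h T r)) * maxdet n z (\<lambda>r. L (h' T r)))"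
    unfolding choice_iff by blast
  have "0 = (\<Sum>T\<in>Pow {0..<?m}. Determinant.det (MT T))"
    using detM det_rows_add[of ?m x y] by (simp add: M_def MT_def)
  also have "\<dots> = (\<Sum>T\<in>\<T>. Determinant.det (MT T))"
    using MT0 by (intro sum.mono_neutral_right) (auto simp: \<T>_def)
  also have "\<dots> = (\<Sum>T\<in>\<T>. \<epsilon> T * (maxdet n z (\<lambda>r. L (h T r)) * maxdet n z (\<lambda>r. L (h' T r))))"
    using eh by (intro sum.cong) auto
  finally show ?thesis using that[of \<epsilon> h h'] eh by auto
qed

section \<open>Straightening with integer coefficients\<close>

inductive_set zspan :: "'r::ring_1 set \<Rightarrow> 'r set" for G where
  zero: "0 \<in> zspan G"
| add: "g \<in> G \<Longrightarrow> a \<in> zspan G \<Longrightarrow> a + g \<in> zspan G"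
| sub: "g \<in> G \<Longrightarrow> a \<in> zspan G \<Longrightarrow> a - g \<in> zspan G"

lemma zspan_gen: "g \<in> G \<Longrightarrow> g \<in> zspan G"
  using zspan.add[OF _ zspan.zero, of g G] by simp

lemma zspan_plus:
  assumes "a \<in> zspan G" "b \<in> zspan G"
  shows "a + b \<in> zspan G"
  using assms(2)
proof induction
  case (add g b)
  then show ?case using zspan.add[of g G "a + b"] by (simp add: add.assoc)
next
  case (sub g b)
  then show ?case using zspan.sub[of g G "a + b"] by (simp add: add_diff_eq)
qed (simp add: assms(1))

lemma zspan_uminus: "a \<in> zspan G \<Longrightarrow> - a \<in> zspan G"
proof (induction a rule: zspan.induct)
  case (add g a)
  then show ?case using zspan.sub[of g G "- a"] by simp
next
  case (sub g a)
  then show ?case using zspan.add[of g G "- a"] by simp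
qed (simp add: zspan.zero)

lemma zspan_sum: "(\<And>i. i \<in> A \<Longrightarrow> f i \<in> zspan G) \<Longrightarrow> sum f A \<in> zspan G"
  by (induction A rule: infinite_finite_induct) (auto intro: zspan.zero zspan_plus)

lemma zspan_bind:
  assumes "a \<in> zspan G" "\<And>g. g \<in> G \<Longrightarrow> u * g * v \<in> zspan H"
  shows "u * a * v \<in> zspan H"
  using assms(1)
proof induction
  case (add g a)
  then show ?case using zspan_plus[OF add.IH assms(2)[OF add.hyps(1)]] by (simp add: distrib_left distrib_right)
next
  case (sub g a)
  then show ?case using zspan_plus[OF sub.IH zspan_uminus[OF assms(2)[OF sub.hyps(1)]]]
    by (simp add: left_diff_distrib right_diff_distrib)
qed (simp add: zspan.zero)

definition n_sets :: "nat set \<Rightarrow> nat \<Rightarrow> nat set set" where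
  "n_sets W n = {C. C \<subseteq> W \<and> finite C \<and> card C = n}"

definition set_le :: "nat \<Rightarrow> nat set \<Rightarrow> nat set \<Rightarrow> bool" where
  "set_le n A B \<longleftrightarrow> (\<forall>j<n. sorted_list_of_set A ! j \<le> sorted_list_of_set B ! j)"

text \<open>Passing from \<open>{0..<n}\<close> to \<open>T\<close> trades values that are at least
  \<open>\<alpha>\<close> for equally many that are at most \<open>\<beta>\<close>.\<close>

lemma sum_split_shuffle:
  fixes L :: "nat \<Rightarrow> nat"
  assumes T: "T \<subseteq> {0..n + i}" "card T = n" "{0..<i} \<subseteq> T" "T \<noteq> {0..<n}"
    and hi: "\<And>r. i \<le> r \<Longrightarrow> r < n \<Longrightarrow> \<alpha> \<le> L r" and lo: "\<And>r. n \<le> r \<Longrightarrow> r \<le> n + i \<Longrightarrow> L r \<le> \<beta>"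
    and "\<beta> < \<alpha>"
  shows "sum L T < sum L {0..<n}"
proof -
  let ?T0 = "{0..<n}"
  have fin: "finite T" using T(1) finite_subset by auto
  have "card (T - ?T0) = card T - card (T \<inter> ?T0)" "card (?T0 - T) = card ?T0 - card (?T0 \<inter> T)"
    using fin by (auto simp: card_Diff_subset_Int)
  then have ceq: "card (T - ?T0) = card (?T0 - T)" using T(2) by (simp add: Int_commute)
  have "T - ?T0 \<noteq> {}"
    using T(2,4) card_subset_eq[of ?T0 T] by auto
  then have d: "0 < card (T - ?T0)" using fin by (simp add: card_gt_0_iff)
  have "L r \<le> \<beta>" if "r \<in> T - ?T0" for r
    using that T(1) by (intro lo) auto
  then have "sum L (T - ?T0) \<le> card (T - ?T0) * \<beta>"
    using sum_bounded_above[of "T - ?T0" L \<beta>] by simp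
  also have "\<dots> < card (?T0 - T) * \<alpha>" using d ceq assms(7) by simp
  also have "\<dots> \<le> sum L (?T0 - T)"
  proof -
    have "\<alpha> \<le> L r" if "r \<in> ?T0 - T" for r
      using that T(3) by (intro hi) (auto simp: not_less[symmetric])
    then show ?thesis using sum_bounded_below[of "?T0 - T" \<alpha> L] by simp
  qed
  finally have "sum L (T - ?T0) < sum L (?T0 - T)" .
  moreover have "sum L T = sum L (T \<inter> ?T0) + sum L (T - ?T0)" "sum L ?T0 = sum L (?T0 \<inter> T) + sum L (?T0 - T)"
    using fin by (simp_all add: sum.Int_Diff)
  ultimately show ?thesis by (simp add: Int_commute)
qed

text \<open>At a violation in place \<open>i\<close>, the \<open>n + 1\<close> shuffled entries are
  those of \<open>A\<close> from place \<open>i\<close> on and those of \<open>B\<close> up to place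
  \<open>i\<close>; all of the latter are smaller than all of the former. In every other nonzero
  term of the shuffle relation the first factor therefore has a smaller sum.\<close>

lemma pair_straighten:
  fixes z :: "nat \<Rightarrow> nat \<Rightarrow> 'r::idom"
  assumes A: "A \<in> n_sets W n" and B: "B \<in> n_sets W n" and nle: "\<not> set_le n A B"
  shows "setdet n z A * setdet n z B \<in> zspan {setdet n z C * setdet n z D |C D.
     C \<in> n_sets W n \<and> D \<in> n_sets W n \<and> \<Sum>C < \<Sum>A \<and> \<Sum>C + \<Sum>D = \<Sum>A + \<Sum>B}"
    (is "_ \<in> zspan ?G")
proof -
  let ?a = "\<lambda>r. sorted_list_of_set A ! r" and ?b = "\<lambda>r. sorted_list_of_set B ! r"
  have fA: "finite A" "card A = n" "A \<subseteq> W" and fB: "finite B" "card B = n" "B \<subseteq> W"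
    using A B by (auto simp: n_sets_def)
  obtain i where i: "i < n" "?b i < ?a i" using nle by (auto simp: set_le_def not_le)
  have am: "?a r \<le> ?a s" and bm: "?b r \<le> ?b s" if "r \<le> s" "s < n" for r s
    using that fA fB by (auto intro!: sorted_nth_mono)
  have abij: "bij_betw ?a {0..<n} A" and bbij: "bij_betw ?b {0..<n} B"
    using fA fB by (simp_all add: nth_sorted_list_bij)
  define L where "L r = (if r < n then ?a r else ?b (r - n))" for r
  let ?T0 = "{0..<n}"
  define \<T> where "\<T> = {T \<in> Pow {0..<2 * n}. card T = n \<and> {0..<i} \<subseteq> T \<and> T \<subseteq> {0..n + i}}"
  obtain \<epsilon> h h' where e: "\<And>T. T \<in> \<T> \<Longrightarrow> \<epsilon> T = 1 \<or> \<epsilon> T = (-1::'r)"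
    and h: "\<And>T. T \<in> \<T> \<Longrightarrow> bij_betw (h T) {0..<n} T"
    and h': "\<And>T. T \<in> \<T> \<Longrightarrow> bij_betw (h' T) {0..<n} ({0..<2 * n} - T)"
    and rel: "(\<Sum>T\<in>\<T>. \<epsilon> T * (maxdet n z (\<lambda>r. L (h T r)) * maxdet n z (\<lambda>r. L (h' T r)))) = 0"
    using shuffle_relation[OF i(1) \<T>_def, of z L] by blast
  let ?t = "\<lambda>T. maxdet n z (\<lambda>r. L (h T r)) * maxdet n z (\<lambda>r. L (h' T r))"
  have fin: "finite \<T>" by (simp add: \<T>_def)
  have T0: "?T0 \<in> \<T>" using i(1) by (auto simp: \<T>_def)
  have shift: "bij_betw (\<lambda>r. r - n) {n..<2 * n} {0..<n}"
    by (rule bij_betwI[of _ _ _ "\<lambda>r. r + n"]) auto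
  have LA: "bij_betw L {0..<n} A"
    using abij by (rule bij_betw_cong[THEN iffD1, rotated]) (simp add: L_def)
  have LB: "bij_betw L {n..<2 * n} B"
    using bij_betw_trans[OF shift bbij] by (rule bij_betw_cong[THEN iffD1, rotated]) (auto simp: L_def)
  have LW: "L r \<in> W" if "r < 2 * n" for r
    using LA LB fA(3) fB(3) that unfolding bij_betw_def by (cases "r < n") auto
  have sumL: "sum L {0..<n} = \<Sum>A" "sum L {n..<2 * n} = \<Sum>B"
    using sum.reindex_bij_betw[OF LA, of "\<lambda>x. x"] sum.reindex_bij_betw[OF LB, of "\<lambda>x. x"] by simp_all
  have pm: "maxdet n z (\<lambda>r. L (k r)) = setdet n z (L ` T) \<or> maxdet n z (\<lambda>r. L (k r)) = - setdet n z (L ` T)"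
    if "bij_betw k {0..<n} T" "inj_on L T" for k T
  proof -
    have "inj_on (L \<circ> k) {0..<n}" using that by (auto simp: bij_betw_def intro: comp_inj_on)
    moreover have "(L \<circ> k) ` {0..<n} = L ` T" using that(1) by (auto simp: bij_betw_def)
    ultimately show ?thesis using maxdet_image[of "L \<circ> k" n z] by (simp add: o_def)
  qed
  have other: "?t T \<in> zspan ?G" if T: "T \<in> \<T> - {?T0}" for T
  proof (cases "inj_on L T \<and> inj_on L ({0..<2 * n} - T)")
    case False
    have "\<not> inj_on (\<lambda>r. L (h T r)) {0..<n} \<or> \<not> inj_on (\<lambda>r. L (h' T r)) {0..<n}"
    proof (rule ccontr)
      assume "\<not> ?thesis"
      then have "inj_on (L \<circ> h T) {0..<n}" "inj_on (L \<circ> h' T) {0..<n}" by (auto simp: o_def)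
      then show False
        using False h[of T] h'[of T] T inj_on_imageI2 by (metis DiffD1 bij_betw_def inj_on_imageI)
    qed
    then have "maxdet n z (\<lambda>r. L (h T r)) = 0 \<or> maxdet n z (\<lambda>r. L (h' T r)) = 0"
      using maxdet_not_inj by blast
    then show ?thesis by (elim disjE) (simp_all add: zspan.zero)
  next
    case True
    have TT: "T \<subseteq> {0..<2 * n}" "card T = n" "{0..<i} \<subseteq> T" "T \<subseteq> {0..n + i}" "T \<noteq> ?T0"
      using T by (auto simp: \<T>_def)
    have finT: "finite T" using TT(1) finite_subset by auto
    let ?T' = "{0..<2 * n} - T"
    have card': "card ?T' = n" using TT finT by (simp add: card_Diff_subset)
    have mem: "L ` T \<in> n_sets W n" "L ` ?T' \<in> n_sets W n"
      using True TT(1,2) card' finT LW by (auto simp: n_sets_def card_image)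
    have sums: "\<Sum>(L ` T) = sum L T" "\<Sum>(L ` ?T') = sum L ?T'"
      using True by (simp_all add: sum.reindex)
    have "sum L T < sum L {0..<n}"
    proof (rule sum_split_shuffle[OF TT(4,2,3,5), of "?a i" L "?b i"])
      show "?a i \<le> L r" if "i \<le> r" "r < n" for r using am[of i r] that by (simp add: L_def)
      show "L r \<le> ?b i" if "n \<le> r" "r \<le> n + i" for r using bm[of "r - n" i] that i by (simp add: L_def)
    qed (rule i(2))
    moreover have "sum L T + sum L ?T' = sum L {0..<2 * n}"
      using TT(1) by (simp add: sum.subset_diff[of T])
    moreover have "sum L {0..<2 * n} = sum L {0..<n} + sum L {n..<2 * n}"
      by (simp add: sum.atLeastLessThan_concat)
    ultimately have "setdet n z (L ` T) * setdet n z (L ` ?T') \<in> ?G"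
      using mem sums sumL by (intro CollectI exI[of _ "L ` T"] exI[of _ "L ` ?T'"] conjI) auto
    then have "setdet n z (L ` T) * setdet n z (L ` ?T') \<in> zspan ?G" by (rule zspan_gen)
    moreover have "?t T = setdet n z (L ` T) * setdet n z (L ` ?T') \<or> ?t T = - (setdet n z (L ` T) * setdet n z (L ` ?T'))"
      using pm[OF h[of T]] pm[OF h'[of T]] T True by auto
    ultimately show ?thesis using zspan_uminus by auto
  qed
  have "\<epsilon> ?T0 * ?t ?T0 = - (\<Sum>T\<in>\<T> - {?T0}. \<epsilon> T * ?t T)"
    using rel sum.remove[OF fin T0, of "\<lambda>T. \<epsilon> T * ?t T"] by (simp add: eq_neg_iff_add_eq_0)
  moreover have "(\<Sum>T\<in>\<T> - {?T0}. \<epsilon> T * ?t T) \<in> zspan ?G"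
  proof (rule zspan_sum)
    fix T assume T: "T \<in> \<T> - {?T0}"
    then show "\<epsilon> T * ?t T \<in> zspan ?G" using other[OF T] e[of T] zspan_uminus[of "?t T"] by auto
  qed
  ultimately have "\<epsilon> ?T0 * ?t ?T0 \<in> zspan ?G" using zspan_uminus by simp
  then have t0: "?t ?T0 \<in> zspan ?G" using e[OF T0] zspan_uminus[of "- ?t ?T0"] by auto
  have "{0..<2 * n} - ?T0 = {n..<2 * n}" by auto
  then have "?t ?T0 = setdet n z A * setdet n z B \<or> ?t ?T0 = - (setdet n z A * setdet n z B)"
    using pm[OF h[OF T0]] pm[OF h'[OF T0]] LA LB by (auto simp: bij_betw_def)
  then show ?thesis using t0 zspan_uminus[of "?t ?T0"] by auto
qed

definition std_list :: "nat set \<Rightarrow> nat \<Rightarrow> nat set list \<Rightarrow> bool" where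
  "std_list W n Cs \<longleftrightarrow> set Cs \<subseteq> n_sets W n \<and> sorted_wrt (set_le n) Cs"

text \<open>The termination measure of \<open>straighten\<close>: positions further left weigh more,
  so it drops when weight passes from a factor to its right neighbour.\<close>

fun content :: "nat set list \<Rightarrow> nat" where
  "content [] = 0"
| "content (C # Cs) = Suc (length Cs) * \<Sum>C + content Cs"

lemma content_decreases:
  assumes "\<Sum>C < \<Sum>A" "\<Sum>C + \<Sum>D = \<Sum>A + \<Sum>B"
  shows "content (xs @ C # D # ys) < content (xs @ A # B # ys)"
proof (induction xs)
  case Nil
  have "Suc (length ys) * (\<Sum>C + \<Sum>D) + \<Sum>C < Suc (length ys) * (\<Sum>A + \<Sum>B) + \<Sum>A"
    using assms by simp
  then show ?case by (simp add: algebra_simps)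
qed simp

lemma not_sorted_adjacent:
  assumes "\<not> sorted_wrt P xs" "transp P"
  obtains us a b vs where "xs = us @ a # b # vs" "\<not> P a b"
proof -
  obtain i where i: "Suc i < length xs" "\<not> P (xs ! i) (xs ! Suc i)"
    using assms sorted_wrt_iff_nth_Suc_transp[OF assms(2), of xs] by auto
  then have "xs = take i xs @ xs ! i # xs ! Suc i # drop (Suc (Suc i)) xs"
    by (metis Cons_nth_drop_Suc Suc_lessD append_take_drop_id)
  then show ?thesis using that i by blast
qed

theorem straighten:
  fixes z :: "nat \<Rightarrow> nat \<Rightarrow> 'r::idom"
  assumes "set Cs \<subseteq> n_sets W n"
  shows "prod_list (map (setdet n z) Cs) \<in>
    zspan {prod_list (map (setdet n z) Ds) |Ds. length Ds = length Cs \<and> std_list W n Ds}"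
  using assms
proof (induction "content Cs" arbitrary: Cs rule: less_induct)
  case less
  let ?v = "\<lambda>Cs. prod_list (map (setdet n z) Cs)"
  let ?H = "{?v Ds |Ds. length Ds = length Cs \<and> std_list W n Ds}"
  show ?case
  proof (cases "sorted_wrt (set_le n) Cs")
    case True
    then show ?thesis using less.prems by (intro zspan_gen) (auto simp: std_list_def)
  next
    case False
    have "transp (set_le n)" by (auto simp: transp_def set_le_def intro: order_trans)
    then obtain us A B vs where Cs: "Cs = us @ A # B # vs" "\<not> set_le n A B"
      using not_sorted_adjacent[OF False] by blast
    have AB: "A \<in> n_sets W n" "B \<in> n_sets W n" using less.prems Cs by auto
    have "?v us * (setdet n z A * setdet n z B) * ?v vs \<in> zspan ?H"
    proof (rule zspan_bind[OF pair_straighten[OF AB Cs(2)]])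
      fix g assume "g \<in> {setdet n z C * setdet n z D |C D.
         C \<in> n_sets W n \<and> D \<in> n_sets W n \<and> \<Sum>C < \<Sum>A \<and> \<Sum>C + \<Sum>D = \<Sum>A + \<Sum>B}"
      then obtain C D where CD: "g = setdet n z C * setdet n z D" "C \<in> n_sets W n" "D \<in> n_sets W n"
        "\<Sum>C < \<Sum>A" "\<Sum>C + \<Sum>D = \<Sum>A + \<Sum>B" by blast
      have "?v (us @ C # D # vs) \<in> zspan {?v Ds |Ds. length Ds = length (us @ C # D # vs) \<and> std_list W n Ds}"
        using less.prems CD Cs content_decreases[OF CD(4,5)] by (intro less.hyps) auto
      then show "?v us * g * ?v vs \<in> zspan ?H" by (simp add: CD(1) Cs(1) mult.assoc)
    qed
    then show ?thesis by (simp add: Cs(1) mult.assoc)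
  qed
qed

section \<open>Standard products of minors and their weights\<close>

lemma sum_ge_card:
  fixes A :: "nat set"
  assumes "finite A" "0 \<notin> A"
  shows "(\<Sum>r<card A. Suc r) \<le> \<Sum>A"
  using assms
proof (induction A rule: finite_linorder_max_induct)
  case (insert b A)
  have "A \<subseteq> {1..<b}" using insert.hyps insert.prems by (auto simp: Suc_le_eq intro!: Nat.gr0I)
  then have "card A \<le> card {1..<b}" by (intro card_mono) auto
  moreover have "0 < b" using insert.prems by auto
  ultimately have "Suc (card A) \<le> b" by auto
  then show ?case using insert by (auto simp: card_insert_if)
qed simp

lemma sum_injective_ge:
  fixes \<kappa> :: "nat \<Rightarrow> nat"
  assumes "inj_on \<kappa> {..<s}" "\<And>r. r < s \<Longrightarrow> 0 < \<kappa> r"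
  shows "(\<Sum>r<s. Suc r) \<le> (\<Sum>r<s. \<kappa> r)"
proof -
  have "(\<Sum>r<card (\<kappa> ` {..<s}). Suc r) \<le> \<Sum>(\<kappa> ` {..<s})"
    using assms(2) by (intro sum_ge_card) fastforce+
  then show ?thesis using assms(1) by (simp add: card_image sum.reindex)
qed

text \<open>Subtracting the last weight \<open>u s\<close> from all others splits the sum into a
  shorter instance and \<open>u s\<close> times the sum of all \<open>\<kappa> r\<close>, which is
  least when the values are \<open>1\<close> to \<open>Suc s\<close>. Equality must then hold in
  both parts.\<close>

lemma rearrangement_decreasing:
  fixes u \<kappa> :: "nat \<Rightarrow> nat"
  assumes "inj_on \<kappa> {..<s}" "\<And>r. r < s \<Longrightarrow> 0 < \<kappa> r"
    and "\<And>r r'. r < r' \<Longrightarrow> r' < s \<Longrightarrow> u r' < u r" "\<And>r. r < s \<Longrightarrow> 0 < u r"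
  shows "(\<Sum>r<s. u r * Suc r) \<le> (\<Sum>r<s. u r * \<kappa> r) \<and>
    ((\<Sum>r<s. u r * \<kappa> r) = (\<Sum>r<s. u r * Suc r) \<longrightarrow> (\<forall>r<s. \<kappa> r = Suc r))"
  using assms
proof (induction s arbitrary: u)
  case (Suc s)
  define v where "v r = u r - u s" for r
  have split: "(\<Sum>r<Suc s. u r * f r) = (\<Sum>r<s. v r * f r) + u s * (\<Sum>r<Suc s. f r)" for f :: "nat \<Rightarrow> nat"
  proof -
    have "u r = v r + u s" if "r < s" for r using Suc.prems(3)[of r s] that by (simp add: v_def)
    then have "(\<Sum>r<s. u r * f r) = (\<Sum>r<s. v r * f r + u s * f r)"
      by (intro sum.cong) (simp_all add: add_mult_distrib)
    then show ?thesis by (simp add: sum.distrib sum_distrib_left distrib_left)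
  qed
  have IH: "(\<Sum>r<s. v r * Suc r) \<le> (\<Sum>r<s. v r * \<kappa> r) \<and>
    ((\<Sum>r<s. v r * \<kappa> r) = (\<Sum>r<s. v r * Suc r) \<longrightarrow> (\<forall>r<s. \<kappa> r = Suc r))"
  proof (rule Suc.IH)
    show "inj_on \<kappa> {..<s}" using Suc.prems(1) by (rule inj_on_subset) auto
    show "0 < \<kappa> r" if "r < s" for r using Suc.prems(2) that by simp
    show "v r' < v r" if "r < r'" "r' < s" for r r'
      using Suc.prems(3)[of r r'] Suc.prems(3)[of r' s] that by (simp add: v_def)
    show "0 < v r" if "r < s" for r using Suc.prems(3)[of r s] that by (simp add: v_def)
  qed
  have S: "(\<Sum>r<Suc s. Suc r) \<le> (\<Sum>r<Suc s. \<kappa> r)"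
    using Suc.prems(1,2) by (rule sum_injective_ge)
  have us: "0 < u s" using Suc.prems(4) by simp
  have mono: "u s * (\<Sum>r<Suc s. Suc r) \<le> u s * (\<Sum>r<Suc s. \<kappa> r)" using S by (rule mult_le_mono2)
  show ?case
  proof (intro conjI impI)
    show "(\<Sum>r<Suc s. u r * Suc r) \<le> (\<Sum>r<Suc s. u r * \<kappa> r)"
      unfolding split using IH mono by linarith
    assume "(\<Sum>r<Suc s. u r * \<kappa> r) = (\<Sum>r<Suc s. u r * Suc r)"
    then have "(\<Sum>r<s. v r * \<kappa> r) = (\<Sum>r<s. v r * Suc r)"
      "u s * (\<Sum>r<Suc s. \<kappa> r) = u s * (\<Sum>r<Suc s. Suc r)"
      unfolding split using IH mono by linarith+
    then have "\<forall>r<s. \<kappa> r = Suc r" "(\<Sum>r<Suc s. \<kappa> r) = (\<Sum>r<Suc s. Suc r)"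
      using IH us by (blast, simp only: mult_cancel1, simp)
    moreover from this(1) have "(\<Sum>r<s. \<kappa> r) = (\<Sum>r<s. Suc r)" by (intro sum.cong) auto
    ultimately show "\<forall>r<Suc s. \<kappa> r = Suc r" by (auto simp: less_Suc_eq)
  qed
qed simp

text \<open>Smaller row and column indices weigh more per unit of inner index, so the weight of a
  minor is least when inner indices increase along with rows and columns. \<open>N\<close> has to
  exceed all row and column indices.\<close>

definition uweight :: "nat \<Rightarrow> uvar \<Rightarrow> nat" where
  "uweight N v = (case v of Orig p \<Rightarrow> 0 | Lft x c \<Rightarrow> (N - x) * c | Rgt c y \<Rightarrow> (N - y) * c)"

lemma uweight_simps [simp]:
  "uweight N (Orig p) = 0" "uweight N (Lft x c) = (N - x) * c" "uweight N (Rgt c y) = (N - y) * c"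
  by (simp_all add: uweight_def)

text \<open>The order is reversed: the leading monomial is the one of least weight.\<close>

interpretation wt: monom_order UNIV "\<lambda>a b. lin (uweight N) b < lin (uweight N) a" for N
  by unfold_locales auto

text \<open>The term of least weight of the factorized minor. Summed over the factors of a product,
  it records how often each row or column index stands in place \<open>t\<close>.\<close>

definition minor_label :: "minor \<Rightarrow> (uvar \<Rightarrow>\<^sub>0 nat)" where
  "minor_label \<pi> = (\<Sum>t<length (fst \<pi>). Poly_Mapping.single (Lft (fst \<pi> ! t) (Suc t)) 1) +
     (\<Sum>t<length (snd \<pi>). Poly_Mapping.single (Rgt (Suc t) (snd \<pi> ! t)) 1)"

text \<open>Cauchy-Binet before the inner indices are sorted: a repeated inner index yields two
  equal rows on the right and contributes nothing.\<close>

lemma det_factor_expand: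
  fixes f :: "nat \<Rightarrow> nat \<Rightarrow> 'r::comm_ring_1"
  assumes "finite C"
  shows "Determinant.det (mat n n (\<lambda>(p, q). \<Sum>c\<in>C. f p c * g c q)) =
    (\<Sum>\<kappa>\<in>{\<kappa>\<in>PiE {0..<n} (\<lambda>_. C). inj_on \<kappa> {0..<n}}.
       \<Sum>p | p permutes {0..<n}. signof p * (\<Prod>i = 0..<n. f i (\<kappa> i) * g (\<kappa> i) (p i)))"
proof -
  have c: "mat n n h \<in> carrier_mat n n" for h :: "nat \<times> nat \<Rightarrow> 'r" by simp
  have "Determinant.det (mat n n (\<lambda>(p, q). \<Sum>c\<in>C. f p c * g c q)) =
      (\<Sum>p | p permutes {0..<n}. signof p * (\<Prod>i = 0..<n. \<Sum>c\<in>C. f i c * g c (p i)))"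
    unfolding det_def'[OF c]
    by (intro sum.cong arg_cong2[of _ _ _ _ "(*)"] prod.cong refl) (auto dest: permutes_in_image)
  also have "\<dots> = (\<Sum>p | p permutes {0..<n}. \<Sum>\<kappa>\<in>PiE {0..<n} (\<lambda>_. C).
      signof p * (\<Prod>i = 0..<n. f i (\<kappa> i) * g (\<kappa> i) (p i)))"
    using assms by (simp add: prod_sum_PiE sum_distrib_left)
  also have "\<dots> = (\<Sum>\<kappa>\<in>PiE {0..<n} (\<lambda>_. C). \<Sum>p | p permutes {0..<n}.
      signof p * (\<Prod>i = 0..<n. f i (\<kappa> i) * g (\<kappa> i) (p i)))"
    by (rule sum.swap)
  also have "\<dots> = (\<Sum>\<kappa>\<in>{\<kappa>\<in>PiE {0..<n} (\<lambda>_. C). inj_on \<kappa> {0..<n}}. \<Sum>p | p permutes {0..<n}.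
      signof p * (\<Prod>i = 0..<n. f i (\<kappa> i) * g (\<kappa> i) (p i)))"
  proof (rule sum.mono_neutral_right)
    show "finite (PiE {0..<n} (\<lambda>_. C))" using assms by (intro finite_PiE) auto
    show "\<forall>\<kappa>\<in>PiE {0..<n} (\<lambda>_. C) - {\<kappa>\<in>PiE {0..<n} (\<lambda>_. C). inj_on \<kappa> {0..<n}}.
      (\<Sum>p | p permutes {0..<n}. signof p * (\<Prod>i = 0..<n. f i (\<kappa> i) * g (\<kappa> i) (p i))) = 0"
    proof
      fix \<kappa> assume "\<kappa> \<in> PiE {0..<n} (\<lambda>_. C) - {\<kappa>\<in>PiE {0..<n} (\<lambda>_. C). inj_on \<kappa> {0..<n}}"
      then obtain i j where ij: "i < n" "j < n" "i \<noteq> j" "\<kappa> i = \<kappa> j" by (auto simp: inj_on_def)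
      have "Determinant.det (mat n n (\<lambda>(i, q). g (\<kappa> i) q)) = 0"
        by (rule det_identical_rows[of _ n i j]) (use ij in \<open>auto intro!: eq_vecI\<close>)
      then have "(\<Sum>p | p permutes {0..<n}. signof p * (\<Prod>i = 0..<n. g (\<kappa> i) (p i))) = 0"
        unfolding det_def'[OF c]
        by (rule trans[rotated]) (intro sum.cong arg_cong2[of _ _ _ _ "(*)"] prod.cong refl,
            auto dest: permutes_in_image)
      moreover have "(\<Sum>p | p permutes {0..<n}. signof p * (\<Prod>i = 0..<n. f i (\<kappa> i) * g (\<kappa> i) (p i))) =
          (\<Prod>i = 0..<n. f i (\<kappa> i)) * (\<Sum>p | p permutes {0..<n}. signof p * (\<Prod>i = 0..<n. g (\<kappa> i) (p i)))"
        by (simp add: prod.distrib sum_distrib_left mult.left_commute)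
      ultimately show "(\<Sum>p | p permutes {0..<n}. signof p * (\<Prod>i = 0..<n. f i (\<kappa> i) * g (\<kappa> i) (p i))) = 0"
        by simp
    qed
  qed auto
  finally show ?thesis .
qed

definition colored_label :: "nat list \<Rightarrow> nat list \<Rightarrow> (nat \<Rightarrow> nat) \<Rightarrow> (nat \<Rightarrow> nat) \<Rightarrow> (uvar \<Rightarrow>\<^sub>0 nat)" where
  "colored_label is js \<kappa> p = (\<Sum>t<length is. Poly_Mapping.single (Lft (is ! t) (\<kappa> t)) 1) +
     (\<Sum>t<length is. Poly_Mapping.single (Rgt (\<kappa> t) (js ! p t)) 1)"

lemma subst_fac_minor_poly:
  assumes len: "length is = length js" and B: "set is \<times> set js \<subseteq> B"
  shows "subst (fac B K) (minor_poly (is, js) :: 'a::field mpoly) =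
    (\<Sum>\<kappa>\<in>{\<kappa>\<in>PiE {0..<length is} (\<lambda>_. {1..K}). inj_on \<kappa> {0..<length is}}.
       \<Sum>p | p permutes {0..<length is}. Poly_Mapping.single (colored_label is js \<kappa> p) (signof p))"
proof -
  let ?n = "length is"
  let ?L = "\<lambda>p c. mono_of (Poly_Mapping.single (Lft (is ! p) c) 1) :: 'a upoly"
  let ?R = "\<lambda>c q. mono_of (Poly_Mapping.single (Rgt c (js ! q)) 1) :: 'a upoly"
  have "fac B K (is ! p, js ! q) = (\<Sum>c\<in>{1..K}. ?L p c * ?R c q)" if "p < ?n" "q < ?n" for p q
  proof -
    have "(is ! p, js ! q) \<in> B" using that len B by auto
    then show ?thesis by (simp add: fac_def colors_def term_monom_def mult_single)
  qed
  then have "subst (fac B K) (minor_poly (is, js) :: 'a mpoly) =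
      Determinant.det (mat ?n ?n (\<lambda>(p, q). \<Sum>c\<in>{1..K}. ?L p c * ?R c q))"
    unfolding subst_minor_poly[OF len] by (intro arg_cong[of _ _ Determinant.det] cong_mat) auto
  also have "\<dots> = (\<Sum>\<kappa>\<in>{\<kappa>\<in>PiE {0..<?n} (\<lambda>_. {1..K}). inj_on \<kappa> {0..<?n}}.
       \<Sum>p | p permutes {0..<?n}. signof p * (\<Prod>i = 0..<?n. ?L i (\<kappa> i) * ?R (\<kappa> i) (p i)))"
    by (rule det_factor_expand) simp
  also have "\<dots> = (\<Sum>\<kappa>\<in>{\<kappa>\<in>PiE {0..<?n} (\<lambda>_. {1..K}). inj_on \<kappa> {0..<?n}}.
       \<Sum>p | p permutes {0..<?n}. Poly_Mapping.single (colored_label is js \<kappa> p) (signof p))"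
  proof (intro sum.cong refl)
    fix \<kappa> p
    have "(\<Prod>i = 0..<?n. ?L i (\<kappa> i) * ?R (\<kappa> i) (p i)) = mono_of (colored_label is js \<kappa> p)"
      unfolding colored_label_def by (simp add: mult_single prod_single sum.distrib atLeast0LessThan)
    moreover have "(signof p :: 'a upoly) * mono_of m = Poly_Mapping.single m (signof p)" for m
      by (cases "sign p = 1") (simp_all add: sign_def single_uminus)
    ultimately show "signof p * (\<Prod>i = 0..<?n. ?L i (\<kappa> i) * ?R (\<kappa> i) (p i)) =
      Poly_Mapping.single (colored_label is js \<kappa> p) (signof p)" by simp
  qed
  finally show ?thesis .
qed

text \<open>The weight has a row part and a column part, and \<open>rearrangement_decreasing\<close>
  applies to each; for the columns \<open>\<kappa>\<close> is composed with the inverse of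
  \<open>p\<close>. Equality in both makes this inverse, hence \<open>p\<close>, the
  identity.\<close>

lemma colored_label_weight:
  assumes len: "length is = length js" and sorted: "sorted_wrt (<) is" "sorted_wrt (<) js"
    and N: "\<And>x. x \<in> set is \<union> set js \<Longrightarrow> x < N"
    and \<kappa>: "inj_on \<kappa> {0..<length is}" "\<And>r. r < length is \<Longrightarrow> 0 < \<kappa> r" and p: "p permutes {0..<length is}"
  shows "lin (uweight N) (minor_label (is, js)) < lin (uweight N) (colored_label is js \<kappa> p) \<or>
    ((\<forall>r<length is. \<kappa> r = Suc r) \<and> p = id)"
proof -
  let ?n = "length is"
  define q where "q = inv_into UNIV p"
  have q: "q permutes {0..<?n}" using p by (simp add: q_def permutes_inv)
  have qb: "bij_betw q {..<?n} {..<?n}" using permutes_imp_bij[OF q] by (simp add: atLeast0LessThan)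
  have \<kappa>': "inj_on \<kappa> {..<?n}" using \<kappa>(1) by (simp add: atLeast0LessThan)
  have w1: "lin (uweight N) (colored_label is js \<kappa> p) =
      (\<Sum>t<?n. (N - is ! t) * \<kappa> t) + (\<Sum>t<?n. (N - js ! t) * \<kappa> (q t))"
  proof -
    have "(\<Sum>t<?n. (N - js ! t) * \<kappa> (q t)) = (\<Sum>t<?n. (N - js ! p t) * \<kappa> t)"
      using permutes_imp_bij[OF p] permutes_inverses(2)[OF p]
      by (subst sum.reindex_bij_betw[of p "{..<?n}" "{..<?n}", symmetric]) (simp_all add: atLeast0LessThan q_def)
    then show ?thesis by (simp add: colored_label_def lin_sum)
  qed
  have w0: "lin (uweight N) (minor_label (is, js)) =
      (\<Sum>t<?n. (N - is ! t) * Suc t) + (\<Sum>t<?n. (N - js ! t) * Suc t)"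
    using len by (simp add: minor_label_def lin_sum)
  have R1: "(\<Sum>r<?n. (N - is ! r) * Suc r) \<le> (\<Sum>r<?n. (N - is ! r) * \<kappa> r) \<and>
    ((\<Sum>r<?n. (N - is ! r) * \<kappa> r) = (\<Sum>r<?n. (N - is ! r) * Suc r) \<longrightarrow> (\<forall>r<?n. \<kappa> r = Suc r))"
  proof (rule rearrangement_decreasing[OF \<kappa>' \<kappa>(2)])
    show "N - is ! r' < N - is ! r" if "r < r'" "r' < ?n" for r r'
      using sorted_wrt_nth_less[OF sorted(1) that] N[of "is ! r'"] nth_mem[OF that(2)] by auto
    show "0 < N - is ! r" if "r < ?n" for r using N nth_mem[OF that] by auto
  qed
  have R2: "(\<Sum>r<?n. (N - js ! r) * Suc r) \<le> (\<Sum>r<?n. (N - js ! r) * \<kappa> (q r)) \<and>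
    ((\<Sum>r<?n. (N - js ! r) * \<kappa> (q r)) = (\<Sum>r<?n. (N - js ! r) * Suc r) \<longrightarrow> (\<forall>r<?n. \<kappa> (q r) = Suc r))"
  proof (rule rearrangement_decreasing)
    show "inj_on (\<lambda>r. \<kappa> (q r)) {..<?n}"
      using comp_inj_on[of q "{..<?n}" \<kappa>] qb \<kappa>' by (simp add: bij_betw_def comp_def)
    show "0 < \<kappa> (q r)" if "r < ?n" for r using \<kappa>(2)[of "q r"] permutes_in_image[OF q, of r] that by auto
    show "N - js ! r' < N - js ! r" if "r < r'" "r' < ?n" for r r'
      using sorted_wrt_nth_less[OF sorted(2) that(1)] N[of "js ! r'"] nth_mem[of r' js] len that by auto
    show "0 < N - js ! r" if "r < ?n" for r using N nth_mem[of r js] len that by auto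
  qed
  show ?thesis
  proof (cases "lin (uweight N) (minor_label (is, js)) < lin (uweight N) (colored_label is js \<kappa> p)")
    case False
    then have "(\<Sum>r<?n. (N - is ! r) * \<kappa> r) = (\<Sum>r<?n. (N - is ! r) * Suc r)"
      "(\<Sum>r<?n. (N - js ! r) * \<kappa> (q r)) = (\<Sum>r<?n. (N - js ! r) * Suc r)"
      unfolding w0 w1 using R1 R2 by linarith+
    then have eq: "\<forall>r<?n. \<kappa> r = Suc r" "\<forall>r<?n. \<kappa> (q r) = Suc r" using R1 R2 by auto
    have "q r = r" for r
    proof (cases "r < ?n")
      case True
      then have "q r < ?n" using permutes_in_image[OF q, of r] by auto
      then show ?thesis using eq True by auto
    qed (use permutes_not_in[OF q, of r] in auto)
    then have "q = id" by auto
    then have "p = id" using permutes_inv_inv[OF p] inv_id by (metis q_def)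
    then show ?thesis using eq by simp
  qed simp
qed

text \<open>Just one term of the expansion has least weight, and its coefficient is 1, so the result
  holds in every characteristic.\<close>

lemma lead_subst_minor:
  assumes len: "length is = length js" and B: "set is \<times> set js \<subseteq> B"
    and sorted: "sorted_wrt (<) is" "sorted_wrt (<) js"
    and N: "\<And>x. x \<in> set is \<union> set js \<Longrightarrow> x < N" and K: "length is \<le> K"
  shows "wt.lead_at N (subst (fac B K) (minor_poly (is, js) :: 'a::field mpoly)) (minor_label (is, js))"
proof -
  let ?n = "length is"
  let ?I = "{\<kappa>\<in>PiE {0..<?n} (\<lambda>_. {1..K}). inj_on \<kappa> {0..<?n}}"
  let ?P = "{p. p permutes {0..<?n}}"
  let ?q = "subst (fac B K) (minor_poly (is, js) :: 'a mpoly)"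
  define \<kappa>0 where "\<kappa>0 = restrict Suc {0..<?n}"
  have \<kappa>0: "\<kappa>0 \<in> ?I" using K by (auto simp: \<kappa>0_def inj_on_def)
  have label: "minor_label (is, js) = colored_label is js \<kappa>0 id"
    using len by (simp add: minor_label_def colored_label_def \<kappa>0_def)
  have other: "lin (uweight N) (minor_label (is, js)) < lin (uweight N) (colored_label is js \<kappa> p)"
    if "\<kappa> \<in> ?I" "p \<in> ?P" "(\<kappa>, p) \<noteq> (\<kappa>0, id)" for \<kappa> p
  proof -
    have "\<kappa> = \<kappa>0" if "\<forall>r<?n. \<kappa> r = Suc r"
    proof
      fix r show "\<kappa> r = \<kappa>0 r" using \<open>\<kappa> \<in> ?I\<close> that by (cases "r < ?n") (auto simp: \<kappa>0_def PiE_def extensional_def)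
    qed
    moreover have "0 < \<kappa> r" if "r < ?n" for r using \<open>\<kappa> \<in> ?I\<close> that by (force simp: PiE_iff)
    ultimately show ?thesis
      using colored_label_weight[OF len sorted N, of \<kappa> p] that by auto
  qed
  have eq: "?q = (\<Sum>(\<kappa>, p)\<in>?I \<times> ?P. Poly_Mapping.single (colored_label is js \<kappa> p) (signof p))"
    unfolding subst_fac_minor_poly[OF len B] by (simp add: sum.cartesian_product)
  have fin: "finite (?I \<times> ?P)" using finite_permutations[of "{0..<?n}"] finite_PiE[of "{0..<?n}" "\<lambda>_. {1..K}"] by auto
  have "coef ?q (minor_label (is, js)) =
      (\<Sum>(\<kappa>, p)\<in>?I \<times> ?P. (signof p when colored_label is js \<kappa> p = minor_label (is, js)))"
    unfolding eq by (simp add: lookup_sum lookup_single split_def)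
  also have "\<dots> = (\<Sum>(\<kappa>, p)\<in>{(\<kappa>0, id)}. (signof p when colored_label is js \<kappa> p = minor_label (is, js)))"
  proof (rule sum.mono_neutral_right[OF fin])
    show "{(\<kappa>0, id)} \<subseteq> ?I \<times> ?P" using \<kappa>0 permutes_id by auto
    show "\<forall>i\<in>?I \<times> ?P - {(\<kappa>0, id)}. (case i of (\<kappa>, p) \<Rightarrow> (signof p :: 'a) when colored_label is js \<kappa> p = minor_label (is, js)) = 0"
    proof
      fix i assume "i \<in> ?I \<times> ?P - {(\<kappa>0, id)}"
      then obtain \<kappa> p where i: "i = (\<kappa>, p)" "\<kappa> \<in> ?I" "p \<in> ?P" "(\<kappa>, p) \<noteq> (\<kappa>0, id)" by blast
      have "colored_label is js \<kappa> p \<noteq> minor_label (is, js)" using other[OF i(2-4)] by auto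
      then show "(case i of (\<kappa>, p) \<Rightarrow> (signof p :: 'a) when colored_label is js \<kappa> p = minor_label (is, js)) = 0"
        by (simp add: i(1))
    qed
  qed
  also have "\<dots> = 1" by (simp add: label)
  finally have c: "coef ?q (minor_label (is, js)) = 1" .
  show ?thesis
    unfolding wt.lead_at_def
  proof (intro conjI ballI impI)
    show "minor_label (is, js) \<in> mkeys ?q" using c by (simp add: in_keys_iff)
    fix M assume M: "M \<in> mkeys ?q" "M \<noteq> minor_label (is, js)"
    have "M \<in> (\<Union>i\<in>?I \<times> ?P. mkeys (case i of (\<kappa>, p) \<Rightarrow> Poly_Mapping.single (colored_label is js \<kappa> p) (signof p :: 'a)))"
      using M(1) unfolding eq by (rule subsetD[OF keys_sum_subset])
    then obtain i where i: "i \<in> ?I \<times> ?P" "M \<in> mkeys (case i of (\<kappa>, p) \<Rightarrow> Poly_Mapping.single (colored_label is js \<kappa> p) (signof p :: 'a))"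
      by (rule UN_E)
    obtain \<kappa> p where kp: "i = (\<kappa>, p)" by (cases i)
    then have Me: "M = colored_label is js \<kappa> p" using i(2) by (auto split: if_splits)
    then have "(\<kappa>, p) \<noteq> (\<kappa>0, id)" using M(2) label by auto
    then show "lin (uweight N) (minor_label (is, js)) < lin (uweight N) M"
      unfolding Me using i(1) kp by (intro other) auto
  qed
qed

section \<open>Recovering a standard product from its label\<close>

lemma antitone_eq_of_card_eq:
  fixes f g :: "nat \<Rightarrow> bool"
  assumes f: "\<And>i j. i \<le> j \<Longrightarrow> j < m \<Longrightarrow> f j \<Longrightarrow> f i" and g: "\<And>i j. i \<le> j \<Longrightarrow> j < m \<Longrightarrow> g j \<Longrightarrow> g i"
    and eq: "(\<Sum>j<m. of_bool (f j) :: nat) = (\<Sum>j<m. of_bool (g j))" and j: "j < m"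
  shows "f j = g j"
proof -
  define F where "F = {j. j < m \<and> f j}"
  define G where "G = {j. j < m \<and> g j}"
  have "card F = card G"
    using eq by (simp add: F_def G_def of_bool_def sum.If_cases Int_def)
  moreover have "F \<subseteq> G \<or> G \<subseteq> F"
  proof (rule ccontr)
    assume "\<not> (F \<subseteq> G \<or> G \<subseteq> F)"
    then obtain a b where "a < m" "f a" "\<not> g a" "b < m" "g b" "\<not> f b" by (auto simp: F_def G_def)
    then show False using f[of a b] f[of b a] g[of a b] g[of b a] by (cases "a \<le> b") auto
  qed
  moreover have "finite F" "finite G" by (simp_all add: F_def G_def)
  ultimately have "F = G" by (metis card_subset_eq)
  then show ?thesis using j by (auto simp: F_def G_def)
qed

text \<open>A missing entry counts as infinite; with this convention \<open>minor_le\<close> becomes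
  an entrywise comparison.\<close>

definition entry_le :: "nat list \<Rightarrow> nat \<Rightarrow> nat \<Rightarrow> bool" where
  "entry_le xs t x \<longleftrightarrow> t < length xs \<and> xs ! t \<le> x"

lemma entry_le_inject:
  assumes "\<And>t x. entry_le xs t x = entry_le ys t x"
  shows "xs = ys"
proof (rule nth_equalityI)
  have "t < length xs \<longleftrightarrow> t < length ys" for t
    using assms[of t "xs ! t"] assms[of t "ys ! t"] by (auto simp: entry_le_def)
  then show len: "length xs = length ys" by (metis linorder_neqE_nat less_irrefl)
  show "xs ! t = ys ! t" if "t < length xs" for t
    using assms[of t "xs ! t"] assms[of t "ys ! t"] that len by (auto simp: entry_le_def)
qed

lemma entry_le_card:
  assumes "sorted_wrt (<) xs"
  shows "entry_le xs t x \<longleftrightarrow> t < card {e \<in> set xs. e \<le> x}"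
  using assms
proof (induction xs arbitrary: t)
  case (Cons a xs)
  show ?case
  proof (cases "a \<le> x")
    case True
    then have "{e \<in> set (a # xs). e \<le> x} = insert a {e \<in> set xs. e \<le> x}" by auto
    moreover have "a \<notin> {e \<in> set xs. e \<le> x}" using Cons.prems by auto
    ultimately have "card {e \<in> set (a # xs). e \<le> x} = Suc (card {e \<in> set xs. e \<le> x})" by simp
    then show ?thesis using Cons True by (cases t) (auto simp: entry_le_def)
  next
    case False
    then have empty: "{e \<in> set (a # xs). e \<le> x} = {}" using Cons.prems by force
    have "\<not> (a # xs) ! t \<le> x" if "t < length (a # xs)"
      using False Cons.prems nth_mem[OF that] by force
    then show ?thesis unfolding empty by (auto simp: entry_le_def)
  qed
qed (simp add: entry_le_def)

lemma minor_le_iff_entry_le: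
  assumes "length (fst \<pi>) = length (snd \<pi>)" "length (fst \<delta>) = length (snd \<delta>)"
  shows "minor_le \<pi> \<delta> \<longleftrightarrow> (\<forall>t x. (entry_le (fst \<delta>) t x \<longrightarrow> entry_le (fst \<pi>) t x) \<and>
    (entry_le (snd \<delta>) t x \<longrightarrow> entry_le (snd \<pi>) t x))" (is "_ \<longleftrightarrow> ?R")
proof
  assume ?R
  then have R: "entry_le (fst \<pi>) t (fst \<delta> ! t)" "entry_le (snd \<pi>) t (snd \<delta> ! t)"
    if "t < length (fst \<delta>)" for t using that assms(2) by (auto simp: entry_le_def)
  have "length (fst \<delta>) \<le> length (fst \<pi>)"
    using R(1)[of "length (fst \<delta>) - 1"] by (cases "length (fst \<delta>)") (auto simp: entry_le_def)
  then show "minor_le \<pi> \<delta>" using R by (auto simp: minor_le_def entry_le_def)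
qed (use assms in \<open>fastforce simp: minor_le_def entry_le_def\<close>)

lemma coef_minor_label:
  "coef (minor_label \<pi>) (Lft x (Suc t)) = of_bool (t < length (fst \<pi>) \<and> fst \<pi> ! t = x)"
  "coef (minor_label \<pi>) (Rgt (Suc t) x) = of_bool (t < length (snd \<pi>) \<and> snd \<pi> ! t = x)"
proof -
  have *: "(\<Sum>s<n. if s = t \<and> a s = x then Suc 0 else 0) = of_bool (t < n \<and> a t = x)" for a :: "nat \<Rightarrow> nat" and n
    by (induction n) (auto simp: less_Suc_eq)
  show "coef (minor_label \<pi>) (Lft x (Suc t)) = of_bool (t < length (fst \<pi>) \<and> fst \<pi> ! t = x)"
    "coef (minor_label \<pi>) (Rgt (Suc t) x) = of_bool (t < length (snd \<pi>) \<and> snd \<pi> ! t = x)"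
    by (simp_all add: minor_label_def lookup_add lookup_sum lookup_single when_def * conj_commute)
qed

lemma coef_minor_label_Orig: "coef (minor_label \<pi>) (Orig p) = 0"
  by (simp add: minor_label_def lookup_add lookup_sum lookup_single)

lemma sum_coef_minor_label:
  "(\<Sum>x\<le>y. coef (minor_label \<pi>) (Lft x (Suc t))) = of_bool (entry_le (fst \<pi>) t y)"
  "(\<Sum>x\<le>y. coef (minor_label \<pi>) (Rgt (Suc t) x)) = of_bool (entry_le (snd \<pi>) t y)"
  unfolding coef_minor_label by (induction y) (auto simp: entry_le_def le_Suc_eq)

text \<open>For all \<open>t\<close> and \<open>y\<close> the labels count the factors whose entry
  in place \<open>t\<close> is at most \<open>y\<close>. In a standard product these factors form an
  initial segment, so their number determines them and the entries can be read off.\<close>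

lemma labels_determine_standard_product:
  fixes \<pi>s \<rho>s :: "minor list"
  assumes len: "length \<pi>s = length \<rho>s"
    and sq: "\<And>\<pi>. \<pi> \<in> set \<pi>s \<union> set \<rho>s \<Longrightarrow> length (fst \<pi>) = length (snd \<pi>)"
    and std: "sorted_wrt minor_le \<pi>s" "sorted_wrt minor_le \<rho>s"
    and eq: "\<And>v. (\<forall>p. v \<noteq> Orig p) \<Longrightarrow>
      (\<Sum>j<length \<pi>s. coef (minor_label (\<pi>s ! j)) v) = (\<Sum>j<length \<pi>s. coef (minor_label (\<rho>s ! j)) v)"
  shows "\<pi>s = \<rho>s"
proof (rule nth_equalityI[OF len])
  fix j assume j: "j < length \<pi>s"
  let ?m = "length \<pi>s"
  have mono: "entry_le (sel (\<sigma>s ! i)) t x"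
    if "sorted_wrt minor_le \<sigma>s" "\<And>\<pi>. \<pi> \<in> set \<sigma>s \<Longrightarrow> length (fst \<pi>) = length (snd \<pi>)"
      "i \<le> j'" "j' < length \<sigma>s" "entry_le (sel (\<sigma>s ! j')) t x" "sel = fst \<or> sel = snd"
    for \<sigma>s :: "minor list" and i j' t x and sel :: "minor \<Rightarrow> nat list"
  proof (cases "i = j'")
    case False
    then have "minor_le (\<sigma>s ! i) (\<sigma>s ! j')"
      using sorted_wrt_nth_less[OF that(1), of i j'] that(3,4) by simp
    moreover have "\<sigma>s ! i \<in> set \<sigma>s" "\<sigma>s ! j' \<in> set \<sigma>s" using that by auto
    ultimately show ?thesis
      using that(2,5,6) minor_le_iff_entry_le[of "\<sigma>s ! i" "\<sigma>s ! j'"] by auto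
  qed (use that in simp)
  have main: "entry_le (sel (\<pi>s ! j)) t y = entry_le (sel (\<rho>s ! j)) t y"
    if sel: "sel = fst \<or> sel = snd" for sel t y
  proof (rule antitone_eq_of_card_eq[of ?m "\<lambda>j. entry_le (sel (\<pi>s ! j)) t y" "\<lambda>j. entry_le (sel (\<rho>s ! j)) t y"])
    show "entry_le (sel (\<pi>s ! i)) t y" if "i \<le> i'" "i' < ?m" "entry_le (sel (\<pi>s ! i')) t y" for i i'
      by (rule mono[OF std(1) _ that(1,2,3) sel]) (use sq in auto)
    show "entry_le (sel (\<rho>s ! i)) t y" if "i \<le> i'" "i' < ?m" "entry_le (sel (\<rho>s ! i')) t y" for i i'
      by (rule mono[OF std(2) _ that(1) _ that(3) sel]) (use sq that len in auto)
    define V where "V x = (if sel = fst then Lft x (Suc t) else Rgt (Suc t) x)" for x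
    have s: "(\<Sum>x\<le>y. coef (minor_label \<pi>) (V x)) = of_bool (entry_le (sel \<pi>) t y)" for \<pi>
    proof (cases "sel = fst")
      case False
      then have "sel = snd" using sel by simp
      then show ?thesis using False by (simp only: V_def if_False sum_coef_minor_label)
    qed (simp only: V_def simp_thms if_True sum_coef_minor_label)
    have "(\<Sum>j<?m. of_bool (entry_le (sel (\<pi>s ! j)) t y) :: nat) = (\<Sum>x\<le>y. \<Sum>j<?m. coef (minor_label (\<pi>s ! j)) (V x))"
      unfolding s[symmetric] by (rule sum.swap)
    also have "\<dots> = (\<Sum>x\<le>y. \<Sum>j<?m. coef (minor_label (\<rho>s ! j)) (V x))"
      by (intro sum.cong refl eq) (simp add: V_def)
    also have "\<dots> = (\<Sum>j<?m. of_bool (entry_le (sel (\<rho>s ! j)) t y))"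
      unfolding s[symmetric] by (rule sum.swap)
    finally show "(\<Sum>j<?m. of_bool (entry_le (sel (\<pi>s ! j)) t y) :: nat) = (\<Sum>j<?m. of_bool (entry_le (sel (\<rho>s ! j)) t y))" .
  qed (rule j)
  show "\<pi>s ! j = \<rho>s ! j"
    using entry_le_inject[OF main[of fst]] entry_le_inject[OF main[of snd]] by (simp add: prod_eq_iff)
qed

subsection \<open>Minors of a box as maximal minors of an extended matrix\<close>

text \<open>
  An \<open>n \<times> w\<close> matrix is extended by the antidiagonal unit matrix in the columns
  \<open>w + 1, \<dots>, w + n\<close>; the unit vector in column \<open>n + 1 + w - i\<close> has its entry \<open>1\<close> in row \<open>i\<close>.
\<close>

definition ext_entry :: "nat \<Rightarrow> nat \<Rightarrow> nat \<Rightarrow> nat \<Rightarrow> 'a::field mpoly" where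
  "ext_entry n w c y = (if y \<le> w then indet (Suc c) y else if Suc c = n + 1 + w - y then 1 else 0)"

text \<open>Expanding the \<open>n\<close>-minor of the extended matrix on the columns
  \<open>S\<close> along its unit columns deletes one row for each of them; up to sign this minor is
  left. For \<open>S = {w + 1..w + n}\<close> it is the empty one, with value 1.\<close>

definition set_minor :: "nat \<Rightarrow> nat \<Rightarrow> nat set \<Rightarrow> minor" where
  "set_minor n w S = (filter (\<lambda>i. n + 1 + w - i \<notin> S) [1..<Suc n], filter (\<lambda>y. y \<in> S) [1..<Suc w])"

lemma set_minor_props:
  assumes S: "S \<in> n_sets {1..n + w} n"
  shows "length (fst (set_minor n w S)) = length (snd (set_minor n w S))"
    and "sorted_wrt (<) (fst (set_minor n w S))" "sorted_wrt (<) (snd (set_minor n w S))"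
    and "set (fst (set_minor n w S)) = {i \<in> {1..n}. n + 1 + w - i \<notin> S}"
    and "set (snd (set_minor n w S)) = {y \<in> {1..w}. y \<in> S}"
proof -
  let ?R = "{i \<in> {1..n}. n + 1 + w - i \<notin> S}" and ?C = "{y \<in> {1..w}. y \<in> S}"
  show sets: "set (fst (set_minor n w S)) = ?R" "set (snd (set_minor n w S)) = ?C"
    by (auto simp: set_minor_def simp del: upt_Suc)
  show sorted: "sorted_wrt (<) (fst (set_minor n w S))" "sorted_wrt (<) (snd (set_minor n w S))"
    by (simp_all add: set_minor_def sorted_wrt_filter del: upt_Suc)
  have fin: "finite S" and card: "card S = n" and sub: "S \<subseteq> {1..n + w}" using S by (auto simp: n_sets_def)
  have "bij_betw (\<lambda>i. n + 1 + w - i) {i \<in> {1..n}. n + 1 + w - i \<in> S} {y \<in> {w + 1..w + n}. y \<in> S}"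
    by (rule bij_betwI[of _ _ _ "\<lambda>i. n + 1 + w - i"]) auto
  then have "card {i \<in> {1..n}. n + 1 + w - i \<in> S} = card {y \<in> {w + 1..w + n}. y \<in> S}"
    by (rule bij_betw_same_card)
  moreover have "card ?R + card {i \<in> {1..n}. n + 1 + w - i \<in> S} = n"
  proof -
    have "?R \<union> {i \<in> {1..n}. n + 1 + w - i \<in> S} = {1..n}" "?R \<inter> {i \<in> {1..n}. n + 1 + w - i \<in> S} = {}" by auto
    then show ?thesis by (metis (no_types, lifting) card_Un_disjoint card_atLeastAtMost diff_Suc_1 finite_Un finite_atLeastAtMost)
  qed
  moreover have "card ?C + card {y \<in> {w + 1..w + n}. y \<in> S} = n"
  proof -
    have "?C \<union> {y \<in> {w + 1..w + n}. y \<in> S} = S" "?C \<inter> {y \<in> {w + 1..w + n}. y \<in> S} = {}" using sub by auto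
    then show ?thesis by (metis (no_types, lifting) card_Un_disjoint card fin finite_Un)
  qed
  ultimately have "card ?R = card ?C" by linarith
  then show "length (fst (set_minor n w S)) = length (snd (set_minor n w S))"
    using sorted distinct_card[of "fst (set_minor n w S)"] distinct_card[of "snd (set_minor n w S)"] sets
    by (simp add: strict_sorted_iff)
qed

lemma inj_on_set_minor: "inj_on (set_minor n w) (n_sets {1..n + w} n)"
proof (rule inj_onI)
  fix S S' assume S: "S \<in> n_sets {1..n + w} n" "S' \<in> n_sets {1..n + w} n" and eq: "set_minor n w S = set_minor n w S'"
  have C: "{y \<in> {1..w}. y \<in> S} = {y \<in> {1..w}. y \<in> S'}"
    and R: "{i \<in> {1..n}. n + 1 + w - i \<notin> S} = {i \<in> {1..n}. n + 1 + w - i \<notin> S'}"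
    using set_minor_props(4,5)[OF S(1)] set_minor_props(4,5)[OF S(2)] eq by auto
  have "y \<in> S \<longleftrightarrow> y \<in> S'" if "y \<in> {1..n + w}" for y
  proof (cases "y \<le> w")
    case True
    then show ?thesis using C that by auto
  next
    case False
    then have "n + 1 + w - y \<in> {1..n}" "n + 1 + w - (n + 1 + w - y) = y" using that by auto
    then show ?thesis using R by (metis (mono_tags, lifting) mem_Collect_eq)
  qed
  then show "S = S'" using S by (auto simp: n_sets_def)
qed

lemma set_le_card:
  assumes "S \<in> n_sets W n" "S' \<in> n_sets W n" "set_le n S S'"
  shows "card {e \<in> S'. e \<le> y} \<le> card {e \<in> S. e \<le> y}"
proof (cases "card {e \<in> S'. e \<le> y}")
  case (Suc t)
  have fin: "finite S" "finite S'" and len: "length (sorted_list_of_set S) = n" "length (sorted_list_of_set S') = n"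
    using assms by (auto simp: n_sets_def)
  have "entry_le (sorted_list_of_set S') t y"
    using entry_le_card[of "sorted_list_of_set S'" t y] fin Suc by simp
  then have "entry_le (sorted_list_of_set S) t y"
    using assms(3) len by (auto simp: entry_le_def set_le_def intro: order_trans)
  then show ?thesis
    using entry_le_card[of "sorted_list_of_set S" t y] fin Suc by simp
qed (metis le0)

text \<open>The antidiagonal arrangement of the unit columns makes this monotone: for
  \<open>z \<le> n\<close> the number of surviving rows up to \<open>z\<close> is
  \<open>z - n\<close> plus the number of elements of \<open>S\<close> up to
  \<open>n + w - z\<close>.\<close>

lemma set_minor_le:
  assumes S: "S \<in> n_sets {1..n + w} n" "S' \<in> n_sets {1..n + w} n" "set_le n S S'"
  shows "minor_le (set_minor n w S) (set_minor n w S')"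
proof -
  have cols: "card {e \<in> {y \<in> {1..w}. y \<in> S'}. e \<le> x} \<le> card {e \<in> {y \<in> {1..w}. y \<in> S}. e \<le> x}" for x
  proof -
    have "{e \<in> {y \<in> {1..w}. y \<in> T}. e \<le> x} = {e \<in> T. e \<le> min x w}" if "T \<in> n_sets {1..n + w} n" for T
      using that by (auto simp: n_sets_def)
    then show ?thesis using set_le_card[OF S, of "min x w"] S by simp
  qed
  have rows: "card {e \<in> {i \<in> {1..n}. n + 1 + w - i \<notin> S'}. e \<le> x} \<le> card {e \<in> {i \<in> {1..n}. n + 1 + w - i \<notin> S}. e \<le> x}" for x
  proof -
    have c: "card {e \<in> {i \<in> {1..n}. n + 1 + w - i \<notin> T}. e \<le> x} + n = min x n + card {e \<in> T. e \<le> n + w - min x n}"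
      if T: "T \<in> n_sets {1..n + w} n" for T
    proof -
      define z where "z = min x n"
      have zx: "i \<le> z \<longleftrightarrow> i \<le> x \<and> i \<le> n" for i by (simp add: z_def)
      have fin: "finite T" and card: "card T = n" and sub: "T \<subseteq> {1..n + w}" using T by (auto simp: n_sets_def)
      have zn: "z \<le> n" by (simp add: z_def)
      have bound: "y \<le> n + w" if "y \<in> T" for y using sub that by auto
      have "bij_betw (\<lambda>i. n + 1 + w - i) {i \<in> {1..z}. n + 1 + w - i \<in> T} {y \<in> T. \<not> y \<le> n + w - z}"
      proof (rule bij_betwI[of _ _ _ "\<lambda>i. n + 1 + w - i"])
        show "(\<lambda>i. n + 1 + w - i) \<in> {y \<in> T. \<not> y \<le> n + w - z} \<rightarrow> {i \<in> {1..z}. n + 1 + w - i \<in> T}"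
        proof (rule funcsetI)
          fix y assume y: "y \<in> {y \<in> T. \<not> y \<le> n + w - z}"
          then have "y \<in> T" "y \<le> n + w" "n + w - z < y" using bound by auto
          moreover from this have "n + 1 + w - (n + 1 + w - y) = y" "1 \<le> n + 1 + w - y" "n + 1 + w - y \<le> z"
            using zn by linarith+
          ultimately show "n + 1 + w - y \<in> {i \<in> {1..z}. n + 1 + w - i \<in> T}" by simp
        qed
      qed (use zn in \<open>auto simp: Suc_diff_le bound\<close>)
      then have "card {i \<in> {1..z}. n + 1 + w - i \<in> T} = card {y \<in> T. \<not> y \<le> n + w - z}"
        by (rule bij_betw_same_card)
      moreover have "card {y \<in> T. y \<le> n + w - z} + card {y \<in> T. \<not> y \<le> n + w - z} = n"
      proof -
        have "card T = card ({y \<in> T. y \<le> n + w - z} \<union> {y \<in> T. \<not> y \<le> n + w - z})"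
          by (rule arg_cong[of _ _ card]) auto
        also have "\<dots> = card {y \<in> T. y \<le> n + w - z} + card {y \<in> T. \<not> y \<le> n + w - z}"
          using fin by (intro card_Un_disjoint) auto
        finally show ?thesis using card by simp
      qed
      moreover have "card {e \<in> {i \<in> {1..n}. n + 1 + w - i \<notin> T}. e \<le> x} + card {i \<in> {1..z}. n + 1 + w - i \<in> T} = z"
      proof -
        have "card {1..z} = card ({e \<in> {i \<in> {1..n}. n + 1 + w - i \<notin> T}. e \<le> x} \<union> {i \<in> {1..z}. n + 1 + w - i \<in> T})"
          by (rule arg_cong[of _ _ card]) (auto simp: zx)
        also have "\<dots> = card {e \<in> {i \<in> {1..n}. n + 1 + w - i \<notin> T}. e \<le> x} + card {i \<in> {1..z}. n + 1 + w - i \<in> T}"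
          by (intro card_Un_disjoint) auto
        finally show ?thesis by simp
      qed
      ultimately show ?thesis unfolding z_def[symmetric] by linarith
    qed
    show ?thesis using c[OF S(1)] c[OF S(2)] set_le_card[OF S, of "n + w - min x n"] by linarith
  qed
  show ?thesis
    using set_minor_props[OF S(1)] set_minor_props[OF S(2)] rows cols
    by (subst minor_le_iff_entry_le) (auto simp: entry_le_card intro: less_le_trans)
qed

lemma setdet_ext_entry:
  assumes S: "S \<in> n_sets {1..n + w} n"
  obtains e where "e = 1 \<or> e = (-1 :: 'a::field mpoly)" "setdet n (ext_entry n w) S = e * minor_poly (set_minor n w S)"
proof -
  let ?rs = "fst (set_minor n w S)" and ?cs = "snd (set_minor n w S)"
  let ?s = "length ?rs"
  have fin: "finite S" and card: "card S = n" and sub: "S \<subseteq> {1..n + w}" using S by (auto simp: n_sets_def)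
  define us where "us = sorted_list_of_set (S \<inter> {w + 1..})"
  define xs where "xs = sorted_list_of_set S"
  note P = set_minor_props[OF S]
  have us: "set us = S \<inter> {w + 1..}" "distinct us" "sorted_wrt (<) us" using fin by (simp_all add: us_def)
  have xs: "xs = ?cs @ us"
  proof -
    have "sorted_wrt (<) (?cs @ us)" using P(3,5) us by (auto simp: sorted_wrt_append)
    moreover have "set (?cs @ us) = S" using P(5) us(1) sub by auto
    ultimately show ?thesis unfolding xs_def
      by (metis sorted_list_of_set.idem_if_sorted_distinct strict_sorted_iff)
  qed
  have lenxs: "length xs = n" using card by (simp add: xs_def)
  have len: "length us + ?s = n" using lenxs P(1) by (simp add: xs)
  define L where "L = map (\<lambda>i. i - 1) ?rs @ map (\<lambda>y. n + w - y) us"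
  define p where "p c = (if c < n then L ! c else c)" for c
  have lenL: "length L = n" using len by (simp add: L_def)
  have usb: "w < y \<and> y \<le> n + w" if "y \<in> set us" for y using that us(1) sub by auto
  have "distinct L"
  proof -
    have "inj_on (\<lambda>i. i - 1) (set ?rs)" using P(4) by (auto simp: inj_on_def)
    moreover have "inj_on (\<lambda>y. n + w - y) (set us)" 
    proof (rule inj_onI)
      fix a b assume "a \<in> set us" "b \<in> set us" "n + w - a = n + w - b"
      then show "a = b" using usb[of a] usb[of b] by linarith
    qed
    moreover have "(\<lambda>i. i - 1) ` set ?rs \<inter> (\<lambda>y. n + w - y) ` set us = {}"
    proof -
      have False if "i \<in> set ?rs" "y \<in> set us" "i - 1 = n + w - y" for i y
      proof -
        have "i \<in> {1..n}" "n + 1 + w - i \<notin> S" using that(1) P(4) by auto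
        moreover have "n + 1 + w - i = y" using that(3) usb[OF that(2)] \<open>i \<in> {1..n}\<close> by auto
        ultimately show False using that(2) us(1) by auto
      qed
      then show ?thesis by auto
    qed
    ultimately show ?thesis
      using P(2) us(2) by (auto simp: L_def distinct_map strict_sorted_iff)
  qed
  moreover have setL: "set L \<subseteq> {0..<n}" using P(4) usb by (fastforce simp: L_def)
  ultimately have "set L = {0..<n}"
    using lenL distinct_card[of L] by (intro card_subset_eq) auto
  then have "bij_betw p {0..<n} {0..<n}"
    using bij_betw_nth[OF \<open>distinct L\<close>, of "{0..<n}" "{0..<n}"] lenL
    by (subst bij_betw_cong[of _ p "\<lambda>c. L ! c"]) (auto simp: p_def atLeast0LessThan)
  then have p: "p permutes {0..<n}" by (rule bij_imp_permutes) (simp add: p_def)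
  let ?Z = "ext_entry n w :: nat \<Rightarrow> nat \<Rightarrow> 'a mpoly"
  let ?A = "mat n n (\<lambda>(r, c). ?Z c (xs ! r))"
  let ?T = "mat n n (\<lambda>(c, r). ?Z c (xs ! r))"
  let ?B = "mat (n - ?s) ?s (\<lambda>(i, j). ?Z (p (i + ?s)) (xs ! j))"
  have "?T = transpose_mat ?A" by (rule eq_matI) auto
  then have detT: "Determinant.det ?T = setdet n ?Z S"
    using det_transpose[of ?A n] by (simp add: setdet_def maxdet_def xs_def)
  have "mat n n (\<lambda>(i, j). ?T $$ (p i, j)) =
      four_block_mat (gen_mat ?rs ?cs) (0\<^sub>m ?s (n - ?s)) ?B (1\<^sub>m (n - ?s))" (is "?M = ?F")
  proof (rule eq_matI)
    show dims: "dim_row ?M = dim_row ?F" "dim_col ?M = dim_col ?F" using len P(1) by (auto simp: gen_mat_def)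
    fix i j assume ij: "i < dim_row ?F" "j < dim_col ?F"
    then have ijn: "i < n" "j < n" using dims by auto
    then have pi: "p i < n" using permutes_in_image[OF p, of i] by auto
    have e: "?M $$ (i, j) = ?Z (p i) (xs ! j)" using ijn pi by simp
    have csj: "xs ! j = ?cs ! j" "xs ! j \<le> w" if "j < ?s"
      using that P(1,5) nth_mem[of j ?cs] by (auto simp: xs nth_append)
    have usj: "xs ! j = us ! (j - ?s)" "w < xs ! j" "xs ! j \<le> n + w" "xs ! j \<in> set us" if "\<not> j < ?s"
    proof -
      have "j - ?s < length us" using that ijn len by auto
      moreover have x: "xs ! j = us ! (j - ?s)" using that P(1) by (simp add: xs nth_append)
      ultimately have u: "xs ! j \<in> set us" by simp
      show "xs ! j = us ! (j - ?s)" "w < xs ! j" "xs ! j \<le> n + w" "xs ! j \<in> set us"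
        using x u usb[OF u] by simp_all
    qed
    have pr: "Suc (p i) = ?rs ! i" "?rs ! i \<in> set ?rs" if "i < ?s"
      using that ijn P(4) nth_mem[OF that] by (auto simp: p_def L_def nth_append)
    have pu: "p i = n + w - us ! (i - ?s)" "us ! (i - ?s) \<in> set us" if "\<not> i < ?s"
    proof -
      have "i - ?s < length us" using that ijn len by auto
      then show "p i = n + w - us ! (i - ?s)" "us ! (i - ?s) \<in> set us"
        using that ijn by (auto simp: p_def L_def nth_append)
    qed
    show "?M $$ (i, j) = ?F $$ (i, j)"
    proof (cases "i < ?s"; cases "j < ?s")
      assume a: "i < ?s" "j < ?s"
      then show ?thesis unfolding e using csj[OF a(2)] pr[OF a(1)] ijn P(1) len
        by (simp add: ext_entry_def gen_mat_def)
    next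
      assume a: "i < ?s" "\<not> j < ?s"
      have "?rs ! i \<noteq> n + 1 + w - xs ! j"
      proof
        assume h: "?rs ! i = n + 1 + w - xs ! j"
        then have "n + 1 + w - ?rs ! i = xs ! j" using usj[OF a(2)] by auto
        moreover have "n + 1 + w - ?rs ! i \<notin> S" using pr(2)[OF a(1)] P(4) by auto
        ultimately show False using usj(4)[OF a(2)] us(1) by auto
      qed
      then show ?thesis unfolding e using usj[OF a(2)] pr[OF a(1)] ijn a P(1) len
        by (simp add: ext_entry_def gen_mat_def)
    next
      assume a: "\<not> i < ?s" "j < ?s"
      then show ?thesis unfolding e using ijn P(1) len by (simp add: gen_mat_def)
    next
      assume a: "\<not> i < ?s" "\<not> j < ?s"
      have "Suc (p i) = n + 1 + w - xs ! j \<longleftrightarrow> us ! (i - ?s) = us ! (j - ?s)"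
        unfolding pu(1)[OF a(1)] usj(1)[OF a(2)]
        using usj[OF a(2)] usb[OF pu(2)[OF a(1)]] by linarith
      also have "\<dots> \<longleftrightarrow> i = j"
      proof -
        have "i - ?s < length us" "j - ?s < length us" using a ijn len by auto
        then show ?thesis using nth_eq_iff_index_eq[OF us(2)] a by auto
      qed
      finally show ?thesis unfolding e using usj[OF a(2)] ijn a P(1) len
        by (simp add: ext_entry_def gen_mat_def) arith
    qed
  qed
  then have "signof p * Determinant.det ?T = Determinant.det (four_block_mat (gen_mat ?rs ?cs) (0\<^sub>m ?s (n - ?s)) ?B (1\<^sub>m (n - ?s)))"
    using det_permute_rows[of ?T n p, OF _ p] by simp
  also have "\<dots> = Determinant.det (gen_mat ?rs ?cs) * Determinant.det (1\<^sub>m (n - ?s))"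
    using P(1) by (intro det_four_block_mat_upper_right_zero) (auto simp: gen_mat_def)
  finally have "signof p * setdet n ?Z S = minor_poly (set_minor n w S)"
    by (simp add: detT minor_poly_def)
  then have "setdet n ?Z S = signof p * minor_poly (set_minor n w S)" by (rule signof_mult_eqD)
  then show ?thesis using that[of "signof p"] sign_cases[of p, where 'r = "'a mpoly"] by auto
qed

subsection \<open>Expansion in standard products\<close>

text \<open>Linear combinations with constant coefficients, over a commutative ring so that the
  echelon forms over the integers are covered as well.\<close>

inductive_set kspan :: "('m::comm_monoid_add \<Rightarrow>\<^sub>0 'c::comm_ring_1) set \<Rightarrow> ('m \<Rightarrow>\<^sub>0 'c) set" for G where
  zero: "0 \<in> kspan G"
| step: "g \<in> G \<Longrightarrow> a \<in> kspan G \<Longrightarrow> Poly_Mapping.single 0 c * g + a \<in> kspan G"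

lemma kspan_gen: "g \<in> G \<Longrightarrow> g \<in> kspan G"
  using kspan.step[OF _ kspan.zero, of g G 1] by simp

lemma kspan_add: "a \<in> kspan G \<Longrightarrow> b \<in> kspan G \<Longrightarrow> a + b \<in> kspan G"
  by (induction rule: kspan.induct) (auto intro: kspan.intros simp: add.assoc)

lemma kspan_scale: "a \<in> kspan G \<Longrightarrow> Poly_Mapping.single 0 c * a \<in> kspan G"
proof (induction rule: kspan.induct)
  case (step g a d)
  then show ?case using kspan.step[of g G _ "c * d"] by (simp add: distrib_left single_0_mult mult.assoc)
qed (simp add: kspan.zero)

lemma kspan_uminus: "a \<in> kspan G \<Longrightarrow> - a \<in> kspan G"
  using kspan_scale[of a G "-1"] by (simp add: single_uminus)

lemma kspan_sum: "(\<And>i. i \<in> A \<Longrightarrow> f i \<in> kspan G) \<Longrightarrow> sum f A \<in> kspan G"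
  by (induction A rule: infinite_finite_induct) (auto intro: kspan.zero kspan_add)

lemma zspan_mult_kspan:
  assumes "a \<in> zspan G" "\<And>g. g \<in> G \<Longrightarrow> u * g \<in> kspan H"
  shows "u * a \<in> kspan H"
  using assms(1)
proof induction
  case (add g a)
  then show ?case using kspan_add[OF add.IH assms(2)[OF add.hyps(1)]] by (simp add: distrib_left)
next
  case (sub g a)
  then show ?case using kspan_add[OF sub.IH kspan_uminus[OF assms(2)[OF sub.hyps(1)]]]
    by (simp add: right_diff_distrib)
qed (simp add: kspan.zero)

lemma kspan_image_sum:
  assumes "a \<in> kspan (T ` Q0)"
  obtains Q \<alpha> where "finite Q" "Q \<subseteq> Q0" "a = (\<Sum>q\<in>Q. Poly_Mapping.single 0 (\<alpha> q) * T q)"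
proof -
  have "\<exists>Q \<alpha>. finite Q \<and> Q \<subseteq> Q0 \<and> a = (\<Sum>q\<in>Q. Poly_Mapping.single 0 (\<alpha> q) * T q)"
    using assms
  proof induction
    case zero
    then show ?case by (intro exI[of _ "{}"]) auto
  next
    case (step g a c)
    then obtain Q \<alpha> q where h: "finite Q" "Q \<subseteq> Q0" "a = (\<Sum>q\<in>Q. Poly_Mapping.single 0 (\<alpha> q) * T q)"
      and q: "q \<in> Q0" "g = T q" by auto
    define \<beta> where "\<beta> = \<alpha>(q := (if q \<in> Q then \<alpha> q else 0) + c)"
    have "Poly_Mapping.single 0 c * g + a = (\<Sum>q\<in>insert q Q. Poly_Mapping.single 0 (\<beta> q) * T q)"
    proof (cases "q \<in> Q")
      case True
      have "(\<Sum>q\<in>insert q Q. Poly_Mapping.single 0 (\<beta> q) * T q) =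
          Poly_Mapping.single 0 (\<beta> q) * T q + (\<Sum>q\<in>Q - {q}. Poly_Mapping.single 0 (\<beta> q) * T q)"
        using h(1) by (subst sum.insert_remove) auto
      also have "(\<Sum>q\<in>Q - {q}. Poly_Mapping.single 0 (\<beta> q) * T q) = (\<Sum>q\<in>Q - {q}. Poly_Mapping.single 0 (\<alpha> q) * T q)"
        by (intro sum.cong) (auto simp: \<beta>_def)
      finally show ?thesis
        unfolding h(3) q(2) sum.remove[OF h(1) True] using True by (simp add: \<beta>_def single_add algebra_simps)
    next
      case False
      have "(\<Sum>q\<in>insert q Q. Poly_Mapping.single 0 (\<beta> q) * T q) =
          Poly_Mapping.single 0 (\<beta> q) * T q + (\<Sum>q\<in>Q. Poly_Mapping.single 0 (\<beta> q) * T q)"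
        using h(1) False by simp
      also have "(\<Sum>q\<in>Q. Poly_Mapping.single 0 (\<beta> q) * T q) = (\<Sum>q\<in>Q. Poly_Mapping.single 0 (\<alpha> q) * T q)"
        using False by (intro sum.cong) (auto simp: \<beta>_def)
      finally show ?thesis using False by (simp add: h(3) q(2) \<beta>_def)
    qed
    then show ?case using h q by (intro exI[of _ "insert q Q"] exI[of _ \<beta>]) auto
  qed
  then show ?thesis using that by blast
qed

text \<open>All lists have the same length \<open>D\<close>, which
  \<open>labels_determine_standard_product\<close> requires; shorter products are padded by factors
  equal to 1 up to sign.\<close>

definition std_index :: "nat \<Rightarrow> nat \<Rightarrow> nat \<Rightarrow> nat \<Rightarrow> nat \<Rightarrow> (monom \<times> nat set list) set" where
  "std_index k l n w D = {(N, Ss). N \<in> monoms k l \<and> mkeys N \<inter> {1..n} \<times> {1..w} = {} \<and>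
     length Ss = D \<and> std_list {1..n + w} n Ss}"

definition std_term :: "nat \<Rightarrow> nat \<Rightarrow> monom \<times> nat set list \<Rightarrow> 'a::field mpoly" where
  "std_term n w q = mono_of (fst q) * prod_list (map (setdet n (ext_entry n w)) (snd q))"

lemma minor_poly_1: "minor_poly ([i], [j]) = indet i j"
  by (simp add: minor_poly_def gen_mat_def det_single)

lemma minor_poly_Nil [simp]: "minor_poly ([], []) = 1"
  by (simp add: minor_poly_def gen_mat_def)

lemma indet_setdet:
  assumes "1 \<le> i" "i \<le> n" "1 \<le> j" "j \<le> w"
  obtains S e where "S \<in> n_sets {1..n + w} n" "e = 1 \<or> e = -1"
    "(indet i j :: 'a::field mpoly) = e * setdet n (ext_entry n w) S"
proof -
  let ?S = "insert j ({w + 1..w + n} - {n + 1 + w - i})"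
  have "card ?S = Suc (card ({w + 1..w + n} - {n + 1 + w - i}))"
    using assms by (intro card_insert_disjoint) auto
  also have "card ({w + 1..w + n} - {n + 1 + w - i}) = n - 1"
    using assms by (subst card_Diff_singleton) auto
  finally have S: "?S \<in> n_sets {1..n + w} n" using assms by (auto simp: n_sets_def)
  have "filter (\<lambda>i'. n + 1 + w - i' \<notin> ?S) [1..<Suc n] = filter (\<lambda>i'. i' = i) [1..<Suc n]"
    using assms by (intro filter_cong) auto
  also have "\<dots> = [i]" using assms by (induction n) auto
  finally have r: "fst (set_minor n w ?S) = [i]" by (simp add: set_minor_def del: upt_Suc)
  have "filter (\<lambda>y. y \<in> ?S) [1..<Suc w] = filter (\<lambda>y. y = j) [1..<Suc w]"
    using assms by (intro filter_cong) auto
  also have "\<dots> = [j]" using assms(3,4) by (induction w) auto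
  finally have c: "snd (set_minor n w ?S) = [j]" by (simp add: set_minor_def del: upt_Suc)
  have sm: "set_minor n w ?S = ([i], [j])" using r c by (simp add: prod_eq_iff)
  obtain e where e: "e = 1 \<or> e = (-1 :: 'a mpoly)" "setdet n (ext_entry n w) ?S = e * minor_poly (set_minor n w ?S)"
    using setdet_ext_entry[OF S] by blast
  then have "(indet i j :: 'a mpoly) = e * setdet n (ext_entry n w) ?S" by (elim disjE) (simp_all only: sm minor_poly_1 mult_1 mult_minus1 minus_minus)
  then show ?thesis using that S e(1) by blast
qed

lemma one_setdet:
  obtains S e where "S \<in> n_sets {1..n + w} n" "e = 1 \<or> e = -1"
    "(1 :: 'a::field mpoly) = e * setdet n (ext_entry n w) S"
proof -
  let ?S = "{w + 1..w + n}"
  have S: "?S \<in> n_sets {1..n + w} n" by (auto simp: n_sets_def)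
  have "set (fst (set_minor n w ?S)) = {}" "set (snd (set_minor n w ?S)) = {}"
    unfolding set_minor_props(4,5)[OF S] by auto
  then have r: "fst (set_minor n w ?S) = []" and c: "snd (set_minor n w ?S) = []" by simp_all
  have sm: "set_minor n w ?S = ([], [])" using r c by (simp add: prod_eq_iff)
  obtain e where e: "e = 1 \<or> e = (-1 :: 'a mpoly)" "setdet n (ext_entry n w) ?S = e * minor_poly (set_minor n w ?S)"
    using setdet_ext_entry[OF S] by blast
  then have "(1 :: 'a mpoly) = e * setdet n (ext_entry n w) ?S" by (elim disjE) (simp_all only: sm minor_poly_Nil mult_1 mult_minus1 minus_minus)
  then show ?thesis using that S e(1) by blast
qed

lemma sign_mult: "e = 1 \<or> e = -1 \<Longrightarrow> e' = 1 \<or> e' = -1 \<Longrightarrow> e * e' = 1 \<or> e * e' = (-1 :: 'r::ring_1)"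
  by auto

text \<open>Indeterminates of the box are 1-minors, the others are collected in \<open>N\<close>,
  and empty minors fill the list up to length \<open>D\<close>.\<close>

lemma monom_setdet_product:
  assumes "m \<in> monoms k l" "total_deg m \<le> D"
  shows "\<exists>N Ss e. N \<in> monoms k l \<and> mkeys N \<inter> {1..n} \<times> {1..w} = {} \<and> length Ss = D \<and>
    set Ss \<subseteq> n_sets {1..n + w} n \<and> (e = 1 \<or> e = -1) \<and>
    (mono_of m :: 'a::field mpoly) = e * (mono_of N * prod_list (map (setdet n (ext_entry n w)) Ss))"
  using assms
proof (induction m arbitrary: D rule: monom_induct)
  case zero
  show ?case
  proof (induction D)
    case 0
    show ?case by (intro exI[of _ 0] exI[of _ "[]"] exI[of _ 1]) auto
  next
    case (Suc D)
    then obtain N Ss e where h: "N \<in> monoms k l" "mkeys N \<inter> {1..n} \<times> {1..w} = {}" "length Ss = D"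
      "set Ss \<subseteq> n_sets {1..n + w} n" "e = 1 \<or> e = -1"
      "(1 :: 'a mpoly) = e * (mono_of N * prod_list (map (setdet n (ext_entry n w)) Ss))" by auto
    obtain S e' where S: "S \<in> n_sets {1..n + w} n" "e' = 1 \<or> e' = -1"
      "(1 :: 'a mpoly) = e' * setdet n (ext_entry n w) S" using one_setdet by blast
    have "(1 :: 'a mpoly) = 1 * 1" by simp
    also have "\<dots> = (e' * setdet n (ext_entry n w) S) * (e * (mono_of N * prod_list (map (setdet n (ext_entry n w)) Ss)))"
      using S(3) h(6) by simp
    also have "\<dots> = (e * e') * (mono_of N * prod_list (map (setdet n (ext_entry n w)) (S # Ss)))"
      by (simp add: mult_ac)
    finally show ?case using h S sign_mult[OF h(5) S(2)]
      by (intro exI[of _ N] exI[of _ "S # Ss"] exI[of _ "e * e'"]) auto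
  qed
next
  case (add m v)
  have m: "m \<in> monoms k l" and v: "v \<in> {1..k} \<times> {1..l}" using add.prems(1) by auto
  have D: "total_deg m + 1 \<le> D" using add.prems(2) by simp
  have dm: "total_deg m \<le> D - 1" "total_deg m \<le> D" using D by simp_all
  show ?case
  proof (cases "v \<in> {1..n} \<times> {1..w}")
    case True
    obtain N Ss e where h: "N \<in> monoms k l" "mkeys N \<inter> {1..n} \<times> {1..w} = {}" "length Ss = D - 1"
      "set Ss \<subseteq> n_sets {1..n + w} n" "e = 1 \<or> e = -1"
      "(mono_of m :: 'a mpoly) = e * (mono_of N * prod_list (map (setdet n (ext_entry n w)) Ss))"
      using add.IH[OF m dm(1)] by (elim exE conjE) (rule that)
    obtain S e' where S: "S \<in> n_sets {1..n + w} n" "e' = 1 \<or> e' = -1"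
      "(indet (fst v) (snd v) :: 'a mpoly) = e' * setdet n (ext_entry n w) S"
      using True indet_setdet[of "fst v" n "snd v" w] by (auto simp: mem_Times_iff)
    have "(mono_of (m + Poly_Mapping.single v 1) :: 'a mpoly) = indet (fst v) (snd v) * mono_of m"
      by (simp add: indet_def mult_single add.commute)
    also have "\<dots> = (e' * setdet n (ext_entry n w) S) * (e * (mono_of N * prod_list (map (setdet n (ext_entry n w)) Ss)))"
      using S(3) h(6) by simp
    also have "\<dots> = (e * e') * (mono_of N * prod_list (map (setdet n (ext_entry n w)) (S # Ss)))"
      by (simp add: mult_ac)
    finally show ?thesis using h S sign_mult[OF h(5) S(2)] D
      by (intro exI[of _ N] exI[of _ "S # Ss"] exI[of _ "e * e'"]) auto
  next
    case False
    obtain N Ss e where h: "N \<in> monoms k l" "mkeys N \<inter> {1..n} \<times> {1..w} = {}" "length Ss = D"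
      "set Ss \<subseteq> n_sets {1..n + w} n" "e = 1 \<or> e = -1"
      "(mono_of m :: 'a mpoly) = e * (mono_of N * prod_list (map (setdet n (ext_entry n w)) Ss))"
      using add.IH[OF m dm(2)] by (elim exE conjE) (rule that)
    have "(mono_of (m + Poly_Mapping.single v 1) :: 'a mpoly) = mono_of (Poly_Mapping.single v 1) * mono_of m"
      by (simp add: mult_single add.commute)
    also have "\<dots> = e * ((mono_of (Poly_Mapping.single v 1) * mono_of N) * prod_list (map (setdet n (ext_entry n w)) Ss))"
      unfolding h(6) by (simp only: mult_ac)
    also have "\<dots> = e * (mono_of (N + Poly_Mapping.single v 1) * prod_list (map (setdet n (ext_entry n w)) Ss))"
      by (simp add: mult_single add.commute)
    finally show ?thesis using h False v
      by (intro exI[of _ "N + Poly_Mapping.single v 1"] exI[of _ Ss] exI[of _ e]) (auto simp: keys_monom_add)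
  qed
qed

lemma standard_expansion:
  assumes "g \<in> polys k l"
  obtains D Q \<alpha> where "finite Q" "Q \<subseteq> std_index k l n w D"
    "g = (\<Sum>q\<in>Q. Poly_Mapping.single 0 (\<alpha> q) * std_term n w q)"
proof -
  \<comment> \<open>A common bound for the degrees of all monomials of \<open>g\<close>.\<close>
  define D where "D = (\<Sum>m\<in>mkeys g. total_deg m)"
  let ?T = "std_term n w :: _ \<Rightarrow> 'a mpoly"
  let ?H = "?T ` std_index k l n w D"
  have mono: "mono_of m \<in> kspan ?H" if m: "m \<in> mkeys g" for m
  proof -
    have deg: "total_deg m \<le> D" unfolding D_def using m by (intro member_le_sum) auto
    have "total_deg m \<le> D" "m \<in> monoms k l" using deg m assms by (auto simp: polys_def)
    from monom_setdet_product[OF this(2,1), of n w]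
    obtain N Ss e where h: "N \<in> monoms k l" "mkeys N \<inter> {1..n} \<times> {1..w} = {}" "length Ss = D"
      "set Ss \<subseteq> n_sets {1..n + w} n" "e = 1 \<or> e = -1"
      "(mono_of m :: 'a mpoly) = e * (mono_of N * prod_list (map (setdet n (ext_entry n w)) Ss))"
      by (elim exE conjE) (rule that)
    have "mono_of N * prod_list (map (setdet n (ext_entry n w)) Ss) \<in> kspan ?H"
    proof (rule zspan_mult_kspan[OF straighten[OF h(4)]])
      fix g :: "'a mpoly" assume "g \<in> {prod_list (map (setdet n (ext_entry n w)) Ds) |Ds. length Ds = length Ss \<and> std_list {1..n + w} n Ds}"
      then obtain Ds where Ds: "g = prod_list (map (setdet n (ext_entry n w)) Ds)" "length Ds = D" "std_list {1..n + w} n Ds"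
        using h(3) by auto
      then have "(N, Ds) \<in> std_index k l n w D" using h by (simp add: std_index_def)
      then have "?T (N, Ds) \<in> kspan ?H" by (intro kspan_gen imageI)
      then show "mono_of N * g \<in> kspan ?H" by (simp add: std_term_def Ds(1))
    qed
    then show ?thesis using h(5,6) kspan_uminus by auto
  qed
  have "(\<Sum>m\<in>mkeys g. Poly_Mapping.single 0 (coef g m) * mono_of m) \<in> kspan ?H"
    using mono by (intro kspan_sum kspan_scale)
  also have "(\<Sum>m\<in>mkeys g. Poly_Mapping.single 0 (coef g m) * mono_of m) = g"
    by (subst (3) poly_eq_sum_single[of g]) (simp add: mult_single)
  finally have "g \<in> kspan ?H" .
  then obtain Q \<alpha> where "finite Q" "Q \<subseteq> std_index k l n w D" "g = (\<Sum>q\<in>Q. Poly_Mapping.single 0 (\<alpha> q) * ?T q)"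
    by (rule kspan_image_sum)
  then show ?thesis by (rule that)
qed

subsection \<open>Leading labels of standard products\<close>

lemma eval_monom_fac_outside:
  assumes "mkeys N \<inter> B = {}"
  shows "\<exists>M. (eval_monom (fac B K) N :: 'a::comm_ring_1 upoly) = mono_of M \<and>
    (\<forall>v. coef M (Orig v) = coef N v) \<and> (\<forall>v. (\<forall>p. v \<noteq> Orig p) \<longrightarrow> coef M v = 0)"
  using assms
proof (induction N rule: monom_induct)
  case zero
  show ?case by (intro exI[of _ 0]) simp
next
  case (add N v)
  then obtain M where M: "(eval_monom (fac B K) N :: 'a upoly) = mono_of M"
    "\<And>v. coef M (Orig v) = coef N v" "\<And>v. (\<forall>p. v \<noteq> Orig p) \<Longrightarrow> coef M v = 0"
    by (auto simp: keys_monom_add)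
  have "v \<notin> B" using add.prems by (auto simp: keys_monom_add)
  then have "(fac B K v :: 'a upoly) = mono_of (Poly_Mapping.single (Orig v) 1)"
    by (simp add: fac_def colors_def term_monom_def)
  then have "(eval_monom (fac B K) (N + Poly_Mapping.single v 1) :: 'a upoly) = mono_of (M + Poly_Mapping.single (Orig v) 1)"
    by (simp add: eval_monom_add M(1) mult_single)
  then show ?case using M(2,3)
    by (intro exI[of _ "M + Poly_Mapping.single (Orig v) 1"]) (auto simp: lookup_add lookup_single when_def)
qed

lemma subst_uminus: "subst \<phi> (- p) = - subst \<phi> p"
  using subst_add[of \<phi> p "- p"] by (simp add: eq_neg_iff_add_eq_0 add.commute)

definition std_label :: "nat \<Rightarrow> nat \<Rightarrow> monom \<times> nat set list \<Rightarrow> (uvar \<Rightarrow>\<^sub>0 nat) \<Rightarrow> bool" where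
  "std_label n w q M \<longleftrightarrow> (\<forall>v. coef M (Orig v) = coef (fst q) v) \<and>
     (\<forall>v. (\<forall>p. v \<noteq> Orig p) \<longrightarrow> coef M v = (\<Sum>j<length (snd q). coef (minor_label (set_minor n w (snd q ! j))) v))"

text \<open>Inner dimension \<open>n\<close> accommodates all minors of a box with \<open>n\<close>
  rows, and \<open>n + w + 1\<close> exceeds all row and column indices. Leading labels then add up
  over the factors.\<close>

lemma lead_std_term:
  assumes "q \<in> std_index k l n w D"
  shows "\<exists>M. wt.lead_at (n + w + 1) (subst (fac ({1..n} \<times> {1..w}) n) (std_term n w q :: 'a::field mpoly)) M \<and> std_label n w q M"
proof -
  let ?B = "{1..n} \<times> {1..w}"
  let ?s = "subst (fac ?B n) :: 'a mpoly \<Rightarrow> _"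
  obtain N Ss where q: "q = (N, Ss)" by (cases q)
  have N: "mkeys N \<inter> ?B = {}" and Ss: "set Ss \<subseteq> n_sets {1..n + w} n"
    using assms by (auto simp: q std_index_def std_list_def)
  obtain M0 where M0: "(eval_monom (fac ?B n) N :: 'a upoly) = mono_of M0"
    "\<And>v. coef M0 (Orig v) = coef N v" "\<And>v. (\<forall>p. v \<noteq> Orig p) \<Longrightarrow> coef M0 v = 0"
    using eval_monom_fac_outside[OF N] by blast
  have L: "wt.lead_at (n + w + 1) (?s (setdet n (ext_entry n w) S)) (minor_label (set_minor n w S))"
    if S: "S \<in> n_sets {1..n + w} n" for S
  proof -
    obtain a b where ab: "set_minor n w S = (a, b)" by (cases "set_minor n w S")
    note P = set_minor_props[OF S, unfolded ab fst_conv snd_conv]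
    obtain e where e: "e = 1 \<or> e = (-1 :: 'a mpoly)" "setdet n (ext_entry n w) S = e * minor_poly (set_minor n w S)"
      using setdet_ext_entry[OF S] by blast
    have len: "length a \<le> n"
    proof -
      have "length a = card (set a)" using P(2) distinct_card[of a] by (simp add: strict_sorted_iff)
      also have "\<dots> \<le> card {1..n}" unfolding P(4) by (intro card_mono) auto
      finally show ?thesis by simp
    qed
    have lead: "wt.lead_at (n + w + 1) (?s (minor_poly (a, b))) (minor_label (a, b))"
    proof (rule lead_subst_minor)
      have sa: "set a \<subseteq> {1..n}" "set b \<subseteq> {1..w}" unfolding P(4,5) by auto
      then show "set a \<times> set b \<subseteq> ?B" by blast
      show "x < n + w + 1" if "x \<in> set a \<union> set b" for x
      proof -
        have "x \<in> {1..n} \<union> {1..w}" using sa that by blast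
        then show ?thesis by auto
      qed
    qed (rule P(1) P(2) P(3) len)+
    then have "?s (setdet n (ext_entry n w) S) = ?s (minor_poly (a, b)) \<or>
        ?s (setdet n (ext_entry n w) S) = - ?s (minor_poly (a, b))"
      using e ab by (auto simp: subst_uminus)
    then show ?thesis using lead ab by (auto simp: wt.lead_at_def)
  qed
  have "wt.lead_at (n + w + 1) (\<Prod>j<length Ss. ?s (setdet n (ext_entry n w) (Ss ! j)))
      (\<Sum>j<length Ss. minor_label (set_minor n w (Ss ! j)))"
  proof (rule wt.lead_at_prod[THEN conjunct1])
    fix j assume "j \<in> {..<length Ss}"
    then have "Ss ! j \<in> n_sets {1..n + w} n" using Ss by auto
    then show "wt.lead_at (n + w + 1) (?s (setdet n (ext_entry n w) (Ss ! j))) (minor_label (set_minor n w (Ss ! j)))"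
      by (rule L)
  qed simp
  moreover have "wt.lead_at (n + w + 1) (mono_of M0 :: 'a upoly) M0" by simp
  ultimately have "wt.lead_at (n + w + 1) (mono_of M0 * (\<Prod>j<length Ss. ?s (setdet n (ext_entry n w) (Ss ! j))))
      (M0 + (\<Sum>j<length Ss. minor_label (set_minor n w (Ss ! j))))"
    by (intro wt.lead_at_mult) auto
  moreover have "?s (std_term n w q) = mono_of M0 * (\<Prod>j<length Ss. ?s (setdet n (ext_entry n w) (Ss ! j)))"
    by (simp add: std_term_def q subst_mult subst_single M0(1)[simplified] prod.list_conv_set_nth subst_prod atLeast0LessThan)
  moreover have "std_label n w q (M0 + (\<Sum>j<length Ss. minor_label (set_minor n w (Ss ! j))))"
    using M0(2,3) by (simp add: std_label_def q lookup_add lookup_sum coef_minor_label_Orig)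
  ultimately show ?thesis by auto
qed

lemma std_label_unique:
  assumes q: "q \<in> std_index k l n w D" "std_label n w q M" and q': "q' \<in> std_index k l n w D" "std_label n w q' M"
  shows "q = q'"
proof -
  obtain N Ss N' Ss' where e: "q = (N, Ss)" "q' = (N', Ss')" by (cases q, cases q')
  have "N = N'"
  proof (rule poly_mapping_eqI)
    fix v
    have "coef M (Orig v) = coef N v" "coef M (Orig v) = coef N' v"
      using q(2) q'(2) by (simp_all only: std_label_def e fst_conv)
    then show "coef N v = coef N' v" by simp
  qed
  moreover have "Ss = Ss'"
  proof -
    have Ss: "set Ss \<subseteq> n_sets {1..n + w} n" "set Ss' \<subseteq> n_sets {1..n + w} n" "length Ss = D" "length Ss' = D"
      and std: "sorted_wrt (set_le n) Ss" "sorted_wrt (set_le n) Ss'"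
      using q(1) q'(1) by (auto simp: e std_index_def std_list_def)
    have "map (set_minor n w) Ss = map (set_minor n w) Ss'"
    proof (rule labels_determine_standard_product)
      show "length (map (set_minor n w) Ss) = length (map (set_minor n w) Ss')" using Ss by simp
      show "length (fst \<pi>) = length (snd \<pi>)"
        if "\<pi> \<in> set (map (set_minor n w) Ss) \<union> set (map (set_minor n w) Ss')" for \<pi>
        using that Ss set_minor_props(1) by auto
      have mono: "sorted_wrt minor_le (map (set_minor n w) Cs)"
        if "sorted_wrt (set_le n) Cs" "set Cs \<subseteq> n_sets {1..n + w} n" for Cs
        unfolding sorted_wrt_map
      proof (rule sorted_wrt_mono_rel[OF _ that(1)])
        fix x y assume "x \<in> set Cs" "y \<in> set Cs" "set_le n x y"
        then show "minor_le (set_minor n w x) (set_minor n w y)" using that(2) by (intro set_minor_le) blast+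
      qed
      show "sorted_wrt minor_le (map (set_minor n w) Ss)" "sorted_wrt minor_le (map (set_minor n w) Ss')"
        using mono[OF std(1) Ss(1)] mono[OF std(2) Ss(2)] .
      show "(\<Sum>j<length (map (set_minor n w) Ss). coef (minor_label (map (set_minor n w) Ss ! j)) v) =
          (\<Sum>j<length (map (set_minor n w) Ss). coef (minor_label (map (set_minor n w) Ss' ! j)) v)"
        if v: "\<forall>p. v \<noteq> Orig p" for v
      proof -
        have "(\<Sum>j<D. coef (minor_label (set_minor n w (Ss ! j))) v) = (\<Sum>j<D. coef (minor_label (set_minor n w (Ss' ! j))) v)"
          using q(2) q'(2) v Ss by (simp add: std_label_def e)
        then show ?thesis using Ss by simp
      qed
    qed
    then show ?thesis
      using inj_on_map_eq_map[OF inj_on_subset[OF inj_on_set_minor[of n w]], of Ss Ss'] Ss(1,2) by simp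
  qed
  ultimately show ?thesis by (simp add: e)
qed

subsection \<open>Principal generalized ideals\<close>

definition below :: "minor \<Rightarrow> minor set" where
  "below \<delta> = {\<pi> \<in> minors (last (fst \<delta>)) (last (snd \<delta>)). minor_le \<pi> \<delta>}"

text \<open>With \<open>\<delta> = (c, d)\<close>: in the upper left corner up to row
  \<open>last c\<close> and column \<open>last d\<close>, the first \<open>c ! t\<close> rows and
  the first \<open>d ! t\<close> columns have rank at most \<open>t\<close>. Since \<open>t\<close>
  counts from 0, the minors have size \<open>Suc t\<close>.\<close>

definition rank_ideal :: "nat \<Rightarrow> nat \<Rightarrow> minor \<Rightarrow> 'a::field mpoly set" where
  "rank_ideal k l \<delta> = (\<Inter>t<length (fst \<delta>).
     det_ideal k l {1..fst \<delta> ! t} {1..last (snd \<delta>)} (Suc t) \<inter>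
     det_ideal k l {1..last (fst \<delta>)} {1..snd \<delta> ! t} (Suc t))"

lemma minors_mono: "r \<le> r' \<Longrightarrow> s \<le> s' \<Longrightarrow> minors r s \<subseteq> minors r' s'"
  by (force simp: minors_def)

lemma strict_sorted_nth_le_last:
  assumes "sorted_wrt (<) (xs :: nat list)" "t < length xs"
  shows "xs ! t \<le> last xs"
proof -
  have "last xs = xs ! (length xs - 1)" using assms(2) by (intro last_conv_nth) auto
  moreover have "t = length xs - 1 \<or> xs ! t < xs ! (length xs - 1)"
    using assms(2) sorted_wrt_nth_less[OF assms(1), of t "length xs - 1"] by fastforce
  ultimately show ?thesis by auto
qed

lemma last_le_of_minors:
  assumes "\<delta> \<in> minors k l"
  shows "1 \<le> last (fst \<delta>)" "last (fst \<delta>) \<le> k" "1 \<le> last (snd \<delta>)" "last (snd \<delta>) \<le> l"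
proof -
  obtain c d where \<delta>: "\<delta> = (c, d)" by (cases \<delta>)
  note D = minorsD[OF assms[unfolded \<delta>]]
  have "last c \<in> set c" "last d \<in> set d" using D(1,2) by (auto intro!: last_in_set)
  then have "last c \<in> {1..k}" "last d \<in> {1..l}" using D(5,6) by blast+
  then show "1 \<le> last (fst \<delta>)" "last (fst \<delta>) \<le> k" "1 \<le> last (snd \<delta>)" "last (snd \<delta>) \<le> l"
    by (simp_all add: \<delta>)
qed

lemma below_subset:
  assumes "\<delta> \<in> minors k l"
  shows "below \<delta> \<subseteq> minors k l"
  using minors_mono[OF last_le_of_minors(2)[OF assms] last_le_of_minors(4)[OF assms]] by (auto simp: below_def)

lemma det_ideal_subset_rows:
  assumes "0 < t"
  shows "R' \<subseteq> set xs \<union> R \<Longrightarrow> det_ideal k l R' C (length xs + t) \<subseteq> (det_ideal k l R C t :: 'a::field mpoly set)"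
proof (induction xs arbitrary: R')
  case Nil
  then show ?case by (simp add: det_ideal_mono)
next
  case (Cons x xs)
  have "det_ideal k l R' C (Suc (length xs + t)) \<subseteq> (det_ideal k l (set xs \<union> R) C (length xs + t) :: 'a mpoly set)"
    using Cons.prems assms by (intro det_ideal_subset_row) auto
  also have "\<dots> \<subseteq> det_ideal k l R C t" by (rule Cons.IH) simp
  finally show ?case by simp
qed

lemma det_ideal_subset_cols:
  assumes "0 < t"
  shows "C' \<subseteq> set xs \<union> C \<Longrightarrow> det_ideal k l R C' (length xs + t) \<subseteq> (det_ideal k l R C t :: 'a::field mpoly set)"
proof (induction xs arbitrary: C')
  case Nil
  then show ?case by (simp add: det_ideal_mono)
next
  case (Cons x xs)
  have "det_ideal k l R C' (Suc (length xs + t)) \<subseteq> (det_ideal k l R (set xs \<union> C) (length xs + t) :: 'a mpoly set)"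
    using Cons.prems assms by (intro det_ideal_subset_col) auto
  also have "\<dots> \<subseteq> det_ideal k l R C t" by (rule Cons.IH) simp
  finally show ?case by simp
qed

lemma strict_sorted_split:
  assumes "sorted_wrt (<) (a :: nat list)" "set a \<subseteq> {1..n}" "t < length a" "a ! t \<le> x"
  shows "set a \<subseteq> set (drop (Suc t) a) \<union> {1..x}"
proof
  fix y assume "y \<in> set a"
  then obtain i where i: "i < length a" "y = a ! i" by (auto simp: in_set_conv_nth)
  show "y \<in> set (drop (Suc t) a) \<union> {1..x}"
  proof (cases "i \<le> t")
    case True
    then have "a ! i \<le> a ! t" using sorted_wrt_nth_less[OF assms(1), of i t] assms(3) by (cases "i = t") auto
    moreover have "1 \<le> a ! i" using assms(2) nth_mem[OF i(1)] by force
    ultimately show ?thesis using assms(4) i by auto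
  next
    case False
    then have "y = drop (Suc t) a ! (i - Suc t)" "i - Suc t < length (drop (Suc t) a)" using i by auto
    then show ?thesis by (metis UnI1 nth_mem)
  qed
qed

text \<open>The rows of \<open>\<pi>\<close> up to place \<open>t\<close> are at most
  \<open>fst \<delta> ! t\<close>; Laplace expansion along the later ones leaves minors of size
  \<open>Suc t\<close> in the required rows. Columns are treated alike.\<close>

lemma below_in_rank_ideal:
  assumes \<delta>: "\<delta> \<in> minors k l" and \<pi>: "\<pi> \<in> below \<delta>"
  shows "(minor_poly \<pi> :: 'a::field mpoly) \<in> rank_ideal k l \<delta>"
proof -
  let ?n = "last (fst \<delta>)" and ?w = "last (snd \<delta>)"
  obtain a b where ab: "\<pi> = (a, b)" by (cases \<pi>)
  have m: "(a, b) \<in> minors ?n ?w" and le: "minor_le (a, b) \<delta>" using \<pi> by (auto simp: below_def ab)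
  note P = minorsD[OF m]
  have mk: "(a, b) \<in> minors k l" using below_subset[OF \<delta>] \<pi> ab by auto
  show ?thesis
    unfolding rank_ideal_def ab
  proof (intro INT_I IntI)
    fix t assume "t \<in> {..<length (fst \<delta>)}"
    then have t: "t < length a" "a ! t \<le> fst \<delta> ! t" "b ! t \<le> snd \<delta> ! t"
      using le by (auto simp: minor_le_def)
    have mem: "(minor_poly (a, b) :: 'a mpoly) \<in> det_ideal k l (set a) (set b) (length a)"
      using mk by (intro in_det_ideal) auto
    have la: "length (drop (Suc t) a) + Suc t = length a" using t by simp
    have lb: "length (drop (Suc t) b) + Suc t = length a" using t P(1) by simp
    have "det_ideal k l (set a) (set b) (length a) \<subseteq> (det_ideal k l (set a) {1..?w} (length a) :: 'a mpoly set)"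
      using P(6) by (intro det_ideal_mono) auto
    also have "\<dots> \<subseteq> det_ideal k l {1..fst \<delta> ! t} {1..?w} (Suc t)"
      using strict_sorted_split[OF P(3,5) t(1,2)]
      by (rule det_ideal_subset_rows[of "Suc t" _ "drop (Suc t) a", unfolded la, rotated]) simp
    finally show "(minor_poly (a, b) :: 'a mpoly) \<in> det_ideal k l {1..fst \<delta> ! t} {1..?w} (Suc t)" by (rule subsetD) (rule mem)
    have "det_ideal k l (set a) (set b) (length a) \<subseteq> (det_ideal k l {1..?n} (set b) (length a) :: 'a mpoly set)"
      using P(5) by (intro det_ideal_mono) auto
    also have "\<dots> \<subseteq> det_ideal k l {1..?n} {1..snd \<delta> ! t} (Suc t)"
      using strict_sorted_split[OF P(4,6) t(1)[unfolded P(1)] t(3)]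
      by (rule det_ideal_subset_cols[of "Suc t" _ "drop (Suc t) b", unfolded lb, rotated]) simp
    finally show "(minor_poly (a, b) :: 'a mpoly) \<in> det_ideal k l {1..?n} {1..snd \<delta> ! t} (Suc t)" by (rule subsetD) (rule mem)
  qed
qed

lemma is_ideal_INT:
  assumes "A \<noteq> {}" "\<And>i. i \<in> A \<Longrightarrow> is_ideal k l (I i)"
  shows "is_ideal k l (\<Inter>i\<in>A. I i)"
  using assms unfolding is_ideal_def by (intro conjI ballI INT_I) (auto, blast)

lemma is_ideal_Int: "is_ideal k l I \<Longrightarrow> is_ideal k l J \<Longrightarrow> is_ideal k l (I \<inter> J)"
  unfolding is_ideal_def by blast

lemma minors_length_pos: "\<delta> \<in> minors k l \<Longrightarrow> 0 < length (fst \<delta>)"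
  by (auto simp: minors_def)

lemma is_ideal_rank_ideal:
  assumes "\<delta> \<in> minors k l"
  shows "is_ideal k l (rank_ideal k l \<delta>)"
  unfolding rank_ideal_def using minors_length_pos[OF assms]
  by (intro is_ideal_INT is_ideal_Int is_ideal_det_ideal) auto

text \<open>By the rank condition number \<open>t\<close>, the monomial \<open>M\<close> contains
  some \<open>Lft x e\<close> with \<open>x \<le> c ! t\<close> and \<open>e > t\<close>. It stems
  from a factor whose row in place \<open>e - 1\<close>, hence also in place \<open>t\<close>, is at
  most \<open>c ! t\<close>; standardness passes this bound on to the first factor.\<close>

lemma first_factor_below:
  assumes \<delta>: "\<delta> \<in> minors k l" and g: "(g :: 'a::field mpoly) \<in> rank_ideal k l \<delta>"
    and q: "(N, Ss) \<in> std_index k l (last (fst \<delta>)) (last (snd \<delta>)) D"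
    and M: "std_label (last (fst \<delta>)) (last (snd \<delta>)) (N, Ss) M"
      "M \<in> mkeys (subst (fac ({1..last (fst \<delta>)} \<times> {1..last (snd \<delta>)}) (last (fst \<delta>))) g)"
  shows "Ss \<noteq> []" "set_minor (last (fst \<delta>)) (last (snd \<delta>)) (hd Ss) \<in> below \<delta>"
proof -
  define n where "n = last (fst \<delta>)"
  define w where "w = last (snd \<delta>)"
  let ?sm = "set_minor n w"
  note nw = n_def[symmetric] w_def[symmetric]
  obtain c d where cd: "\<delta> = (c, d)" by (cases \<delta>)
  note P = minorsD[OF \<delta>[unfolded cd]]
  have Ss: "set Ss \<subseteq> n_sets {1..n + w} n" and std: "sorted_wrt (set_le n) Ss"
    using q by (auto simp: std_index_def std_list_def nw)
  have label: "coef M v = (\<Sum>j<length Ss. coef (minor_label (?sm (Ss ! j))) v)" if "\<forall>p. v \<noteq> Orig p" for v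
    using M(1) that unfolding std_label_def nw snd_conv by blast
  have first: "entry_le (sel (?sm (hd Ss))) t x" "Ss \<noteq> []"
    if j: "j < length Ss" "entry_le (sel (?sm (Ss ! j))) t x" and sel: "sel = fst \<or> sel = snd" for sel j t x
  proof -
    show ne: "Ss \<noteq> []" using j(1) by auto
    show "entry_le (sel (?sm (hd Ss))) t x"
    proof (cases "j = 0")
      case False
      have in1: "Ss ! 0 \<in> n_sets {1..n + w} n" "Ss ! j \<in> n_sets {1..n + w} n"
        using Ss j(1) nth_mem[of 0 Ss] nth_mem[of j Ss] by (meson ne length_greater_0_conv subsetD)+
      have "set_le n (Ss ! 0) (Ss ! j)" using sorted_wrt_nth_less[OF std, of 0 j] False j(1) by auto
      then have "minor_le (?sm (Ss ! 0)) (?sm (Ss ! j))" using in1 by (intro set_minor_le)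
      then show ?thesis
        using sel j(2) minor_le_iff_entry_le[OF set_minor_props(1)[OF in1(1)] set_minor_props(1)[OF in1(2)]]
          hd_conv_nth[OF ne] by auto
    qed (use j hd_conv_nth[OF ne] in simp)
  qed
  have cbound: "c ! t \<le> n" "d ! t \<le> w" if "t < length c" for t
    using strict_sorted_nth_le_last[OF P(3) that] strict_sorted_nth_le_last[OF P(4), of t] that P(1) cd
    by (simp_all add: n_def w_def)
  have mem: "g \<in> det_ideal k l {1..c ! t} {1..w} (Suc t)" "g \<in> det_ideal k l {1..n} {1..d ! t} (Suc t)"
    if "t < length c" for t
    using g that unfolding rank_ideal_def nw by (auto simp: cd)
  have rows: "entry_le (fst (?sm (hd Ss))) t (c ! t) \<and> Ss \<noteq> []" if t: "t < length c" for t
  proof -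
    have "\<exists>x\<in>{1..c ! t}. \<exists>e\<ge>Suc t. Lft x e \<in> mkeys M"
      using cbound[OF t] M(2) by (intro fac_keys_rows[OF mem(1)[OF t], where B = "{1..n} \<times> {1..w}" and K = n]) (auto simp: nw)
    then obtain x e where xe: "x \<le> c ! t" "Suc t \<le> e" "Lft x e \<in> mkeys M" by auto
    then obtain u where u: "e = Suc u" "t \<le> u" by (cases e) auto
    have "coef M (Lft x e) \<noteq> 0" using xe(3) by (simp add: in_keys_iff)
    then obtain j where j: "j < length Ss" "coef (minor_label (?sm (Ss ! j))) (Lft x (Suc u)) \<noteq> 0"
      unfolding u(1) by (subst (asm) label) (auto elim: sum.not_neutral_contains_not_neutral)
    then have e: "entry_le (fst (?sm (Ss ! j))) u x"
      by (auto simp: coef_minor_label entry_le_def split: if_splits)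
    have sorted: "sorted_wrt (<) (fst (?sm (Ss ! j)))"
      using Ss j(1) by (intro set_minor_props(2)) (auto dest: nth_mem)
    have "entry_le (fst (?sm (Ss ! j))) t (c ! t)"
      using e u(2) xe(1) sorted_wrt_nth_less[OF sorted, of t u]
      by (cases "t = u") (auto simp: entry_le_def)
    from first[where sel = fst, OF j(1) this] show ?thesis by auto
  qed
  have cols: "entry_le (snd (?sm (hd Ss))) t (d ! t)" if t: "t < length c" for t
  proof -
    have "\<exists>y\<in>{1..d ! t}. \<exists>e\<ge>Suc t. Rgt e y \<in> mkeys M"
      using cbound[OF t] M(2) by (intro fac_keys_cols[OF mem(2)[OF t], where B = "{1..n} \<times> {1..w}" and K = n]) (auto simp: nw)
    then obtain x e where xe: "x \<le> d ! t" "Suc t \<le> e" "Rgt e x \<in> mkeys M" by auto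
    then obtain u where u: "e = Suc u" "t \<le> u" by (cases e) auto
    have "coef M (Rgt e x) \<noteq> 0" using xe(3) by (simp add: in_keys_iff)
    then obtain j where j: "j < length Ss" "coef (minor_label (?sm (Ss ! j))) (Rgt (Suc u) x) \<noteq> 0"
      unfolding u(1) by (subst (asm) label) (auto elim: sum.not_neutral_contains_not_neutral)
    then have e: "entry_le (snd (?sm (Ss ! j))) u x"
      by (auto simp: coef_minor_label entry_le_def split: if_splits)
    have sorted: "sorted_wrt (<) (snd (?sm (Ss ! j)))"
      using Ss j(1) by (intro set_minor_props(3)) (auto dest: nth_mem)
    have "entry_le (snd (?sm (Ss ! j))) t (d ! t)"
      using e u(2) xe(1) sorted_wrt_nth_less[OF sorted, of t u]
      by (cases "t = u") (auto simp: entry_le_def)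
    from first[where sel = snd, OF j(1) this] show ?thesis by auto
  qed
  have lc: "0 < length c" using P(2) by simp
  show ne: "Ss \<noteq> []" using rows[OF lc] by simp
  have hd: "hd Ss \<in> n_sets {1..n + w} n" using ne Ss by auto
  note H = set_minor_props[OF hd]
  have len: "length c \<le> length (fst (?sm (hd Ss)))"
    using rows[of "length c - 1"] lc by (auto simp: entry_le_def)
  have "fst (?sm (hd Ss)) \<noteq> []" using len lc by auto
  then have "?sm (hd Ss) \<in> minors n w" using H by (auto simp: minors_def split_def)
  moreover have "minor_le (?sm (hd Ss)) \<delta>"
    using len rows cols by (auto simp: minor_le_def cd entry_le_def)
  ultimately show "set_minor (last (fst \<delta>)) (last (snd \<delta>)) (hd Ss) \<in> below \<delta>"
    by (simp add: below_def nw)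
qed

lemma setdet_in_polys:
  assumes "S \<in> n_sets {1..n + w} n" "n \<le> k" "w \<le> l"
  shows "setdet n (ext_entry n w) S \<in> polys k l"
proof -
  obtain e where e: "e = 1 \<or> e = (-1 :: 'a mpoly)" "setdet n (ext_entry n w) S = e * minor_poly (set_minor n w S)"
    using setdet_ext_entry[OF assms(1)] by blast
  have "(minor_poly (set_minor n w S) :: 'a mpoly) \<in> polys k l"
  proof (cases "fst (set_minor n w S) = []")
    case True
    then have "set_minor n w S = ([], [])" using set_minor_props(1)[OF assms(1)] by (simp add: prod_eq_iff)
    then show ?thesis by simp
  next
    case False
    then have "set_minor n w S \<in> minors n w" using set_minor_props[OF assms(1)] by (auto simp: minors_def split_def)
    then show ?thesis using minors_mono[OF assms(2,3)] by (intro minor_poly_in_polys) auto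
  qed
  then show ?thesis unfolding e(2) using e(1) by (intro polys_mult) auto
qed

lemma polys_prod_list: "(\<And>p. p \<in> set ps \<Longrightarrow> p \<in> polys k l) \<Longrightarrow> prod_list ps \<in> polys k l"
  by (induction ps) auto

text \<open>For the hard inclusion, the standard term with the lightest leading label cannot cancel
  under the factorization, so its first minor is in \<open>below \<delta>\<close>. The term then
  lies in both ideals, and removing it leaves a shorter combination.\<close>

theorem below_ideal_eq_rank_ideal:
  assumes \<delta>: "\<delta> \<in> minors k l"
  shows "idl k l (minor_poly ` below \<delta>) = (rank_ideal k l \<delta> :: 'a::field mpoly set)"
proof
  let ?I = "idl k l (minor_poly ` below \<delta>) :: 'a mpoly set" and ?R = "rank_ideal k l \<delta> :: 'a mpoly set"
  define n where "n = last (fst \<delta>)"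
  define w where "w = last (snd \<delta>)"
  note nw = n_def[symmetric] w_def[symmetric]
  have nwk: "n \<le> k" "w \<le> l" using last_le_of_minors[OF \<delta>] by (simp_all add: n_def w_def)
  note R = is_ideal_rank_ideal[OF \<delta>, where 'a = 'a]
  show sub: "?I \<subseteq> ?R"
    by (rule idl_least[OF R]) (use below_in_rank_ideal[OF \<delta>] in auto)
  have I: "is_ideal k l ?I"
    using below_subset[OF \<delta>] minor_poly_in_polys by (intro is_ideal_idl) blast
  let ?T = "std_term n w :: _ \<Rightarrow> 'a mpoly" and ?s = "subst (fac ({1..n} \<times> {1..w}) n) :: 'a mpoly \<Rightarrow> _"
  have main: "g \<in> ?I"
    if "finite Q" "Q \<subseteq> std_index k l n w D" "g = (\<Sum>q\<in>Q. Poly_Mapping.single 0 (\<alpha> q) * ?T q)" "g \<in> ?R" for g Q \<alpha> D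
    using that
  proof (induction Q arbitrary: g rule: finite_psubset_induct)
    case (psubset Q)
    have "\<exists>M. wt.lead_at (n + w + 1) (?s (?T q)) M \<and> std_label n w q M" if "q \<in> Q" for q
      using lead_std_term[of q k l n w D] psubset.prems(1) that by blast
    then obtain L where L: "\<And>q. q \<in> Q \<Longrightarrow> wt.lead_at (n + w + 1) (?s (?T q)) (L q) \<and> std_label n w q (L q)"
      by metis
    let ?wt = "\<lambda>q. lin (uweight (n + w + 1)) (L q)"
    consider "Q = {}" | q where "q \<in> Q" "\<alpha> q = 0" | "Q \<noteq> {}" "\<forall>q\<in>Q. \<alpha> q \<noteq> 0" by blast
    then show ?case
    proof cases
      case 1
      then show ?thesis using psubset.prems(2) is_idealD(2)[OF I] by simp
    next
      case (2 q)
      have "g = (\<Sum>q\<in>Q - {q}. Poly_Mapping.single 0 (\<alpha> q) * ?T q)"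
        using psubset.prems(2) 2 psubset.hyps by (simp add: sum.remove)
      then show ?thesis using psubset.IH[of "Q - {q}" g] 2 psubset.prems by auto
    next
      case 3
      obtain q where q: "q \<in> Q" "\<And>q'. q' \<in> Q \<Longrightarrow> ?wt q \<le> ?wt q'"
        using ex_is_arg_min_if_finite[OF psubset.hyps 3(1), of ?wt] unfolding is_arg_min_linorder by auto
      \<comment> \<open>A key of the image of \<open>q'\<close> other than its leading label is
        heavier than that label, hence heavier than the minimum; equal labels would force
        \<open>q' = q\<close>.\<close>
      have other: "coef (?s (?T q')) (L q) = 0" if "q' \<in> Q" "q' \<noteq> q" for q'
      proof (rule ccontr)
        assume "coef (?s (?T q')) (L q) \<noteq> 0"
        then have k': "L q \<in> mkeys (?s (?T q'))" by (simp add: in_keys_iff)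
        have "L q \<noteq> L q'"
        proof
          assume eq: "L q = L q'"
          have "q = q'"
          proof (rule std_label_unique)
            show "q \<in> std_index k l n w D" "q' \<in> std_index k l n w D" using q(1) that(1) psubset.prems(1) by blast+
            show "std_label n w q (L q)" "std_label n w q' (L q)" using L[OF q(1)] L[OF that(1)] eq by simp_all
          qed
          then show False using that(2) by simp
        qed
        then have "?wt q' < ?wt q" using L[OF that(1)] k' by (auto simp: wt.lead_at_def)
        then show False using q(2)[OF that(1)] by simp
      qed
      have "coef (?s g) (L q) = (\<Sum>q'\<in>Q. \<alpha> q' * coef (?s (?T q')) (L q))"
      proof -
        have "?s g = (\<Sum>q'\<in>Q. Poly_Mapping.single 0 (\<alpha> q') * ?s (?T q'))"
          by (simp add: psubset.prems(2) subst_sum subst_mult subst_single)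
        then show ?thesis by (simp add: lookup_sum coef_single_mult[of 0 _ _ "L q", simplified])
      qed
      also have "\<dots> = \<alpha> q * coef (?s (?T q)) (L q)"
      proof -
        have "(\<Sum>q'\<in>Q - {q}. \<alpha> q' * coef (?s (?T q')) (L q)) = 0"
        proof (rule sum.neutral, rule ballI)
          fix q' assume "q' \<in> Q - {q}"
          then show "\<alpha> q' * coef (?s (?T q')) (L q) = 0" using other[of q'] by simp
        qed
        then show ?thesis by (simp add: sum.remove[OF psubset.hyps q(1)])
      qed
      also have "\<dots> \<noteq> 0" using 3(2) q(1) L[OF q(1)] by (auto simp: wt.lead_at_def in_keys_iff)
      finally have key: "L q \<in> mkeys (?s g)" by (simp add: in_keys_iff)
      obtain N Ss where NS: "q = (N, Ss)" by (cases q)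
      have ix: "(N, Ss) \<in> std_index k l n w D" using q(1) NS psubset.prems(1) by auto
      have ne: "Ss \<noteq> []" and fb: "set_minor n w (hd Ss) \<in> below \<delta>"
        using first_factor_below[OF \<delta> psubset.prems(3), of N Ss D "L q"] ix L[OF q(1)] key
        unfolding nw NS by auto
      have Ss: "set Ss \<subseteq> n_sets {1..n + w} n" "N \<in> monoms k l" using ix by (auto simp: std_index_def std_list_def)
      obtain S Ts where ST: "Ss = S # Ts" using ne by (cases Ss) auto
      obtain e where e: "e = 1 \<or> e = (-1 :: 'a mpoly)" "setdet n (ext_entry n w) S = e * minor_poly (set_minor n w S)"
        using setdet_ext_entry[of S n w] Ss ST by auto
      have "prod_list (map (setdet n (ext_entry n w)) Ts) \<in> (polys k l :: 'a mpoly set)"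
      proof (rule polys_prod_list)
        fix p :: "'a mpoly" assume "p \<in> set (map (setdet n (ext_entry n w)) Ts)"
        then obtain S' where "S' \<in> set Ts" "p = setdet n (ext_entry n w) S'" by auto
        moreover from this have "S' \<in> n_sets {1..n + w} n" using Ss(1) ST by auto
        ultimately show "p \<in> polys k l" using setdet_in_polys nwk by blast
      qed
      then have "mono_of N * prod_list (map (setdet n (ext_entry n w)) Ts) * e \<in> polys k l"
        using e(1) Ss(2) by (intro polys_mult) auto
      moreover have "minor_poly (set_minor n w S) \<in> ?I" using fb ST by (intro idl_gen) auto
      ultimately have "(mono_of N * prod_list (map (setdet n (ext_entry n w)) Ts) * e) * minor_poly (set_minor n w S) \<in> ?I"
        by (rule is_idealD(4)[OF I])
      then have T: "?T q \<in> ?I" by (simp add: std_term_def NS ST e(2) mult_ac)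
      let ?t = "Poly_Mapping.single 0 (\<alpha> q) * ?T q"
      have t: "?t \<in> ?I" using T by (intro is_idealD(4)[OF I]) auto
      have "g - ?t = (\<Sum>q\<in>Q - {q}. Poly_Mapping.single 0 (\<alpha> q) * ?T q)"
        using q(1) psubset.hyps by (simp add: psubset.prems(2) sum.remove)
      moreover have "g - ?t \<in> ?R" using psubset.prems(3) t sub by (intro is_idealD(5)[OF R]) auto
      ultimately have "g - ?t \<in> ?I" using psubset.IH[of "Q - {q}" "g - ?t"] q(1) psubset.prems(1) by auto
      then show ?thesis using is_idealD(3)[OF I _ t, of "g - ?t"] by simp
    qed
  qed
  show "?R \<subseteq> ?I"
  proof
    fix g assume g: "g \<in> ?R"
    then have "g \<in> polys k l" using is_idealD(1)[OF R] by auto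
    then obtain D Q \<alpha> where "finite Q" "Q \<subseteq> std_index k l n w D" "g = (\<Sum>q\<in>Q. Poly_Mapping.single 0 (\<alpha> q) * ?T q)"
      by (rule standard_expansion)
    then show "g \<in> ?I" using g by (rule main)
  qed
qed

section \<open>From rank conditions to arbitrary generalized ideals\<close>

lemma knutson_INT:
  assumes "finite A" "A \<noteq> {}" "\<And>i. i \<in> A \<Longrightarrow> I i \<in> knutson_ideals R f"
  shows "(\<Inter>i\<in>A. I i) \<in> knutson_ideals R f"
  using assms
proof (induction A rule: finite_ne_induct)
  case (insert i A)
  then have "I i \<inter> (\<Inter>i\<in>A. I i) \<in> knutson_ideals R f" by (intro knutson_ideals.inter) auto
  then show ?case by simp
qed simp

lemma strict_sorted_nth_ge:
  assumes "sorted_wrt (<) (xs :: nat list)" "set xs \<subseteq> {1..n}" "t < length xs"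
  shows "Suc t \<le> xs ! t"
  using assms(3)
proof (induction t)
  case 0
  then show ?case using nth_mem[of 0 xs] assms(2) by force
next
  case (Suc t)
  then show ?case using sorted_wrt_nth_less[OF assms(1), of t "Suc t"] by auto
qed

theorem below_ideal_knutson:
  assumes kl: "1 \<le> k" "1 \<le> l" "k \<le> l + 1" and \<delta>: "\<delta> \<in> minors k l"
  shows "idl k l (minor_poly ` below \<delta>) \<in> knutson_ideals (mat_poly_ring k l) (minors_product k l :: 'a::field mpoly)"
  unfolding below_ideal_eq_rank_ideal[OF \<delta>] rank_ideal_def
proof (intro knutson_INT knutson_ideals.inter)
  obtain c d where cd: "\<delta> = (c, d)" by (cases \<delta>)
  note P = minorsD[OF \<delta>[unfolded cd]]
  show "{..<length (fst \<delta>)} \<noteq> {}" using minors_length_pos[OF \<delta>] by auto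
  fix t assume t: "t \<in> {..<length (fst \<delta>)}"
  then have tc: "t < length c" "t < length d" using P(1) by (auto simp: cd)
  have ge: "Suc t \<le> c ! t" "Suc t \<le> d ! t"
    using strict_sorted_nth_ge[OF P(3,5) tc(1)] strict_sorted_nth_ge[OF P(4,6) tc(2)] by auto
  have le: "c ! t \<le> last c" "d ! t \<le> last d" "last c \<le> k" "last d \<le> l"
    using strict_sorted_nth_le_last[OF P(3) tc(1)] strict_sorted_nth_le_last[OF P(4) tc(2)]
      last_le_of_minors[OF \<delta>] by (simp_all add: cd)
  show "det_ideal k l {1..fst \<delta> ! t} {1..last (snd \<delta>)} (Suc t) \<in> knutson_ideals (mat_poly_ring k l) (minors_product k l :: 'a mpoly)"
    "det_ideal k l {1..last (fst \<delta>)} {1..snd \<delta> ! t} (Suc t) \<in> knutson_ideals (mat_poly_ring k l) (minors_product k l :: 'a mpoly)"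
    unfolding cd fst_conv snd_conv using ge le by (intro det_ideal_knutson[OF kl]; linarith)+
qed simp

lemma finite_minors: "finite (minors k l)"
proof -
  have fin: "finite {xs. sorted_wrt (<) xs \<and> set xs \<subseteq> {1..n::nat}}" for n
  proof (rule finite_subset)
    show "{xs. sorted_wrt (<) xs \<and> set xs \<subseteq> {1..n}} \<subseteq> {xs. set xs \<subseteq> {1..n} \<and> length xs \<le> n}"
    proof safe
      fix xs :: "nat list" assume "sorted_wrt (<) xs" "set xs \<subseteq> {1..n}"
      moreover from this have "card (set xs) \<le> card {1..n}" by (intro card_mono) auto
      ultimately show "length xs \<le> n" using distinct_card[of xs] by (simp add: strict_sorted_iff)
    qed
    show "finite {xs. set xs \<subseteq> {1..n} \<and> length xs \<le> n}" by (rule finite_lists_length_le) simp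
  qed
  show ?thesis
    by (rule finite_subset[OF _ finite_cartesian_product[OF fin[of k] fin[of l]]]) (auto simp: minors_def)
qed

lemma minor_le_refl: "minor_le \<delta> \<delta>"
  by (simp add: minor_le_def)

lemma in_below_self:
  assumes "\<delta> \<in> minors k l"
  shows "\<delta> \<in> below \<delta>"
proof -
  obtain c d where cd: "\<delta> = (c, d)" by (cases \<delta>)
  note P = minorsD[OF assms[unfolded cd]]
  have "set c \<subseteq> {1..last c}" "set d \<subseteq> {1..last d}"
    using P(5,6) strict_sorted_nth_le_last[OF P(3)] strict_sorted_nth_le_last[OF P(4)]
    by (force simp: in_set_conv_nth)+
  then show ?thesis using P by (auto simp: below_def minors_def minor_le_refl cd)
qed

lemma generalized_ideal_eq_UN_below:
  assumes "generalized_ideal k l \<Omega>"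
  shows "\<Omega> = (\<Union>\<delta>\<in>\<Omega>. below \<delta>)"
proof
  have sub: "\<Omega> \<subseteq> minors k l" using assms by (simp add: generalized_ideal_def)
  show "\<Omega> \<subseteq> (\<Union>\<delta>\<in>\<Omega>. below \<delta>)" using sub in_below_self by blast
  show "(\<Union>\<delta>\<in>\<Omega>. below \<delta>) \<subseteq> \<Omega>" using assms unfolding generalized_ideal_def below_def by blast
qed

text \<open>A union of generating sets gives a sum of ideals, and there are only finitely many
  minors. Nonemptiness enters because every Knutson ideal contains the nonzero \<open>f\<close>,
  while the empty set generates the zero ideal.\<close>

theorem generalized_poset_ideal_knutson:
  assumes kl: "1 \<le> k" "1 \<le> l" "k \<le> l + 1" and \<Omega>: "generalized_ideal k l \<Omega>" "\<Omega> \<noteq> {}"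
  shows "(generalized_poset_ideal k l \<Omega> :: 'a::field mpoly set)
    \<in> knutson_ideals (mat_poly_ring k l) (minors_product k l)"
proof -
  have sub: "\<Omega> \<subseteq> minors k l" using \<Omega>(1) by (simp add: generalized_ideal_def)
  have polys: "minor_poly ` A \<subseteq> (polys k l :: 'a mpoly set)" if "A \<subseteq> minors k l" for A
    using that minor_poly_in_polys by blast
  have "idl k l (minor_poly ` (\<Union>\<delta>\<in>A. below \<delta>)) \<in> knutson_ideals (mat_poly_ring k l) (minors_product k l :: 'a mpoly)"
    if "finite A" "A \<noteq> {}" "A \<subseteq> minors k l" for A
    using that
  proof (induction A rule: finite_ne_induct)
    case (singleton \<delta>)
    then show ?case using below_ideal_knutson[OF kl] by simp
  next
    case (insert \<delta> A)
    have "idl k l (minor_poly ` below \<delta> \<union> minor_poly ` (\<Union>\<delta>\<in>A. below \<delta>)) \<in> knutson_ideals (mat_poly_ring k l) (minors_product k l :: 'a mpoly)"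
    proof (rule knutson_idl_Un)
      show "minor_poly ` below \<delta> \<subseteq> (polys k l :: 'a mpoly set)"
        using insert.prems by (intro polys below_subset) auto
      have "(\<Union>\<delta>\<in>A. below \<delta>) \<subseteq> minors k l" using below_subset insert.prems by blast
      then show "minor_poly ` (\<Union>\<delta>\<in>A. below \<delta>) \<subseteq> (polys k l :: 'a mpoly set)" by (rule polys)
    qed (use insert below_ideal_knutson[OF kl, of \<delta>] in auto)
    then show ?case by (simp add: image_Un)
  qed
  from this[of \<Omega>] show ?thesis
    using \<Omega> sub finite_subset[OF sub finite_minors]
    by (simp add: generalized_poset_ideal_def genideal_eq_idl[OF polys] flip: generalized_ideal_eq_UN_below)
qed

section \<open>Frobenius splittings\<close>

abbreviation rep_monom :: "nat \<Rightarrow> ('v \<Rightarrow>\<^sub>0 nat) \<Rightarrow> ('v \<Rightarrow>\<^sub>0 nat)" where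
  "rep_monom c m \<equiv> (\<Sum>i<c. m)"

lemma coef_rep_monom [simp]: "coef (rep_monom c m) v = c * coef m v"
  by (simp add: lookup_sum)

lemma coef_full_monom: "coef (full_monom k l) v = of_bool (v \<in> {1..k} \<times> {1..l})"
  by (simp add: full_monom_def lookup_sum lookup_single when_def)

lemma full_monom_in_monoms: "full_monom k l \<in> monoms k l"
  unfolding full_monom_def by (intro monoms_sum) simp

lemma rep_monom_in_monoms: "m \<in> monoms k l \<Longrightarrow> rep_monom c m \<in> monoms k l"
  by (intro monoms_sum)

text \<open>\<open>\<tau>\<close> splits the Frobenius map of the coefficient field. For a perfect
  field it is the \<open>p\<close>-th root, but the field is arbitrary here.\<close>

locale frobenius_splitting =
  fixes \<tau> :: "'a::field \<Rightarrow> 'a" and p :: nat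
  assumes p_eq: "p = CHAR('a)" and p_pos: "0 < p"
    and \<tau>_add: "\<tau> (a + b) = \<tau> a + \<tau> b" and \<tau>_scale: "\<tau> (a ^ p * b) = a * \<tau> b" and \<tau>_1: "\<tau> 1 = 1"

text \<open>The field is a vector space over itself with scalars acting through their
  \<open>p\<close>-th powers; a linear functional that is 1 at 1 exists by extending
  \<open>{1}\<close> to a basis.\<close>

lemma ex_frobenius_splitting:
  assumes "CHAR('a::field) > 0"
  shows "\<exists>\<tau>. frobenius_splitting (\<tau> :: 'a \<Rightarrow> 'a) CHAR('a)"
proof -
  let ?p = "CHAR('a)"
  have prime: "Factorial_Ring.prime ?p" using assms by (rule prime_CHAR_semidom)
  interpret vector_space_pair "\<lambda>a b. a ^ ?p * b :: 'a" "(*) :: 'a \<Rightarrow> 'a \<Rightarrow> 'a"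
    using freshmans_dream[OF prime refl]
    by unfold_locales (simp_all add: distrib_left distrib_right power_mult_distrib mult.assoc)
  have "vs1.independent {1 :: 'a}"
    unfolding vs1.dependent_finite[OF finite.insertI[OF finite.emptyI]] using assms by simp
  then obtain \<tau> :: "'a \<Rightarrow> 'a" where "Vector_Spaces.linear (\<lambda>a b. a ^ ?p * b) (*) \<tau>" "\<tau> 1 = 1"
    using linear_independent_extend[of "{1 :: 'a}" "\<lambda>_. 1"] by auto
  then show ?thesis
    using assms linear_add linear_scale
    by (intro exI[of _ \<tau>]) (unfold_locales, auto)
qed

context frobenius_splitting
begin

lemma prime_p: "Factorial_Ring.prime p"
  using prime_CHAR_semidom[where 'a = 'a] p_eq p_pos by simp

lemma \<tau>_0 [simp]: "\<tau> 0 = 0"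
  using \<tau>_add[of 0 0] by (metis add.right_neutral add_left_cancel)

lemma CHAR_mpoly: "CHAR('a mpoly) = p"
proof (rule CHAR_eqI)
  have of_nat: "(of_nat n :: 'a mpoly) = Poly_Mapping.single 0 (of_nat n)" for n
  proof (induction n)
    case (Suc n)
    then show ?case by (simp only: of_nat_Suc single_add single_one)
  qed simp
  show "of_nat p = (0 :: 'a mpoly)" by (simp add: of_nat p_eq)
  show "p dvd n" if "of_nat n = (0 :: 'a mpoly)" for n
  proof -
    have "Poly_Mapping.single 0 (of_nat n :: 'a) = (0 :: 'a mpoly)" using that by (simp only: of_nat)
    then have "coef (Poly_Mapping.single 0 (of_nat n :: 'a) :: 'a mpoly) 0 = 0" by (simp only: lookup_zero)
    then have "of_nat n = (0 :: 'a)" by (simp only: lookup_single_eq)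
    then show ?thesis by (simp only: p_eq of_nat_eq_0_iff_char_dvd)
  qed
qed

lemma mpoly_power_sum: "(\<Sum>i\<in>A. f i :: 'a mpoly) ^ p = (\<Sum>i\<in>A. f i ^ p)"
  using prime_p CHAR_mpoly by (intro freshmans_dream_sum) auto

text \<open>Inside the matrix all exponents are \<open>p - 1\<close> modulo \<open>p\<close>: the
  monomials on which the usual trace of the Frobenius map does not vanish.\<close>

definition twist :: "nat \<Rightarrow> nat \<Rightarrow> monom \<Rightarrow> monom" where
  "twist k l n = rep_monom p n + rep_monom (p - 1) (full_monom k l)"

lemma inj_twist: "inj (twist k l)"
proof (rule injI, rule poly_mapping_eqI)
  fix m n v assume "twist k l m = twist k l n"
  then have "coef (twist k l m) v = coef (twist k l n) v" by simp
  then show "coef m v = coef n v" using p_pos by (simp add: twist_def lookup_add)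
qed

definition trace :: "nat \<Rightarrow> nat \<Rightarrow> 'a mpoly \<Rightarrow> 'a mpoly" where
  "trace k l h = Poly_Mapping.map \<tau> (Poly_Mapping.map_key (twist k l) h)"

lemma coef_trace: "coef (trace k l h) n = \<tau> (coef h (twist k l n))"
  by (simp add: trace_def map.rep_eq map_key.rep_eq[OF inj_twist] when_def)

lemma trace_add: "trace k l (g + h) = trace k l g + trace k l h"
  by (rule poly_mapping_eqI) (simp add: coef_trace lookup_add \<tau>_add)

lemma trace_0 [simp]: "trace k l 0 = 0"
  by (rule poly_mapping_eqI) (simp add: coef_trace)

lemma trace_sum: "trace k l (\<Sum>i\<in>A. f i) = (\<Sum>i\<in>A. trace k l (f i))"
  by (induction A rule: infinite_finite_induct) (simp_all add: trace_add)

lemma twist_in_monoms: "twist k l n \<in> monoms k l \<longleftrightarrow> n \<in> monoms k l"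
proof -
  have "rep_monom p n \<in> monoms k l \<longleftrightarrow> n \<in> monoms k l"
  proof
    assume "rep_monom p n \<in> monoms k l"
    moreover have "rep_monom p n = n + rep_monom (p - 1) n"
      using p_pos by (intro poly_mapping_eqI) (simp add: lookup_add mult_eq_if)
    ultimately show "n \<in> monoms k l" by simp
  qed (rule rep_monom_in_monoms)
  then show ?thesis using full_monom_in_monoms rep_monom_in_monoms by (auto simp: twist_def)
qed

lemma trace_in_polys:
  assumes "h \<in> polys k l"
  shows "trace k l h \<in> polys k l"
proof -
  have "n \<in> monoms k l" if "n \<in> mkeys (trace k l h)" for n
  proof -
    have "twist k l n \<in> mkeys h" using that \<tau>_0 by (metis coef_trace in_keys_iff)
    then have "twist k l n \<in> monoms k l" using assms by (auto simp: polys_def)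
    then show ?thesis by (simp only: twist_in_monoms)
  qed
  then show ?thesis by (auto simp: polys_def)
qed

text \<open>
  A monomial that does not divide \<open>n\<close> has no \<open>p\<close>-th power dividing the twisted monomial, since the
  exponents of the full monomial are at most \<open>1\<close>.
\<close>

lemma trace_power_single_mult:
  "trace k l (Poly_Mapping.single m a ^ p * g) = Poly_Mapping.single m a * trace k l g"
proof (rule poly_mapping_eqI)
  fix n
  have pow: "Poly_Mapping.single m a ^ p = Poly_Mapping.single (rep_monom p m) (a ^ p)"
    by (induction p) (simp_all add: mult_single add.commute flip: single_one)
  show "coef (trace k l (Poly_Mapping.single m a ^ p * g)) n = coef (Poly_Mapping.single m a * trace k l g) n"
  proof (cases "\<exists>b. n = m + b")
    case True
    then obtain b where b: "n = m + b" by blast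
    have "twist k l n = rep_monom p m + twist k l b"
      by (simp add: twist_def b sum.distrib add.assoc)
    then show ?thesis
      by (simp add: coef_trace pow coef_single_mult \<tau>_scale b)
  next
    case False
    then obtain v where v: "coef n v < coef m v" unfolding monom_finite_le by (auto simp: not_le)
    have "twist k l n \<noteq> rep_monom p m + b" for b
    proof
      assume "twist k l n = rep_monom p m + b"
      then have "coef (twist k l n) v = coef (rep_monom p m + b) v" by simp
      then have "p * coef n v + (p - 1) * coef (full_monom k l) v = p * coef m v + coef b v"
        by (simp add: twist_def lookup_add)
      moreover have "(p - 1) * coef (full_monom k l) v \<le> p - 1" by (simp add: coef_full_monom)
      moreover have "p * coef n v + p \<le> p * coef m v"
        using mult_le_mono2[of "Suc (coef n v)" "coef m v" p] v by (simp add: add.commute)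
      ultimately show False using p_pos by linarith
    qed
    then show ?thesis
      using False by (simp add: coef_trace pow coef_single_mult_0)
  qed
qed

lemma trace_power_mult: "trace k l (h ^ p * g) = h * trace k l g"
proof -
  have "trace k l (h ^ p * g) = trace k l ((\<Sum>m\<in>mkeys h. Poly_Mapping.single m (coef h m)) ^ p * g)"
    by (simp flip: poly_eq_sum_single)
  also have "\<dots> = (\<Sum>m\<in>mkeys h. Poly_Mapping.single m (coef h m) * trace k l g)"
    by (simp only: mpoly_power_sum sum_distrib_right trace_sum trace_power_single_mult)
  also have "\<dots> = (\<Sum>m\<in>mkeys h. Poly_Mapping.single m (coef h m)) * trace k l g"
    by (simp add: sum_distrib_right)
  finally show ?thesis by (simp flip: poly_eq_sum_single)
qed

text \<open>The leading monomial of \<open>f ^ (p - 1)\<close> is \<open>twist k l 0\<close>,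
  because that of \<open>f\<close> is \<open>full_monom k l\<close>; dividing by its coefficient
  normalizes the value at 1.\<close>

definition split_map :: "nat \<Rightarrow> nat \<Rightarrow> 'a mpoly \<Rightarrow> 'a mpoly" where
  "split_map k l g = trace k l (Poly_Mapping.single 0 (inverse (coef (minors_product k l) (full_monom k l) ^ (p - 1))) *
     minors_product k l ^ (p - 1) * g)"

lemma split_map_add: "split_map k l (g + h) = split_map k l g + split_map k l h"
  by (simp add: split_map_def distrib_left trace_add)

lemma split_map_power_mult: "split_map k l (h ^ p * g) = h * split_map k l g"
  unfolding split_map_def by (simp only: mult.left_commute[of _ "h ^ p"] trace_power_mult)

lemma split_map_0 [simp]: "split_map k l 0 = 0"
  by (simp add: split_map_def)

context
  fixes k l :: nat
  assumes kl: "1 \<le> k" "1 \<le> l" "k \<le> l + 1"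
begin

lemma split_map_in_polys: "g \<in> polys k l \<Longrightarrow> split_map k l g \<in> polys k l"
  unfolding split_map_def using minors_product_in_polys[OF kl]
  by (intro trace_in_polys polys_mult polys_power polys_single) auto

text \<open>Multiplication by \<open>f ^ (p - 1)\<close> moves the leading monomial to
  \<open>twist k l n\<close>, and \<open>twist\<close> preserves the order, so nothing above
  \<open>n\<close> survives the trace.\<close>

lemma lead_split_map:
  assumes ao: "adiag_order k l prec" and g: "monom_order.lead_at prec g (rep_monom p n)" "g \<in> polys k l"
    "coef g (rep_monom p n) = 1" and n: "n \<in> monoms k l"
  shows "monom_order.lead_at prec (split_map k l g) n" "coef (split_map k l g) n = 1"
proof -
  interpret adiag_order k l prec by (rule ao)
  let ?f = "minors_product k l :: 'a mpoly" and ?F = "full_monom k l"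
  let ?c = "inverse (coef ?f ?F ^ (p - 1))"
  let ?h = "Poly_Mapping.single 0 ?c * ?f ^ (p - 1) * g"
  have lf: "lead_at ?f ?F" using lead_minors_product[OF kl] .
  then have c0: "coef ?f ?F \<noteq> 0" by (auto simp: lead_at_def in_keys_iff)
  have fM: "mkeys ?f \<subseteq> monoms k l" using minors_product_in_polys[OF kl] by (auto simp: polys_def)
  note lfp = lead_at_power[OF lf fM, of "p - 1"]
  have l1: "lead_at (Poly_Mapping.single 0 ?c * ?f ^ (p - 1)) (0 + rep_monom (p - 1) ?F)"
    "coef (Poly_Mapping.single 0 ?c * ?f ^ (p - 1)) (0 + rep_monom (p - 1) ?F) = ?c * coef ?f ?F ^ (p - 1)"
    using lead_at_mult[of "Poly_Mapping.single 0 ?c" 0, OF _ _ lfp(1,3)] c0 lfp(2) by (simp_all split: if_splits)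
  have k1: "mkeys (Poly_Mapping.single 0 ?c * ?f ^ (p - 1)) \<subseteq> monoms k l"
    using polys_mult[OF polys_single[OF monoms_0] polys_power[OF minors_product_in_polys[OF kl]]]
    by (simp add: polys_def)
  have gM: "mkeys g \<subseteq> monoms k l" using g(2) by (simp add: polys_def)
  have lh: "lead_at ?h (twist k l n)" "coef ?h (twist k l n) = 1"
    using lead_at_mult[OF l1(1) k1 g(1) gM] l1(2) g(3) c0 by (simp_all add: twist_def add.commute)
  show c1: "coef (split_map k l g) n = 1"
    unfolding split_map_def coef_trace lh(2) \<tau>_1 ..
  show "lead_at (split_map k l g) n"
    unfolding lead_at_def
  proof (intro conjI ballI impI)
    show "n \<in> mkeys (split_map k l g)" using c1 by (simp add: in_keys_iff)
    fix m assume m: "m \<in> mkeys (split_map k l g)" "m \<noteq> n"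
    have mM: "m \<in> monoms k l" using split_map_in_polys[OF g(2)] m(1) by (auto simp: polys_def)
    have "coef ?h (twist k l m) \<noteq> 0"
      using m(1) \<tau>_0 by (metis coef_trace in_keys_iff split_map_def)
    moreover have "twist k l m \<noteq> twist k l n" using m(2) inj_twist by (auto dest: injD)
    ultimately have less: "prec (twist k l m) (twist k l n)" using lh(1) by (auto simp: lead_at_def in_keys_iff)
    show "prec m n"
    proof (rule ccontr)
      assume "\<not> prec m n"
      then have nm: "prec n m" using total[OF mM n m(2)] by blast
      have "prec (rep_monom c n) (rep_monom c m)" if "0 < c" for c
        using that
      proof (induction c rule: nat_induct_non_zero)
        case (Suc c)
        then show ?case
          using prec_add_right_less[OF _ _ _ _ nm, of "rep_monom c n" "rep_monom c m"] n mM
          by (simp add: add.commute rep_monom_in_monoms)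
      qed (simp add: nm)
      from this[OF p_pos] have "prec (twist k l n) (twist k l m)"
        unfolding twist_def using n mM by (intro mono) (auto intro: rep_monom_in_monoms full_monom_in_monoms)
      then show False
        using less irrefl trans[of "twist k l n" "twist k l m" "twist k l n"] n mM
        by (auto simp: twist_in_monoms)
    qed
  qed
qed

text \<open>The leading monomial of 1 is \<open>0\<close>, which \<open>lead_split_map\<close> keeps
  with coefficient 1, and \<open>deglex\<close> has no monomial below \<open>0\<close>.\<close>

lemma split_map_1: "split_map k l 1 = 1"
proof (rule poly_mapping_eqI)
  fix n
  have ao: "adiag_order k l deglex" by unfold_locales
  have r: "rep_monom p 0 = (0 :: monom)" by simp
  note L = lead_split_map[OF ao, of 1 0, unfolded r]
  have lead: "deglex.lead_at (split_map k l 1) 0" "coef (split_map k l 1) 0 = 1"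
    by (rule L; simp add: deglex.lead_at_one)+
  show "coef (split_map k l 1) n = coef 1 n"
  proof (cases "n = 0")
    case True
    then show ?thesis using lead(2) by simp
  next
    case False
    have "\<not> deglex n 0"
    proof
      assume "deglex n 0"
      then have "total_deg n = 0" by (auto simp: deglex_def)
      moreover obtain v where "v \<in> mkeys n" using False keys_eq_empty[of n] by blast
      ultimately show False using lin_pos[of v n "\<lambda>_. 1"] by simp
    qed
    then have "n \<notin> mkeys (split_map k l 1)" using lead(1) False by (auto simp: deglex.lead_at_def)
    then show ?thesis using False by (simp add: in_keys_iff lookup_one)
  qed
qed

text \<open>On the principal ideal, \<open>f ^ (p - 1)\<close> times a multiple of \<open>f\<close>
  is a multiple of \<open>f ^ p\<close>, and the trace extracts \<open>f\<close>. For a colon ideal,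
  \<open>j\<close> times the image of \<open>g\<close> is the image of \<open>j ^ p * g\<close>,
  which is a multiple of \<open>g * j\<close>. Sums use additivity.\<close>

theorem split_map_compatible:
  assumes "I \<in> knutson_ideals (mat_poly_ring k l) (minors_product k l)" "g \<in> I"
  shows "split_map k l g \<in> I"
  using assms
proof (induction arbitrary: g rule: knutson_ideals.induct)
  case principal
  let ?f = "minors_product k l :: 'a mpoly"
  let ?c = "Poly_Mapping.single 0 (inverse (coef ?f (full_monom k l) ^ (p - 1))) :: 'a mpoly"
  obtain h where h: "g = h * ?f" "h \<in> polys k l" using principal unfolding cgenideal_eq by auto
  have "split_map k l g = trace k l (?f ^ p * (?c * h))"
  proof -
    have "?c * ?f ^ (p - 1) * g = ?f ^ p * (?c * h)"
      using p_pos by (simp add: h(1) power_eq_if mult_ac)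
    then show ?thesis unfolding split_map_def by (rule arg_cong)
  qed
  also have "\<dots> = trace k l (?c * h) * ?f" by (simp add: trace_power_mult mult.commute)
  finally have "split_map k l g = trace k l (?c * h) * ?f" .
  moreover have "trace k l (?c * h) \<in> polys k l" using h(2) by (intro trace_in_polys polys_mult) auto
  ultimately show ?case unfolding cgenideal_eq by blast
next
  case (colon I J)
  have I: "is_ideal k l I" using knutson_is_ideal[OF colon.hyps(1) minors_product_in_polys[OF kl]] .
  have J: "J \<subseteq> polys k l" using colon.hyps(2) is_idealD(1) by (auto simp: ideal_iff_is_ideal)
  have g: "g \<in> polys k l" "\<And>j. j \<in> J \<Longrightarrow> g * j \<in> I" using colon.prems by (auto simp: colon_ideal_def)
  have "split_map k l g * j \<in> I" if j: "j \<in> J" for j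
  proof -
    have m: "j ^ (p - 1) * (g * j) \<in> I" using J j by (intro is_idealD(4)[OF I] g(2)) auto
    have e: "j ^ (p - 1) * (g * j) = j ^ p * g" using p_pos by (simp add: power_eq_if mult_ac)
    from m[unfolded e] have "split_map k l (j ^ p * g) \<in> I" by (rule colon.IH)
    then show ?thesis unfolding split_map_power_mult by (simp only: mult.commute)
  qed
  then show ?case using split_map_in_polys[OF g(1)] by (simp add: colon_ideal_def)
next
  case (add I J)
  then show ?case by (fastforce simp: set_add_eq split_map_add)
qed auto

subsection \<open>Leading monomials of compatible ideals\<close>

text \<open>For large \<open>N\<close> the monomial \<open>m\<close> divides the
  \<open>p ^ N\<close>-th power of its radical \<open>s\<close>. A multiple of \<open>g\<close> has
  that power as leading monomial, and \<open>N\<close> applications of the splitting bring it down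
  to \<open>s\<close>.\<close>

theorem compatible_lead_radical:
  assumes I: "is_ideal k l I" and comp: "\<And>g. g \<in> I \<Longrightarrow> split_map k l g \<in> I"
    and ao: "adiag_order k l prec" and g: "g \<in> I" "monom_order.lead_at prec g m" and s: "\<And>v. coef s v = of_bool (v \<in> mkeys m)"
  shows "\<exists>g'\<in>I. monom_order.lead_at prec g' s"
proof -
  interpret adiag_order k l prec by (rule ao)
  have mM: "m \<in> monoms k l" using g is_idealD(1)[OF I] by (auto simp: lead_at_def polys_def)
  have "mkeys s = mkeys m" using s by (auto simp: in_keys_iff)
  then have sM: "s \<in> monoms k l" using mM by (simp add: monoms_def)
  have desc: "\<exists>g'\<in>I. lead_at g' s" if "g \<in> I" "lead_at g (rep_monom (p ^ N) s)" for N g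
    using that
  proof (induction N arbitrary: g)
    case (Suc N)
    let ?n = "rep_monom (p ^ N) s"
    have e: "rep_monom (p ^ Suc N) s = rep_monom p ?n" by (rule poly_mapping_eqI) (simp add: mult.assoc)
    let ?c = "coef g (rep_monom p ?n)"
    let ?g = "Poly_Mapping.single 0 (inverse ?c) * g"
    have c0: "?c \<noteq> 0" using Suc.prems(2) e by (auto simp: lead_at_def in_keys_iff)
    have gI: "?g \<in> I" using Suc.prems(1) by (intro is_idealD(4)[OF I]) auto
    have lead: "lead_at g (rep_monom p ?n)" using Suc.prems(2) unfolding e .
    have gM: "mkeys g \<subseteq> monoms k l" using Suc.prems(1) is_idealD(1)[OF I] by (auto simp: polys_def)
    have "lead_at (Poly_Mapping.single 0 (inverse ?c)) (0 :: monom)" using c0 by simp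
    then have lg: "lead_at ?g (rep_monom p ?n)" "coef ?g (rep_monom p ?n) = 1"
      using lead_at_mult[of "Poly_Mapping.single 0 (inverse ?c)" 0 g "rep_monom p ?n", OF _ _ lead gM] c0
      by (auto split: if_splits)
    have "lead_at (split_map k l ?g) ?n"
      using gI is_idealD(1)[OF I] sM by (intro lead_split_map(1)[OF ao lg(1) _ lg(2)] rep_monom_in_monoms) auto
    then show ?case using Suc.IH[OF comp[OF gI]] by blast
  qed auto
  \<comment> \<open>The degree of \<open>m\<close> will do, since
    \<open>d \<le> 2 ^ d \<le> p ^ d\<close>.\<close>
  obtain N where N: "\<And>v. coef m v \<le> p ^ N * coef s v"
  proof -
    have p2: "2 \<le> p" using prime_p prime_ge_2_nat by blast
    have "coef m v \<le> p ^ total_deg m * coef s v" for v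
    proof (cases "v \<in> mkeys m")
      case True
      have "coef m v \<le> total_deg m" by (rule coef_le_total_deg)
      also have "\<dots> \<le> 2 ^ total_deg m" using less_exp by (rule less_imp_le)
      also have "\<dots> \<le> p ^ total_deg m" using p2 by (rule power_mono) simp
      finally show ?thesis using True by (simp add: s)
    qed (simp add: in_keys_iff)
    then show ?thesis by (rule that)
  qed
  have "\<exists>a. rep_monom (p ^ N) s = m + a" unfolding monom_finite_le using N by simp
  then obtain a where a: "rep_monom (p ^ N) s = m + a" by blast
  then have aM: "a \<in> monoms k l" using rep_monom_in_monoms[OF sM, of "p ^ N"] by simp
  have gM: "mkeys g \<subseteq> monoms k l" using g(1) is_idealD(1)[OF I] by (auto simp: polys_def)
  have "lead_at (mono_of a * g) (a + m)"
    using lead_at_mult(1)[of "mono_of a" a g m] g(2) gM aM by simp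
  moreover have "mono_of a * g \<in> I" using g(1) aM by (intro is_idealD(4)[OF I]) auto
  ultimately show ?thesis using desc[of "mono_of a * g" N] a by (simp add: add.commute)
qed

end

end

subsection \<open>F-purity from a splitting of the Frobenius map\<close>

definition tensor_gens ::
  "('s, 'x) ring_scheme \<Rightarrow> ('s, 'n) module \<Rightarrow> ('s, 'm) module \<Rightarrow> ('n \<times> 'm \<Rightarrow>\<^sub>0 int) set" where
  "tensor_gens S N M =
     {frag_of (x \<oplus>\<^bsub>N\<^esub> x', y) - frag_of (x, y) - frag_of (x', y) | x x' y.
         x \<in> carrier N \<and> x' \<in> carrier N \<and> y \<in> carrier M} \<union>
      {frag_of (x, y \<oplus>\<^bsub>M\<^esub> y') - frag_of (x, y) - frag_of (x, y') | x y y'.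
         x \<in> carrier N \<and> y \<in> carrier M \<and> y' \<in> carrier M} \<union>
      {frag_of (s \<odot>\<^bsub>N\<^esub> x, y) - frag_of (x, s \<odot>\<^bsub>M\<^esub> y) | s x y.
         s \<in> carrier S \<and> x \<in> carrier N \<and> y \<in> carrier M}"

lemma tensor_rels_eq: "tensor_rels S N M = generate (free_Abelian_group (carrier N \<times> carrier M)) (tensor_gens S N M)"
  by (simp add: tensor_rels_def tensor_gens_def)

lemma keys_diff_in: "a \<in> A \<Longrightarrow> b \<in> A \<Longrightarrow> c \<in> A \<Longrightarrow> mkeys (frag_of a - frag_of b - frag_of c) \<subseteq> A"
  "a \<in> A \<Longrightarrow> b \<in> A \<Longrightarrow> mkeys (frag_of a - frag_of b) \<subseteq> A"
proof -
  have 1: "mkeys (frag_of a - frag_of b) \<subseteq> A" if "a \<in> A" "b \<in> A" for a b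
    by (rule order_trans[OF keys_minus_subset]) (use that in auto)
  show "a \<in> A \<Longrightarrow> b \<in> A \<Longrightarrow> mkeys (frag_of a - frag_of b) \<subseteq> A" by (rule 1)
  show "a \<in> A \<Longrightarrow> b \<in> A \<Longrightarrow> c \<in> A \<Longrightarrow> mkeys (frag_of a - frag_of b - frag_of c) \<subseteq> A"
    by (rule order_trans[OF keys_minus_subset]) (use 1[of a b] in auto)
qed

lemma tensor_gens_keys:
  assumes "\<And>x x'. x \<in> carrier N \<Longrightarrow> x' \<in> carrier N \<Longrightarrow> x \<oplus>\<^bsub>N\<^esub> x' \<in> carrier N"
    and "\<And>y y'. y \<in> carrier M \<Longrightarrow> y' \<in> carrier M \<Longrightarrow> y \<oplus>\<^bsub>M\<^esub> y' \<in> carrier M"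
    and "\<And>s x. s \<in> carrier S \<Longrightarrow> x \<in> carrier N \<Longrightarrow> s \<odot>\<^bsub>N\<^esub> x \<in> carrier N"
    and "\<And>s y. s \<in> carrier S \<Longrightarrow> y \<in> carrier M \<Longrightarrow> s \<odot>\<^bsub>M\<^esub> y \<in> carrier M"
    and "g \<in> tensor_gens S N M"
  shows "mkeys g \<subseteq> carrier N \<times> carrier M"
  using assms(5) unfolding tensor_gens_def
  by (elim UnE CollectE exE conjE) (simp_all add: keys_diff_in assms(1-4))

text \<open>
  A splitting \<open>\<sigma>\<close> of the Frobenius map is linear from \<open>F\<^sub>* S\<close> to \<open>S\<close>, hence induces a left
  inverse of the tensored Frobenius map.
\<close>

theorem pure_of_splitting:
  fixes S :: "('s, 'x) ring_scheme"
  assumes S: "cring S"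
    and \<sigma>: "\<And>x. x \<in> carrier S \<Longrightarrow> \<sigma> x \<in> carrier S"
      "\<And>x y. x \<in> carrier S \<Longrightarrow> y \<in> carrier S \<Longrightarrow> \<sigma> (x \<oplus>\<^bsub>S\<^esub> y) = \<sigma> x \<oplus>\<^bsub>S\<^esub> \<sigma> y"
      "\<And>s x. s \<in> carrier S \<Longrightarrow> x \<in> carrier S \<Longrightarrow> \<sigma> ((s [^]\<^bsub>S\<^esub> p) \<otimes>\<^bsub>S\<^esub> x) = s \<otimes>\<^bsub>S\<^esub> \<sigma> x"
      "\<sigma> \<one>\<^bsub>S\<^esub> = \<one>\<^bsub>S\<^esub>"
  shows "pure_map TYPE('m) S (regular_module S) (frobenius_module p S) (\<lambda>x. x [^]\<^bsub>S\<^esub> p)"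
  unfolding pure_map_def
proof (intro allI impI)
  fix M :: "('s, 'm) module" assume M: "Module.module S M"
  interpret S: cring S by (rule S)
  interpret M: Module.module S M by (rule M)
  let ?N = "regular_module S" and ?N' = "frobenius_module p S"
  let ?X = "carrier S \<times> carrier M"
  let ?A = "free_Abelian_group ?X"
  let ?G = "tensor_gens S ?N M" and ?G' = "tensor_gens S ?N' M"
  let ?H = "generate ?A ?G" and ?H' = "generate ?A ?G'"
  let ?\<Phi> = "frag_extend (\<lambda>(x, y). frag_of (x [^]\<^bsub>S\<^esub> p, y)) :: ('s \<times> 'm \<Rightarrow>\<^sub>0 int) \<Rightarrow> _"
  let ?\<Psi> = "frag_extend (\<lambda>(x, y). frag_of (\<sigma> x, y)) :: ('s \<times> 'm \<Rightarrow>\<^sub>0 int) \<Rightarrow> _"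
  have cN: "carrier ?N = carrier S" "carrier ?N' = carrier S" by (simp_all add: regular_module_def frobenius_module_def)
  have H: "tensor_rels S ?N M = ?H" "tensor_rels S ?N' M = ?H'" by (simp_all add: tensor_rels_eq cN)
  have Gk: "mkeys g \<subseteq> ?X" if "g \<in> ?G" for g
    using tensor_gens_keys[OF _ _ _ _ that] by (simp add: regular_module_def)
  have G'k: "mkeys g \<subseteq> ?X" if "g \<in> ?G'" for g
    using tensor_gens_keys[OF _ _ _ _ that] by (simp add: frobenius_module_def)
  have sub: "subgroup ?H ?A"
    using Gk by (intro group.generate_is_subgroup) auto
  have zero: "0 \<in> ?H'" using generate.one[of ?A ?G'] by simp
  have gens: "?\<Psi> g \<in> ?G" if "g \<in> ?G'" for g
    using that[unfolded tensor_gens_def]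
  proof (elim UnE CollectE exE conjE)
    fix x x' y assume "g = frag_of (x \<oplus>\<^bsub>?N'\<^esub> x', y) - frag_of (x, y) - frag_of (x', y)"
      "x \<in> carrier ?N'" "x' \<in> carrier ?N'" "y \<in> carrier M"
    moreover from this have "?\<Psi> g = frag_of (\<sigma> x \<oplus>\<^bsub>?N\<^esub> \<sigma> x', y) - frag_of (\<sigma> x, y) - frag_of (\<sigma> x', y)"
      using \<sigma>(2) by (simp add: frag_extend_diff regular_module_def frobenius_module_def)
    ultimately show "?\<Psi> g \<in> ?G" using \<sigma>(1) unfolding tensor_gens_def cN by blast
  next
    fix x y y' assume "g = frag_of (x, y \<oplus>\<^bsub>M\<^esub> y') - frag_of (x, y) - frag_of (x, y')"
      "x \<in> carrier ?N'" "y \<in> carrier M" "y' \<in> carrier M"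
    moreover from this have "?\<Psi> g = frag_of (\<sigma> x, y \<oplus>\<^bsub>M\<^esub> y') - frag_of (\<sigma> x, y) - frag_of (\<sigma> x, y')"
      by (simp add: frag_extend_diff)
    ultimately show "?\<Psi> g \<in> ?G" using \<sigma>(1) unfolding tensor_gens_def cN by blast
  next
    fix s x y assume "g = frag_of (s \<odot>\<^bsub>?N'\<^esub> x, y) - frag_of (x, s \<odot>\<^bsub>M\<^esub> y)"
      "s \<in> carrier S" "x \<in> carrier ?N'" "y \<in> carrier M"
    moreover from this have "?\<Psi> g = frag_of (s \<odot>\<^bsub>?N\<^esub> \<sigma> x, y) - frag_of (\<sigma> x, s \<odot>\<^bsub>M\<^esub> y)"
      using \<sigma>(3) by (simp add: frag_extend_diff regular_module_def frobenius_module_def)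
    ultimately show "?\<Psi> g \<in> ?G" using \<sigma>(1) unfolding tensor_gens_def cN by blast
  qed
  have \<Psi>H: "?\<Psi> h \<in> ?H" if "h \<in> ?H'" for h
    using that
  proof (induction rule: generate.induct)
    case one
    then show ?case using generate.one[of ?A ?G] by simp
  next
    case (incl h)
    then show ?case by (intro generate.incl gens)
  next
    case (inv h)
    have "inv\<^bsub>?A\<^esub> ?\<Psi> h \<in> ?H" using inv by (intro generate.inv gens)
    moreover have "inv\<^bsub>?A\<^esub> ?\<Psi> h = - ?\<Psi> h" using Gk[OF gens[OF inv]] by simp
    moreover have "inv\<^bsub>?A\<^esub> h = - h" using G'k[OF inv] by simp
    ultimately show ?case by (simp add: frag_extend_minus)
  next
    case (eng h1 h2)
    then show ?case using generate.eng[of "?\<Psi> h1" ?A ?G "?\<Psi> h2"] by (simp add: frag_extend_add)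
  qed
  have \<sigma>p: "\<sigma> (x [^]\<^bsub>S\<^esub> p) = x" if "x \<in> carrier S" for x
    using \<sigma>(3)[OF that S.one_closed] \<sigma>(4) that by simp
  have \<Psi>\<Phi>: "?\<Psi> (?\<Phi> c) = c" if "c \<in> carrier ?A" for c
  proof -
    have "?\<Phi> c = frag_extend (frag_of \<circ> (\<lambda>(x, y). (x [^]\<^bsub>S\<^esub> p, y))) c"
      by (intro frag_extend_eq) auto
    then have "?\<Psi> (?\<Phi> c) = frag_extend ((\<lambda>(x, y). frag_of (\<sigma> x, y)) \<circ> (\<lambda>(x, y). (x [^]\<^bsub>S\<^esub> p, y))) c"
      by (simp add: frag_extend_compose)
    also have "\<dots> = frag_extend frag_of c"
      using that \<sigma>p by (intro frag_extend_eq) auto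
    also have "\<dots> = c" by (rule frag_expansion[symmetric])
    finally show ?thesis .
  qed
  show "inj_on (tensor_map S ?N' M (\<lambda>x. x [^]\<^bsub>S\<^esub> p)) (carrier (tensor S ?N M))"
  proof (rule inj_onI)
    fix C1 C2 assume C: "C1 \<in> carrier (tensor S ?N M)" "C2 \<in> carrier (tensor S ?N M)"
      and eq: "tensor_map S ?N' M (\<lambda>x. x [^]\<^bsub>S\<^esub> p) C1 = tensor_map S ?N' M (\<lambda>x. x [^]\<^bsub>S\<^esub> p) C2"
    have "carrier (tensor S ?N M) = rcosets\<^bsub>?A\<^esub> ?H"
      by (simp add: tensor_def FactGroup_def H cN)
    then obtain c1 c2 where c: "c1 \<in> carrier ?A" "C1 = ?H #>\<^bsub>?A\<^esub> c1" "c2 \<in> carrier ?A" "C2 = ?H #>\<^bsub>?A\<^esub> c2"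
      using C by (auto simp: RCOSETS_def)
    have tm: "tensor_map S ?N' M (\<lambda>x. x [^]\<^bsub>S\<^esub> p) C = {h + ?\<Phi> c |h c. h \<in> ?H' \<and> c \<in> C}" for C
      by (auto simp: tensor_map_def H cN set_mult_def)
    have "c1 \<in> C1" using group.rcos_self[OF group_free_Abelian_group c(1) sub] c(2) by simp
    then have "?\<Phi> c1 \<in> tensor_map S ?N' M (\<lambda>x. x [^]\<^bsub>S\<^esub> p) C1"
      unfolding tm using zero by force
    then have "?\<Phi> c1 \<in> tensor_map S ?N' M (\<lambda>x. x [^]\<^bsub>S\<^esub> p) C2" by (simp only: eq)
    then obtain h x where hx: "?\<Phi> c1 = h + ?\<Phi> x" "h \<in> ?H'" "x \<in> C2" unfolding tm by blast
    obtain h2 where h2: "h2 \<in> ?H" "x = h2 + c2" using hx(3) unfolding c(4) by (auto simp: r_coset_def)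
    have h2A: "h2 \<in> carrier ?A" using subgroup.mem_carrier[OF sub h2(1)] .
    then have xA: "x \<in> carrier ?A"
      using c(3) keys_add[of h2 c2] by (auto simp: h2(2))
    have "c1 = ?\<Psi> (?\<Phi> c1)" using \<Psi>\<Phi>[OF c(1)] by simp
    also have "\<dots> = ?\<Psi> h + x" unfolding hx(1) frag_extend_add by (simp only: \<Psi>\<Phi>[OF xA])
    finally have "c1 = (?\<Psi> h + h2) + c2" by (simp add: h2(2) add.assoc)
    moreover have "?\<Psi> h + h2 \<in> ?H"
      using generate.eng[OF \<Psi>H[OF hx(2)] h2(1)] by simp
    ultimately have "c1 \<in> ?H #>\<^bsub>?A\<^esub> c2" by (auto simp: r_coset_def)
    then show "C1 = C2"
      unfolding c using group.repr_independence[OF group_free_Abelian_group _ c(3) sub] by blast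
  qed
qed

text \<open>As \<open>\<phi>\<close> preserves \<open>I\<close>, it descends to a splitting of the
  Frobenius map of the quotient. Properness of \<open>I\<close> makes the additive order of 1
  exactly \<open>p\<close>.\<close>

theorem F_pure_quotient:
  fixes I :: "'a::field mpoly set"
  assumes I: "is_ideal k l I" and one: "1 \<notin> I" and p: "Factorial_Ring.prime p" "of_nat p = (0 :: 'a mpoly)"
    and \<phi>: "\<And>g. g \<in> polys k l \<Longrightarrow> \<phi> g \<in> polys k l" "\<And>g h. \<phi> (g + h) = \<phi> g + \<phi> h"
      "\<And>g h. \<phi> (h ^ p * g) = h * \<phi> g" "\<phi> 1 = 1" "\<And>g. g \<in> I \<Longrightarrow> \<phi> g \<in> I"
  shows "F_pure TYPE('m) (mat_poly_ring k l Quot I)"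
proof -
  let ?R = "mat_poly_ring k l :: 'a mpoly ring"
  let ?S = "?R Quot I"
  let ?q = "\<lambda>g. I +>\<^bsub>?R\<^esub> g"
  interpret R: cring ?R by (rule cring_mat_poly_ring)
  interpret ideal I ?R using I by (simp add: ideal_iff_is_ideal)
  have S: "cring ?S" by (rule quotient_is_cring) (rule R.cring_axioms)
  interpret S: cring ?S by (rule S)
  interpret q: ring_hom_ring ?R ?S ?q by (rule rcos_ring_hom_ring)
  have carr: "carrier ?S = ?q ` polys k l"
    by (auto simp: FactRing_def A_RCOSETS_def' a_r_coset_def)
  have qeq: "?q g = ?q h \<longleftrightarrow> g - h \<in> I" if "g \<in> polys k l" "h \<in> polys k l" for g h
  proof
    have q: "?q g = {i + g |i. i \<in> I}" for g by (auto simp: a_r_coset_def')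
    assume "?q g = ?q h"
    moreover have "0 + g \<in> ?q g" unfolding q using is_idealD(2)[OF I] by blast
    ultimately have "0 + g \<in> ?q h" by simp
    then show "g - h \<in> I" unfolding q by auto
  next
    have q: "?q g = {i + g |i. i \<in> I}" for g by (auto simp: a_r_coset_def')
    have sub: "?q g \<subseteq> ?q h" if gh: "g - h \<in> I" for g h
    proof
      fix x assume "x \<in> ?q g"
      then obtain i where i: "i \<in> I" "x = i + g" unfolding q by blast
      have "x = (i + (g - h)) + h" using i(2) by simp
      moreover have "i + (g - h) \<in> I" using i(1) gh by (rule is_idealD(3)[OF I])
      ultimately show "x \<in> ?q h" unfolding q by blast
    qed
    assume "g - h \<in> I"
    moreover from this have "h - g \<in> I" using is_idealD(6)[OF I, of "g - h"] by simp
    ultimately show "?q g = ?q h" using sub by blast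
  qed
  have qmult: "?q g \<otimes>\<^bsub>?S\<^esub> ?q h = ?q (g * h)" if "g \<in> polys k l" "h \<in> polys k l" for g h
    using q.hom_mult[of g h] that by simp
  have qadd: "?q g \<oplus>\<^bsub>?S\<^esub> ?q h = ?q (g + h)" if "g \<in> polys k l" "h \<in> polys k l" for g h
    using q.hom_add[of g h] that by simp
  have qone: "\<one>\<^bsub>?S\<^esub> = ?q 1" using q.hom_one by simp
  have qpow: "?q g [^]\<^bsub>?S\<^esub> n = ?q (g ^ n)" if "g \<in> polys k l" for g and n :: nat
  proof (induction n)
    case (Suc n)
    then show ?case using qmult[of "g ^ n" g] that by (simp add: polys_power mult.commute)
  qed (simp add: qone)
  \<comment> \<open>The choice of the representative is immaterial because \<open>\<phi>\<close> is
    additive and preserves \<open>I\<close>; this is \<open>\<sigma>q\<close> below.\<close>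
  define \<sigma> where "\<sigma> C = ?q (\<phi> (SOME g. g \<in> polys k l \<and> ?q g = C))" for C
  have \<phi>_diff: "\<phi> (g - h) = \<phi> g - \<phi> h" for g h using \<phi>(2)[of "g - h" h] by simp
  have \<sigma>q: "\<sigma> (?q g) = ?q (\<phi> g)" if g: "g \<in> polys k l" for g
  proof -
    let ?g = "SOME g'. g' \<in> polys k l \<and> ?q g' = ?q g"
    have s: "?g \<in> polys k l" "?q ?g = ?q g" using someI[of "\<lambda>g'. g' \<in> polys k l \<and> ?q g' = ?q g" g] g by auto
    then have "\<phi> ?g - \<phi> g \<in> I" using qeq[OF s(1) g] \<phi>(5)[of "?g - g"] by (simp add: \<phi>_diff)
    then show ?thesis unfolding \<sigma>_def using qeq[OF \<phi>(1)[OF s(1)] \<phi>(1)[OF g]] by simp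
  qed
  have char: "ring_char ?S = p"
  proof -
    have npow: "\<one>\<^bsub>?S\<^esub> [^]\<^bsub>add_monoid ?S\<^esub> n = ?q (of_nat n)" for n :: nat
    proof (induction n)
      case 0
      then show ?case using q.hom_zero by simp
    next
      case (Suc n)
      have "of_nat n \<in> polys k l" by (induction n) auto
      then show ?case using Suc qadd[of "of_nat n" 1] by (simp add: qone add.commute)
    qed
    have "\<one>\<^bsub>?S\<^esub> [^]\<^bsub>add_monoid ?S\<^esub> p = \<one>\<^bsub>add_monoid ?S\<^esub>"
      unfolding npow p(2) using q.hom_zero by simp
    then have "group.ord (add_monoid ?S) \<one>\<^bsub>?S\<^esub> dvd p" by (subst (asm) group.pow_eq_id[OF S.a_group]) simp_all
    moreover have "group.ord (add_monoid ?S) \<one>\<^bsub>?S\<^esub> \<noteq> 1"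
    proof
      assume "group.ord (add_monoid ?S) \<one>\<^bsub>?S\<^esub> = 1"
      then have "\<one>\<^bsub>?S\<^esub> = \<zero>\<^bsub>?S\<^esub>" using group.ord_eq_1[OF S.a_group, of "\<one>\<^bsub>?S\<^esub>"] by simp
      then have "?q 1 = ?q 0" using qone q.hom_zero by simp
      then show False using qeq[of 1 0] one by simp
    qed
    ultimately show ?thesis unfolding ring_char_def using p(1) by (auto simp: prime_nat_iff)
  qed
  have "pure_map TYPE('m) ?S (regular_module ?S) (frobenius_module p ?S) (\<lambda>x. x [^]\<^bsub>?S\<^esub> p)"
  proof (rule pure_of_splitting[OF S, where \<sigma> = \<sigma>])
    show "\<sigma> x \<in> carrier ?S" if "x \<in> carrier ?S" for x
      using that \<phi>(1) unfolding carr by (auto simp: \<sigma>q)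
    show "\<sigma> (x \<oplus>\<^bsub>?S\<^esub> y) = \<sigma> x \<oplus>\<^bsub>?S\<^esub> \<sigma> y" if xy: "x \<in> carrier ?S" "y \<in> carrier ?S" for x y
    proof -
      obtain g h where "g \<in> polys k l" "h \<in> polys k l" "x = ?q g" "y = ?q h" using xy unfolding carr by blast
      then show ?thesis using \<phi>(1) by (simp add: qadd \<sigma>q polys_add \<phi>(2))
    qed
    show "\<sigma> ((s [^]\<^bsub>?S\<^esub> p) \<otimes>\<^bsub>?S\<^esub> x) = s \<otimes>\<^bsub>?S\<^esub> \<sigma> x" if xy: "s \<in> carrier ?S" "x \<in> carrier ?S" for s x
    proof -
      obtain g h where "g \<in> polys k l" "h \<in> polys k l" "s = ?q g" "x = ?q h" using xy unfolding carr by blast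
      then show ?thesis using \<phi>(1) by (simp add: qpow qmult \<sigma>q polys_power polys_mult \<phi>(3))
    qed
    show "\<sigma> \<one>\<^bsub>?S\<^esub> = \<one>\<^bsub>?S\<^esub>" by (simp add: qone \<sigma>q \<phi>(4))
  qed
  then show ?thesis using S p(1) by (simp add: F_pure_def char)
qed

subsection \<open>Initial ideals\<close>

lemma initial_monom_eq:
  assumes "total_monom_order M prec" and lead: "monom_order.lead_at prec p m" and p: "mkeys p \<subseteq> M"
  shows "initial_monom prec p = m"
  unfolding initial_monom_def
proof (rule the_equality)
  interpret total_monom_order M prec by (rule assms(1))
  show "m \<in> mkeys p \<and> (\<forall>n\<in>mkeys p. n \<noteq> m \<longrightarrow> prec n m)" using lead by (simp add: lead_at_def)
  fix m' assume "m' \<in> mkeys p \<and> (\<forall>n\<in>mkeys p. n \<noteq> m' \<longrightarrow> prec n m')"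
  then have "lead_at p m'" by (simp add: lead_at_def)
  then show "m' = m" using lead_at_unique[OF _ lead p] by blast
qed

text \<open>The diagonal monomial occurs in the 2-minor, so it precedes the antidiagonal one, which
  is initial.\<close>

lemma adiag_order_of_antidiagonal:
  assumes "antidiagonal_term_order TYPE('a::field) k l prec"
  shows "adiag_order k l prec"
proof -
  have t: "term_order k l prec" and
    anti: "\<And>\<delta>. \<delta> \<in> minors k l \<Longrightarrow> initial_monom prec (minor_poly \<delta> :: 'a mpoly) = antidiagonal \<delta>"
    using assms by (auto simp: antidiagonal_term_order_def)
  interpret total_monom_order "monoms k l" prec
  proof unfold_locales
    note T = t[unfolded term_order_def]
    fix a b c assume a: "a \<in> monoms k l"
    show "\<not> prec a a" using T[THEN conjunct1] a by blast
    assume b: "b \<in> monoms k l"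
    show "a + b \<in> monoms k l" using a b by simp
    show "prec a b \<or> prec b a" if "a \<noteq> b" using T[THEN conjunct2, THEN conjunct2, THEN conjunct1] a b that by blast
    assume c: "c \<in> monoms k l"
    show "prec a c" if "prec a b" "prec b c" using T[THEN conjunct2, THEN conjunct1] a b c that by blast
    show "prec (a + c) (b + c)" if "prec a b"
      using T[THEN conjunct2, THEN conjunct2, THEN conjunct2, THEN conjunct2] a b c that by blast
  qed simp
  show ?thesis
  proof unfold_locales
    fix i i' j j' assume h: "1 \<le> i" "i < i'" "i' \<le> k" "1 \<le> j" "j < j'" "j' \<le> l"
    let ?\<delta> = "([i, i'], [j, j'])"
    let ?d = "var i j + var i' j'" and ?a = "var i j' + var i' j"
    have \<delta>: "?\<delta> \<in> minors k l" using h by (auto simp: minors_def)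
    have ad: "antidiagonal ?\<delta> = ?a"
      by (simp add: antidiagonal_def numeral_2_eq_2 lessThan_Suc add.commute)
    have "coef ?d (i, j) \<noteq> coef ?a (i, j)" using h by (simp add: lookup_add lookup_single)
    then have ne: "?d \<noteq> ?a" by metis
    have poly: "mkeys (minor_poly ?\<delta> :: 'a mpoly) \<subseteq> monoms k l"
      using minor_poly_in_polys[OF \<delta>] by (auto simp: polys_def)
    have dk: "?d \<in> mkeys (minor_poly ?\<delta> :: 'a mpoly)"
    proof -
      let ?pm = "perm_monom [i, i'] [j, j']"
      let ?P = "{p. p permutes {0..<length [i, i']}}"
      have len: "length [i, i'] = length [j, j']" by simp
      have d: "?d = ?pm id" by (simp add: perm_monom_def numeral_2_eq_2 lessThan_Suc add.commute)
      have inj: "p = id" if "p \<in> ?P" "?pm p = ?pm id" for p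
        using that h by (intro perm_monom_inj[of "[i, i']" "[j, j']" p id]) (auto simp: permutes_id)
      have "coef (minor_poly ?\<delta> :: 'a mpoly) ?d = (\<Sum>p\<in>?P. (signof p when ?pm p = ?pm id))"
        unfolding d minor_poly_expand[OF len] lookup_sum lookup_single ..
      also have "\<dots> = (\<Sum>p\<in>{id}. (signof p when ?pm p = ?pm id))"
      proof (rule sum.mono_neutral_right)
        show "finite ?P" by (simp add: finite_permutations)
        show "{id} \<subseteq> ?P" using permutes_id by auto
        show "\<forall>p\<in>?P - {id}. (signof p when ?pm p = ?pm id) = (0 :: 'a)" using inj by (auto simp: when_def)
      qed
      also have "\<dots> = 1" by simp
      finally show ?thesis by (simp add: in_keys_iff)
    qed
    then have "(minor_poly ?\<delta> :: 'a mpoly) \<noteq> 0" by auto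
    then obtain m where m: "lead_at (minor_poly ?\<delta> :: 'a mpoly) m" using poly by (rule ex_lead)
    then have "m = ?a" using initial_monom_eq[OF total_monom_order_axioms m poly] anti[OF \<delta>] ad by simp
    then show "prec ?d ?a" using m dk ne unfolding lead_at_def by blast
  qed
qed

text \<open>Radicality of the initial ideal in terms of leading monomials only, a form that can be
  compared across characteristics.\<close>

definition lead_radical :: "nat \<Rightarrow> nat \<Rightarrow> (monom \<Rightarrow> monom \<Rightarrow> bool) \<Rightarrow> 'a::field mpoly set \<Rightarrow> bool" where
  "lead_radical k l prec I \<longleftrightarrow> (\<forall>g\<in>I. \<forall>m s. monom_order.lead_at prec g m \<longrightarrow>
     (\<forall>v. coef s v = of_bool (v \<in> mkeys m)) \<longrightarrow> (\<exists>g'\<in>I. monom_order.lead_at prec g' s))"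

lemma ex_squarefree_part:
  fixes m :: monom
  obtains s :: monom where "\<And>v. coef s v = of_bool (v \<in> mkeys m)"
proof -
  have "coef (\<Sum>p\<in>mkeys m. Poly_Mapping.single p 1 :: monom) v = of_bool (v \<in> mkeys m)" for v
    by (simp add: lookup_sum lookup_single when_def)
  then show ?thesis by (rule that)
qed

text \<open>Each leading monomial is a multiple of its radical, which is again a leading monomial;
  the squarefree ones therefore generate.\<close>

theorem squarefree_initial_ideal:
  fixes I :: "'a::field mpoly set"
  assumes order: "total_monom_order (monoms k l) prec" and I: "is_ideal k l I" and rad: "lead_radical k l prec I"
  shows "squarefree_monomial_ideal k l (initial_ideal k l prec I)"
proof -
  interpret total_monom_order "monoms k l" prec by (rule order)
  let ?\<Lambda> = "{m. \<exists>g\<in>I. lead_at g m}"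
  let ?A = "{m \<in> ?\<Lambda>. \<forall>v. coef m v \<le> 1}"
  have IM: "mkeys g \<subseteq> monoms k l" if "g \<in> I" for g using that is_idealD(1)[OF I] by (auto simp: polys_def)
  have \<Lambda>M: "?\<Lambda> \<subseteq> monoms k l" using IM by (auto simp: lead_at_def)
  have gens: "(\<lambda>p. Poly_Mapping.single (initial_monom prec p) 1) ` (I - {0}) = (mono_of ` ?\<Lambda> :: 'a mpoly set)"
  proof (intro equalityI subsetI)
    fix x assume "x \<in> (\<lambda>p. mono_of (initial_monom prec p) :: 'a mpoly) ` (I - {0})"
    then obtain g where g: "g \<in> I" "g \<noteq> 0" "x = mono_of (initial_monom prec g)" by auto
    obtain m where m: "lead_at g m" using g(2) IM[OF g(1)] by (rule ex_lead)
    then show "x \<in> mono_of ` ?\<Lambda>" using g initial_monom_eq[OF order m IM[OF g(1)]] by auto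
  next
    fix x assume "x \<in> (mono_of ` ?\<Lambda> :: 'a mpoly set)"
    then obtain g m where g: "x = mono_of m" "g \<in> I" "lead_at g m" by auto
    then have "g \<noteq> 0" by (auto simp: lead_at_def)
    then show "x \<in> (\<lambda>p. mono_of (initial_monom prec p)) ` (I - {0})"
      using g initial_monom_eq[OF order g(3) IM[OF g(2)]] by (intro image_eqI[of _ _ g]) auto
  qed
  have pol: "mono_of ` B \<subseteq> (polys k l :: 'a mpoly set)" if "B \<subseteq> monoms k l" for B using that by auto
  have A: "?A \<subseteq> monoms k l" using \<Lambda>M by auto
  have "mono_of ` ?\<Lambda> \<subseteq> idl k l (mono_of ` ?A :: 'a mpoly set)"
  proof
    fix x assume "x \<in> (mono_of ` ?\<Lambda> :: 'a mpoly set)"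
    then obtain g m where g: "x = mono_of m" "g \<in> I" "lead_at g m" by auto
    obtain s :: monom where s: "\<And>v. coef s v = of_bool (v \<in> mkeys m)" by (rule ex_squarefree_part[of m]) (rule that)
    have "\<exists>g'\<in>I. lead_at g' s" using rad[unfolded lead_radical_def, rule_format, OF g(2,3) s] .
    then have "s \<in> ?A" using s by auto
    then have ms: "(mono_of s :: 'a mpoly) \<in> idl k l (mono_of ` ?A)" by (intro idl_gen) auto
    have "\<exists>a. m = s + a" unfolding monom_finite_le using s by (auto simp: in_keys_iff)
    then obtain a where a: "m = s + a" by blast
    have "m \<in> monoms k l" using \<Lambda>M g by blast
    then have "a \<in> monoms k l" by (simp add: a)
    from this ms have "(mono_of a * mono_of s :: 'a mpoly) \<in> idl k l (mono_of ` ?A)"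
      by (intro is_idealD(4)[OF is_ideal_idl[OF pol[OF A]]] polys_single)
    then show "x \<in> idl k l (mono_of ` ?A)" by (simp add: g(1) a mult_single add.commute)
  qed
  then have "idl k l (mono_of ` ?\<Lambda>) \<subseteq> (idl k l (mono_of ` ?A) :: 'a mpoly set)"
    by (rule idl_least[OF is_ideal_idl[OF pol[OF A]]])
  moreover have "mono_of ` ?A \<subseteq> (idl k l (mono_of ` ?\<Lambda>) :: 'a mpoly set)"
    by (rule image_subsetI, rule idl_gen) auto
  then have "idl k l (mono_of ` ?A) \<subseteq> (idl k l (mono_of ` ?\<Lambda>) :: 'a mpoly set)"
    by (rule idl_least[OF is_ideal_idl[OF pol[OF \<Lambda>M]]])
  ultimately have "idl k l (mono_of ` ?\<Lambda>) = (idl k l (mono_of ` ?A) :: 'a mpoly set)" by (rule equalityI)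
  then have "initial_ideal k l prec I = genideal (mat_poly_ring k l) (mono_of ` ?A)"
    unfolding initial_ideal_def gens genideal_eq_idl[OF pol[OF \<Lambda>M]] genideal_eq_idl[OF pol[OF A]] .
  moreover have "\<forall>m\<in>?A. \<forall>v. coef m v \<le> 1" by simp
  ultimately show ?thesis unfolding squarefree_monomial_ideal_def by (intro exI conjI) (rule A)
qed

subsection \<open>Generalized poset ideals\<close>

lemma generalized_ideal_subset: "generalized_ideal k l \<Omega> \<Longrightarrow> \<Omega> \<subseteq> minors k l"
  by (simp add: generalized_ideal_def)

lemma generalized_poset_ideal_eq_idl:
  assumes "\<Omega> \<subseteq> minors k l"
  shows "(generalized_poset_ideal k l \<Omega> :: 'a::field mpoly set) = idl k l (minor_poly ` \<Omega>)"
    "is_ideal k l (generalized_poset_ideal k l \<Omega> :: 'a mpoly set)"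
proof -
  have "minor_poly ` \<Omega> \<subseteq> (polys k l :: 'a mpoly set)" using assms minor_poly_in_polys by blast
  then show "generalized_poset_ideal k l \<Omega> = (idl k l (minor_poly ` \<Omega>) :: 'a mpoly set)"
    "is_ideal k l (generalized_poset_ideal k l \<Omega> :: 'a mpoly set)"
    by (simp_all add: generalized_poset_ideal_def genideal_eq_idl is_ideal_idl)
qed

text \<open>The constant coefficient is the value at the origin, where all minors vanish; this makes
  the poset ideals proper.\<close>

lemma coef_0_mult: "coef (g * h) 0 = coef g 0 * coef (h :: 'a::field mpoly) 0"
proof -
  have "(subst (\<lambda>_. 0) p :: 'a mpoly) = Poly_Mapping.single 0 (coef p 0)" for p :: "'a mpoly"
  proof -
    have e: "eval_monom (\<lambda>_. 0) m = (of_bool (m = 0) :: 'a mpoly)" for m :: monom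
    proof (cases "m = 0")
      case False
      then obtain v where "v \<in> mkeys m" using keys_eq_empty[of m] by blast
      then have "(0 :: 'a mpoly) ^ coef m v = 0" by (simp add: in_keys_iff)
      then have "(eval_monom (\<lambda>_. 0) m :: 'a mpoly) = 0"
        unfolding eval_monom_def using \<open>v \<in> mkeys m\<close> by (intro prod_zero) auto
      then show ?thesis using False by simp
    qed simp
    have "(subst (\<lambda>_. 0) p :: 'a mpoly) = (\<Sum>m\<in>insert 0 (mkeys p). Poly_Mapping.single 0 (coef p m) * (of_bool (m = 0) :: 'a mpoly))"
      by (subst subst_superset[of "insert 0 (mkeys p)"]) (auto simp: e)
    also have "\<dots> = Poly_Mapping.single 0 (coef p 0)"
      by (subst sum.insert_remove) (auto intro!: sum.neutral)
    finally show ?thesis .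
  qed
  note s = this
  have "Poly_Mapping.single 0 (coef (g * h) 0) = (Poly_Mapping.single 0 (coef g 0 * coef h 0) :: 'a mpoly)"
    unfolding s[symmetric] subst_mult single_0_mult ..
  then show ?thesis by (metis lookup_single_eq)
qed

lemma one_notin_generalized_poset_ideal:
  assumes "\<Omega> \<subseteq> minors k l"
  shows "1 \<notin> (generalized_poset_ideal k l \<Omega> :: 'a::field mpoly set)"
proof
  let ?J = "{g \<in> polys k l. coef g 0 = (0 :: 'a)}"
  have J: "is_ideal k l ?J" unfolding is_ideal_def by (auto simp: coef_0_mult lookup_add)
  have "minor_poly ` \<Omega> \<subseteq> ?J"
  proof (rule image_subsetI)
    fix \<delta> assume "\<delta> \<in> \<Omega>"
    moreover obtain a b where ab: "\<delta> = (a, b)" by (cases \<delta>)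
    ultimately have d: "(a, b) \<in> minors k l" using assms by auto
    note D = minorsD[OF d]
    have "coef (minor_poly (a, b) :: 'a mpoly) 0 = 0"
      unfolding minor_poly_expand[OF D(1)] lookup_sum
    proof (rule sum.neutral, rule ballI)
      fix p
      have "coef (perm_monom a b p) (a ! 0, b ! p 0) \<noteq> 0"
        using D(2) by (auto simp: perm_monom_def lookup_sum lookup_single when_def)
      then have "perm_monom a b p \<noteq> 0" by auto
      then show "coef (Poly_Mapping.single (perm_monom a b p) (signof p :: 'a)) 0 = 0"
        by (simp add: lookup_single)
    qed
    then show "minor_poly \<delta> \<in> ?J" using minor_poly_in_polys[OF d] ab by blast
  qed
  then have "generalized_poset_ideal k l \<Omega> \<subseteq> ?J"
    unfolding generalized_poset_ideal_eq_idl(1)[OF assms] by (rule idl_least[OF J])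
  moreover assume "1 \<in> (generalized_poset_ideal k l \<Omega> :: 'a mpoly set)"
  ultimately show False by auto
qed

lemma generalized_poset_ideal_empty: "generalized_poset_ideal k l {} = {0 :: 'a::field mpoly}"
proof -
  have "is_ideal k l {0 :: 'a mpoly}" by (simp add: is_ideal_def)
  then show ?thesis
    unfolding generalized_poset_ideal_eq_idl(1)[OF empty_subsetI]
    using idl_least[of k l "{0 :: 'a mpoly}" "{}"] idl.zero by auto
qed

lemma (in frobenius_splitting) generalized_poset_ideal_compatible:
  assumes kl: "1 \<le> k" "1 \<le> l" "k \<le> l + 1" and \<Omega>: "generalized_ideal k l \<Omega>"
    and g: "g \<in> generalized_poset_ideal k l \<Omega>"
  shows "split_map k l g \<in> generalized_poset_ideal k l \<Omega>"
proof (cases "\<Omega> = {}")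
  case True
  then show ?thesis using g by (simp add: generalized_poset_ideal_empty)
next
  case False
  then show ?thesis using split_map_compatible[OF kl generalized_poset_ideal_knutson[OF kl \<Omega>] g] by simp
qed

theorem lead_radical_pos_char:
  assumes kl: "1 \<le> k" "1 \<le> l" "k \<le> l + 1" and \<Omega>: "generalized_ideal k l \<Omega>"
    and ao: "adiag_order k l prec" and char: "CHAR('a) > 0"
  shows "lead_radical k l prec (generalized_poset_ideal k l \<Omega> :: 'a::field mpoly set)"
proof -
  obtain \<tau> :: "'a \<Rightarrow> 'a" where "frobenius_splitting \<tau> CHAR('a)" using ex_frobenius_splitting[OF char] by blast
  then interpret frobenius_splitting \<tau> "CHAR('a)" .
  show ?thesis
    unfolding lead_radical_def
    using compatible_lead_radical[OF kl generalized_poset_ideal_eq_idl(2)[OF generalized_ideal_subset[OF \<Omega>]]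
        generalized_poset_ideal_compatible[OF kl \<Omega>] ao] by blast
qed

section \<open>Reduction modulo a prime\<close>

subsection \<open>Integer models\<close>

definition int_to_field :: "('m \<Rightarrow>\<^sub>0 int) \<Rightarrow> ('m \<Rightarrow>\<^sub>0 'a::ring_1)" where
  "int_to_field p = Poly_Mapping.map of_int p"

lemma coef_int_to_field [simp]: "coef (int_to_field p) m = of_int (coef p m)"
  by (simp add: int_to_field_def map.rep_eq when_def)

lemma int_to_field_0 [simp]: "int_to_field 0 = 0"
  by (rule poly_mapping_eqI) simp

lemma int_to_field_add: "int_to_field (p + q) = int_to_field p + int_to_field q"
  by (rule poly_mapping_eqI) (simp add: lookup_add)

lemma int_to_field_sum: "int_to_field (sum f A) = (\<Sum>i\<in>A. int_to_field (f i))"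
  by (induction A rule: infinite_finite_induct) (simp_all add: int_to_field_add)

lemma int_to_field_single: "int_to_field (Poly_Mapping.single m c) = Poly_Mapping.single m (of_int c)"
  by (rule poly_mapping_eqI) (simp add: lookup_single when_def)

lemma int_to_field_single_mult:
  fixes p :: "'m::cancel_comm_monoid_add \<Rightarrow>\<^sub>0 int"
  shows "int_to_field (Poly_Mapping.single m c * p) = Poly_Mapping.single m (of_int c :: 'a::comm_ring_1) * int_to_field p"
proof (rule poly_mapping_eqI)
  fix n
  show "coef (int_to_field (Poly_Mapping.single m c * p)) n =
    coef (Poly_Mapping.single m (of_int c :: 'a) * int_to_field p) n"
  proof (cases "\<exists>b. n = m + b")
    case True
    then obtain b where "n = m + b" by blast
    then show ?thesis by (simp add: coef_single_mult)
  next
    case False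
    then have "coef (Poly_Mapping.single m c * p) n = 0"
      "coef (Poly_Mapping.single m (of_int c :: 'a) * int_to_field p) n = 0"
      by (intro coef_single_mult_0; blast)+
    then show ?thesis by simp
  qed
qed

definition minor_int :: "minor \<Rightarrow> (monom \<Rightarrow>\<^sub>0 int)" where
  "minor_int \<delta> = (\<Sum>p | p permutes {0..<length (fst \<delta>)}. Poly_Mapping.single (perm_monom (fst \<delta>) (snd \<delta>) p) (sign p))"

lemma int_to_field_minor_int:
  assumes "\<delta> \<in> minors k l"
  shows "int_to_field (minor_int \<delta>) = (minor_poly \<delta> :: 'a::field mpoly)"
proof -
  obtain a b where ab: "\<delta> = (a, b)" by (cases \<delta>)
  have len: "length a = length b" using minorsD(1) assms ab by blast
  show ?thesis
    by (simp add: ab minor_int_def minor_poly_expand[OF len] int_to_field_sum int_to_field_single)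
qed

lemma total_deg_perm_monom: "total_deg (perm_monom a b p) = length a"
  by (simp add: perm_monom_def lin_sum)

lemma minor_int_keys:
  assumes "\<delta> \<in> minors k l" "m \<in> mkeys (minor_int \<delta>)"
  shows "m \<in> monoms k l" "total_deg m = length (fst \<delta>)"
proof -
  obtain a b where ab: "\<delta> = (a, b)" by (cases \<delta>)
  have "m \<in> (\<Union>p\<in>{p. p permutes {0..<length a}}. mkeys (Poly_Mapping.single (perm_monom a b p) (sign p)))"
    using assms(2) unfolding minor_int_def ab fst_conv snd_conv by (rule subsetD[OF keys_sum_subset])
  then obtain p where p: "p permutes {0..<length a}" "m = perm_monom a b p" by (auto split: if_splits)
  then show "m \<in> monoms k l" using assms(1) perm_monom_in_monoms[of a b k l p] by (simp add: ab)
  show "total_deg m = length (fst \<delta>)" unfolding p(2) ab fst_conv by (rule total_deg_perm_monom)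
qed

text \<open>Integer polynomials whose images span the part of degree \<open>d\<close> of the ideal
  over every field at once.\<close>

definition degree_gens :: "nat \<Rightarrow> nat \<Rightarrow> minor set \<Rightarrow> nat \<Rightarrow> (monom \<Rightarrow>\<^sub>0 int) set" where
  "degree_gens k l \<Omega> d = {mono_of a * minor_int \<delta> |a \<delta>. a \<in> monoms k l \<and> \<delta> \<in> \<Omega> \<and> total_deg a + length (fst \<delta>) = d}"

lemma finite_degree_gens:
  assumes "\<Omega> \<subseteq> minors k l"
  shows "finite (degree_gens k l \<Omega> d)"
proof -
  have fin: "finite \<Omega>" using assms finite_minors by (rule finite_subset)
  have "degree_gens k l \<Omega> d \<subseteq> (\<lambda>(a, \<delta>). mono_of a * minor_int \<delta>) ` ({m \<in> monoms k l. total_deg m \<le> d} \<times> \<Omega>)"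
  proof
    fix v assume "v \<in> degree_gens k l \<Omega> d"
    then obtain a \<delta> where h: "v = mono_of a * minor_int \<delta>" "a \<in> monoms k l" "\<delta> \<in> \<Omega>" "total_deg a + length (fst \<delta>) = d"
      by (auto simp: degree_gens_def)
    then have "(a, \<delta>) \<in> {m \<in> monoms k l. total_deg m \<le> d} \<times> \<Omega>" by simp
    then show "v \<in> (\<lambda>(a, \<delta>). mono_of a * minor_int \<delta>) ` ({m \<in> monoms k l. total_deg m \<le> d} \<times> \<Omega>)"
      using h(1) by (intro image_eqI[of _ _ "(a, \<delta>)"]) simp_all
  qed
  then show ?thesis
    by (rule finite_subset) (intro finite_imageI finite_cartesian_product finite_monoms_deg fin)
qed

lemma degree_gens_keys:
  assumes \<Omega>: "\<Omega> \<subseteq> minors k l" and v: "v \<in> degree_gens k l \<Omega> d" and n: "n \<in> mkeys v"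
  shows "n \<in> monoms k l" "total_deg n = d"
proof -
  obtain a \<delta> where h: "v = mono_of a * minor_int \<delta>" "a \<in> monoms k l" "\<delta> \<in> \<Omega>" "total_deg a + length (fst \<delta>) = d"
    using v by (auto simp: degree_gens_def)
  have \<delta>: "\<delta> \<in> minors k l" using h(3) \<Omega> by blast
  have "coef v n \<noteq> 0" using n by (simp add: in_keys_iff)
  then obtain b where b: "n = a + b" using coef_single_mult_0[of n a 1 "minor_int \<delta>"] h(1) by blast
  then have "coef (minor_int \<delta>) b \<noteq> 0" using \<open>coef v n \<noteq> 0\<close> h(1) by (simp add: coef_single_mult)
  then have "b \<in> mkeys (minor_int \<delta>)" by (simp add: in_keys_iff)
  from minor_int_keys[OF \<delta> this] show "n \<in> monoms k l" "total_deg n = d" using b h by simp_all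
qed

lemma int_to_field_degree_gens:
  assumes \<Omega>: "\<Omega> \<subseteq> minors k l" and v: "v \<in> degree_gens k l \<Omega> d"
  shows "(int_to_field v :: 'a::field mpoly) \<in> generalized_poset_ideal k l \<Omega>"
proof -
  note I = generalized_poset_ideal_eq_idl[OF \<Omega>, where 'a = 'a]
  obtain a \<delta> where h: "v = mono_of a * minor_int \<delta>" "a \<in> monoms k l" "\<delta> \<in> \<Omega>"
    using v by (auto simp: degree_gens_def)
  have \<delta>: "\<delta> \<in> minors k l" using h(3) \<Omega> by blast
  have "(int_to_field v :: 'a mpoly) = mono_of a * minor_poly \<delta>"
    unfolding h(1) int_to_field_single_mult int_to_field_minor_int[OF \<delta>] of_int_1 ..
  moreover have "(minor_poly \<delta> :: 'a mpoly) \<in> generalized_poset_ideal k l \<Omega>"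
    unfolding I(1) using h(3) by (intro idl_gen) auto
  ultimately show ?thesis using h(2) is_idealD(4)[OF I(2)] by auto
qed

lemma kspan_subset_ideal:
  assumes I: "is_ideal k l I" and G: "G \<subseteq> I" and a: "a \<in> kspan G"
  shows "a \<in> I"
  using a
proof induction
  case zero
  then show ?case by (rule is_idealD(2)[OF I])
next
  case (step g a c)
  then show ?case using G by (intro is_idealD(3)[OF I] is_idealD(4)[OF I]) auto
qed

definition homogeneous_part :: "nat \<Rightarrow> 'a::field mpoly \<Rightarrow> 'a mpoly" where
  "homogeneous_part d g = (\<Sum>n\<in>{n \<in> mkeys g. total_deg n = d}. Poly_Mapping.single n (coef g n))"

lemma coef_homogeneous_part: "coef (homogeneous_part d g) n = (if total_deg n = d then coef g n else 0)"
proof -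
  have "coef (homogeneous_part d g) n = (\<Sum>m\<in>{n \<in> mkeys g. total_deg n = d}. if m = n then coef g n else 0)"
    unfolding homogeneous_part_def lookup_sum by (intro sum.cong) (auto simp: lookup_single when_def)
  also have "\<dots> = (if n \<in> {n \<in> mkeys g. total_deg n = d} then coef g n else 0)" by simp
  finally show ?thesis by (auto simp: in_keys_iff)
qed

lemma homogeneous_part_in_kspan:
  assumes \<Omega>: "\<Omega> \<subseteq> minors k l" and g: "(g :: 'a::field mpoly) \<in> generalized_poset_ideal k l \<Omega>"
  shows "homogeneous_part d g \<in> kspan (int_to_field ` degree_gens k l \<Omega> d)"
proof -
  have step: "homogeneous_part d (Poly_Mapping.single n c * minor_poly \<delta>) \<in> kspan (int_to_field ` degree_gens k l \<Omega> d)"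
    if n: "n \<in> monoms k l" and \<delta>: "\<delta> \<in> \<Omega>" for n \<delta> and c :: 'a
  proof -
    let ?v = "mono_of n * minor_int \<delta>"
    have d: "\<delta> \<in> minors k l" using \<delta> \<Omega> by blast
    have v: "?v \<in> degree_gens k l \<Omega> (total_deg n + length (fst \<delta>))"
      using n \<delta> unfolding degree_gens_def by blast
    have e: "Poly_Mapping.single n c * minor_poly \<delta> = Poly_Mapping.single 0 c * (int_to_field ?v :: 'a mpoly)"
      unfolding int_to_field_single_mult int_to_field_minor_int[OF d] by (simp add: mult_single flip: mult.assoc)
    have ce: "coef (Poly_Mapping.single n c * minor_poly \<delta>) m = c * of_int (coef ?v m)" for m
      unfolding e using coef_single_mult[of 0 c "int_to_field ?v" m] by simp
    show ?thesis
    proof (cases "total_deg n + length (fst \<delta>) = d")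
      case True
      have "homogeneous_part d (Poly_Mapping.single n c * minor_poly \<delta>) = Poly_Mapping.single n c * minor_poly \<delta>"
      proof (rule poly_mapping_eqI)
        fix m
        show "coef (homogeneous_part d (Poly_Mapping.single n c * minor_poly \<delta>)) m = coef (Poly_Mapping.single n c * minor_poly \<delta>) m"
          using degree_gens_keys(2)[OF \<Omega> v, of m] True
          by (cases "m \<in> mkeys ?v") (simp_all add: coef_homogeneous_part ce in_keys_iff)
      qed
      then show ?thesis unfolding e using v True by (simp only:) (intro kspan_scale kspan_gen imageI)
    next
      case False
      have "homogeneous_part d (Poly_Mapping.single n c * minor_poly \<delta>) = 0"
      proof (rule poly_mapping_eqI)
        fix m
        show "coef (homogeneous_part d (Poly_Mapping.single n c * minor_poly \<delta>)) m = coef 0 m"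
          using degree_gens_keys(2)[OF \<Omega> v, of m] False
          by (cases "m \<in> mkeys ?v") (simp_all add: coef_homogeneous_part ce in_keys_iff)
      qed
      then show ?thesis by (simp add: kspan.zero)
    qed
  qed
  have add: "homogeneous_part d (a + b) = homogeneous_part d a + homogeneous_part d b" for a b :: "'a mpoly"
    by (rule poly_mapping_eqI) (simp add: coef_homogeneous_part lookup_add)
  have zero: "homogeneous_part d (0 :: 'a mpoly) = 0"
    by (rule poly_mapping_eqI) (simp add: coef_homogeneous_part)
  have sum: "homogeneous_part d (\<Sum>i\<in>A. f i) = (\<Sum>i\<in>A. homogeneous_part d (f i))" for A and f :: "monom \<Rightarrow> 'a mpoly"
    by (induction A rule: infinite_finite_induct) (simp_all add: add zero)
  show ?thesis
    using g unfolding generalized_poset_ideal_eq_idl(1)[OF \<Omega>]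
  proof induction
    case zero
    then show ?case unfolding \<open>homogeneous_part d (0 :: 'a mpoly) = 0\<close> by (rule kspan.zero)
  next
    case (step g h a)
    obtain \<delta> where \<delta>: "\<delta> \<in> \<Omega>" "g = minor_poly \<delta>" using step.hyps(1) by auto
    have "h * g = (\<Sum>n\<in>mkeys h. Poly_Mapping.single n (coef h n) * minor_poly \<delta>)"
      unfolding \<delta>(2) sum_distrib_right[symmetric] by (simp flip: poly_eq_sum_single)
    then have "homogeneous_part d (h * g) = (\<Sum>n\<in>mkeys h. homogeneous_part d (Poly_Mapping.single n (coef h n) * minor_poly \<delta>))"
      by (simp only: sum)
    also have "\<dots> \<in> kspan (int_to_field ` degree_gens k l \<Omega> d)"
      using step.hyps(2) \<delta>(1) by (intro kspan_sum \<open>\<And>n \<delta> c. n \<in> monoms k l \<Longrightarrow> \<delta> \<in> \<Omega> \<Longrightarrow> homogeneous_part d (Poly_Mapping.single n c * minor_poly \<delta>) \<in> kspan (int_to_field ` degree_gens k l \<Omega> d)\<close>)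
        (auto simp: polys_def)
    finally show ?case unfolding add using step.IH by (rule kspan_add)
  qed
qed

subsection \<open>Echelon forms\<close>

text \<open>Integer echelon form with one multiplier \<open>N\<close> for all denominators: the
  leading monomials in \<open>W\<close> are distinct, their coefficients divide \<open>N\<close>,
  and \<open>N\<close> brings \<open>V\<close> into the span of \<open>W\<close>. Over any field
  where \<open>N\<close> is invertible, \<open>W\<close> thus remains an echelon form of
  \<open>V\<close>.\<close>

definition echelon :: "('m::comm_monoid_add \<Rightarrow> 'm \<Rightarrow> bool) \<Rightarrow> ('m \<Rightarrow>\<^sub>0 int) set \<Rightarrow> ('m \<Rightarrow>\<^sub>0 int) set \<Rightarrow> int \<Rightarrow> bool" where
  "echelon prec V W N \<longleftrightarrow> finite W \<and> N \<noteq> 0 \<and> W \<subseteq> kspan V \<and> (\<forall>v\<in>V. Poly_Mapping.single 0 N * v \<in> kspan W) \<and>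
     (\<forall>w\<in>W. \<exists>m. m \<in> mkeys w \<and> (\<forall>n\<in>mkeys w. n \<noteq> m \<longrightarrow> prec n m) \<and> coef w m dvd N \<and>
       (\<forall>w'\<in>W. m \<in> mkeys w' \<and> (\<forall>n\<in>mkeys w'. n \<noteq> m \<longrightarrow> prec n m) \<longrightarrow> w' = w))"

lemma echelon_lead:
  assumes "echelon prec V W N" "w \<in> W"
  shows "\<exists>m. m \<in> mkeys w \<and> (\<forall>n\<in>mkeys w. n \<noteq> m \<longrightarrow> prec n m) \<and> coef w m dvd N \<and>
    (\<forall>w'\<in>W. m \<in> mkeys w' \<and> (\<forall>n\<in>mkeys w'. n \<noteq> m \<longrightarrow> prec n m) \<longrightarrow> w' = w)"
  using assms(1)[unfolded echelon_def] by (elim conjE) (rule bspec[OF _ assms(2)])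

lemma kspan_mono: "a \<in> kspan G \<Longrightarrow> G \<subseteq> H \<Longrightarrow> a \<in> kspan H"
  by (induction rule: kspan.induct) (auto intro: kspan.intros)

lemma kspan_kspan: "a \<in> kspan G \<Longrightarrow> G \<subseteq> kspan H \<Longrightarrow> a \<in> kspan H"
  by (induction rule: kspan.induct) (auto intro: kspan.zero kspan_add kspan_scale)

lemma keys_single_0_mult:
  fixes v :: "'m::cancel_comm_monoid_add \<Rightarrow>\<^sub>0 'c::comm_ring_1"
  shows "coef (Poly_Mapping.single 0 c * v) m = c * coef v m"
  using coef_single_mult[of 0 c v m] by simp

lemma keys_kspan:
  fixes G :: "('m::cancel_comm_monoid_add \<Rightarrow>\<^sub>0 'c::comm_ring_1) set"
  assumes "a \<in> kspan G" "\<And>g. g \<in> G \<Longrightarrow> mkeys g \<subseteq> Y"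
  shows "mkeys a \<subseteq> Y"
  using assms(1)
proof induction
  case (step g a c)
  have "mkeys (Poly_Mapping.single 0 c * g) \<subseteq> mkeys g"
    by (auto simp: in_keys_iff keys_single_0_mult)
  then show ?case using assms(2)[OF step.hyps(1)] step.IH keys_add[of "Poly_Mapping.single 0 c * g" a] by blast
qed simp

context total_monom_order
begin

lemma ex_echelon:
  fixes V :: "('m \<Rightarrow>\<^sub>0 int) set"
  assumes "finite Y" "Y \<subseteq> M" "finite V" "\<And>v. v \<in> V \<Longrightarrow> mkeys v \<subseteq> Y"
  shows "\<exists>W N. echelon prec V W N"
  using assms
proof (induction "card Y" arbitrary: Y V)
  case 0
  then have "Y = {}" by simp
  then have "V \<subseteq> {0}" using "0.prems"(4) by fastforce
  then have "echelon prec V {} 1" by (auto simp: echelon_def kspan.zero)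
  then show ?case by blast
next
  case (Suc c)
  then have "Y \<noteq> {}" by auto
  then obtain x where x: "x \<in> Y" "\<And>n. n \<in> Y \<Longrightarrow> n \<noteq> x \<Longrightarrow> prec n x" using ex_max[of Y] Suc.prems by blast
  have card: "c = card (Y - {x})" using Suc.hyps(2) x(1) Suc.prems(1) by simp
  show ?case
  proof (cases "\<forall>v\<in>V. coef v x = 0")
    case True
    have "mkeys v \<subseteq> Y - {x}" if "v \<in> V" for v
      using Suc.prems(4)[OF that] True that by (auto simp: in_keys_iff)
    then show ?thesis using Suc.hyps(1)[OF card _ _ Suc.prems(3)] Suc.prems(1,2) by blast
  next
    case False
    then obtain v0 where v0: "v0 \<in> V" "coef v0 x \<noteq> 0" by blast
    define c0 where "c0 = coef v0 x"
    \<comment> \<open>Fraction-free elimination of \<open>x\<close> with pivot \<open>v0\<close>;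
      this is why the multiplier grows by the factor \<open>c0\<close>.\<close>
    define r where "r v = Poly_Mapping.single 0 c0 * v + Poly_Mapping.single 0 (- coef v x) * v0" for v
    have r0: "coef (r v) x = 0" for v by (simp add: r_def lookup_add keys_single_0_mult c0_def)
    have rk: "mkeys (r v) \<subseteq> Y - {x}" if v: "v \<in> V" for v
    proof -
      have "n \<in> Y - {x}" if n: "n \<in> mkeys (r v)" for n
      proof -
        have "n \<noteq> x" using n r0 by (auto simp: in_keys_iff)
        moreover have "coef v n \<noteq> 0 \<or> coef v0 n \<noteq> 0"
          using n by (auto simp: in_keys_iff r_def lookup_add keys_single_0_mult)
        then have "n \<in> Y" using Suc.prems(4)[OF v] Suc.prems(4)[OF v0(1)] by (auto simp: in_keys_iff)
        ultimately show ?thesis by simp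
      qed
      then show ?thesis by blast
    qed
    obtain W N where WN: "echelon prec (r ` V) W N"
      using Suc.hyps(1)[OF card, of "r ` V"] Suc.prems(1-3) rk by blast
    have Wk: "mkeys w \<subseteq> Y - {x}" if "w \<in> W" for w
      using keys_kspan[of w "r ` V" "Y - {x}"] WN that rk by (auto simp: echelon_def)
    have rV: "r ` V \<subseteq> kspan V" 
      unfolding r_def by (rule image_subsetI, rule kspan_add; rule kspan_scale, rule kspan_gen) (simp_all add: v0(1))
    have "echelon prec V (insert v0 W) (N * c0)"
      unfolding echelon_def
    proof (intro conjI ballI)
      show "finite (insert v0 W)" "N * c0 \<noteq> 0" using WN v0(2) by (auto simp: echelon_def c0_def)
      show "insert v0 W \<subseteq> kspan V"
        using WN rV v0(1) by (auto simp: echelon_def intro: kspan_gen kspan_kspan)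
      show "Poly_Mapping.single 0 (N * c0) * v \<in> kspan (insert v0 W)" if v: "v \<in> V" for v
      proof -
        have "Poly_Mapping.single 0 (N * c0) * v = Poly_Mapping.single 0 N * r v + Poly_Mapping.single 0 (N * coef v x) * v0"
          by (rule poly_mapping_eqI)
            (simp only: r_def lookup_add keys_single_0_mult, simp only: algebra_simps)
        moreover have "Poly_Mapping.single 0 N * r v \<in> kspan (insert v0 W)"
          using WN v by (auto simp: echelon_def intro: kspan_mono)
        moreover have "Poly_Mapping.single 0 (N * coef v x) * v0 \<in> kspan (insert v0 W)"
          by (intro kspan_scale kspan_gen) simp
        ultimately show ?thesis by (simp add: kspan_add)
      qed
      show "\<exists>m. m \<in> mkeys w \<and> (\<forall>n\<in>mkeys w. n \<noteq> m \<longrightarrow> prec n m) \<and> coef w m dvd N * c0 \<and>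
          (\<forall>w'\<in>insert v0 W. m \<in> mkeys w' \<and> (\<forall>n\<in>mkeys w'. n \<noteq> m \<longrightarrow> prec n m) \<longrightarrow> w' = w)"
        if w: "w \<in> insert v0 W" for w
      proof (cases "w = v0")
        case True
        have "x \<in> mkeys w'" "w' \<in> insert v0 W \<Longrightarrow> w' = w" if "x \<in> mkeys w'" for w' using that Wk True by auto
        then show ?thesis using True v0(2) x(2) Suc.prems(4)[OF v0(1)]
          by (intro exI[of _ x]) (auto simp: c0_def in_keys_iff)
      next
        case False
        then have wW: "w \<in> W" using w by simp
        then obtain m where m: "m \<in> mkeys w" "\<forall>n\<in>mkeys w. n \<noteq> m \<longrightarrow> prec n m" "coef w m dvd N"
          "\<forall>w'\<in>W. m \<in> mkeys w' \<and> (\<forall>n\<in>mkeys w'. n \<noteq> m \<longrightarrow> prec n m) \<longrightarrow> w' = w"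
          using echelon_lead[OF WN] by blast
        have mX: "m \<in> Y" "m \<noteq> x" using m(1) Wk[OF wW] by auto
        have "\<not> (\<forall>n\<in>mkeys v0. n \<noteq> m \<longrightarrow> prec n m)"
        proof
          assume "\<forall>n\<in>mkeys v0. n \<noteq> m \<longrightarrow> prec n m"
          then have "prec x m" using v0(2) mX(2) by (auto simp: in_keys_iff)
          moreover have "prec m x" using x(2) mX by blast
          ultimately show False
            using irrefl[of x] trans[of x m x] mX(1) x(1) Suc.prems(2) by blast
        qed
        then show ?thesis using m by (intro exI[of _ m]) auto
      qed
    qed
    then show ?thesis by blast
  qed
qed

text \<open>Where \<open>N\<close> is nonzero, the leading coefficients of \<open>W\<close> stay
  nonzero and the images of \<open>V\<close> and \<open>W\<close> have the same span. In a
  combination of elements with distinct leading monomials the largest of these cannot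
  cancel.\<close>

lemma leads_of_echelon:
  fixes V W :: "('m \<Rightarrow>\<^sub>0 int) set"
  assumes ech: "echelon prec V W N" and N: "(of_int N :: 'a::field) \<noteq> 0"
    and VM: "\<And>v. v \<in> V \<Longrightarrow> mkeys v \<subseteq> M"
  shows "(\<exists>g\<in>kspan (int_to_field ` V :: ('m \<Rightarrow>\<^sub>0 'a) set). lead_at g m) \<longleftrightarrow> (\<exists>w\<in>W. lead_at w m)"
proof -
  let ?c = "int_to_field :: ('m \<Rightarrow>\<^sub>0 int) \<Rightarrow> ('m \<Rightarrow>\<^sub>0 'a)"
  have span: "?c a \<in> kspan (?c ` G)" if "a \<in> kspan G" for a G
    using that
  proof induction
    case (step g a c)
    then show ?case
      unfolding int_to_field_add int_to_field_single_mult by (intro kspan.step imageI)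
  qed (simp add: kspan.zero)
  have WM: "mkeys w \<subseteq> M" if "w \<in> W" for w
    using keys_kspan[of w V M] ech that VM by (auto simp: echelon_def)
  have Wlead: "\<exists>m. lead_at w m \<and> lead_at (?c w) m \<and> (\<forall>w'\<in>W. lead_at w' m \<longrightarrow> w' = w)" if w: "w \<in> W" for w
  proof -
    obtain m where m: "m \<in> mkeys w" "\<forall>n\<in>mkeys w. n \<noteq> m \<longrightarrow> prec n m" "coef w m dvd N"
      "\<forall>w'\<in>W. m \<in> mkeys w' \<and> (\<forall>n\<in>mkeys w'. n \<noteq> m \<longrightarrow> prec n m) \<longrightarrow> w' = w"
      using echelon_lead[OF ech w] by blast
    obtain e where "N = coef w m * e" using m(3) by (rule dvdE)
    then have "(of_int (coef w m) :: 'a) \<noteq> 0" using N by auto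
    moreover have "mkeys (?c w) \<subseteq> mkeys w" by (auto simp: in_keys_iff)
    ultimately show ?thesis using m by (intro exI[of _ m]) (auto simp: lead_at_def in_keys_iff)
  qed
  show ?thesis
  proof
    assume "\<exists>w\<in>W. lead_at w m"
    then obtain w where w: "w \<in> W" "lead_at w m" by blast
    obtain m' where m': "lead_at w m'" "lead_at (?c w) m'" using Wlead[OF w(1)] by blast
    then have "lead_at (?c w) m" using lead_at_unique[OF w(2) m'(1) WM[OF w(1)]] by simp
    moreover have "?c w \<in> kspan (?c ` V)" using span ech w(1) by (auto simp: echelon_def)
    ultimately show "\<exists>g\<in>kspan (?c ` V). lead_at g m" by blast
  next
    assume "\<exists>g\<in>kspan (?c ` V). lead_at g m"
    then obtain g where g: "g \<in> kspan (?c ` V)" "lead_at g m" by blast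
    have "?c ` V \<subseteq> kspan (?c ` W)"
    proof (rule image_subsetI)
      fix v assume "v \<in> V"
      then have "Poly_Mapping.single 0 N * v \<in> kspan W" using ech by (auto simp: echelon_def)
      then have "Poly_Mapping.single 0 (of_int N) * ?c v \<in> kspan (?c ` W)"
        using span[of "Poly_Mapping.single 0 N * v" W] by (simp add: int_to_field_single_mult)
      then have "Poly_Mapping.single 0 (inverse (of_int N)) * (Poly_Mapping.single 0 (of_int N) * ?c v) \<in> kspan (?c ` W)"
        by (rule kspan_scale)
      then show "?c v \<in> kspan (?c ` W)"
        by (simp only: mult.assoc[symmetric] mult_single left_inverse N not_False_eq_True add_0_left single_one mult_1)
    qed
    then have "g \<in> kspan (?c ` W)" using g(1) kspan_kspan by blast
    then obtain Q \<alpha> where Q: "finite Q" "Q \<subseteq> W" "g = (\<Sum>w\<in>Q. Poly_Mapping.single 0 (\<alpha> w) * ?c w)"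
      by (rule kspan_image_sum)
    define P where "P = {w \<in> Q. \<alpha> w \<noteq> 0}"
    have P: "finite P" "P \<subseteq> W" using Q by (auto simp: P_def)
    have gc: "coef g n = (\<Sum>w\<in>P. \<alpha> w * coef (?c w) n)" for n
    proof -
      have "coef g n = (\<Sum>w\<in>Q. \<alpha> w * coef (?c w) n)" by (simp add: Q(3) lookup_sum keys_single_0_mult)
      also have "\<dots> = (\<Sum>w\<in>P. \<alpha> w * coef (?c w) n)" using Q(1) by (intro sum.mono_neutral_right) (auto simp: P_def)
      finally show ?thesis .
    qed
    obtain L where L: "\<And>w. w \<in> W \<Longrightarrow> lead_at w (L w) \<and> lead_at (?c w) (L w) \<and> (\<forall>w'\<in>W. lead_at w' (L w) \<longrightarrow> w' = w)"
      using Wlead by metis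
    have "P \<noteq> {}"
    proof
      assume "P = {}"
      then have "coef g m = 0" by (simp add: gc)
      then show False using g(2) by (simp add: lead_at_def in_keys_iff)
    qed
    moreover have LM: "L w \<in> M" if "w \<in> W" for w using L[OF that] WM[OF that] by (auto simp: lead_at_def)
    ultimately obtain x where x: "x \<in> L ` P" "\<And>n. n \<in> L ` P \<Longrightarrow> n \<noteq> x \<Longrightarrow> prec n x"
      using ex_max[of "L ` P"] P by blast
    then obtain w where w: "w \<in> P" "x = L w" by blast
    have wW: "w \<in> W" using w(1) P(2) by blast
    have below: "n = x \<or> prec n x" if n: "n \<in> mkeys (?c w')" and w': "w' \<in> P" for n w'
    proof -
      have w'W: "w' \<in> W" using w' P(2) by blast
      have "coef w' n \<noteq> 0" using n by (auto simp: in_keys_iff)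
      then have "n \<in> M" using WM[OF w'W] by (auto simp: in_keys_iff)
      have "n = L w' \<or> prec n (L w')" using L[OF w'W] n by (auto simp: lead_at_def)
      moreover have "L w' = x \<or> prec (L w') x" using x(2) w' by blast
      ultimately show ?thesis using trans[OF \<open>n \<in> M\<close> LM[OF w'W] LM[OF wW]] w(2) by auto
    qed
    have zero: "coef (?c w') x = 0" if w': "w' \<in> P" "w' \<noteq> w" for w'
    proof (rule ccontr)
      assume "coef (?c w') x \<noteq> 0"
      then have k: "x \<in> mkeys (?c w')" by (simp add: in_keys_iff)
      have w'W: "w' \<in> W" using w' P(2) by blast
      have ne: "L w' \<noteq> x" 
      proof
        assume "L w' = x"
        then have "lead_at w' (L w)" using L[OF w'W] w(2) by simp
        then show False using L[OF wW] w'W w'(2) by blast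
      qed
      then have "prec x (L w')" using L[OF w'W] k by (auto simp: lead_at_def)
      moreover have "prec (L w') x" using x(2) w'(1) ne by blast
      ultimately show False using trans[of x "L w'" x] irrefl[of x] LM[OF w'W] LM[OF wW] w(2) by blast
    qed
    have "coef g x = \<alpha> w * coef (?c w) x"
      unfolding gc sum.remove[OF P(1) w(1)] using zero by (simp add: sum.neutral)
    also have "\<dots> \<noteq> 0" using w L[OF wW] by (auto simp: P_def lead_at_def in_keys_iff)
    finally have gx: "x \<in> mkeys g" by (simp add: in_keys_iff)
    have "lead_at g x"
      unfolding lead_at_def
    proof (intro conjI ballI impI gx)
      fix n assume n: "n \<in> mkeys g" "n \<noteq> x"
      then have "(\<Sum>w\<in>P. \<alpha> w * coef (?c w) n) \<noteq> 0" by (simp add: in_keys_iff gc)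
      then obtain w' where w': "w' \<in> P" "\<alpha> w' * coef (?c w') n \<noteq> 0" by (rule sum.not_neutral_contains_not_neutral)
      then have "w' \<in> P" "coef (?c w') n \<noteq> 0" by auto
      then show "prec n x" using below[of n w'] n(2) by (auto simp: in_keys_iff)
    qed
    moreover have "mkeys g \<subseteq> M"
      using keys_kspan[OF g(1), of M] VM by (force simp: in_keys_iff)
    ultimately have "m = x" using lead_at_unique[OF g(2)] by blast
    then show "\<exists>w\<in>W. lead_at w m" using L[OF wW] wW w(2) by blast
  qed
qed

end

text \<open>The minors are homogeneous, so the part of degree \<open>total_deg m\<close> of an
  element is again in the ideal and keeps the leading monomial \<open>m\<close>.\<close>

lemma leads_of_generalized_poset_ideal:
  assumes ao: "total_monom_order (monoms k l) prec" and \<Omega>: "\<Omega> \<subseteq> minors k l"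
    and ech: "echelon prec (degree_gens k l \<Omega> (total_deg m)) W N" and N: "(of_int N :: 'a::field) \<noteq> 0"
  shows "(\<exists>g\<in>(generalized_poset_ideal k l \<Omega> :: 'a mpoly set). monom_order.lead_at prec g m) \<longleftrightarrow>
    (\<exists>w\<in>W. monom_order.lead_at prec w m)"
proof -
  interpret total_monom_order "monoms k l" prec by (rule ao)
  let ?V = "degree_gens k l \<Omega> (total_deg m)" and ?I = "generalized_poset_ideal k l \<Omega> :: 'a mpoly set"
  have "(\<exists>g\<in>?I. lead_at g m) \<longleftrightarrow> (\<exists>g\<in>kspan (int_to_field ` ?V :: 'a mpoly set). lead_at g m)"
  proof
    assume "\<exists>g\<in>?I. lead_at g m"
    then obtain g where g: "g \<in> ?I" "lead_at g m" by blast
    have "lead_at (homogeneous_part (total_deg m) g) m"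
      using g(2) by (auto simp: lead_at_def in_keys_iff coef_homogeneous_part split: if_splits)
    then show "\<exists>g\<in>kspan (int_to_field ` ?V :: 'a mpoly set). lead_at g m"
      using homogeneous_part_in_kspan[OF \<Omega> g(1)] by blast
  next
    assume "\<exists>g\<in>kspan (int_to_field ` ?V :: 'a mpoly set). lead_at g m"
    then show "\<exists>g\<in>?I. lead_at g m"
      using kspan_subset_ideal[OF generalized_poset_ideal_eq_idl(2)[OF \<Omega>], of "int_to_field ` ?V"]
        int_to_field_degree_gens[OF \<Omega>] by blast
  qed
  also have "\<dots> \<longleftrightarrow> (\<exists>w\<in>W. lead_at w m)"
    by (rule leads_of_echelon[OF ech N]) (use degree_gens_keys(1)[OF \<Omega>] in blast)
  finally show ?thesis .
qed

lemma ex_degree_gens_echelon: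
  assumes ao: "total_monom_order (monoms k l) prec" and \<Omega>: "\<Omega> \<subseteq> minors k l"
  shows "\<exists>W N. echelon prec (degree_gens k l \<Omega> d) W N"
proof -
  interpret total_monom_order "monoms k l" prec by (rule ao)
  show ?thesis
    by (rule ex_echelon[of "{m \<in> monoms k l. total_deg m \<le> d}"])
      (use finite_monoms_deg finite_degree_gens[OF \<Omega>] degree_gens_keys[OF \<Omega>] in auto)
qed

subsection \<open>Characteristic zero\<close>

text \<open>
  A failure of radicality modulo \<open>p\<close>, phrased over the integers: this predicate has no free
  variables besides \<open>p\<close>, so a hypothetical failing prime can be turned into a type.
\<close>

definition radical_failure :: "nat \<Rightarrow> bool" where
  "radical_failure p \<longleftrightarrow> Factorial_Ring.prime p \<and> (\<exists>k l \<Omega> prec m s W N W' N'.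
     1 \<le> k \<and> 1 \<le> l \<and> k \<le> l + 1 \<and> generalized_ideal k l \<Omega> \<and> adiag_order k l prec \<and>
     (\<forall>v. coef s v = of_bool (v \<in> mkeys m)) \<and>
     echelon prec (degree_gens k l \<Omega> (total_deg m)) W N \<and> \<not> int p dvd N \<and>
     echelon prec (degree_gens k l \<Omega> (total_deg s)) W' N' \<and> \<not> int p dvd N' \<and>
     (\<exists>w\<in>W. monom_order.lead_at prec w m) \<and> \<not> (\<exists>w\<in>W'. monom_order.lead_at prec w s))"

text \<open>A type definition cannot depend on variables fixed inside a proof, so the prime must be
  a closed constant; the default 2 keeps it prime if there is no failure.\<close>

definition failing_prime :: nat where
  "failing_prime = (if \<exists>p. radical_failure p then SOME p. radical_failure p else 2)"

lemma prime_failing_prime: "Factorial_Ring.prime failing_prime"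
proof (cases "\<exists>p. radical_failure p")
  case True
  then have "radical_failure failing_prime" unfolding failing_prime_def by (simp add: someI_ex)
  then show ?thesis by (simp add: radical_failure_def)
qed (simp add: failing_prime_def)

text \<open>Its cardinality makes \<open>failing_index mod_ring\<close> the prime field in which a
  failure would take place.\<close>

typedef failing_index = "{..<failing_prime}"
  using prime_gt_0_nat[OF prime_failing_prime] by auto

lemma CARD_failing_index: "CARD(failing_index) = failing_prime"
  using type_definition.card[OF type_definition_failing_index] by simp

instance failing_index :: prime_card
  by intro_classes (simp add: CARD_failing_index prime_failing_prime)

text \<open>Over the field with \<open>failing_prime\<close> elements the echelon forms describe the
  actual leading monomials, so a failure contradicts \<open>lead_radical_pos_char\<close>.\<close>

lemma no_radical_failure: "\<not> radical_failure p"
proof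
  assume "radical_failure p"
  then have "\<exists>p. radical_failure p" by (rule exI)
  then have "radical_failure failing_prime" unfolding failing_prime_def by (simp add: someI_ex)
  then obtain k l \<Omega> prec m s W N W' N' where kl: "1 \<le> k" "1 \<le> l" "k \<le> l + 1"
    and \<Omega>: "generalized_ideal k l \<Omega>" and ao: "adiag_order k l prec" and s: "\<forall>v. coef s v = of_bool (v \<in> mkeys m)"
    and W: "echelon prec (degree_gens k l \<Omega> (total_deg m)) W N" "\<not> int failing_prime dvd N"
    and W': "echelon prec (degree_gens k l \<Omega> (total_deg s)) W' N'" "\<not> int failing_prime dvd N'"
    and lead: "\<exists>w\<in>W. monom_order.lead_at prec w m" "\<not> (\<exists>w\<in>W'. monom_order.lead_at prec w s)"
    unfolding radical_failure_def by (elim conjE exE) (rule that)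
  let ?I = "generalized_poset_ideal k l \<Omega> :: failing_index mod_ring mpoly set"
  have char: "CHAR(failing_index mod_ring) = failing_prime" by (simp add: CARD_failing_index)
  have nz: "(of_int N :: failing_index mod_ring) \<noteq> 0" "(of_int N' :: failing_index mod_ring) \<noteq> 0"
    using W(2) W'(2) by (simp_all add: of_int_eq_0_iff_char_dvd char CARD_failing_index)
  note sub = generalized_ideal_subset[OF \<Omega>]
  have tm: "total_monom_order (monoms k l) prec" using ao by (rule adiag_order.axioms)
  have "CHAR(failing_index mod_ring) > 0" using prime_gt_0_nat[OF prime_failing_prime] char by simp
  then have "lead_radical k l prec ?I" by (rule lead_radical_pos_char[OF kl \<Omega> ao])
  then show False
    using lead leads_of_generalized_poset_ideal[OF tm sub W(1) nz(1)]
      leads_of_generalized_poset_ideal[OF tm sub W'(1) nz(2)] s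
    unfolding lead_radical_def by blast
qed

lemma ex_prime_not_dvd:
  assumes "(N :: int) \<noteq> 0"
  obtains p where "Factorial_Ring.prime p" "\<not> int p dvd N"
proof -
  obtain p where p: "Factorial_Ring.prime p" "nat \<bar>N\<bar> < p" using bigger_prime by blast
  have "\<not> int p dvd N" using p(2) zdvd_imp_le[of "int p" "\<bar>N\<bar>"] assms by auto
  then show ?thesis using that p(1) by blast
qed

text \<open>In characteristic zero, echelon forms in the degrees of \<open>m\<close> and of its
  radical hold the leading monomials. Modulo a prime dividing neither multiplier they are the same,
  and there a failure is excluded.\<close>

theorem lead_radical_generalized_poset_ideal:
  assumes kl: "1 \<le> k" "1 \<le> l" "k \<le> l + 1" and \<Omega>: "generalized_ideal k l \<Omega>" and ao: "adiag_order k l prec"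
  shows "lead_radical k l prec (generalized_poset_ideal k l \<Omega> :: 'a::field mpoly set)"
proof (cases "CHAR('a) = 0")
  case False
  then show ?thesis using lead_radical_pos_char[OF kl \<Omega> ao] by simp
next
  case True
  let ?I = "generalized_poset_ideal k l \<Omega> :: 'a mpoly set"
  note sub = generalized_ideal_subset[OF \<Omega>]
  have tm: "total_monom_order (monoms k l) prec" using ao by (rule adiag_order.axioms)
  show ?thesis
    unfolding lead_radical_def
  proof (intro ballI allI impI)
    fix g and m s :: monom assume g: "g \<in> ?I" "monom_order.lead_at prec g m" and s: "\<forall>v. coef s v = of_bool (v \<in> mkeys m)"
    obtain W N where W: "echelon prec (degree_gens k l \<Omega> (total_deg m)) W N" using ex_degree_gens_echelon[OF tm sub] by blast
    obtain W' N' where W': "echelon prec (degree_gens k l \<Omega> (total_deg s)) W' N'" using ex_degree_gens_echelon[OF tm sub] by blast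
    have N: "N \<noteq> 0" "N' \<noteq> 0" using W W' by (simp_all add: echelon_def)
    then have nz: "(of_int N :: 'a) \<noteq> 0" "(of_int N' :: 'a) \<noteq> 0"
      using True by (simp_all add: of_int_eq_0_iff_char_dvd)
    obtain p where p: "Factorial_Ring.prime p" "\<not> int p dvd N * N'" using ex_prime_not_dvd[of "N * N'"] N by auto
    then have "\<not> int p dvd N" "\<not> int p dvd N'" by auto
    moreover have "\<exists>w\<in>W. monom_order.lead_at prec w m"
      using leads_of_generalized_poset_ideal[OF tm sub W nz(1)] g by blast
    ultimately have "\<exists>w\<in>W'. monom_order.lead_at prec w s"
      using no_radical_failure[of p] p(1) kl \<Omega> ao s W W' unfolding radical_failure_def by blast
    then show "\<exists>g'\<in>?I. monom_order.lead_at prec g' s"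
      using leads_of_generalized_poset_ideal[OF tm sub W' nz(2)] by blast
  qed
qed

theorem corollary5p10:
  fixes k l :: nat and \<Omega> :: "minor set"
  assumes "1 \<le> k" and "1 \<le> l" and "k \<le> l + 1"
    and "generalized_ideal k l \<Omega>"
  shows "(\<Omega> \<noteq> {} \<longrightarrow>
            (generalized_poset_ideal k l \<Omega> :: 'a::field mpoly set)
              \<in> knutson_ideals (mat_poly_ring k l) (minors_product k l)) \<and>
         (\<forall>prec. antidiagonal_term_order TYPE('a) k l prec \<longrightarrow>
            squarefree_monomial_ideal k l
              (initial_ideal k l prec (generalized_poset_ideal k l \<Omega> :: 'a mpoly set))) \<and>
         (CHAR('a) > 0 \<longrightarrow>
            F_pure TYPE('m)
              (mat_poly_ring k l Quot (generalized_poset_ideal k l \<Omega> :: 'a mpoly set)))"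
proof (intro conjI impI allI)
  let ?I = "generalized_poset_ideal k l \<Omega> :: 'a mpoly set"
  note sub = generalized_ideal_subset[OF assms(4)]
  note I = generalized_poset_ideal_eq_idl(2)[OF sub, where 'a = 'a]
  show "?I \<in> knutson_ideals (mat_poly_ring k l) (minors_product k l)" if "\<Omega> \<noteq> {}"
    by (rule generalized_poset_ideal_knutson[OF assms that])
  show "squarefree_monomial_ideal k l (initial_ideal k l prec ?I)"
    if "antidiagonal_term_order TYPE('a) k l prec" for prec
  proof -
    have ao: "adiag_order k l prec" using that by (rule adiag_order_of_antidiagonal)
    show ?thesis
      by (rule squarefree_initial_ideal[OF adiag_order.axioms(1)[OF ao] I
            lead_radical_generalized_poset_ideal[OF assms ao]])
  qed
  show "F_pure TYPE('m) (mat_poly_ring k l Quot ?I)" if char: "CHAR('a) > 0"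
  proof -
    obtain \<tau> :: "'a \<Rightarrow> 'a" where "frobenius_splitting \<tau> CHAR('a)" using ex_frobenius_splitting[OF char] by blast
    then interpret frobenius_splitting \<tau> "CHAR('a)" .
    have zero: "of_nat CHAR('a) = (0 :: 'a mpoly)" using of_nat_CHAR[where 'a = "'a mpoly"] by (simp only: CHAR_mpoly)
    show ?thesis
      by (rule F_pure_quotient[OF I one_notin_generalized_poset_ideal[OF sub] prime_p zero,
            where \<phi> = "split_map k l"])
        (simp_all add: split_map_in_polys[OF assms(1-3)] split_map_add split_map_power_mult split_map_1[OF assms(1-3)]
          generalized_poset_ideal_compatible[OF assms])
  qed
qed

end
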